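(* Let $n\ge1$, let $\mathcal C$ be an $n$-Frobenius category, let $M\in\mathcal C$ and fix a unit conflation $\delta_M\in\operatorname{Ext}^n(M,\Omega^nM)$. Then there exists a ring homomorphism $\varphi:\operatorname{Hom}_{\mathcal C}(M,M)\to(\operatorname{Ext}^n(M,\Omega^nM)/\mathcal P,+,\circ)$ with $\varphi(f)=\overline{\delta_Mf}$, such that $\varphi(f)$ is an invertible element for any quasi-invertible morphism $f$, and $\varphi(f)=0$ if $f$ is an $n$-$\operatorname{Ext}$-phantom morphism.
   Context: Let $\mathcal A$ be an abelian category and $\mathcal C$ a full additive extension-closed subcategory with the inherited exact structure: conflations are short exact sequences of $\mathcal A$ with all terms in $\mathcal C$ (first map an inflation, second a deflation). $\operatorname{Ext}^t(A,B)=\operatorname{Ext}^t_{\mathcal C}(A,B)$ ($t\ge1$) is the abelian group (Baer sum) of equivalence classes of exact sequences $B\to X_{t-1}\to\cdots\to X_0\to A$ spliced from $t$ conflations. $g\gamma$, $\gamma h$ denote push-out along $g$ and pull-back along $h$. $P\in\mathcal C$ is $n$-projective (resp. $n$-injective) if $\operatorname{Ext}^i(P,Y)=0$ (resp. $\operatorname{Ext}^i(Y,P)=0$) for all $i>n$, $Y\in\mathcal C$. $\mathcal C$ is $n$-Frobenius if every object has a deflation from an $n$-projective and an inflation into an $n$-injective, and $n$-projectives and $n$-injectives coincide. $\mathcal P(X,Y)\subseteq\operatorname{Ext}^n(X,Y)$ is the subgroup of elements $\eta h$ with $h:X\to P$, $P$ $n$-projective, $\eta\in\operatorname{Ext}^n(P,Y)$;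 bars denote classes modulo $\mathcal P$, and $\bar\gamma+\bar\gamma':=\overline{\gamma+\gamma'}$ (Baer sum). A unit conflation of length $n$ is of the form $B\to P_{n-1}\to\cdots\to P_0\to A$ with all $P_i$ $n$-projective; $B$ is then an $n$-th syzygy $\Omega^nA$ of $A$; $\mathcal U^n(B)$ denotes the class of unit conflations of length $n$ beginning with $B$. A right unit factorization of $\gamma\in\operatorname{Ext}^n(M,\Omega^nN)$ is an equality $\gamma=\delta f$ with $\delta\in\mathcal U^n(\Omega^nN)$ and $f$ a morphism; these always exist. $\Sigma$ is the class of quasi-invertible morphisms: those $f:A\to B$ such that $\operatorname{Ext}^{n+1}(X,A)\to\operatorname{Ext}^{n+1}(X,B)$, $\gamma\mapsto f\gamma$, is an isomorphism for all $X\in\mathcal C$ (equivalently, the analogous condition with pull-backs). A morphism $f:A\to B$ is an $n$-$\operatorname{Ext}$-phantom morphism if $\gamma f\in\mathcal P$ for all $Y\in\mathcal C$ and $\gamma\in\operatorname{Ext}^n(B,Y)$ (equivalently, $f\gamma\in\mathcal P$ for all $Y$ and $\gamma\in\operatorname{Ext}^n(Y,A)$). For $\delta,\delta'\in\mathcal U^n(B)$, a co-angled pair $[\delta a,\delta'b]$ consists of deflations $a,b\in\Sigma$ from a common object to the right end terms of $\delta,\delta'$ respectively, such that $\delta a=\delta'b$ is again in $\mathcal U^n(B)$; such pairs always exist. For $b:X\to X'$ in $\Sigma$ and $\gamma\in\operatorname{Ext}^n(X,Y)$, $\gamma b^{-1}$ denotes an element $\gamma'\in\operatorname{Ext}^n(X',Y)$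 with $\gamma-\gamma'b\in\mathcal P$; it exists and is unique modulo $\mathcal P$. Composition: with the fixed unit conflation $\delta_M$, for $\beta,\gamma\in\operatorname{Ext}^n(M,\Omega^nM)$ put $\bar\beta\circ\bar\gamma:=\overline{((\beta a_1)b_1^{-1})f}$, where $\gamma=\delta f$ is a right unit factorization and $[\delta_Ma_1,\delta b_1]$ is a co-angled pair; this is well-defined and makes $(\operatorname{Ext}^n(M,\Omega^nM)/\mathcal P,+,\circ)$ a ring with identity $\bar\delta_M$. *)

theory Defs
  imports "HOL-Algebra.RingHom" "HOL-Algebra.Coset"
begin

section \<open>Abelian categories\<close>

record ('a, 'b) cat_data =
  Obj :: "'a set"
  Mor :: "'b set"
  src :: "'b \<Rightarrow> 'a"
  tgt :: "'b \<Rightarrow> 'a"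
  idm :: "'a \<Rightarrow> 'b"
  cmp :: "'b \<Rightarrow> 'b \<Rightarrow> 'b"  (infixl "\<cdot>\<index>" 70)
  addm :: "'b \<Rightarrow> 'b \<Rightarrow> 'b"  (infixl "\<boxplus>\<index>" 65)
  zrm :: "'a \<Rightarrow> 'a \<Rightarrow> 'b"

definition Hom :: "('a, 'b, 'x) cat_data_scheme \<Rightarrow> 'a \<Rightarrow> 'a \<Rightarrow> 'b set"
  where "Hom A X Y = {f \<in> Mor A. src A f = X \<and> tgt A f = Y}"

text \<open>Composition is written in the usual order: \<open>g \<cdot> f\<close> is \<open>f\<close> followed by \<open>g\<close>.\<close>

locale category =
  fixes A :: "('a, 'b) cat_data" (structure)
  assumes src_in: "f \<in> Mor A \<Longrightarrow> src A f \<in> Obj A"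
    and tgt_in: "f \<in> Mor A \<Longrightarrow> tgt A f \<in> Obj A"
    and idm_in: "X \<in> Obj A \<Longrightarrow> idm A X \<in> Hom A X X"
    and cmp_in: "f \<in> Hom A X Y \<Longrightarrow> g \<in> Hom A Y Z \<Longrightarrow> g \<cdot> f \<in> Hom A X Z"
    and cmp_assoc: "f \<in> Hom A W X \<Longrightarrow> g \<in> Hom A X Y \<Longrightarrow> h \<in> Hom A Y Z
      \<Longrightarrow> h \<cdot> (g \<cdot> f) = (h \<cdot> g) \<cdot> f"
    and cmp_id_left: "f \<in> Hom A X Y \<Longrightarrow> idm A Y \<cdot> f = f"
    and cmp_id_right: "f \<in> Hom A X Y \<Longrightarrow> f \<cdot> idm A X = f"
begin

definition monic :: "'b \<Rightarrow> bool" where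
  "monic f \<longleftrightarrow> f \<in> Mor A \<and>
    (\<forall>W. \<forall>g \<in> Hom A W (src A f). \<forall>h \<in> Hom A W (src A f). f \<cdot> g = f \<cdot> h \<longrightarrow> g = h)"

definition epic :: "'b \<Rightarrow> bool" where
  "epic f \<longleftrightarrow> f \<in> Mor A \<and>
    (\<forall>W. \<forall>g \<in> Hom A (tgt A f) W. \<forall>h \<in> Hom A (tgt A f) W. g \<cdot> f = h \<cdot> f \<longrightarrow> g = h)"

definition zero_object :: "'a \<Rightarrow> bool" where
  "zero_object Z \<longleftrightarrow> Z \<in> Obj A \<and>
    (\<forall>X \<in> Obj A. (\<exists>!f. f \<in> Hom A X Z) \<and> (\<exists>!f. f \<in> Hom A Z X))"

text \<open>\<open>is_pushout f g u v\<close>: the square \<open>u \<cdot> f = v \<cdot> g\<close> is a push-out;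
  \<open>is_pullback p h u q\<close>: the square \<open>p \<cdot> u = h \<cdot> q\<close> is a pull-back.\<close>

definition is_pushout :: "'b \<Rightarrow> 'b \<Rightarrow> 'b \<Rightarrow> 'b \<Rightarrow> bool" where
  "is_pushout f g u v \<longleftrightarrow>
    f \<in> Mor A \<and> g \<in> Mor A \<and> src A f = src A g \<and>
    (\<exists>S. u \<in> Hom A (tgt A f) S \<and> v \<in> Hom A (tgt A g) S \<and> u \<cdot> f = v \<cdot> g \<and>
      (\<forall>T. \<forall>u' \<in> Hom A (tgt A f) T. \<forall>v' \<in> Hom A (tgt A g) T. u' \<cdot> f = v' \<cdot> g \<longrightarrow>
        (\<exists>!t. t \<in> Hom A S T \<and> t \<cdot> u = u' \<and> t \<cdot> v = v')))"

definition is_pullback :: "'b \<Rightarrow> 'b \<Rightarrow> 'b \<Rightarrow> 'b \<Rightarrow> bool" where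
  "is_pullback p h u q \<longleftrightarrow>
    p \<in> Mor A \<and> h \<in> Mor A \<and> tgt A p = tgt A h \<and>
    (\<exists>S. u \<in> Hom A S (src A p) \<and> q \<in> Hom A S (src A h) \<and> p \<cdot> u = h \<cdot> q \<and>
      (\<forall>T. \<forall>u' \<in> Hom A T (src A p). \<forall>q' \<in> Hom A T (src A h). p \<cdot> u' = h \<cdot> q' \<longrightarrow>
        (\<exists>!t. t \<in> Hom A T S \<and> u \<cdot> t = u' \<and> q \<cdot> t = q')))"

end

locale preadditive_category = category +
  assumes Hom_comm_group: "X \<in> Obj A \<Longrightarrow> Y \<in> Obj A \<Longrightarrow>
      comm_group \<lparr>carrier = Hom A X Y, monoid.mult = addm A, one = zrm A X Y\<rparr>"
    and cmp_add_left: "f \<in> Hom A X Y \<Longrightarrow> g \<in> Hom A Y Z \<Longrightarrow> h \<in> Hom A Y Z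
      \<Longrightarrow> (g \<boxplus> h) \<cdot> f = (g \<cdot> f) \<boxplus> (h \<cdot> f)"
    and cmp_add_right: "f \<in> Hom A X Y \<Longrightarrow> g \<in> Hom A X Y \<Longrightarrow> h \<in> Hom A Y Z
      \<Longrightarrow> h \<cdot> (f \<boxplus> g) = (h \<cdot> f) \<boxplus> (h \<cdot> g)"
begin

definition End_ring :: "'a \<Rightarrow> 'b ring" where
  "End_ring X = \<lparr>carrier = Hom A X X, monoid.mult = cmp A, one = idm A X,
     zero = zrm A X X, add = addm A\<rparr>"

definition is_kernel :: "'b \<Rightarrow> 'b \<Rightarrow> bool" where
  "is_kernel k f \<longleftrightarrow> f \<in> Mor A \<and> k \<in> Mor A \<and> tgt A k = src A f \<and>
    f \<cdot> k = zrm A (src A k) (tgt A f) \<and>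
    (\<forall>W. \<forall>g \<in> Hom A W (src A f). f \<cdot> g = zrm A W (tgt A f) \<longrightarrow>
      (\<exists>!h. h \<in> Hom A W (src A k) \<and> k \<cdot> h = g))"

definition is_cokernel :: "'b \<Rightarrow> 'b \<Rightarrow> bool" where
  "is_cokernel c f \<longleftrightarrow> f \<in> Mor A \<and> c \<in> Mor A \<and> src A c = tgt A f \<and>
    c \<cdot> f = zrm A (src A f) (tgt A c) \<and>
    (\<forall>W. \<forall>g \<in> Hom A (tgt A f) W. g \<cdot> f = zrm A (src A f) W \<longrightarrow>
      (\<exists>!h. h \<in> Hom A (tgt A c) W \<and> h \<cdot> c = g))"

definition short_exact :: "'b \<Rightarrow> 'b \<Rightarrow> bool" where
  "short_exact i p \<longleftrightarrow> is_kernel i p \<and> is_cokernel p i"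

definition is_biproduct :: "'a \<Rightarrow> 'a \<Rightarrow> 'a \<Rightarrow> 'b \<Rightarrow> 'b \<Rightarrow> 'b \<Rightarrow> 'b \<Rightarrow> bool" where
  "is_biproduct X Y S i j p q \<longleftrightarrow>
    i \<in> Hom A X S \<and> j \<in> Hom A Y S \<and> p \<in> Hom A S X \<and> q \<in> Hom A S Y \<and>
    p \<cdot> i = idm A X \<and> q \<cdot> j = idm A Y \<and>
    p \<cdot> j = zrm A Y X \<and> q \<cdot> i = zrm A X Y \<and>
    (i \<cdot> p) \<boxplus> (j \<cdot> q) = idm A S"

end

locale abelian_category = preadditive_category +
  assumes ex_zero_object: "\<exists>Z. zero_object Z"
    and ex_biproduct: "X \<in> Obj A \<Longrightarrow> Y \<in> Obj A \<Longrightarrow> \<exists>S i j p q. is_biproduct X Y S i j p q"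
    and ex_kernel: "f \<in> Mor A \<Longrightarrow> \<exists>k. is_kernel k f"
    and ex_cokernel: "f \<in> Mor A \<Longrightarrow> \<exists>c. is_cokernel c f"
    and monic_is_kernel: "monic f \<Longrightarrow> \<exists>g. is_kernel f g"
    and epic_is_cokernel: "epic f \<Longrightarrow> \<exists>g. is_cokernel f g"
begin

text \<open>A chosen zero object and chosen biproducts. They only serve to write down representatives;
  the equivalence classes of extensions built from them do not depend on the choice.\<close>

definition zobj :: 'a where
  "zobj = (SOME Z. zero_object Z)"

definition bip :: "'a \<Rightarrow> 'a \<Rightarrow> 'a \<times> 'b \<times> 'b \<times> 'b \<times> 'b" where
  "bip X Y = (SOME (S, i, j, p, q). is_biproduct X Y S i j p q)"

definition inj1 :: "'a \<Rightarrow> 'a \<Rightarrow> 'b" where "inj1 X Y = (case bip X Y of (S, i, j, p, q) \<Rightarrow> i)"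
definition inj2 :: "'a \<Rightarrow> 'a \<Rightarrow> 'b" where "inj2 X Y = (case bip X Y of (S, i, j, p, q) \<Rightarrow> j)"
definition prj1 :: "'a \<Rightarrow> 'a \<Rightarrow> 'b" where "prj1 X Y = (case bip X Y of (S, i, j, p, q) \<Rightarrow> p)"
definition prj2 :: "'a \<Rightarrow> 'a \<Rightarrow> 'b" where "prj2 X Y = (case bip X Y of (S, i, j, p, q) \<Rightarrow> q)"

definition diag :: "'a \<Rightarrow> 'b" where
  "diag X = inj1 X X \<boxplus> inj2 X X"

definition codiag :: "'a \<Rightarrow> 'b" where
  "codiag X = prj1 X X \<boxplus> prj2 X X"

definition dsum :: "'b \<Rightarrow> 'b \<Rightarrow> 'b" where
  "dsum f g =
    (inj1 (tgt A f) (tgt A g) \<cdot> f \<cdot> prj1 (src A f) (src A g)) \<boxplus>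
    (inj2 (tgt A f) (tgt A g) \<cdot> g \<cdot> prj2 (src A f) (src A g))"

end

section \<open>Extension-closed subcategories and Yoneda Ext\<close>

text \<open>A full subcategory is given by its set of objects.\<close>

locale extension_closed_subcategory = abelian_category +
  fixes C :: "'a set"
  assumes sub_Obj: "C \<subseteq> Obj A"
    and sub_zero: "\<exists>Z \<in> C. zero_object Z"
    and sub_biproduct: "X \<in> C \<Longrightarrow> Y \<in> C \<Longrightarrow> \<exists>S i j p q. S \<in> C \<and> is_biproduct X Y S i j p q"
    and sub_extension: "short_exact i p \<Longrightarrow> src A i \<in> C \<Longrightarrow> tgt A p \<in> C \<Longrightarrow> tgt A i \<in> C"

text \<open>The exact sequence \<open>B \<rightarrow> X\<^sub>t\<^sub>-\<^sub>1 \<rightarrow> \<dots> \<rightarrow> X\<^sub>0 \<rightarrow> A\<close> spliced from \<open>t\<close> conflations is represented by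
  the list of these conflations, from left to right: the head has the form
  \<open>B \<rightarrow> X\<^sub>t\<^sub>-\<^sub>1 \<rightarrow> K\<close> and the last entry the form \<open>L \<rightarrow> X\<^sub>0 \<rightarrow> A\<close>. The objects at which the
  conflations are spliced are the images of the differentials, hence they are determined by the
  sequence up to unique isomorphism, and every morphism of sequences extends uniquely to them.
  Equivalence of such lists is therefore Yoneda equivalence of the spliced sequences.\<close>

type_synonym 'b extn = "('b \<times> 'b) list"

context extension_closed_subcategory
begin

definition conflation :: "'b \<Rightarrow> 'b \<Rightarrow> bool" where
  "conflation i p \<longleftrightarrow> short_exact i p \<and> src A i \<in> C \<and> tgt A i \<in> C \<and> tgt A p \<in> C"

definition inflation :: "'b \<Rightarrow> bool" where
  "inflation i \<longleftrightarrow> (\<exists>p. conflation i p)"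

definition deflation :: "'b \<Rightarrow> bool" where
  "deflation p \<longleftrightarrow> (\<exists>i. conflation i p)"

definition extns :: "nat \<Rightarrow> 'a \<Rightarrow> 'a \<Rightarrow> 'b extn set" where
  "extns t X Y = {E. E \<noteq> [] \<and> length E = t \<and> (\<forall>(i, p) \<in> set E. conflation i p) \<and>
     successively (\<lambda>(i, p) (j, q). tgt A p = src A j) E \<and>
     src A (fst (hd E)) = Y \<and> tgt A (snd (last E)) = X}"

definition conflation_map :: "'b \<Rightarrow> 'b \<Rightarrow> 'b \<Rightarrow> 'b \<times> 'b \<Rightarrow> 'b \<times> 'b \<Rightarrow> bool" where
  "conflation_map u v w = (\<lambda>(i, p) (j, q).
     u \<in> Hom A (src A i) (src A j) \<and> v \<in> Hom A (tgt A i) (tgt A j) \<and>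
     w \<in> Hom A (tgt A p) (tgt A q) \<and> v \<cdot> i = j \<cdot> u \<and> w \<cdot> p = q \<cdot> v)"

definition extn_map :: "nat \<Rightarrow> 'a \<Rightarrow> 'a \<Rightarrow> 'b extn \<Rightarrow> 'b extn \<Rightarrow> bool" where
  "extn_map t X Y E F \<longleftrightarrow> E \<in> extns t X Y \<and> F \<in> extns t X Y \<and>
    (\<exists>k v. k 0 = idm A Y \<and> k t = idm A X \<and>
       (\<forall>s < t. conflation_map (k s) (v s) (k (Suc s)) (E ! s) (F ! s)))"

definition extn_rel :: "nat \<Rightarrow> 'a \<Rightarrow> 'a \<Rightarrow> ('b extn \<times> 'b extn) set" where
  "extn_rel t X Y = {(E, F). E \<in> extns t X Y \<and> F \<in> extns t X Y \<and> equivclp (extn_map t X Y) E F}"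

definition Ext :: "nat \<Rightarrow> 'a \<Rightarrow> 'a \<Rightarrow> 'b extn set set" where
  "Ext t X Y = extns t X Y // extn_rel t X Y"

definition extn_class :: "nat \<Rightarrow> 'a \<Rightarrow> 'a \<Rightarrow> 'b extn \<Rightarrow> 'b extn set" where
  "extn_class t X Y E = extn_rel t X Y `` {E}"

definition pushout_extn :: "'b \<Rightarrow> 'b extn \<Rightarrow> 'b extn \<Rightarrow> bool" where
  "pushout_extn g E F \<longleftrightarrow> (\<exists>i p i' p' u Es.
     E = (i, p) # Es \<and> F = (i', p') # Es \<and> is_pushout i g u i' \<and>
     p' \<in> Hom A (tgt A i') (tgt A p) \<and> p' \<cdot> u = p \<and> p' \<cdot> i' = zrm A (tgt A g) (tgt A p))"

definition pullback_extn :: "'b \<Rightarrow> 'b extn \<Rightarrow> 'b extn \<Rightarrow> bool" where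
  "pullback_extn h E F \<longleftrightarrow> (\<exists>i p i' p' u Es.
     E = Es @ [(i, p)] \<and> F = Es @ [(i', p')] \<and> is_pullback p h u p' \<and>
     i' \<in> Hom A (src A i) (src A p') \<and> u \<cdot> i' = i \<and> p' \<cdot> i' = zrm A (src A i) (src A h))"

text \<open>For \<open>\<gamma>\<close> in \<open>Ext t X Y\<close>: \<open>push t X g \<gamma>\<close> is the class of the push-out along
  \<open>g : Y \<rightarrow> Y'\<close> of any representative, \<open>pull t Y \<gamma> h\<close> the class of the pull-back along
  \<open>h : X' \<rightarrow> X\<close>.\<close>

definition push :: "nat \<Rightarrow> 'a \<Rightarrow> 'b \<Rightarrow> 'b extn set \<Rightarrow> 'b extn set" where
  "push t X g \<gamma> = (\<Union>E \<in> \<gamma>. \<Union>F \<in> {F. pushout_extn g E F}. extn_class t X (tgt A g) F)"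

definition pull :: "nat \<Rightarrow> 'a \<Rightarrow> 'b extn set \<Rightarrow> 'b \<Rightarrow> 'b extn set" where
  "pull t Y \<gamma> h = (\<Union>E \<in> \<gamma>. \<Union>F \<in> {F. pullback_extn h E F}. extn_class t (src A h) Y F)"

definition dsum_extn :: "'b extn \<Rightarrow> 'b extn \<Rightarrow> 'b extn" where
  "dsum_extn = map2 (\<lambda>(i, p) (j, q). (dsum i j, dsum p q))"

definition dsum_class :: "nat \<Rightarrow> 'a \<Rightarrow> 'a \<Rightarrow> 'b extn set \<Rightarrow> 'b extn set \<Rightarrow> 'b extn set" where
  "dsum_class t X Y \<gamma> \<gamma>' = (\<Union>E \<in> \<gamma>. \<Union>F \<in> \<gamma>'.
     extn_class t (src A (prj1 X X)) (src A (prj1 Y Y)) (dsum_extn E F))"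

definition baer_sum :: "nat \<Rightarrow> 'a \<Rightarrow> 'a \<Rightarrow> 'b extn set \<Rightarrow> 'b extn set \<Rightarrow> 'b extn set" where
  "baer_sum t X Y \<gamma> \<gamma>' =
     pull t Y (push t (src A (prj1 X X)) (codiag Y) (dsum_class t X Y \<gamma> \<gamma>')) (diag X)"

text \<open>The zero element: the split conflation \<open>Y \<rightarrow> Y \<oplus> X \<rightarrow> X\<close> for \<open>t = 1\<close>; for larger \<open>t\<close>
  the splice of \<open>Y \<rightarrow> Y \<oplus> 0 \<rightarrow> 0\<close>, copies of \<open>0 \<rightarrow> 0 \<oplus> 0 \<rightarrow> 0\<close>, and \<open>0 \<rightarrow> 0 \<oplus> X \<rightarrow> X\<close>.\<close>

definition zero_extn :: "nat \<Rightarrow> 'a \<Rightarrow> 'a \<Rightarrow> 'b extn" where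
  "zero_extn t X Y =
    (let K = (\<lambda>s. if s = 0 then Y else if s = t then X else zobj)
     in map (\<lambda>s. (inj1 (K s) (K (Suc s)), prj2 (K s) (K (Suc s)))) [0..<t])"

definition Ext_group :: "nat \<Rightarrow> 'a \<Rightarrow> 'a \<Rightarrow> 'b extn set monoid" where
  "Ext_group t X Y = \<lparr>carrier = Ext t X Y, monoid.mult = baer_sum t X Y,
     one = extn_class t X Y (zero_extn t X Y)\<rparr>"

section \<open>\<open>n\<close>-Frobenius categories\<close>

definition n_projective :: "nat \<Rightarrow> 'a \<Rightarrow> bool" where
  "n_projective n P \<longleftrightarrow> P \<in> C \<and> (\<forall>i > n. \<forall>Y \<in> C. Ext i P Y = {\<one>\<^bsub>Ext_group i P Y\<^esub>})"

definition n_injective :: "nat \<Rightarrow> 'a \<Rightarrow> bool" where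
  "n_injective n P \<longleftrightarrow> P \<in> C \<and> (\<forall>i > n. \<forall>Y \<in> C. Ext i Y P = {\<one>\<^bsub>Ext_group i Y P\<^esub>})"

definition n_Frobenius :: "nat \<Rightarrow> bool" where
  "n_Frobenius n \<longleftrightarrow>
    (\<forall>X \<in> C. \<exists>p. deflation p \<and> n_projective n (src A p) \<and> tgt A p = X) \<and>
    (\<forall>X \<in> C. \<exists>i. inflation i \<and> src A i = X \<and> n_injective n (tgt A i)) \<and>
    (\<forall>P. n_projective n P \<longleftrightarrow> n_injective n P)"

definition proj_ext :: "nat \<Rightarrow> 'a \<Rightarrow> 'a \<Rightarrow> 'b extn set set" where
  "proj_ext n X Y = {pull n Y \<eta> h | \<eta> h P.
     n_projective n P \<and> h \<in> Hom A X P \<and> \<eta> \<in> Ext n P Y}"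

definition bar :: "nat \<Rightarrow> 'a \<Rightarrow> 'a \<Rightarrow> 'b extn set \<Rightarrow> 'b extn set set" where
  "bar n X Y \<gamma> = proj_ext n X Y #>\<^bsub>Ext_group n X Y\<^esub> \<gamma>"

text \<open>Elements of \<open>Ext n X B\<close> represented by a unit conflation \<open>B \<rightarrow> P\<^sub>n\<^sub>-\<^sub>1 \<rightarrow> \<dots> \<rightarrow> P\<^sub>0 \<rightarrow> X\<close>.\<close>

definition unit_exts :: "nat \<Rightarrow> 'a \<Rightarrow> 'a \<Rightarrow> 'b extn set set" where
  "unit_exts n X B = {\<delta> \<in> Ext n X B. \<exists>E \<in> \<delta>. \<forall>(i, p) \<in> set E. n_projective n (tgt A i)}"

definition right_unit_factorization ::
    "nat \<Rightarrow> 'a \<Rightarrow> 'a \<Rightarrow> 'a \<Rightarrow> 'b extn set \<Rightarrow> 'b extn set \<Rightarrow> 'b \<Rightarrow> bool" where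
  "right_unit_factorization n X B D \<gamma> \<delta> f \<longleftrightarrow>
     \<gamma> \<in> Ext n X B \<and> \<delta> \<in> unit_exts n D B \<and> f \<in> Hom A X D \<and> \<gamma> = pull n B \<delta> f"

definition quasi_invertible :: "nat \<Rightarrow> 'b \<Rightarrow> bool" where
  "quasi_invertible n f \<longleftrightarrow> f \<in> Mor A \<and> src A f \<in> C \<and> tgt A f \<in> C \<and>
     (\<forall>X \<in> C. push (Suc n) X f \<in>
        iso (Ext_group (Suc n) X (src A f)) (Ext_group (Suc n) X (tgt A f)))"

definition ext_phantom :: "nat \<Rightarrow> 'b \<Rightarrow> bool" where
  "ext_phantom n f \<longleftrightarrow> f \<in> Mor A \<and> src A f \<in> C \<and> tgt A f \<in> C \<and>
     (\<forall>Y \<in> C. \<forall>\<gamma> \<in> Ext n (tgt A f) Y. pull n Y \<gamma> f \<in> proj_ext n (src A f) Y)"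

definition co_angled_pair ::
    "nat \<Rightarrow> 'a \<Rightarrow> 'a \<Rightarrow> 'a \<Rightarrow> 'a \<Rightarrow> 'b extn set \<Rightarrow> 'b extn set \<Rightarrow> 'b \<Rightarrow> 'b \<Rightarrow> bool" where
  "co_angled_pair n B D D' L \<delta> \<delta>' a b \<longleftrightarrow>
     \<delta> \<in> unit_exts n D B \<and> \<delta>' \<in> unit_exts n D' B \<and>
     a \<in> Hom A L D \<and> b \<in> Hom A L D' \<and> deflation a \<and> deflation b \<and>
     quasi_invertible n a \<and> quasi_invertible n b \<and>
     pull n B \<delta> a = pull n B \<delta>' b \<and> pull n B \<delta> a \<in> unit_exts n L B"

text \<open>\<open>is_right_quotient n X X' Y \<gamma> b \<gamma>'\<close>: the element \<open>\<gamma>'\<close> of \<open>Ext n X' Y\<close> is a value of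
  \<open>\<gamma> b\<^sup>-\<^sup>1\<close> for \<open>b : X \<rightarrow> X'\<close>.\<close>

definition is_right_quotient ::
    "nat \<Rightarrow> 'a \<Rightarrow> 'a \<Rightarrow> 'a \<Rightarrow> 'b extn set \<Rightarrow> 'b \<Rightarrow> 'b extn set \<Rightarrow> bool" where
  "is_right_quotient n X X' Y \<gamma> b \<gamma>' \<longleftrightarrow>
     \<gamma> \<in> Ext n X Y \<and> b \<in> Hom A X X' \<and> quasi_invertible n b \<and> \<gamma>' \<in> Ext n X' Y \<and>
     \<gamma> \<otimes>\<^bsub>Ext_group n X Y\<^esub> inv\<^bsub>Ext_group n X Y\<^esub> (pull n Y \<gamma>' b) \<in> proj_ext n X Y"

text \<open>The product of two classes, for a fixed unit conflation \<open>\<delta>\<^sub>M\<close> from \<open>B\<close> to \<open>M\<close>. The definite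
  description ranges over all representatives \<open>\<beta>\<close>, \<open>\<gamma>\<close>, all right unit factorizations
  \<open>\<gamma> = \<delta> f\<close>, all co-angled pairs \<open>[\<delta>\<^sub>M a, \<delta> b]\<close> and all values \<open>\<epsilon>\<close> of \<open>(\<beta> a) b\<^sup>-\<^sup>1\<close>.\<close>

definition ext_comp ::
    "nat \<Rightarrow> 'a \<Rightarrow> 'a \<Rightarrow> 'b extn set \<Rightarrow> 'b extn set set \<Rightarrow> 'b extn set set \<Rightarrow> 'b extn set set" where
  "ext_comp n M B \<delta>\<^sub>M x y = (THE z. \<exists>\<beta> \<gamma> \<delta> D f L a b \<epsilon>.
     \<beta> \<in> Ext n M B \<and> \<gamma> \<in> Ext n M B \<and> x = bar n M B \<beta> \<and> y = bar n M B \<gamma> \<and>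
     right_unit_factorization n M B D \<gamma> \<delta> f \<and>
     co_angled_pair n B M D L \<delta>\<^sub>M \<delta> a b \<and>
     is_right_quotient n L D B (pull n B \<beta> a) b \<epsilon> \<and>
     z = bar n M B (pull n B \<epsilon> f))"

text \<open>The additive structure is that of the quotient group \<open>Ext n M B / proj_ext n M B\<close>.\<close>

definition Ext_ring :: "nat \<Rightarrow> 'a \<Rightarrow> 'a \<Rightarrow> 'b extn set \<Rightarrow> 'b extn set set ring" where
  "Ext_ring n M B \<delta>\<^sub>M =
     (let Q = Ext_group n M B Mod proj_ext n M B
      in \<lparr>carrier = carrier Q, monoid.mult = ext_comp n M B \<delta>\<^sub>M, one = bar n M B \<delta>\<^sub>M,
          zero = one Q, add = monoid.mult Q\<rparr>)"

end

end

theory Submission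
  imports Defs
begin

text \<open>An extension \<open>\<gamma> \<in> Ext\<^sup>n(M, \<Omega>\<^sup>nM)\<close> acts on \<open>Ext\<^sup>n\<^sup>+\<^sup>1(\<Omega>\<^sup>nM, Y)\<close> by
  \<open>\<xi> \<mapsto> \<xi> \<gamma> \<delta>\<^sub>M\<^sup>-\<^sup>1\<close>, because splicing with a unit conflation is bijective on \<open>Ext\<^sup>k\<close> for
  \<open>k > n\<close>. For a suitable \<open>Y\<close> two extensions act in the same way if and only if they are congruent
  modulo \<open>\<P>\<close>, and every representative of \<open>\<beta> \<circ> \<gamma>\<close> acts as the composition of the two actions.
  Hence the composition is well defined and all ring axioms reduce to those for maps of abelian
  groups. A quasi-invertible \<open>f\<close> yields a left inverse of the class of \<open>\<delta>\<^sub>M f\<close> by solving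
  \<open>\<delta>\<^sub>M = \<epsilon> f\<close> modulo \<open>\<P>\<close>; as \<open>\<delta>\<^sub>M f\<close> acts injectively, it is a two-sided inverse. The input from
  homological algebra is the long exact sequence of Yoneda Ext, which holds because splicing of
  extensions is a tensor product over the category.\<close>

section \<open>Abelian categories\<close>

text \<open>In degree n, splicing with a unit conflation is onto Ext^(n+1), but it kills exactly the
  elements that factor through an n-projective. So Ext^n modulo these embeds into Ext^(n+1), the
  first degree where units and quasi-invertible morphisms can be cancelled. This is why the action
  lives in degree n + 1 and why the test object is the end of a unit conflation of length n + 1.

  There need not be enough projectives or injectives in the usual sense, so Ext is not computed from
  resolutions and exactness has to be read off chains of maps of sequences. Whether an extension
  attached to the right end of a conflation lifts through its deflation is unchanged by each
  elementary map, thanks to a Mayer-Vietoris conflation, and it holds for split conflations. A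
  vanishing splice is linked by such maps to a split one.

  Arrows carry no indices: a class determines its degree and its ends. This turns morphisms and
  extensions into one graded category, so that the formal part needs only associativity and
  distributivity.\<close>

context category
begin

lemma Hom_iff [simp]: "f \<in> Hom A X Y \<longleftrightarrow> f \<in> Mor A \<and> src A f = X \<and> tgt A f = Y"
  by (auto simp: Hom_def)

lemma src_Obj [simp]: "f \<in> Mor A \<Longrightarrow> src A f \<in> Obj A"
  by (rule src_in)

lemma tgt_Obj [simp]: "f \<in> Mor A \<Longrightarrow> tgt A f \<in> Obj A"
  by (rule tgt_in)

lemma idm_simps [simp]:
  assumes "X \<in> Obj A"
  shows "idm A X \<in> Mor A" "src A (idm A X) = X" "tgt A (idm A X) = X"
  using idm_in[OF assms] by auto

lemma cmp_simps [simp]: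
  assumes "f \<in> Mor A" "g \<in> Mor A" "src A g = tgt A f"
  shows "g \<cdot> f \<in> Mor A" "src A (g \<cdot> f) = src A f" "tgt A (g \<cdot> f) = tgt A g"
  using cmp_in[of f "src A f" "tgt A f" g "tgt A g"] assms by auto

lemma cmp_assoc_simp [simp]:
  assumes "f \<in> Mor A" "g \<in> Mor A" "h \<in> Mor A" "src A g = tgt A f" "src A h = tgt A g"
  shows "(h \<cdot> g) \<cdot> f = h \<cdot> (g \<cdot> f)"
  using cmp_assoc[of f "src A f" "tgt A f" g "tgt A g" h "tgt A h"] assms by auto

lemma cmp_idm [simp]:
  "f \<in> Mor A \<Longrightarrow> tgt A f = X \<Longrightarrow> idm A X \<cdot> f = f"
  "f \<in> Mor A \<Longrightarrow> src A f = X \<Longrightarrow> f \<cdot> idm A X = f"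
  using cmp_id_left[of f] cmp_id_right[of f] by auto

lemma cmp_reassoc:
  assumes "g \<cdot> f = k" "f \<in> Mor A" "g \<in> Mor A" "src A g = tgt A f"
    and "x \<in> Mor A" "tgt A x = src A f"
  shows "g \<cdot> (f \<cdot> x) = k \<cdot> x"
  using cmp_assoc_simp[of x f g] assms by simp

lemma monicD:
  assumes "monic f" "f \<cdot> g = f \<cdot> h" "g \<in> Mor A" "h \<in> Mor A" "src A g = src A h"
    "tgt A g = src A f" "tgt A h = src A f"
  shows "g = h"
  using assms unfolding monic_def by auto

lemma epicD:
  assumes "epic f" "g \<cdot> f = h \<cdot> f" "g \<in> Mor A" "h \<in> Mor A" "tgt A g = tgt A h"
    "src A g = tgt A f" "src A h = tgt A f"
  shows "g = h"
  using assms unfolding epic_def by auto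

lemma monic_factor:
  assumes "monic (g \<cdot> f)" "f \<in> Mor A" "g \<in> Mor A" "src A g = tgt A f"
  shows "monic f"
  unfolding monic_def
proof (intro conjI allI ballI impI)
  fix W x y assume "x \<in> Hom A W (src A f)" "y \<in> Hom A W (src A f)" "f \<cdot> x = f \<cdot> y"
  then show "x = y"
    using assms monicD[OF assms(1), of x y] by simp
qed (use assms in auto)

lemma monic_cmp:
  assumes "monic f" "monic g" "src A g = tgt A f"
  shows "monic (g \<cdot> f)"
proof -
  have [simp]: "f \<in> Mor A" "g \<in> Mor A"
    using assms by (auto simp: monic_def)
  show ?thesis
    unfolding monic_def
  proof (intro conjI allI ballI impI)
    fix W x y assume h: "x \<in> Hom A W (src A (g \<cdot> f))" "y \<in> Hom A W (src A (g \<cdot> f))"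
      "(g \<cdot> f) \<cdot> x = (g \<cdot> f) \<cdot> y"
    then have "f \<cdot> x = f \<cdot> y"
      by - (rule monicD[OF assms(2)], use assms in auto)
    then show "x = y"
      by - (rule monicD[OF assms(1)], use h assms in auto)
  qed (use assms in auto)
qed

end

section \<open>Zero morphisms, negatives and kernels in a preadditive category\<close>

context preadditive_category
begin

lemma zrm_simps [simp]:
  assumes "X \<in> Obj A" "Y \<in> Obj A"
  shows "zrm A X Y \<in> Mor A" "src A (zrm A X Y) = X" "tgt A (zrm A X Y) = Y"
proof -
  interpret comm_group "\<lparr>carrier = Hom A X Y, monoid.mult = addm A, one = zrm A X Y\<rparr>"
    using Hom_comm_group assms .
  show "zrm A X Y \<in> Mor A" "src A (zrm A X Y) = X" "tgt A (zrm A X Y) = Y"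
    using one_closed by auto
qed

lemma addm_simps [simp]:
  assumes "f \<in> Mor A" "g \<in> Mor A" "src A g = src A f" "tgt A g = tgt A f"
  shows "f \<boxplus> g \<in> Mor A" "src A (f \<boxplus> g) = src A f" "tgt A (f \<boxplus> g) = tgt A f"
proof -
  interpret comm_group "\<lparr>carrier = Hom A (src A f) (tgt A f), monoid.mult = addm A,
    one = zrm A (src A f) (tgt A f)\<rparr>"
    using Hom_comm_group assms by simp
  show "f \<boxplus> g \<in> Mor A" "src A (f \<boxplus> g) = src A f" "tgt A (f \<boxplus> g) = tgt A f"
    using m_closed[of f g] assms by auto
qed

lemma addm_assoc:
  assumes "f \<in> Mor A" "g \<in> Mor A" "h \<in> Mor A" "src A g = src A f" "tgt A g = tgt A f"
    "src A h = src A f" "tgt A h = tgt A f"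
  shows "(f \<boxplus> g) \<boxplus> h = f \<boxplus> (g \<boxplus> h)"
proof -
  interpret comm_group "\<lparr>carrier = Hom A (src A f) (tgt A f), monoid.mult = addm A,
    one = zrm A (src A f) (tgt A f)\<rparr>"
    using Hom_comm_group assms by simp
  show ?thesis
    using m_assoc[of f g h] assms by auto
qed

lemma addm_comm:
  assumes "f \<in> Mor A" "g \<in> Mor A" "src A g = src A f" "tgt A g = tgt A f"
  shows "f \<boxplus> g = g \<boxplus> f"
proof -
  interpret comm_group "\<lparr>carrier = Hom A (src A f) (tgt A f), monoid.mult = addm A,
    one = zrm A (src A f) (tgt A f)\<rparr>"
    using Hom_comm_group assms by simp
  show ?thesis
    using m_comm[of f g] assms by auto
qed

lemma addm_zrm [simp]:
  assumes "f \<in> Mor A" "src A f = X" "tgt A f = Y"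
  shows "f \<boxplus> zrm A X Y = f" "zrm A X Y \<boxplus> f = f"
proof -
  interpret comm_group "\<lparr>carrier = Hom A (src A f) (tgt A f), monoid.mult = addm A,
    one = zrm A (src A f) (tgt A f)\<rparr>"
    using Hom_comm_group[of "src A f" "tgt A f"] assms(1) by simp
  show "f \<boxplus> zrm A X Y = f" "zrm A X Y \<boxplus> f = f"
    using r_one[of f] l_one[of f] assms by auto
qed

text \<open>The category data record addition and zero only, so a negative is chosen;
  \<open>negm_unique\<close> shows that the choice is immaterial.\<close>

definition negm :: "'b \<Rightarrow> 'b" where
  "negm f = (SOME g. g \<in> Hom A (src A f) (tgt A f) \<and> f \<boxplus> g = zrm A (src A f) (tgt A f))"

lemma negm_simps [simp]:
  assumes "f \<in> Mor A"
  shows "negm f \<in> Mor A" "src A (negm f) = src A f" "tgt A (negm f) = tgt A f"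
    "f \<boxplus> negm f = zrm A (src A f) (tgt A f)"
proof -
  interpret comm_group "\<lparr>carrier = Hom A (src A f) (tgt A f), monoid.mult = addm A,
    one = zrm A (src A f) (tgt A f)\<rparr>"
    using Hom_comm_group assms by simp
  have "\<exists>g. g \<in> Hom A (src A f) (tgt A f) \<and> f \<boxplus> g = zrm A (src A f) (tgt A f)"
    using r_inv_ex[of f] assms by auto
  from someI_ex[OF this, folded negm_def]
  show "negm f \<in> Mor A" "src A (negm f) = src A f" "tgt A (negm f) = tgt A f"
    "f \<boxplus> negm f = zrm A (src A f) (tgt A f)"
    by auto
qed

lemma addm_cancel:
  assumes "f \<boxplus> h = g \<boxplus> h" "f \<in> Mor A" "g \<in> Mor A" "h \<in> Mor A"
    "src A f = src A h" "src A g = src A h" "tgt A f = tgt A h" "tgt A g = tgt A h"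
  shows "f = g"
proof -
  have "f = f \<boxplus> (h \<boxplus> negm h)"
    using assms by simp
  also have "\<dots> = (f \<boxplus> h) \<boxplus> negm h"
    using assms(2-) by (subst addm_assoc) auto
  also have "\<dots> = g \<boxplus> (h \<boxplus> negm h)"
    unfolding assms(1) using assms(2-) by (subst addm_assoc) auto
  finally show ?thesis
    using assms by simp
qed

lemma cmp_addm:
  assumes "f \<in> Mor A" "g \<in> Mor A" "h \<in> Mor A" "src A g = src A f" "tgt A g = tgt A f"
  shows "src A h = tgt A f \<Longrightarrow> h \<cdot> (f \<boxplus> g) = (h \<cdot> f) \<boxplus> (h \<cdot> g)"
    "tgt A h = src A f \<Longrightarrow> (f \<boxplus> g) \<cdot> h = (f \<cdot> h) \<boxplus> (g \<cdot> h)"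
  using cmp_add_right[of f "src A f" "tgt A f" g h "tgt A h"]
    cmp_add_left[of h "src A h" "tgt A h" f "tgt A f" g] assms by auto

text \<open>Distributivity gives \<open>f 0 + f 0 = f 0\<close>, and one copy cancels in the group
  of morphisms.\<close>

lemma cmp_zrm [simp]:
  assumes "f \<in> Mor A" "X \<in> Obj A"
  shows "src A f = Y \<Longrightarrow> f \<cdot> zrm A X Y = zrm A X (tgt A f)"
    "tgt A f = Y \<Longrightarrow> zrm A Y X \<cdot> f = zrm A (src A f) X"
proof -
  show "f \<cdot> zrm A X Y = zrm A X (tgt A f)" if "src A f = Y"
  proof -
    have "(f \<cdot> zrm A X Y) \<boxplus> (f \<cdot> zrm A X Y) = f \<cdot> (zrm A X Y \<boxplus> zrm A X Y)"
      using assms that by (subst cmp_addm) auto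
    also have "\<dots> = zrm A X (tgt A f) \<boxplus> (f \<cdot> zrm A X Y)"
      using assms that by auto
    finally show ?thesis
      by (rule addm_cancel[of _ "f \<cdot> zrm A X Y" "zrm A X (tgt A f)"]) (use assms that in auto)
  qed
  show "zrm A Y X \<cdot> f = zrm A (src A f) X" if "tgt A f = Y"
  proof -
    have "(zrm A Y X \<cdot> f) \<boxplus> (zrm A Y X \<cdot> f) = (zrm A Y X \<boxplus> zrm A Y X) \<cdot> f"
      using assms that by (subst cmp_addm) auto
    also have "\<dots> = zrm A (src A f) X \<boxplus> (zrm A Y X \<cdot> f)"
      using assms that by auto
    finally show ?thesis
      by (rule addm_cancel[of _ "zrm A Y X \<cdot> f" "zrm A (src A f) X"]) (use assms that in auto)
  qed
qed

lemma negm_unique: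
  assumes "g \<boxplus> f = zrm A (src A f) (tgt A f)" "f \<in> Mor A" "g \<in> Mor A"
    "src A g = src A f" "tgt A g = tgt A f"
  shows "g = negm f"
  by (rule addm_cancel[of _ f]) (use assms in \<open>auto simp: addm_comm[of "negm f" f]\<close>)

lemma negm_cmp:
  assumes "f \<in> Mor A" "g \<in> Mor A" "src A g = tgt A f"
  shows "negm g \<cdot> f = negm (g \<cdot> f)" "g \<cdot> negm f = negm (g \<cdot> f)"
proof -
  show "negm g \<cdot> f = negm (g \<cdot> f)"
    by (rule negm_unique) (use assms in \<open>auto simp: cmp_addm(2)[symmetric] addm_comm[of "negm g" g]\<close>)
  show "g \<cdot> negm f = negm (g \<cdot> f)"
    by (rule negm_unique) (use assms in \<open>auto simp: cmp_addm(1)[symmetric] addm_comm[of "negm f" f]\<close>)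
qed

lemma negm_zero_iff:
  assumes "f \<boxplus> negm g = zrm A (src A f) (tgt A f)" "f \<in> Mor A" "g \<in> Mor A"
    "src A g = src A f" "tgt A g = tgt A f"
  shows "f = g"
  by (rule addm_cancel[of f "negm g" g]) (use assms in auto)

lemma negm_negm [simp]:
  assumes "f \<in> Mor A"
  shows "negm (negm f) = f"
  by (rule negm_unique[symmetric]) (use assms in auto)

text \<open>Two composites agree precisely when the composite with the difference vanishes, so
  morphisms killed by \<open>f\<close> are the only ones to test.\<close>

lemma monicI:
  assumes "f \<in> Mor A"
    and "\<And>x. x \<in> Mor A \<Longrightarrow> tgt A x = src A f \<Longrightarrow> f \<cdot> x = zrm A (src A x) (tgt A f)
      \<Longrightarrow> x = zrm A (src A x) (src A f)"
  shows "monic f"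
  unfolding monic_def
proof (intro conjI allI ballI impI)
  fix W x y assume h: "x \<in> Hom A W (src A f)" "y \<in> Hom A W (src A f)" "f \<cdot> x = f \<cdot> y"
  then have "f \<cdot> (x \<boxplus> negm y) = zrm A W (tgt A f)"
    using assms(1) by (auto simp: cmp_addm negm_cmp)
  then have "x \<boxplus> negm y = zrm A W (src A f)"
    using assms(2)[of "x \<boxplus> negm y"] h by auto
  then show "x = y"
    by - (rule negm_zero_iff, use h in auto)
qed (use assms in auto)

lemma monic_zeroD:
  assumes "monic f" "f \<cdot> x = zrm A (src A x) (tgt A f)" "x \<in> Mor A" "tgt A x = src A f"
  shows "x = zrm A (src A x) (src A f)"
proof -
  have "f \<in> Mor A"
    using assms by (auto simp: monic_def)
  then show ?thesis
    by - (rule monicD[OF assms(1)], use assms in auto)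
qed

text \<open>Uniqueness of the factorization is delivered by \<open>monic k\<close>, which leaves its
  existence to check.\<close>

lemma is_kernelI:
  assumes "f \<in> Mor A" "monic k" "tgt A k = src A f" "f \<cdot> k = zrm A (src A k) (tgt A f)"
    and "\<And>g. g \<in> Mor A \<Longrightarrow> tgt A g = src A f \<Longrightarrow> f \<cdot> g = zrm A (src A g) (tgt A f) \<Longrightarrow>
      \<exists>h \<in> Mor A. src A h = src A g \<and> tgt A h = src A k \<and> k \<cdot> h = g"
  shows "is_kernel k f"
proof -
  have k: "k \<in> Mor A"
    using assms(2) by (auto simp: monic_def)
  have "\<exists>!h. h \<in> Hom A W (src A k) \<and> k \<cdot> h = g"
    if "g \<in> Hom A W (src A f)" "f \<cdot> g = zrm A W (tgt A f)" for W g
  proof -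
    have "\<exists>h\<in>Mor A. src A h = src A g \<and> tgt A h = src A k \<and> k \<cdot> h = g"
      using assms(5)[of g] that by auto
    then show ?thesis
      using monicD[OF assms(2)] that by (metis (no_types) Hom_iff)
  qed
  then show ?thesis
    using assms(1-4) k unfolding is_kernel_def by blast
qed

lemma is_kernel_simps:
  assumes "is_kernel k f"
  shows "f \<in> Mor A" "k \<in> Mor A" "tgt A k = src A f" "f \<cdot> k = zrm A (src A k) (tgt A f)"
  using assms unfolding is_kernel_def by auto

lemma is_kernel_lift:
  assumes "is_kernel k f" "g \<in> Mor A" "tgt A g = src A f" "f \<cdot> g = zrm A (src A g) (tgt A f)"
  obtains h where "h \<in> Mor A" "src A h = src A g" "tgt A h = src A k" "k \<cdot> h = g"
proof -
  have "\<exists>!h. h \<in> Hom A (src A g) (src A k) \<and> k \<cdot> h = g"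
    using assms(2-4) by (intro assms(1)[unfolded is_kernel_def, THEN conjunct2, THEN conjunct2,
      THEN conjunct2, THEN conjunct2, rule_format]) auto
  then show ?thesis
    using that by auto
qed

lemma is_kernel_monic:
  assumes "is_kernel k f"
  shows "monic k"
proof (rule monicI)
  fix x assume x: "x \<in> Mor A" "tgt A x = src A k" "k \<cdot> x = zrm A (src A x) (tgt A k)"
  note [simp] = is_kernel_simps[OF assms]
  have "f \<cdot> (k \<cdot> x) = zrm A (src A x) (tgt A f)"
    using x by simp
  then have "\<exists>!h. h \<in> Hom A (src A x) (src A k) \<and> k \<cdot> h = k \<cdot> x"
    using assms x unfolding is_kernel_def by (metis (no_types) Hom_iff cmp_simps)
  moreover have "k \<cdot> zrm A (src A x) (src A k) = k \<cdot> x"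
    using x by simp
  ultimately show "x = zrm A (src A x) (src A k)"
    using x by (metis (no_types) Hom_iff zrm_simps is_kernel_simps(2)[OF assms] src_Obj)
qed (use is_kernel_simps[OF assms] in auto)

end

text \<open>The opposite category turns every statement about kernels, push-outs and inflations
  into its dual.\<close>

definition op_cat :: "('a, 'b) cat_data \<Rightarrow> ('a, 'b) cat_data" where
  "op_cat A = \<lparr>Obj = Obj A, Mor = Mor A, src = tgt A, tgt = src A, idm = idm A,
     cmp = (\<lambda>g f. cmp A f g), addm = addm A, zrm = (\<lambda>X Y. zrm A Y X)\<rparr>"

lemma op_cat_simps [simp]:
  "Obj (op_cat A) = Obj A" "Mor (op_cat A) = Mor A" "src (op_cat A) = tgt A"
  "tgt (op_cat A) = src A" "idm (op_cat A) = idm A" "cmp (op_cat A) = (\<lambda>g f. cmp A f g)"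
  "addm (op_cat A) = addm A" "zrm (op_cat A) = (\<lambda>X Y. zrm A Y X)"
  by (simp_all add: op_cat_def)

lemma Hom_op [simp]: "Hom (op_cat A) X Y = Hom A Y X"
  by (auto simp: Hom_def)

lemma (in category) category_op: "category (op_cat A)"
  by unfold_locales (auto simp del: Hom_iff intro: cmp_in cmp_id_left cmp_id_right
    cmp_assoc[symmetric] idm_in)

lemma (in category) op_monic [simp]:
  "category.monic (op_cat A) = epic" "category.epic (op_cat A) = monic"
  "category.zero_object (op_cat A) = zero_object"
  "category.is_pushout (op_cat A) = is_pullback"
  "category.is_pullback (op_cat A) = is_pushout"
proof -
  interpret o: category "op_cat A"
    by (rule category_op)
  show "o.monic = epic" "o.epic = monic" "o.zero_object = zero_object"
    "o.is_pushout = is_pullback" "o.is_pullback = is_pushout"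
    unfolding fun_eq_iff
    by (simp_all add: o.monic_def epic_def o.epic_def monic_def del: Hom_iff o.Hom_iff,
      auto simp: o.zero_object_def zero_object_def o.is_pushout_def
        is_pullback_def o.is_pullback_def is_pushout_def simp del: Hom_iff o.Hom_iff)
qed

lemma (in preadditive_category) preadditive_op: "preadditive_category (op_cat A)"
proof -
  interpret o: category "op_cat A"
    by (rule category_op)
  show ?thesis
    by (intro preadditive_category.intro category_op preadditive_category_axioms.intro)
      (auto simp del: Hom_iff o.Hom_iff intro: Hom_comm_group cmp_add_left cmp_add_right)
qed

lemma (in preadditive_category) op_kernel [simp]:
  "preadditive_category.is_kernel (op_cat A) = is_cokernel"
  "preadditive_category.is_cokernel (op_cat A) = is_kernel"
  "preadditive_category.short_exact (op_cat A) = (\<lambda>i p. short_exact p i)"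
  "preadditive_category.is_biproduct (op_cat A) = (\<lambda>X Y S i j p q. is_biproduct X Y S p q i j)"
proof -
  interpret o: preadditive_category "op_cat A"
    by (rule preadditive_op)
  show ker: "o.is_kernel = is_cokernel" "o.is_cokernel = is_kernel"
    unfolding fun_eq_iff
    by (simp_all add: o.is_kernel_def is_cokernel_def o.is_cokernel_def is_kernel_def
        del: Hom_iff o.Hom_iff)
  show "o.short_exact = (\<lambda>i p. short_exact p i)"
    unfolding fun_eq_iff o.short_exact_def short_exact_def ker by auto
  show "o.is_biproduct = (\<lambda>X Y S i j p q. is_biproduct X Y S p q i j)"
    unfolding fun_eq_iff o.is_biproduct_def is_biproduct_def by (auto simp del: Hom_iff o.Hom_iff)
qed

lemma (in abelian_category) abelian_op: "abelian_category (op_cat A)"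
proof -
  interpret o: preadditive_category "op_cat A"
    by (rule preadditive_op)
  show ?thesis
    by (intro abelian_category.intro preadditive_op abelian_category_axioms.intro)
      (auto intro: ex_zero_object ex_kernel ex_cokernel monic_is_kernel epic_is_cokernel,
        metis ex_biproduct)
qed

lemma (in extension_closed_subcategory) extension_closed_op:
  "extension_closed_subcategory (op_cat A) C"
proof -
  interpret o: abelian_category "op_cat A"
    by (rule abelian_op)
  show ?thesis
  proof
    fix i p assume h: "o.short_exact i p" "src (op_cat A) i \<in> C" "tgt (op_cat A) p \<in> C"
    then have "short_exact p i"
      by simp
    then have "tgt A p \<in> C" "tgt A p = src A i"
      using h sub_extension[of p i] by (auto simp: short_exact_def is_kernel_def)
    then show "tgt (op_cat A) i \<in> C"
      by simp
  qed (use sub_Obj sub_zero in \<open>auto\<close>, metis sub_biproduct)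
qed

lemma (in extension_closed_subcategory) op_conflation [simp]:
  "extension_closed_subcategory.conflation (op_cat A) C = (\<lambda>i p. conflation p i)"
  "extension_closed_subcategory.inflation (op_cat A) C = deflation"
  "extension_closed_subcategory.deflation (op_cat A) C = inflation"
proof -
  interpret o: extension_closed_subcategory "op_cat A" C
    by (rule extension_closed_op)
  show c: "o.conflation = (\<lambda>i p. conflation p i)"
    unfolding fun_eq_iff o.conflation_def conflation_def
    by (auto simp: short_exact_def is_kernel_def)
  show "o.inflation = deflation" "o.deflation = inflation"
    unfolding fun_eq_iff o.inflation_def deflation_def o.deflation_def inflation_def c by auto
qed

section \<open>Dual statements, short exact sequences and biproducts\<close>

context preadditive_category
begin

lemma op_negm [simp]: "preadditive_category.negm (op_cat A) = negm"
proof -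
  interpret o: preadditive_category "op_cat A"
    by (rule preadditive_op)
  show ?thesis
    unfolding fun_eq_iff by (simp add: o.negm_def negm_def del: Hom_iff o.Hom_iff)
qed

lemmas is_cokernel_simps = preadditive_category.is_kernel_simps[OF preadditive_op, simplified]
lemmas is_cokernel_lift = preadditive_category.is_kernel_lift[OF preadditive_op, simplified]
lemmas is_cokernel_epic = preadditive_category.is_kernel_monic[OF preadditive_op, simplified]
lemmas is_cokernelI = preadditive_category.is_kernelI[OF preadditive_op, simplified]
lemmas epicI = preadditive_category.monicI[OF preadditive_op, simplified]
lemmas epic_zeroD = preadditive_category.monic_zeroD[OF preadditive_op, simplified]
lemmas epic_cmp = category.monic_cmp[OF category_op, simplified]
lemmas epic_factor = category.monic_factor[OF category_op, simplified]

lemma short_exact_simps: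
  assumes "short_exact i p"
  shows "i \<in> Mor A" "p \<in> Mor A" "src A p = tgt A i" "p \<cdot> i = zrm A (src A i) (tgt A p)"
    "monic i" "epic p" "is_kernel i p" "is_cokernel p i"
  using assms is_kernel_simps[of i p] is_kernel_monic[of i p] is_cokernel_epic[of p i]
  unfolding short_exact_def by auto

lemma short_exact_lift:
  assumes "short_exact i p" "x \<in> Mor A" "tgt A x = tgt A i" "p \<cdot> x = zrm A (src A x) (tgt A p)"
  obtains y where "y \<in> Mor A" "src A y = src A x" "tgt A y = src A i" "i \<cdot> y = x"
  using is_kernel_lift[of i p x] short_exact_simps[OF assms(1)] assms by metis

lemma short_exact_colift:
  assumes "short_exact i p" "x \<in> Mor A" "src A x = tgt A i" "x \<cdot> i = zrm A (src A i) (tgt A x)"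
  obtains y where "y \<in> Mor A" "src A y = tgt A p" "tgt A y = tgt A x" "y \<cdot> p = x"
  using is_cokernel_lift[of p i x] short_exact_simps[OF assms(1)] assms by metis

lemma is_biproduct_simps:
  assumes "is_biproduct X Y S i j p q"
  shows "i \<in> Mor A" "src A i = X" "tgt A i = S" "j \<in> Mor A" "src A j = Y" "tgt A j = S"
    "p \<in> Mor A" "src A p = S" "tgt A p = X" "q \<in> Mor A" "src A q = S" "tgt A q = Y"
    "p \<cdot> i = idm A X" "q \<cdot> j = idm A Y" "p \<cdot> j = zrm A Y X" "q \<cdot> i = zrm A X Y"
    "X \<in> Obj A" "Y \<in> Obj A" "S \<in> Obj A"
    "x \<in> Mor A \<Longrightarrow> tgt A x = X \<Longrightarrow> p \<cdot> (i \<cdot> x) = x"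
    "x \<in> Mor A \<Longrightarrow> tgt A x = Y \<Longrightarrow> q \<cdot> (j \<cdot> x) = x"
    "x \<in> Mor A \<Longrightarrow> tgt A x = Y \<Longrightarrow> p \<cdot> (j \<cdot> x) = zrm A (src A x) X"
    "x \<in> Mor A \<Longrightarrow> tgt A x = X \<Longrightarrow> q \<cdot> (i \<cdot> x) = zrm A (src A x) Y"
proof -
  show s[simp]: "i \<in> Mor A" "src A i = X" "tgt A i = S" "j \<in> Mor A" "src A j = Y" "tgt A j = S"
    "p \<in> Mor A" "src A p = S" "tgt A p = X" "q \<in> Mor A" "src A q = S" "tgt A q = Y"
    and e[simp]: "p \<cdot> i = idm A X" "q \<cdot> j = idm A Y" "p \<cdot> j = zrm A Y X" "q \<cdot> i = zrm A X Y"
    using assms by (auto simp: is_biproduct_def)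
  show o[simp]: "X \<in> Obj A" "Y \<in> Obj A" "S \<in> Obj A"
    using src_Obj[of i] src_Obj[of j] tgt_Obj[of i] by simp_all
  show "x \<in> Mor A \<Longrightarrow> tgt A x = X \<Longrightarrow> p \<cdot> (i \<cdot> x) = x"
    "x \<in> Mor A \<Longrightarrow> tgt A x = Y \<Longrightarrow> q \<cdot> (j \<cdot> x) = x"
    "x \<in> Mor A \<Longrightarrow> tgt A x = Y \<Longrightarrow> p \<cdot> (j \<cdot> x) = zrm A (src A x) X"
    "x \<in> Mor A \<Longrightarrow> tgt A x = X \<Longrightarrow> q \<cdot> (i \<cdot> x) = zrm A (src A x) Y"
    using cmp_reassoc[OF e(1), of x] cmp_reassoc[OF e(2), of x] cmp_reassoc[OF e(3), of x]
      cmp_reassoc[OF e(4), of x]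
    by simp_all
qed

lemma biproduct_decomp:
  assumes "is_biproduct X Y S i j p q"
  shows "x \<in> Mor A \<Longrightarrow> tgt A x = S \<Longrightarrow> x = (i \<cdot> (p \<cdot> x)) \<boxplus> (j \<cdot> (q \<cdot> x))"
    "x \<in> Mor A \<Longrightarrow> src A x = S \<Longrightarrow> x = (x \<cdot> i) \<cdot> p \<boxplus> (x \<cdot> j) \<cdot> q"
proof -
  note [simp] = is_biproduct_simps[OF assms]
  have id: "(i \<cdot> p) \<boxplus> (j \<cdot> q) = idm A S"
    using assms by (auto simp: is_biproduct_def)
  show "x = (i \<cdot> (p \<cdot> x)) \<boxplus> (j \<cdot> (q \<cdot> x))" if "x \<in> Mor A" "tgt A x = S"
    using that arg_cong[OF id, of "\<lambda>z. z \<cdot> x"] by (simp add: cmp_addm)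
  show "x = (x \<cdot> i) \<cdot> p \<boxplus> (x \<cdot> j) \<cdot> q" if "x \<in> Mor A" "src A x = S"
    using that arg_cong[OF id, of "\<lambda>z. x \<cdot> z"] by (simp add: cmp_addm)
qed

lemma biproduct_eqI:
  assumes "is_biproduct X Y S i j p q" "x \<in> Mor A" "y \<in> Mor A"
  shows "tgt A x = S \<Longrightarrow> tgt A y = S \<Longrightarrow> p \<cdot> x = p \<cdot> y \<Longrightarrow> q \<cdot> x = q \<cdot> y \<Longrightarrow> x = y"
    "src A x = S \<Longrightarrow> src A y = S \<Longrightarrow> x \<cdot> i = y \<cdot> i \<Longrightarrow> x \<cdot> j = y \<cdot> j \<Longrightarrow> x = y"
  using biproduct_decomp[OF assms(1), of x] biproduct_decomp[OF assms(1), of y] assms by auto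

end

section \<open>Universal properties of push-outs and pull-backs\<close>

context category
begin

lemma pushout_simps:
  assumes "is_pushout f g u v"
  shows "f \<in> Mor A" "g \<in> Mor A" "src A g = src A f" "u \<in> Mor A" "v \<in> Mor A"
    "src A u = tgt A f" "src A v = tgt A g" "tgt A v = tgt A u" "u \<cdot> f = v \<cdot> g"
  using assms unfolding is_pushout_def by auto

lemma pushout_unique:
  assumes "is_pushout f g u v" "t \<cdot> u = s \<cdot> u" "t \<cdot> v = s \<cdot> v" "t \<in> Mor A" "s \<in> Mor A"
    "src A t = tgt A u" "src A s = tgt A u" "tgt A t = tgt A s"
  shows "t = s"
proof -
  note p = pushout_simps[OF assms(1)]
  have "(s \<cdot> u) \<cdot> f = (s \<cdot> v) \<cdot> g"
    using p assms by simp
  with assms(1) have "\<exists>!x. x \<in> Hom A (tgt A u) (tgt A s) \<and> x \<cdot> u = s \<cdot> u \<and> x \<cdot> v = s \<cdot> v"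
    unfolding is_pushout_def using p(4-9) assms(4-8) by (elim conjE exE) simp
  then show ?thesis
    using assms(2-) by (metis (no_types) Hom_iff)
qed

lemma pushout_colift:
  assumes "is_pushout f g u v" "u' \<in> Mor A" "v' \<in> Mor A" "src A u' = tgt A f"
    "src A v' = tgt A g" "tgt A v' = tgt A u'" "u' \<cdot> f = v' \<cdot> g"
  obtains t where "t \<in> Mor A" "src A t = tgt A u" "tgt A t = tgt A u'" "t \<cdot> u = u'" "t \<cdot> v = v'"
proof -
  have "\<exists>!t. t \<in> Hom A (tgt A u) (tgt A u') \<and> t \<cdot> u = u' \<and> t \<cdot> v = v'"
    using assms unfolding is_pushout_def by (elim conjE exE) simp
  then show ?thesis
    using that by auto
qed

lemma is_pushoutI:
  assumes "f \<in> Mor A" "g \<in> Mor A" "src A g = src A f" "u \<in> Mor A" "v \<in> Mor A"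
    "src A u = tgt A f" "src A v = tgt A g" "tgt A v = tgt A u" "u \<cdot> f = v \<cdot> g"
    and colift: "\<And>u' v'. u' \<in> Mor A \<Longrightarrow> v' \<in> Mor A \<Longrightarrow> src A u' = tgt A f \<Longrightarrow>
      src A v' = tgt A g \<Longrightarrow> tgt A v' = tgt A u' \<Longrightarrow> u' \<cdot> f = v' \<cdot> g \<Longrightarrow>
      \<exists>t \<in> Mor A. src A t = tgt A u \<and> tgt A t = tgt A u' \<and> t \<cdot> u = u' \<and> t \<cdot> v = v'"
    and unique: "\<And>t s. t \<in> Mor A \<Longrightarrow> s \<in> Mor A \<Longrightarrow> src A t = tgt A u \<Longrightarrow> src A s = tgt A u \<Longrightarrow>
      tgt A t = tgt A s \<Longrightarrow> t \<cdot> u = s \<cdot> u \<Longrightarrow> t \<cdot> v = s \<cdot> v \<Longrightarrow> t = s"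
  shows "is_pushout f g u v"
proof -
  have "\<exists>!t. t \<in> Hom A (tgt A u) T \<and> t \<cdot> u = u' \<and> t \<cdot> v = v'"
    if h: "u' \<in> Hom A (tgt A f) T" "v' \<in> Hom A (tgt A g) T" "u' \<cdot> f = v' \<cdot> g" for T u' v'
  proof -
    obtain t where t: "t \<in> Mor A" "src A t = tgt A u" "tgt A t = tgt A u'" "t \<cdot> u = u'" "t \<cdot> v = v'"
      using colift[of u' v'] h by auto
    show ?thesis
    proof (rule ex1I)
      show "t \<in> Hom A (tgt A u) T \<and> t \<cdot> u = u' \<and> t \<cdot> v = v'"
        using t h by auto
      fix s assume "s \<in> Hom A (tgt A u) T \<and> s \<cdot> u = u' \<and> s \<cdot> v = v'"
      then show "s = t"
        using t h unique[of s t] by auto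
    qed
  qed
  then show ?thesis
    unfolding is_pushout_def using assms(1-9) by (intro conjI exI[of _ "tgt A u"] allI ballI impI) auto
qed

lemmas pullback_unique = category.pushout_unique[OF category_op, simplified]
lemmas pullback_lift = category.pushout_colift[OF category_op, simplified]

end

section \<open>Short exact sequences in an abelian category: five lemma and push-outs\<close>

context abelian_category
begin

text \<open>The monic \<open>f\<close> is the kernel of some \<open>g\<close>, and \<open>g\<close>
  factors through the cokernel \<open>c\<close>. Hence whatever \<open>c\<close> kills is killed by
  \<open>g\<close> and lifts through \<open>f\<close>.\<close>

lemma monic_cokernel_short_exact:
  assumes "monic f" "is_cokernel c f"
  shows "short_exact f c"
proof -
  note [simp] = is_cokernel_simps[OF assms(2)]
  obtain g where g: "is_kernel f g"
    using monic_is_kernel assms by auto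
  note [simp] = is_kernel_simps[OF g]
  obtain y where y [simp]: "y \<in> Mor A" "src A y = tgt A c" "tgt A y = tgt A g" and yc: "y \<cdot> c = g"
    using is_cokernel_lift[OF assms(2), of g] by auto
  have "is_kernel f c"
  proof (rule is_kernelI)
    fix x assume x [simp]: "x \<in> Mor A" "tgt A x = src A c" "c \<cdot> x = zrm A (src A x) (tgt A c)"
    have "g \<cdot> x = zrm A (src A x) (tgt A g)"
      unfolding yc[symmetric] by simp
    then show "\<exists>h\<in>Mor A. src A h = src A x \<and> tgt A h = src A f \<and> f \<cdot> h = x"
      using is_kernel_lift[OF g, of x] by auto
  qed (use assms in auto)
  then show ?thesis
    using assms by (auto simp: short_exact_def)
qed

lemmas epic_kernel_short_exact =
  abelian_category.monic_cokernel_short_exact[OF abelian_op, simplified]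

text \<open>An epic has zero cokernel, so the identity of the target lifts through \<open>f\<close>,
  which as a monic is the kernel of its cokernel. The right inverse obtained is two-sided because
  \<open>f\<close> can be cancelled.\<close>

lemma monic_epic_iso:
  assumes "monic f" "epic f"
  obtains g where "g \<in> Mor A" "src A g = tgt A f" "tgt A g = src A f"
    "f \<cdot> g = idm A (tgt A f)" "g \<cdot> f = idm A (src A f)"
proof -
  have f [simp]: "f \<in> Mor A"
    using assms by (auto simp: monic_def)
  obtain c where c: "is_cokernel c f"
    using ex_cokernel[OF f] by blast
  note [simp] = is_cokernel_simps[OF c]
  have se: "short_exact f c"
    using monic_cokernel_short_exact[OF assms(1) c] .
  have "c = zrm A (tgt A f) (tgt A c)"
    using epic_zeroD[OF assms(2), of c] by simp
  then have "c \<cdot> idm A (tgt A f) = zrm A (tgt A f) (tgt A c)"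
    by simp
  then obtain g where g: "g \<in> Mor A" "src A g = tgt A f" "tgt A g = src A f" "f \<cdot> g = idm A (tgt A f)"
    using short_exact_lift[OF se, of "idm A (tgt A f)"] by auto
  have "f \<cdot> (g \<cdot> f) = f \<cdot> idm A (src A f)"
    using g cmp_reassoc[OF g(4), of f] by simp
  then have "g \<cdot> f = idm A (src A f)"
    by - (rule monicD[OF assms(1)], use g in auto)
  then show ?thesis
    using that g by auto
qed

text \<open>A chase with generalized elements: if \<open>t x = 0\<close> then
  \<open>p x = p' t x = 0\<close>, so \<open>x = i y\<close>; now \<open>i' y = t x = 0\<close>
  forces \<open>y = 0\<close>.\<close>

lemma five_monic:
  assumes "short_exact i p" "short_exact i' p'" "t \<in> Mor A" "src A t = tgt A i" "tgt A t = tgt A i'"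
    and "t \<cdot> i = i'" "p' \<cdot> t = p" "tgt A p' = tgt A p"
  shows "monic t"
proof (rule monicI)
  fix x assume x [simp]: "x \<in> Mor A" "tgt A x = src A t" "t \<cdot> x = zrm A (src A x) (tgt A t)"
  note [simp] = short_exact_simps[OF assms(1)] short_exact_simps[OF assms(2)] assms(3-5)
  have "p \<cdot> x = p' \<cdot> (t \<cdot> x)"
    using cmp_reassoc[OF assms(7), of x] by simp
  also have "\<dots> = zrm A (src A x) (tgt A p)"
    using assms(8) by simp
  finally obtain y where y [simp]: "y \<in> Mor A" "src A y = src A x" "tgt A y = src A i"
    and iy: "i \<cdot> y = x"
    using short_exact_lift[OF assms(1), of x] by auto
  have src: "src A i' = src A i"
    using assms(6) by auto
  have "i' \<cdot> y = t \<cdot> x"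
    using cmp_reassoc[OF assms(6), of y] iy by simp
  then have "y = zrm A (src A y) (src A i')"
    using monic_zeroD[of i' y] src by simp
  then show "x = zrm A (src A x) (src A t)"
    using iy src by (metis assms(4) cmp_zrm(1) short_exact_simps(1)[OF assms(1)] src_Obj x(1) y(2))
qed (use assms in auto)

lemmas five_epic = abelian_category.five_monic[OF abelian_op, simplified]

lemma short_five:
  assumes "short_exact i p" "short_exact i' p'" "t \<in> Mor A" "src A t = tgt A i" "tgt A t = tgt A i'"
    and "t \<cdot> i = i'" "p' \<cdot> t = p" "tgt A p' = tgt A p"
  obtains s where "s \<in> Mor A" "src A s = tgt A i'" "tgt A s = tgt A i"
    "t \<cdot> s = idm A (tgt A i')" "s \<cdot> t = idm A (tgt A i)" "s \<cdot> i' = i" "p \<cdot> s = p'"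
proof -
  note [simp] = short_exact_simps[OF assms(1)] short_exact_simps[OF assms(2)] assms(3-5)
  have "src A i' = src A i"
    using assms(6) by auto
  then have "epic t"
    using five_epic[OF assms(2,1), of t] assms by simp
  moreover have "monic t"
    using five_monic[OF assms] .
  ultimately obtain s where s: "s \<in> Mor A" "src A s = tgt A t" "tgt A s = src A t"
    "t \<cdot> s = idm A (tgt A t)" "s \<cdot> t = idm A (src A t)"
    using monic_epic_iso by blast
  have "s \<cdot> i' = i"
    using cmp_reassoc[OF s(5), of i] s assms(6) by simp
  moreover have "p \<cdot> s = p'"
    using s assms(7) by (metis assms(3-5) cmp_assoc_simp cmp_idm(2) short_exact_simps(2,3)[OF assms(2)])
  ultimately show ?thesis
    using that s by simp
qed

text \<open>The push-out is the cokernel \<open>c\<close> of \<open>m = (i, -g)\<close> into the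
  biproduct. Biproduct, \<open>m\<close> and \<open>c\<close> stay visible in the conclusion because
  later squares need the explicit components and not just the universal property.\<close>

lemma ex_pushout:
  assumes "short_exact i p" "g \<in> Mor A" "src A g = src A i"
  obtains S a b a' b' m c u i' p' where
    "is_biproduct (tgt A i) (tgt A g) S a b a' b'" "m = (a \<cdot> i) \<boxplus> (b \<cdot> negm g)" "short_exact m c"
    "u = c \<cdot> a" "i' = c \<cdot> b" "is_pushout i g u i'" "short_exact i' p'" "p' \<cdot> u = p"
    "tgt A p' = tgt A p"
proof -
  note [simp] = short_exact_simps[OF assms(1)] assms(2,3)
  obtain S a b a' b' where bp: "is_biproduct (tgt A i) (tgt A g) S a b a' b'"
    using ex_biproduct by (meson assms(2) short_exact_simps(1)[OF assms(1)] tgt_Obj)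
  note [simp] = is_biproduct_simps[OF bp]
  define m where "m = (a \<cdot> i) \<boxplus> (b \<cdot> negm g)"
  have m [simp]: "m \<in> Mor A" "src A m = src A i" "tgt A m = S" "a' \<cdot> m = i" "b' \<cdot> m = negm g"
    by (simp_all add: m_def cmp_addm)
  have "monic (a' \<cdot> m)"
    by simp
  then have "monic m"
    by (rule monic_factor) auto
  moreover obtain c where c: "is_cokernel c m"
    using ex_cokernel[OF m(1)] by blast
  ultimately have se: "short_exact m c"
    using monic_cokernel_short_exact by blast
  note [simp] = is_cokernel_simps[OF c]
  have x_m: "x \<cdot> m = (x \<cdot> a) \<cdot> i \<boxplus> negm ((x \<cdot> b) \<cdot> g)" if "x \<in> Mor A" "src A x = S" for x
    using that by (simp add: m_def cmp_addm negm_cmp)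
  have colift: "\<exists>t\<in>Mor A. src A t = tgt A c \<and> tgt A t = tgt A u' \<and> t \<cdot> (c \<cdot> a) = u' \<and> t \<cdot> (c \<cdot> b) = v'"
    if [simp]: "u' \<in> Mor A" "v' \<in> Mor A" "src A u' = tgt A i" "src A v' = tgt A g"
      "tgt A v' = tgt A u'" and e: "u' \<cdot> i = v' \<cdot> g" for u' v'
  proof -
    let ?x = "(u' \<cdot> a') \<boxplus> (v' \<cdot> b')"
    have x [simp]: "?x \<cdot> a = u'" "?x \<cdot> b = v'"
      by (simp_all add: cmp_addm)
    have "?x \<cdot> m = zrm A (src A m) (tgt A ?x)"
      using e by (subst x_m) simp_all
    then obtain t where t: "t \<in> Mor A" "src A t = tgt A c" "tgt A t = tgt A ?x" "t \<cdot> c = ?x"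
      using short_exact_colift[OF se, of ?x] by auto
    then show ?thesis
      using cmp_reassoc[OF t(4), of a] cmp_reassoc[OF t(4), of b] by auto
  qed
  have "(c \<cdot> a) \<cdot> i \<boxplus> negm ((c \<cdot> b) \<cdot> g) = zrm A (src A m) (tgt A c)"
    using x_m[of c] by simp
  then have ca: "(c \<cdot> a) \<cdot> i = (c \<cdot> b) \<cdot> g"
    by - (rule negm_zero_iff, auto)
  have epic: "epic c"
    using short_exact_simps[OF se] by simp
  have po: "is_pushout i g (c \<cdot> a) (c \<cdot> b)"
  proof (rule is_pushoutI)
    fix t s assume [simp]: "t \<in> Mor A" "s \<in> Mor A" and "src A t = tgt A (c \<cdot> a)"
      "src A s = tgt A (c \<cdot> a)" "tgt A t = tgt A s"
      and e: "t \<cdot> (c \<cdot> a) = s \<cdot> (c \<cdot> a)" "t \<cdot> (c \<cdot> b) = s \<cdot> (c \<cdot> b)"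
    then have [simp]: "src A t = tgt A c" "src A s = tgt A c" "tgt A t = tgt A s"
      by simp_all
    have "t \<cdot> c = s \<cdot> c"
      using e by - (rule biproduct_eqI(2)[OF bp], simp_all)
    then show "t = s"
      by - (rule epicD[OF epic], simp_all)
  qed (use ca colift in simp_all)
  obtain p' where p' [simp]: "p' \<in> Mor A" "src A p' = tgt A c" "tgt A p' = tgt A p"
    and p'u: "p' \<cdot> (c \<cdot> a) = p" and p'i: "p' \<cdot> (c \<cdot> b) = zrm A (tgt A g) (tgt A p)"
    using colift[of p "zrm A (tgt A g) (tgt A p)"] by auto
  \<comment> \<open>If \<open>c b x = 0\<close> then \<open>b x = m y\<close>; the first component
    gives \<open>i y = 0\<close>, so \<open>y = 0\<close> and \<open>b x = 0\<close>.\<close>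
  have mon: "monic (c \<cdot> b)"
  proof (rule monicI)
    fix x assume [simp]: "x \<in> Mor A" and "tgt A x = src A (c \<cdot> b)"
      and "(c \<cdot> b) \<cdot> x = zrm A (src A x) (tgt A (c \<cdot> b))"
    then have [simp]: "tgt A x = tgt A g" and e: "c \<cdot> (b \<cdot> x) = zrm A (src A x) (tgt A c)"
      by simp_all
    obtain y where y: "y \<in> Mor A" "src A y = src A x" "tgt A y = src A i" "m \<cdot> y = b \<cdot> x"
      using short_exact_lift[OF se, of "b \<cdot> x"] e by auto
    have "i \<cdot> y = a' \<cdot> (m \<cdot> y)"
      using y cmp_reassoc[OF m(4), of y] by simp
    also have "\<dots> = zrm A (src A x) (tgt A i)"
      using y(4) by simp
    finally have "y = zrm A (src A x) (src A i)"
      using monic_zeroD[of i y] y by simp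
    then have "b \<cdot> x = zrm A (src A x) S"
      using y(4) by simp
    then have "b' \<cdot> (b \<cdot> x) = zrm A (src A x) (tgt A g)"
      by (simp del: is_biproduct_simps)
    then show "x = zrm A (src A x) (src A (c \<cdot> b))"
      by simp
  qed simp
  have "is_cokernel p' (c \<cdot> b)"
  proof (rule is_cokernelI)
    have "epic (p' \<cdot> (c \<cdot> a))"
      using p'u by simp
    then show "epic p'"
      by (rule epic_factor) auto
    fix x assume [simp]: "x \<in> Mor A" and "src A x = tgt A (c \<cdot> b)"
      and xz: "x \<cdot> (c \<cdot> b) = zrm A (src A (c \<cdot> b)) (tgt A x)"
    then have [simp]: "src A x = tgt A c"
      by simp
    have "(x \<cdot> (c \<cdot> a)) \<cdot> i = (x \<cdot> (c \<cdot> b)) \<cdot> g"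
      using ca by simp
    also have "\<dots> = zrm A (src A i) (tgt A x)"
      unfolding xz by simp
    finally obtain y where y [simp]: "y \<in> Mor A" "src A y = tgt A p" "tgt A y = tgt A x"
      and yp: "y \<cdot> p = x \<cdot> (c \<cdot> a)"
      using short_exact_colift[OF assms(1), of "x \<cdot> (c \<cdot> a)"] by auto
    have "y \<cdot> p' = x"
    proof (rule pushout_unique[OF po])
      show "(y \<cdot> p') \<cdot> (c \<cdot> a) = x \<cdot> (c \<cdot> a)"
        using p'u yp by simp
      show "(y \<cdot> p') \<cdot> (c \<cdot> b) = x \<cdot> (c \<cdot> b)"
        using p'i xz by simp
    qed simp_all
    then show "\<exists>h\<in>Mor A. tgt A h = tgt A x \<and> src A h = tgt A p' \<and> h \<cdot> p' = x"
      using y p' by (intro bexI[of _ y]) auto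
  qed (use p'i in simp_all)
  then have "short_exact (c \<cdot> b) p'"
    using monic_cokernel_short_exact[OF mon] by blast
  from that[OF bp m_def se refl refl po this p'u p'(3)] show ?thesis .
qed

text \<open>An arbitrary push-out square is compared with the constructed one: the comparison
  \<open>t\<close> satisfies \<open>t i' = i0\<close> with \<open>i0\<close> monic, so
  \<open>i'\<close> is monic. The cokernel property needs the universal property alone.\<close>

lemma pushout_short_exact:
  assumes "short_exact i p" "is_pushout i g u i'" "p' \<in> Mor A" "src A p' = tgt A i'"
    "tgt A p' = tgt A p" "p' \<cdot> u = p" "p' \<cdot> i' = zrm A (tgt A g) (tgt A p)"
  shows "short_exact i' p'"
proof -
  note [simp] = short_exact_simps[OF assms(1)] pushout_simps[OF assms(2)] assms(3-5)
  obtain u0 i0 p0 where po: "is_pushout i g u0 i0" "short_exact i0 p0"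
    using ex_pushout[OF assms(1), of g] by (metis pushout_simps(2,3)[OF assms(2)])
  note [simp] = pushout_simps[OF po(1)]
  obtain t where t: "t \<in> Mor A" "src A t = tgt A u" "tgt A t = tgt A u0" "t \<cdot> u = u0" "t \<cdot> i' = i0"
    using pushout_colift[OF assms(2), of u0 i0] by auto
  have "monic (t \<cdot> i')"
    using t short_exact_simps(5)[OF po(2)] by simp
  then have "monic i'"
    by (rule monic_factor) (use t in auto)
  moreover have "is_cokernel p' i'"
  proof (rule is_cokernelI)
    have "epic (p' \<cdot> u)"
      using assms(6) by simp
    then show "epic p'"
      by (rule epic_factor) auto
    fix x assume [simp]: "x \<in> Mor A" and "src A x = tgt A i'"
      and xz: "x \<cdot> i' = zrm A (src A i') (tgt A x)"
    then have [simp]: "src A x = tgt A u"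
      by simp
    have "(x \<cdot> u) \<cdot> i = (x \<cdot> i') \<cdot> g"
      by simp
    also have "\<dots> = zrm A (src A i) (tgt A x)"
      unfolding xz by simp
    finally obtain y where y [simp]: "y \<in> Mor A" "src A y = tgt A p" "tgt A y = tgt A x"
      and yp: "y \<cdot> p = x \<cdot> u"
      using short_exact_colift[OF assms(1), of "x \<cdot> u"] by auto
    have "y \<cdot> p' = x"
      by (rule pushout_unique[OF assms(2)]) (use assms yp xz in auto)
    then show "\<exists>h\<in>Mor A. tgt A h = tgt A x \<and> src A h = tgt A p' \<and> h \<cdot> p' = x"
      by (intro bexI[of _ y]) simp_all
  qed (use assms(7) in simp_all)
  ultimately show ?thesis
    using monic_cokernel_short_exact by blast
qed

lemmas ex_pullback = abelian_category.ex_pushout[OF abelian_op, simplified]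

end

section \<open>Chosen biproducts, direct sums of sequences, splitting\<close>

context abelian_category
begin

text \<open>This is the form in which the object of the chosen biproduct occurs in
  \<open>dsum_class\<close> and \<open>baer_sum\<close>.\<close>

definition bsum :: "'a \<Rightarrow> 'a \<Rightarrow> 'a" where
  "bsum X Y = src A (prj1 X Y)"

lemma bip_biproduct:
  assumes "X \<in> Obj A" "Y \<in> Obj A"
  shows "is_biproduct X Y (bsum X Y) (inj1 X Y) (inj2 X Y) (prj1 X Y) (prj2 X Y)"
proof -
  have "\<exists>x. case x of (S, i, j, p, q) \<Rightarrow> is_biproduct X Y S i j p q"
    using ex_biproduct[OF assms] by auto
  from someI_ex[OF this]
  obtain S i j p q where b: "bip X Y = (S, i, j, p, q)" "is_biproduct X Y S i j p q"
    by (auto simp: bip_def split: prod.splits)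
  then show ?thesis
    using is_biproduct_simps[OF b(2)] by (simp add: inj1_def inj2_def prj1_def prj2_def bsum_def)
qed

lemmas bip_simps [simp] = is_biproduct_simps(1-16,19-23)[OF bip_biproduct]

lemma dsum_simps [simp]:
  assumes "f \<in> Mor A" "g \<in> Mor A"
  shows "dsum f g \<in> Mor A" "src A (dsum f g) = bsum (src A f) (src A g)"
    "tgt A (dsum f g) = bsum (tgt A f) (tgt A g)"
  using assms by (simp_all add: dsum_def)

lemma dsum_inj:
  assumes "f \<in> Mor A" "g \<in> Mor A" "src A f = X" "src A g = Y" "tgt A f = X'" "tgt A g = Y'"
  shows "dsum f g \<cdot> inj1 X Y = inj1 X' Y' \<cdot> f" "dsum f g \<cdot> inj2 X Y = inj2 X' Y' \<cdot> g"
    "prj1 X' Y' \<cdot> dsum f g = f \<cdot> prj1 X Y" "prj2 X' Y' \<cdot> dsum f g = g \<cdot> prj2 X Y"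
  using assms(1,2) unfolding assms(3-6)[symmetric] by (simp_all add: dsum_def cmp_addm)

lemma dsum_inj_cmp:
  assumes "f \<in> Mor A" "g \<in> Mor A" "src A f = X" "src A g = Y" "tgt A f = X'" "tgt A g = Y'"
    and "x \<in> Mor A"
  shows "tgt A x = X \<Longrightarrow> dsum f g \<cdot> (inj1 X Y \<cdot> x) = inj1 X' Y' \<cdot> (f \<cdot> x)"
    "tgt A x = Y \<Longrightarrow> dsum f g \<cdot> (inj2 X Y \<cdot> x) = inj2 X' Y' \<cdot> (g \<cdot> x)"
proof -
  have [simp]: "X \<in> Obj A" "Y \<in> Obj A" "X' \<in> Obj A" "Y' \<in> Obj A"
    using assms by auto
  show "tgt A x = X \<Longrightarrow> dsum f g \<cdot> (inj1 X Y \<cdot> x) = inj1 X' Y' \<cdot> (f \<cdot> x)"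
    "tgt A x = Y \<Longrightarrow> dsum f g \<cdot> (inj2 X Y \<cdot> x) = inj2 X' Y' \<cdot> (g \<cdot> x)"
    using cmp_reassoc[OF dsum_inj(1)[OF assms(1-6)], of x]
      cmp_reassoc[OF dsum_inj(2)[OF assms(1-6)], of x] assms
    by simp_all
qed

lemma dsum_cmp:
  assumes "f \<in> Mor A" "g \<in> Mor A" "f' \<in> Mor A" "g' \<in> Mor A" "src A f' = tgt A f" "src A g' = tgt A g"
  shows "dsum f' g' \<cdot> dsum f g = dsum (f' \<cdot> f) (g' \<cdot> g)"
  by (rule biproduct_eqI(2)[OF bip_biproduct[of "src A f" "src A g"]])
    (use assms in \<open>simp_all add: dsum_inj dsum_inj_cmp\<close>)

lemma dsum_idm:
  assumes "X \<in> Obj A" "Y \<in> Obj A"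
  shows "dsum (idm A X) (idm A Y) = idm A (bsum X Y)"
  by (rule biproduct_eqI(2)[OF bip_biproduct[of X Y]]) (use assms in \<open>simp_all add: dsum_inj\<close>)

text \<open>Arbitrary biproducts are allowed because the ones chosen in the opposite category need
  not be the opposites of the chosen ones; in this generality duality yields the cokernel
  half.\<close>

lemma biproduct_is_kernel:
  assumes b0: "is_biproduct (src A i) (src A j) S0 a0 b0 c0 d0"
    and b1: "is_biproduct (src A p) (src A q) S1 a1 b1 c1 d1"
    and b2: "is_biproduct (tgt A p) (tgt A q) S2 a2 b2 c2 d2"
    and i: "is_kernel i p" and j: "is_kernel j q"
  shows "is_kernel ((a1 \<cdot> (i \<cdot> c0)) \<boxplus> (b1 \<cdot> (j \<cdot> d0))) ((a2 \<cdot> (p \<cdot> c1)) \<boxplus> (b2 \<cdot> (q \<cdot> d1)))"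
    (is "is_kernel ?i ?p")
proof (rule is_kernelI)
  note [simp] = is_biproduct_simps[OF b0] is_biproduct_simps[OF b1] is_biproduct_simps[OF b2]
    is_kernel_simps[OF i] is_kernel_simps[OF j]
  have [simp]: "?p \<in> Mor A" "src A ?p = S1" "tgt A ?p = S2"
    "?i \<in> Mor A" "src A ?i = S0" "tgt A ?i = S1"
    by simp_all
  have pi [simp]: "p \<cdot> (i \<cdot> x) = zrm A (src A x) (tgt A p)"
    if "x \<in> Mor A" "tgt A x = src A i" for x
    using cmp_reassoc[OF is_kernel_simps(4)[OF i], of x] that by simp
  have qj [simp]: "q \<cdot> (j \<cdot> x) = zrm A (src A x) (tgt A q)"
    if "x \<in> Mor A" "tgt A x = src A j" for x
    using cmp_reassoc[OF is_kernel_simps(4)[OF j], of x] that by simp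
  show "?p \<in> Mor A" "tgt A ?i = src A ?p"
    by simp_all
  show "?p \<cdot> ?i = zrm A (src A ?i) (tgt A ?p)"
    by (simp add: cmp_addm)
  show "monic ?i"
  proof (rule monicI)
    fix x assume [simp]: "x \<in> Mor A" and "tgt A x = src A ?i" and z: "?i \<cdot> x = zrm A (src A x) (tgt A ?i)"
    then have [simp]: "tgt A x = S0"
      by simp
    have "c1 \<cdot> (?i \<cdot> x) = i \<cdot> (c0 \<cdot> x)" "d1 \<cdot> (?i \<cdot> x) = j \<cdot> (d0 \<cdot> x)"
      by (simp_all add: cmp_addm)
    then have "c0 \<cdot> x = zrm A (src A x) (src A i)" "d0 \<cdot> x = zrm A (src A x) (src A j)"
      using monic_zeroD[OF is_kernel_monic[OF i], of "c0 \<cdot> x"]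
        monic_zeroD[OF is_kernel_monic[OF j], of "d0 \<cdot> x"] z by auto
    then show "x = zrm A (src A x) (src A ?i)"
      by - (rule biproduct_eqI(1)[OF b0], simp_all)
  qed simp
  fix x assume x [simp]: "x \<in> Mor A" and "tgt A x = src A ?p" and z: "?p \<cdot> x = zrm A (src A x) (tgt A ?p)"
  then have [simp]: "tgt A x = S1"
    by simp
  have "c2 \<cdot> (?p \<cdot> x) = p \<cdot> (c1 \<cdot> x)" "d2 \<cdot> (?p \<cdot> x) = q \<cdot> (d1 \<cdot> x)"
    by (simp_all add: cmp_addm)
  then have "p \<cdot> (c1 \<cdot> x) = zrm A (src A x) (tgt A p)" "q \<cdot> (d1 \<cdot> x) = zrm A (src A x) (tgt A q)"
    using z by auto
  then obtain y1 y2 where y [simp]: "y1 \<in> Mor A" "src A y1 = src A x" "tgt A y1 = src A i"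
    "y2 \<in> Mor A" "src A y2 = src A x" "tgt A y2 = src A j"
    and e: "i \<cdot> y1 = c1 \<cdot> x" "j \<cdot> y2 = d1 \<cdot> x"
    using is_kernel_lift[OF i, of "c1 \<cdot> x"] is_kernel_lift[OF j, of "d1 \<cdot> x"]
    by (smt (verit) cmp_simps \<open>tgt A x = S1\<close> is_biproduct_simps(7-12)[OF b1] x)
  let ?y = "(a0 \<cdot> y1) \<boxplus> (b0 \<cdot> y2)"
  have "?i \<cdot> ?y = x"
    by (rule biproduct_eqI(1)[OF b1]) (simp_all add: cmp_addm e)
  then show "\<exists>h\<in>Mor A. src A h = src A x \<and> tgt A h = src A ?i \<and> ?i \<cdot> h = x"
    by (intro bexI[of _ ?y]) simp_all
qed

lemmas biproduct_is_cokernel = abelian_category.biproduct_is_kernel[OF abelian_op, simplified]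

lemma dsum_short_exact:
  assumes "short_exact i p" "short_exact j q"
  shows "short_exact (dsum i j) (dsum p q)"
proof -
  note [simp] = short_exact_simps(1-3)[OF assms(1)] short_exact_simps(1-3)[OF assms(2)]
  note b = bip_biproduct[of "src A i" "src A j"] bip_biproduct[of "tgt A i" "tgt A j"]
    bip_biproduct[of "tgt A p" "tgt A q"]
  note b2 = bip_biproduct[of "src A p" "src A q"]
  note k = short_exact_simps(7,8)[OF assms(1)] short_exact_simps(7,8)[OF assms(2)]
  have "is_kernel (dsum i j) (dsum p q)"
    using biproduct_is_kernel[OF _ _ _ k(1,3), OF b(1) b2 b(3)] by (simp add: dsum_def)
  moreover have "is_cokernel (dsum p q) (dsum i j)"
    using biproduct_is_cokernel[OF _ _ _ k(2,4), OF b(3,2,1)] by (simp add: dsum_def)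
  ultimately show ?thesis
    by (simp add: short_exact_def)
qed

lemma biproduct_short_exact:
  assumes b: "is_biproduct X Y S i j p q"
  shows "short_exact i q"
proof -
  note [simp] = is_biproduct_simps[OF b]
  have "monic (p \<cdot> i)"
    by (rule monicI) simp_all
  then have i: "monic i"
    by (rule monic_factor) simp_all
  have "epic (q \<cdot> j)"
    by (rule epicI) simp_all
  then have q: "epic q"
    by (rule epic_factor) simp_all
  have "is_kernel i q"
  proof (rule is_kernelI)
    fix x assume [simp]: "x \<in> Mor A" "q \<cdot> x = zrm A (src A x) (tgt A q)" and "tgt A x = src A q"
    then have [simp]: "tgt A x = S"
      by simp
    have "i \<cdot> (p \<cdot> x) = x"
      by (rule biproduct_eqI(1)[OF b]) simp_all
    then show "\<exists>h\<in>Mor A. src A h = src A x \<and> tgt A h = src A i \<and> i \<cdot> h = x"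
      by (intro bexI[of _ "p \<cdot> x"]) simp_all
  qed (use i in simp_all)
  then show ?thesis
    by (rule epic_kernel_short_exact[OF q])
qed

lemma is_biproduct_swap:
  assumes b: "is_biproduct X Y S i j p q"
  shows "is_biproduct Y X S j i q p"
proof -
  note [simp] = is_biproduct_simps[OF b]
  show ?thesis
    using b unfolding is_biproduct_def by (auto simp: addm_comm[of "j \<cdot> q" "i \<cdot> p"])
qed

text \<open>The morphism \<open>1 - i r\<close> vanishes on \<open>i\<close>, hence equals
  \<open>s p\<close>; then \<open>p s p = p\<close>, and the epic \<open>p\<close> cancels.\<close>

lemma split_section:
  assumes "short_exact i p" "r \<in> Mor A" "src A r = tgt A i" "r \<cdot> i = idm A (src A i)"
  obtains s where "s \<in> Mor A" "src A s = tgt A p" "tgt A s = tgt A i" "p \<cdot> s = idm A (tgt A p)"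
proof -
  note [simp] = short_exact_simps[OF assms(1)] assms(2,3)
  have [simp]: "tgt A r = src A i"
    using assms(4) cmp_simps(3)[of i r] by simp
  let ?x = "idm A (tgt A i) \<boxplus> negm (i \<cdot> r)"
  have "?x \<cdot> i = zrm A (src A i) (tgt A ?x)"
    using assms(4) by (simp add: cmp_addm negm_cmp)
  then obtain s where s: "s \<in> Mor A" "src A s = tgt A p" "tgt A s = tgt A i" "s \<cdot> p = ?x"
    using short_exact_colift[OF assms(1), of ?x] by auto
  have "p \<cdot> ?x = p"
    using cmp_reassoc[OF short_exact_simps(4)[OF assms(1)], of r] by (simp add: cmp_addm negm_cmp)
       (metis addm_zrm(1) negm_simps(1-4) zrm_simps assms(2,3) \<open>tgt A r = src A i\<close> negm_unique short_exact_simps(1-3)[OF assms(1)] src_Obj tgt_Obj)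
  then have "(p \<cdot> s) \<cdot> p = idm A (tgt A p) \<cdot> p"
    using s by simp
  then have "p \<cdot> s = idm A (tgt A p)"
    by - (rule epicD[of p], use s in simp_all)
  then show ?thesis
    using that s by auto
qed

lemmas split_retraction = abelian_category.split_section[OF abelian_op, simplified]

text \<open>The third isomorphism theorem in push-out form: dividing \<open>tgt A j\<close> by the
  image of \<open>j i\<close> amounts to pushing \<open>j\<close> out along \<open>p\<close>, the
  quotient by the image of \<open>i\<close>.\<close>

lemma pushout_epic_short_exact:
  assumes "short_exact i p" "short_exact j q" "src A j = tgt A i" "is_pushout j p u k"
  shows "short_exact (j \<cdot> i) u"
proof -
  note [simp] = short_exact_simps[OF assms(1)] short_exact_simps[OF assms(2)] assms(3)
    pushout_simps[OF assms(4)]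
  have "monic (j \<cdot> i)"
    by (rule monic_cmp) simp_all
  moreover have "is_cokernel u (j \<cdot> i)"
  proof (rule is_cokernelI)
    show "u \<cdot> (j \<cdot> i) = zrm A (src A (j \<cdot> i)) (tgt A u)"
      using cmp_reassoc[OF pushout_simps(9)[OF assms(4)], of i] by simp
    show "epic u"
      unfolding epic_def
    proof (intro conjI allI ballI impI)
      fix W t s assume "t \<in> Hom A (tgt A u) W" "s \<in> Hom A (tgt A u) W" and e: "t \<cdot> u = s \<cdot> u"
      then have ts [simp]: "t \<in> Mor A" "src A t = tgt A u" "tgt A t = W"
        "s \<in> Mor A" "src A s = tgt A u" "tgt A s = W"
        by auto
      have "(t \<cdot> k) \<cdot> p = (t \<cdot> u) \<cdot> j"
        by simp
      also have "\<dots> = (s \<cdot> k) \<cdot> p"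
        unfolding e by simp
      finally have "t \<cdot> k = s \<cdot> k"
        by - (rule epicD[of p], simp_all)
      then show "t = s"
        using e by - (rule pushout_unique[OF assms(4)], simp_all)
    qed simp
    fix x assume [simp]: "x \<in> Mor A" and "src A x = tgt A (j \<cdot> i)"
      and z: "x \<cdot> (j \<cdot> i) = zrm A (src A (j \<cdot> i)) (tgt A x)"
    then have [simp]: "src A x = tgt A j"
      by simp
    obtain y where y: "y \<in> Mor A" "src A y = tgt A p" "tgt A y = tgt A x" "y \<cdot> p = x \<cdot> j"
      using short_exact_colift[OF assms(1), of "x \<cdot> j"] z by auto
    obtain t where t: "t \<in> Mor A" "src A t = tgt A u" "tgt A t = tgt A x" "t \<cdot> u = x"
      using pushout_colift[OF assms(4), of x y] y by auto
    then show "\<exists>h\<in>Mor A. tgt A h = tgt A x \<and> src A h = tgt A u \<and> h \<cdot> u = x"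
      by (intro bexI[of _ t]) simp_all
  qed simp_all
  ultimately show ?thesis
    using monic_cokernel_short_exact by blast
qed

end

section \<open>Conflations, their morphisms, push-outs and pull-backs\<close>

context extension_closed_subcategory
begin

lemma C_Obj [simp]: "X \<in> C \<Longrightarrow> X \<in> Obj A"
  using sub_Obj by auto

lemma conflation_simps:
  assumes "conflation i p"
  shows "short_exact i p" "i \<in> Mor A" "p \<in> Mor A" "src A p = tgt A i" "p \<cdot> i = zrm A (src A i) (tgt A p)"
    "src A i \<in> C" "tgt A i \<in> C" "tgt A p \<in> C"
  using assms short_exact_simps[of i p] unfolding conflation_def by auto

lemma conflationI:
  assumes "short_exact i p" "src A i \<in> C" "tgt A p \<in> C"
  shows "conflation i p"
  using assms sub_extension unfolding conflation_def by auto

lemma zero_object_eq: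
  assumes "zero_object Z" "f \<in> Mor A" "g \<in> Mor A"
  shows "tgt A f = Z \<Longrightarrow> tgt A g = Z \<Longrightarrow> src A f = src A g \<Longrightarrow> f = g"
    "src A f = Z \<Longrightarrow> src A g = Z \<Longrightarrow> tgt A f = tgt A g \<Longrightarrow> f = g"
  using assms unfolding zero_object_def by (metis Hom_iff src_Obj, metis Hom_iff tgt_Obj)

text \<open>The first sequence puts the chosen zero object into \<open>C\<close>, where a priori
  just some zero object lies. The second is the trivial conflation used to see that the class of a
  conflation dies on its middle term.\<close>

lemma zero_object_short_exact:
  assumes "zero_object Z" "zero_object Z'" "X \<in> Obj A"
  shows "short_exact (zrm A Z Z') (zrm A Z' Z)" "short_exact (zrm A Z X) (idm A X)"
proof -
  have [simp]: "Z \<in> Obj A" "Z' \<in> Obj A"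
    using assms by (auto simp: zero_object_def)
  have m: "monic (zrm A Z Y)" if "Y \<in> Obj A" for Y
    by (rule monicI) (use that in \<open>auto intro: zero_object_eq(1)[OF assms(1)]\<close>)
  have "is_cokernel (zrm A Z' Z) (zrm A Z Z')"
  proof (rule is_cokernelI)
    show "epic (zrm A Z' Z)"
      by (rule epicI) (auto intro: zero_object_eq(2)[OF assms(1)])
    fix x assume x: "x \<in> Mor A" "src A x = tgt A (zrm A Z Z')"
    then show "\<exists>h\<in>Mor A. tgt A h = tgt A x \<and> src A h = tgt A (zrm A Z' Z) \<and> h \<cdot> zrm A Z' Z = x"
      by (intro bexI[of _ "zrm A Z (tgt A x)"] conjI)
        (auto intro!: zero_object_eq(2)[OF assms(2)])
  qed auto
  then show "short_exact (zrm A Z Z') (zrm A Z' Z)"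
    by (rule monic_cokernel_short_exact[OF m, rotated]) auto
  have "is_cokernel (idm A X) (zrm A Z X)"
  proof (rule is_cokernelI)
    show "epic (idm A X)"
      by (rule epicI) (use assms in auto)
    fix x assume x: "x \<in> Mor A" "src A x = tgt A (zrm A Z X)"
    then show "\<exists>h\<in>Mor A. tgt A h = tgt A x \<and> src A h = tgt A (idm A X) \<and> h \<cdot> idm A X = x"
      using assms by (intro bexI[of _ x] conjI) auto
  qed (use assms in auto)
  then show "short_exact (zrm A Z X) (idm A X)"
    by (rule monic_cokernel_short_exact[OF m, rotated]) (use assms in auto)
qed

lemma zobj_zero: "zero_object zobj"
  unfolding zobj_def using ex_zero_object by (rule someI_ex)

lemma zobj_C [simp]: "zobj \<in> C"
proof -
  obtain Z where Z: "Z \<in> C" "zero_object Z"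
    using sub_zero by auto
  have "zobj \<in> Obj A"
    using zobj_zero by (auto simp: zero_object_def)
  then show ?thesis
    using sub_extension[OF zero_object_short_exact(1)[OF Z(2) zobj_zero, of Z]] Z by auto
qed

lemma zobj_Obj [simp]: "zobj \<in> Obj A"
  by simp

lemma biproduct_C:
  assumes "is_biproduct X Y S i j p q" "X \<in> C" "Y \<in> C"
  shows "conflation i q" "conflation j p" "S \<in> C"
proof -
  show "conflation i q" "conflation j p"
    using assms is_biproduct_simps[OF assms(1)] biproduct_short_exact[OF assms(1)]
      biproduct_short_exact[OF is_biproduct_swap[OF assms(1)]]
    by (auto intro: conflationI)
  then show "S \<in> C"
    using is_biproduct_simps[OF assms(1)] by (auto simp: conflation_def)
qed

lemma bsum_C [simp]: "X \<in> C \<Longrightarrow> Y \<in> C \<Longrightarrow> bsum X Y \<in> C"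
  using biproduct_C(3)[OF bip_biproduct] by auto

definition confl :: "'b \<times> 'b \<Rightarrow> bool" where
  "confl e \<longleftrightarrow> conflation (fst e) (snd e)"

abbreviation lft :: "'b \<times> 'b \<Rightarrow> 'a" where
  "lft e \<equiv> src A (fst e)"

abbreviation rgt :: "'b \<times> 'b \<Rightarrow> 'a" where
  "rgt e \<equiv> tgt A (snd e)"

text \<open>In the three notions below, \<open>e\<close> and \<open>f\<close> are conflations: \<open>cmap g h e f\<close> is a
  morphism of conflations with outer components \<open>g\<close> and \<open>h\<close>, so that it expresses
  \<open>g e = f h\<close>.\<close>

definition cmap :: "'b \<Rightarrow> 'b \<Rightarrow> 'b \<times> 'b \<Rightarrow> 'b \<times> 'b \<Rightarrow> bool" where
  "cmap g h e f \<longleftrightarrow> confl e \<and> confl f \<and> (\<exists>v. conflation_map g v h e f)"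

definition pushes :: "'b \<Rightarrow> 'b \<times> 'b \<Rightarrow> 'b \<times> 'b \<Rightarrow> bool" where
  "pushes g e f \<longleftrightarrow> (\<exists>u. is_pushout (fst e) g u (fst f) \<and>
     snd f \<in> Hom A (tgt A (fst f)) (rgt e) \<and> snd f \<cdot> u = snd e \<and>
     snd f \<cdot> fst f = zrm A (tgt A g) (rgt e))"

definition pulls :: "'b \<Rightarrow> 'b \<times> 'b \<Rightarrow> 'b \<times> 'b \<Rightarrow> bool" where
  "pulls h e f \<longleftrightarrow> (\<exists>u. is_pullback (snd e) h u (snd f) \<and>
     fst f \<in> Hom A (lft e) (src A (snd f)) \<and> u \<cdot> fst f = fst e \<and>
     snd f \<cdot> fst f = zrm A (lft e) (src A h))"

lemma op_confl [simp]:
  "extension_closed_subcategory.confl (op_cat A) C = (\<lambda>e. confl (prod.swap e))"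
  by (simp add: fun_eq_iff extension_closed_subcategory.confl_def[OF extension_closed_op] confl_def)

lemma op_cmap [simp]:
  "extension_closed_subcategory.cmap (op_cat A) C =
     (\<lambda>h g f e. cmap g h (prod.swap e) (prod.swap f))"
proof -
  have "extension_closed_subcategory.conflation_map (op_cat A) h v g (i, p) (j, q) =
    conflation_map g v h (q, j) (p, i)" if "conflation p i" "conflation q j" for g h v i j p q
    using conflation_simps[OF that(1)] conflation_simps[OF that(2)]
    unfolding extension_closed_subcategory.conflation_map_def[OF extension_closed_op] conflation_map_def
    by auto
  then show ?thesis
    unfolding fun_eq_iff extension_closed_subcategory.cmap_def[OF extension_closed_op] cmap_def
    by (auto simp: confl_def)
qed

lemma op_pushes [simp]:
  "extension_closed_subcategory.pushes (op_cat A) = (\<lambda>h e f. pulls h (prod.swap e) (prod.swap f))"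
  "extension_closed_subcategory.pulls (op_cat A) = (\<lambda>h e f. pushes h (prod.swap e) (prod.swap f))"
  unfolding fun_eq_iff extension_closed_subcategory.pushes_def[OF extension_closed_op] pushes_def
    extension_closed_subcategory.pulls_def[OF extension_closed_op] pulls_def
  by simp_all

lemma cmapI:
  assumes "conflation i p" "conflation j q" "g \<in> Mor A" "src A g = src A i" "tgt A g = src A j"
    "v \<in> Mor A" "src A v = tgt A i" "tgt A v = tgt A j"
    "h \<in> Mor A" "src A h = tgt A p" "tgt A h = tgt A q" "v \<cdot> i = j \<cdot> g" "h \<cdot> p = q \<cdot> v"
  shows "cmap g h (i, p) (j, q)"
  using assms by (auto simp: cmap_def confl_def conflation_map_def)

lemma cmapE:
  assumes "cmap g h e f"
  obtains i p j q v where "e = (i, p)" "f = (j, q)" "conflation i p" "conflation j q"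
    "g \<in> Mor A" "src A g = src A i" "tgt A g = src A j"
    "v \<in> Mor A" "src A v = tgt A i" "tgt A v = tgt A j"
    "h \<in> Mor A" "src A h = tgt A p" "tgt A h = tgt A q" "v \<cdot> i = j \<cdot> g" "h \<cdot> p = q \<cdot> v"
  using assms by (cases e; cases f) (auto simp: cmap_def confl_def conflation_map_def)

lemma cmap_ends:
  assumes "cmap g h e f"
  shows "confl e" "confl f" "g \<in> Mor A" "src A g = lft e" "tgt A g = lft f"
    "h \<in> Mor A" "src A h = rgt e" "tgt A h = rgt f"
  using assms by (auto elim!: cmapE simp: confl_def)

lemma confl_ends:
  assumes "confl e"
  shows "fst e \<in> Mor A" "snd e \<in> Mor A" "src A (snd e) = tgt A (fst e)" "lft e \<in> C" "rgt e \<in> C"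
    "tgt A (fst e) \<in> C" "short_exact (fst e) (snd e)"
  using assms conflation_simps[of "fst e" "snd e"] by (auto simp: confl_def)

lemma cmap_refl:
  assumes "confl e"
  shows "cmap (idm A (lft e)) (idm A (rgt e)) e e"
proof -
  obtain i p where e [simp]: "e = (i, p)"
    by (cases e)
  then have c: "conflation i p"
    using assms by (simp add: confl_def)
  show ?thesis
    using conflation_simps[OF c] by (auto intro!: cmapI[OF c c, of _ "idm A (tgt A i)"])
qed

lemma cmap_trans:
  assumes "cmap g h e f" "cmap g' h' f k"
  shows "cmap (g' \<cdot> g) (h' \<cdot> h) e k"
proof -
  from assms(1) obtain i p j q v where e: "e = (i, p)" "f = (j, q)" "conflation i p" "conflation j q"
    "g \<in> Mor A" "src A g = src A i" "tgt A g = src A j"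
    "v \<in> Mor A" "src A v = tgt A i" "tgt A v = tgt A j"
    "h \<in> Mor A" "src A h = tgt A p" "tgt A h = tgt A q" "v \<cdot> i = j \<cdot> g" "h \<cdot> p = q \<cdot> v"
    by (rule cmapE)
  from assms(2) obtain i' p' v' where k: "k = (i', p')" "conflation i' p'"
    "g' \<in> Mor A" "src A g' = src A j" "tgt A g' = src A i'"
    "v' \<in> Mor A" "src A v' = tgt A j" "tgt A v' = tgt A i'"
    "h' \<in> Mor A" "src A h' = tgt A q" "tgt A h' = tgt A p'" "v' \<cdot> j = i' \<cdot> g'" "h' \<cdot> q = p' \<cdot> v'"
    by (rule cmapE) (use e in auto)
  note [simp] = conflation_simps[OF e(3)] conflation_simps[OF e(4)] conflation_simps[OF k(2)]
  have "(v' \<cdot> v) \<cdot> i = i' \<cdot> (g' \<cdot> g)"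
    using cmp_reassoc[OF k(12), of g] e k(1-11) by simp
  moreover have "(h' \<cdot> h) \<cdot> p = p' \<cdot> (v' \<cdot> v)"
    using cmp_reassoc[OF k(13), of v] e k(1-11) by simp
  ultimately show ?thesis
    using e k by (auto intro: cmapI[of _ _ _ _ _ "v' \<cdot> v"])
qed

lemma pushes_cmap:
  assumes "pushes g e f" "confl e" "tgt A g \<in> C"
  shows "cmap g (idm A (rgt e)) e f"
proof -
  obtain i p j q where e [simp]: "e = (i, p)" "f = (j, q)"
    by (cases e; cases f)
  have c: "conflation i p"
    using assms by (simp add: confl_def)
  note [simp] = conflation_simps[OF c]
  obtain u where u: "is_pushout i g u j" "q \<in> Mor A" "src A q = tgt A j" "tgt A q = tgt A p"
    "q \<cdot> u = p" "q \<cdot> j = zrm A (tgt A g) (tgt A p)"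
    using assms by (auto simp: pushes_def)
  note [simp] = pushout_simps[OF u(1)]
  have "conflation j q"
    using pushout_short_exact[OF conflation_simps(1)[OF c] u(1)] u assms by (intro conflationI) auto
  then show ?thesis
    unfolding e by (rule cmapI[OF c, of _ _ _ u]) (use u assms(3) in simp_all)
qed

lemma ex_pushes:
  assumes "confl e" "g \<in> Mor A" "src A g = lft e" "tgt A g \<in> C"
  obtains f where "pushes g e f"
proof -
  obtain i p where e [simp]: "e = (i, p)"
    by (cases e)
  have c: "conflation i p"
    using assms by (simp add: confl_def)
  note [simp] = conflation_simps[OF c]
  obtain u i' p' where f: "is_pushout i g u i'" "short_exact i' p'" "p' \<cdot> u = p" "tgt A p' = tgt A p"
    using ex_pushout[OF conflation_simps(1)[OF c] assms(2)] assms(3) by (metis e fst_conv)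
  note [simp] = pushout_simps[OF f(1)] short_exact_simps[OF f(2)]
  have "pushes g e (i', p')"
    using f by (auto simp: pushes_def)
  then show ?thesis
    using that by blast
qed

text \<open>The universal property supplies the middle component, and compatibility with the
  deflations is checked on the two legs of the push-out. Together with \<open>pulls_factor\<close>
  this makes push-outs and pull-backs of classes independent of all choices.\<close>

lemma pushes_factor:
  assumes "cmap g h e f" "pushes g e k"
  shows "cmap (idm A (tgt A g)) h k f"
proof -
  have "tgt A g \<in> C"
    using cmap_ends[OF assms(1)] confl_ends by auto
  then have ek: "cmap g (idm A (rgt e)) e k"
    using pushes_cmap[OF assms(2) cmap_ends(1)[OF assms(1)]] by simp
  from assms(1) obtain i p j q v where e: "e = (i, p)" "f = (j, q)" and c: "conflation i p" "conflation j q"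
    and m: "g \<in> Mor A" "src A g = src A i" "tgt A g = src A j"
    "v \<in> Mor A" "src A v = tgt A i" "tgt A v = tgt A j"
    "h \<in> Mor A" "src A h = tgt A p" "tgt A h = tgt A q" and s: "v \<cdot> i = j \<cdot> g" "h \<cdot> p = q \<cdot> v"
    by (rule cmapE)
  note [simp] = e m conflation_simps[OF c(1)] conflation_simps[OF c(2)]
  obtain i' p' where k [simp]: "k = (i', p')"
    by (cases k)
  have c': "conflation i' p'"
    using cmap_ends(2)[OF ek] by (simp add: confl_def)
  obtain u where u: "is_pushout i g u i'" "tgt A p' = tgt A p" "p' \<cdot> u = p"
    "p' \<cdot> i' = zrm A (tgt A g) (tgt A p)"
    using assms(2) by (auto simp: pushes_def)
  note [simp] = pushout_simps[OF u(1)] conflation_simps(1-4)[OF c']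
  obtain t where t: "t \<in> Mor A" "src A t = tgt A u" "tgt A t = tgt A v" "t \<cdot> u = v" "t \<cdot> i' = j"
    using pushout_colift[OF u(1), of v j] s by auto
  have "h \<cdot> p' = q \<cdot> t"
  proof (rule pushout_unique[OF u(1)])
    show "(h \<cdot> p') \<cdot> u = (q \<cdot> t) \<cdot> u" "(h \<cdot> p') \<cdot> i' = (q \<cdot> t) \<cdot> i'"
      using u t s by (auto simp del: conflation_simps(5)[OF c'])
  qed (use u t in auto)
  moreover have "src A i' = tgt A g"
    by simp
  ultimately show ?thesis
    unfolding e(2) k by - (rule cmapI[OF c' c(2), of _ t], use t u in simp_all)
qed

lemma pulls_cmap:
  assumes "pulls h e f" "confl e" "src A h \<in> C"
  shows "cmap (idm A (lft e)) h f e"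
  using extension_closed_subcategory.pushes_cmap[OF extension_closed_op, of h "prod.swap e" "prod.swap f"]
    assms by simp

lemma ex_pulls:
  assumes "confl e" "h \<in> Mor A" "tgt A h = rgt e" "src A h \<in> C"
  obtains f where "pulls h e f"
proof -
  obtain f where "pulls h (prod.swap (prod.swap e)) (prod.swap f)"
    by (rule extension_closed_subcategory.ex_pushes[OF extension_closed_op, of "prod.swap e" h])
      (use assms in auto)
  then show ?thesis
    using that[of "prod.swap f"] by simp
qed

lemma pulls_factor:
  assumes "cmap g h e f" "pulls h f k"
  shows "cmap g (idm A (src A h)) e k"
  using extension_closed_subcategory.pushes_factor[OF extension_closed_op, of h g "prod.swap f"
    "prod.swap e" "prod.swap k"] assms by simp

text \<open>With identities at both ends the middle component is invertible by the short five
  lemma.\<close>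

lemma cmap_sym:
  assumes "cmap (idm A Y) (idm A X) e f" "X \<in> Obj A" "Y \<in> Obj A"
  shows "cmap (idm A Y) (idm A X) f e"
proof -
  from assms(1) obtain i p j q v where e: "e = (i, p)" "f = (j, q)" and c: "conflation i p" "conflation j q"
    and m: "src A (idm A Y) = src A i" "tgt A (idm A Y) = src A j"
    "v \<in> Mor A" "src A v = tgt A i" "tgt A v = tgt A j"
    "src A (idm A X) = tgt A p" "tgt A (idm A X) = tgt A q" and s: "v \<cdot> i = j \<cdot> idm A Y" "idm A X \<cdot> p = q \<cdot> v"
    by (rule cmapE)
  have ends: "src A i = Y" "src A j = Y" "tgt A p = X" "tgt A q = X"
    using m assms by auto
  note [simp] = conflation_simps(2-4)[OF c(1)] conflation_simps(2-4)[OF c(2)] e assms(2,3) ends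
  obtain s where "s \<in> Mor A" "src A s = tgt A j" "tgt A s = tgt A i" "s \<cdot> j = i" "p \<cdot> s = q"
    using short_five[OF conflation_simps(1)[OF c(1)] conflation_simps(1)[OF c(2)] m(3-5)] s by auto
  then show ?thesis
    unfolding e by - (rule cmapI[OF c(2,1), of _ s], simp_all)
qed

lemma cmap_dsum:
  assumes "cmap g h e f" "cmap g' h' e' f'"
  shows "cmap (dsum g g') (dsum h h') (dsum (fst e) (fst e'), dsum (snd e) (snd e'))
    (dsum (fst f) (fst f'), dsum (snd f) (snd f'))"
proof -
  from assms(1) obtain i p j q v where e: "e = (i, p)" "f = (j, q)" "conflation i p" "conflation j q"
    "g \<in> Mor A" "src A g = src A i" "tgt A g = src A j"
    "v \<in> Mor A" "src A v = tgt A i" "tgt A v = tgt A j"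
    "h \<in> Mor A" "src A h = tgt A p" "tgt A h = tgt A q" "v \<cdot> i = j \<cdot> g" "h \<cdot> p = q \<cdot> v"
    by (rule cmapE)
  from assms(2) obtain i' p' j' q' v' where e': "e' = (i', p')" "f' = (j', q')" "conflation i' p'" "conflation j' q'"
    "g' \<in> Mor A" "src A g' = src A i'" "tgt A g' = src A j'"
    "v' \<in> Mor A" "src A v' = tgt A i'" "tgt A v' = tgt A j'"
    "h' \<in> Mor A" "src A h' = tgt A p'" "tgt A h' = tgt A q'" "v' \<cdot> i' = j' \<cdot> g'" "h' \<cdot> p' = q' \<cdot> v'"
    by (rule cmapE)
  note [simp] = conflation_simps[OF e(3)] conflation_simps[OF e(4)] conflation_simps[OF e'(3)]
    conflation_simps[OF e'(4)]
  have "conflation (dsum i i') (dsum p p')" "conflation (dsum j j') (dsum q q')"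
    by (auto intro!: conflationI dsum_short_exact)
  then show ?thesis
    unfolding e(1,2) e'(1,2) fst_conv snd_conv
    by (rule cmapI[of _ _ _ _ _ "dsum v v'"]) (use e(3-) e'(3-) in \<open>simp_all add: dsum_cmp\<close>)
qed

lemma confl_dsum:
  assumes "confl e" "confl f"
  shows "confl (dsum (fst e) (fst f), dsum (snd e) (snd f))"
  using cmap_dsum[OF cmap_refl[OF assms(1)] cmap_refl[OF assms(2)]] by (rule cmap_ends)

section \<open>Split conflations: the low-degree part of the long exact sequences\<close>

definition splits :: "'b \<times> 'b \<Rightarrow> bool" where
  "splits e \<longleftrightarrow> (\<exists>r \<in> Mor A. src A r = tgt A (fst e) \<and> r \<cdot> fst e = idm A (lft e))"

text \<open>A retraction of the inflation and a section of the deflation exist together; this makes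
  the notion self-dual, as \<open>op_splits\<close> requires.\<close>

lemma splits_iff:
  assumes "confl e"
  shows "splits e \<longleftrightarrow> (\<exists>s \<in> Mor A. tgt A s = tgt A (fst e) \<and> snd e \<cdot> s = idm A (rgt e))"
  using split_section[OF confl_ends(7)[OF assms]] split_retraction[OF confl_ends(7)[OF assms]]
    confl_ends[OF assms] unfolding splits_def by metis

lemma op_splits [simp]:
  assumes "confl (prod.swap e)"
  shows "extension_closed_subcategory.splits (op_cat A) e \<longleftrightarrow> splits (prod.swap e)"
  unfolding splits_iff[OF assms] extension_closed_subcategory.splits_def[OF extension_closed_op]
  using confl_ends[OF assms] by auto

lemma splits_cmap:
  assumes "cmap (idm A Y) (idm A X) e f" "X \<in> Obj A" "Y \<in> Obj A"
  shows "splits e \<longleftrightarrow> splits f"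
proof -
  have *: "splits e" if cm: "cmap (idm A Y) (idm A X) e f" and "splits f" for e f
  proof -
    from cm obtain i p j q v where e: "e = (i, p)" "f = (j, q)" and c: "conflation i p" "conflation j q"
      and m: "src A (idm A Y) = src A i" "tgt A (idm A Y) = src A j"
      "v \<in> Mor A" "src A v = tgt A i" "tgt A v = tgt A j" and s: "v \<cdot> i = j \<cdot> idm A Y"
      by (rule cmapE)
    obtain r where r: "r \<in> Mor A" "src A r = tgt A j" "r \<cdot> j = idm A (src A j)"
      using \<open>splits f\<close> e by (auto simp: splits_def)
    have "(r \<cdot> v) \<cdot> i = idm A (src A i)"
      using conflation_simps(2)[OF c(1)] conflation_simps(2)[OF c(2)] m assms(2,3) s r by auto
    then show ?thesis
      unfolding splits_def using r m e by (intro bexI[of _ "r \<cdot> v"]) auto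
  qed
  show ?thesis
    using *[OF assms(1)] *[OF cmap_sym[OF assms]] by blast
qed

text \<open>Exactness at Hom: a section of the pull-back \<open>e\<close>, followed by the middle
  component, lifts \<open>h\<close> through \<open>p\<close>.\<close>

lemma splits_pull_lift:
  assumes "cmap (idm A Y) h e (i, p)" "splits e" "Y \<in> Obj A"
  obtains k where "k \<in> Mor A" "src A k = src A h" "tgt A k = tgt A i" "p \<cdot> k = h"
proof -
  from assms(1) obtain i' p' v where e: "e = (i', p')" and c: "conflation i' p'" "conflation i p"
    and m: "v \<in> Mor A" "src A v = tgt A i'" "tgt A v = tgt A i"
    "h \<in> Mor A" "src A h = tgt A p'" "tgt A h = tgt A p" and s: "h \<cdot> p' = p \<cdot> v"
    by (rule cmapE) auto
  note [simp] = conflation_simps(2-4)[OF c(1)] conflation_simps(2-4)[OF c(2)] e m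
  obtain k where k: "k \<in> Mor A" "tgt A k = tgt A i'" "p' \<cdot> k = idm A (tgt A p')"
    using assms(2) cmap_ends(1)[OF assms(1)] by (auto simp: splits_iff)
  then have [simp]: "src A k = tgt A p'"
    by (metis cmp_simps(2) idm_simps(2) \<open>src A p' = tgt A i'\<close> \<open>p' \<in> Mor A\<close> tgt_Obj)
  have "p \<cdot> (v \<cdot> k) = h"
    using k cmp_reassoc[OF s[symmetric], of k] by simp
  then show ?thesis
    using that[of "v \<cdot> k"] k by simp
qed

text \<open>Exactness at Ext^1 into the left end: the retraction of the split push-out extends
  \<open>j\<close> over the middle term of \<open>e\<close>, and passing to cokernels exhibits
  \<open>e\<close> as a pull-back of \<open>(j, q)\<close>.\<close>

lemma splits_push_map:
  assumes "cmap j (idm A X) e f" "splits f" "conflation j q" "X \<in> Obj A"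
  obtains h where "cmap (idm A (lft e)) h e (j, q)"
proof -
  from assms(1) obtain i p i' p' v where e: "e = (i, p)" "f = (i', p')" and c: "conflation i p" "conflation i' p'"
    and m: "src A j = src A i" "tgt A j = src A i'" "v \<in> Mor A" "src A v = tgt A i" "tgt A v = tgt A i'"
    and s: "v \<cdot> i = i' \<cdot> j"
    by (rule cmapE)
  note [simp] = conflation_simps(2-4)[OF c(1)] conflation_simps(2-4)[OF c(2)] e m conflation_simps[OF assms(3)]
  obtain r where r: "r \<in> Mor A" "src A r = tgt A i'" "r \<cdot> i' = idm A (src A i')"
    using assms(2) by (auto simp: splits_def)
  have [simp]: "tgt A r = src A i'"
    by (metis r cmp_simps(3) idm_simps(3) \<open>i' \<in> Mor A\<close> src_Obj)
  have rv: "(r \<cdot> v) \<cdot> i = j"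
    using r s cmp_reassoc[OF r(3), of j] by simp
  then have "(q \<cdot> (r \<cdot> v)) \<cdot> i = zrm A (src A i) (tgt A q)"
    using r by simp
  then obtain h where h: "h \<in> Mor A" "src A h = tgt A p" "tgt A h = tgt A q" "h \<cdot> p = q \<cdot> (r \<cdot> v)"
    using short_exact_colift[OF conflation_simps(1)[OF c(1)], of "q \<cdot> (r \<cdot> v)"] r by auto
  have "cmap (idm A (lft e)) h e (j, q)"
    unfolding e fst_conv by (rule cmapI[OF c(1) assms(3), of _ "r \<cdot> v"]) (use r rv h in simp_all)
  then show ?thesis
    using that by blast
qed

text \<open>Exactness at Ext^1 into the middle term. Dividing the middle term of \<open>e\<close> by
  the image of \<open>src A i\<close> gives the middle term of the push-out along \<open>p\<close>.
  A section \<open>s\<close> of that push-out pulls the conflation \<open>(j i, u)\<close> back to a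
  conflation \<open>k\<close> beginning with \<open>src A i\<close>, and its push-out along
  \<open>i\<close> is \<open>e\<close>.\<close>

lemma splits_push_lift:
  assumes "conflation i p" "cmap p (idm A X) e f" "splits f" "X \<in> Obj A"
  obtains k where "cmap i (idm A X) k e"
proof -
  have "tgt A p \<in> C"
    using conflation_simps[OF assms(1)] by auto
  then obtain f' where f': "pushes p e f'"
    using ex_pushes[of e p] cmap_ends[OF assms(2)] confl_ends by metis
  have ef': "cmap p (idm A (rgt e)) e f'"
    using pushes_cmap[OF f'] cmap_ends[OF assms(2)] \<open>tgt A p \<in> C\<close> by auto
  have X: "X = rgt e"
    using cmap_ends[OF assms(2)] assms(4) by auto
  have "cmap (idm A (tgt A p)) (idm A X) f' f"
    using pushes_factor[OF assms(2) f'] .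
  then have "splits f'"
    using splits_cmap[of "tgt A p" X f' f] assms(3,4) \<open>tgt A p \<in> C\<close> by simp
  obtain j q j' q' where e [simp]: "e = (j, q)" "f' = (j', q')"
    by (cases e; cases f')
  have c: "conflation j q" "conflation j' q'"
    using cmap_ends[OF ef'] by (auto simp: confl_def)
  obtain u where u: "is_pushout j p u j'" "q' \<cdot> u = q" "tgt A q' = tgt A q"
    using f' by (auto simp: pushes_def)
  note po = pushout_simps[OF u(1)]
  note [simp] = conflation_simps(2-4,6-)[OF c(1)] conflation_simps(2-4,6-)[OF c(2)] po
    conflation_simps(2-4,6-)[OF assms(1)]
  have ji [simp]: "src A j = tgt A i"
    by (metis conflation_simps(4)[OF assms(1)] cmap_ends(4)[OF assms(2)] e(1) fst_conv)
  have se: "short_exact (j \<cdot> i) u"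
    using pushout_epic_short_exact[OF conflation_simps(1)[OF assms(1)] conflation_simps(1)[OF c(1)] ji u(1)] .
  have tu: "tgt A u = tgt A j'"
    by simp
  have cji: "confl (j \<cdot> i, u)"
    unfolding confl_def fst_conv snd_conv
    by (rule conflationI[OF se]) (simp_all del: po(8) add: tu)
  obtain s where s: "s \<in> Mor A" "tgt A s = tgt A j'" "q' \<cdot> s = idm A (tgt A q')"
    using \<open>splits f'\<close> cmap_ends(2)[OF ef'] by (auto simp: splits_iff)
  have ss [simp]: "src A s = tgt A q'"
    by (metis s cmp_simps(2) idm_simps(2) conflation_simps(3,4)[OF c(2)] tgt_Obj)
  obtain k where k: "pulls s (j \<cdot> i, u) k"
    using ex_pulls[OF cji s(1)] s(2) ss u(3) by (metis conflation_simps(8)[OF c(1)] snd_conv tu)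
  have "cmap (idm A (src A i)) s k (j \<cdot> i, u)"
    using pulls_cmap[OF k cji] s u(3) by simp
  then obtain f1 f2 w where kk: "k = (f1, f2)" and cf: "conflation f1 f2" and m: "src A i = src A f1"
      "w \<in> Mor A" "src A w = tgt A f1" "tgt A w = tgt A (j \<cdot> i)" "tgt A q = tgt A f2"
      and w: "w \<cdot> f1 = (j \<cdot> i) \<cdot> idm A (src A i)" "s \<cdot> f2 = u \<cdot> w"
    using u(3) by (elim cmapE) auto
  note [simp] = conflation_simps(2-4,6-)[OF cf]
  have "q \<cdot> w = q' \<cdot> (u \<cdot> w)"
    using cmp_reassoc[OF u(2), of w] m by simp
  also have "\<dots> = f2"
    unfolding w(2)[symmetric] using cmp_reassoc[OF s(3), of f2] s m u(3) by simp
  finally have "cmap i (idm A X) k e"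
    unfolding kk X e by (intro cmapI[OF cf c(1), of _ w]) (use m w in auto)
  then show ?thesis
    using that by blast
qed

text \<open>The cokernel of \<open>j i\<close> is the push-out \<open>u\<close>, whose target is an
  extension of \<open>tgt A q\<close> by \<open>tgt A p\<close> and so lies in \<open>C\<close>. The
  morphism of conflations is needed in \<open>gunit_factor\<close> to write an extension as a
  pull-back of a unit.\<close>

lemma inflation_trans:
  assumes "conflation i p" "conflation j q" "src A j = tgt A i"
  obtains r h where "conflation (j \<cdot> i) r" "cmap (idm A (src A i)) h (i, p) (j \<cdot> i, r)"
proof -
  note [simp] = conflation_simps(2-4,6-)[OF assms(1)] conflation_simps(2-4,6-)[OF assms(2)] assms(3)
  obtain f where f: "pushes p (j, q) f"
    using ex_pushes[of "(j, q)" p] assms by (auto simp: confl_def)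
  obtain u where u: "is_pushout j p u (fst f)"
    using f by (auto simp: pushes_def)
  have cf: "confl f"
    using pushes_cmap[OF f] cmap_ends(2) assms(2) by (auto simp: confl_def)
  note po = pushout_simps[OF u]
  note [simp] = po confl_ends[OF cf]
  have se: "short_exact (j \<cdot> i) u"
    using pushout_epic_short_exact[OF conflation_simps(1)[OF assms(1)] conflation_simps(1)[OF assms(2)] _ u]
    by simp
  have tu: "tgt A u = tgt A (fst f)"
    by simp
  have c: "conflation (j \<cdot> i) u"
    by (rule conflationI[OF se]) (simp_all del: po(8) add: tu)
  have "cmap (idm A (src A i)) (fst f) (i, p) (j \<cdot> i, u)"
    by (rule cmapI[OF assms(1) c, of _ j]) simp_all
  then show ?thesis
    using that c by blast
qed

end

section \<open>Yoneda Ext\<close>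

context extension_closed_subcategory
begin

text \<open>A recursive form of the conditions in \<open>extns\<close> that also makes sense for the
  empty list, so that inductions and splicing need no side conditions.\<close>

fun chain :: "'a \<Rightarrow> 'a \<Rightarrow> 'b extn \<Rightarrow> bool" where
  "chain X Y [] \<longleftrightarrow> X = Y"
| "chain X Y (e # E) \<longleftrightarrow> confl e \<and> lft e = Y \<and> chain X (rgt e) E"

lemma chain_append: "chain X Y (E @ F) \<longleftrightarrow> (\<exists>Z. chain Z Y E \<and> chain X Z F)"
  by (induction E arbitrary: Y) auto

lemma chain_ends:
  assumes "chain X Y E" "E \<noteq> []"
  shows "X = rgt (last E)" "Y = lft (hd E)" "X \<in> C" "Y \<in> C"
proof -
  have "X = rgt (last E) \<and> Y = lft (hd E) \<and> X \<in> C \<and> Y \<in> C"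
    using assms
  proof (induction E arbitrary: Y)
    case (Cons e E)
    then show ?case
      using confl_ends[of e] by (cases "E = []") auto
  qed simp
  then show "X = rgt (last E)" "Y = lft (hd E)" "X \<in> C" "Y \<in> C"
    by auto
qed

lemma extns_iff: "E \<in> extns t X Y \<longleftrightarrow> E \<noteq> [] \<and> length E = t \<and> chain X Y E"
proof -
  have "chain X Y E \<longleftrightarrow> (\<forall>e \<in> set E. confl e) \<and> successively (\<lambda>e f. rgt e = lft f) E \<and>
      lft (hd E) = Y \<and> rgt (last E) = X" if "E \<noteq> []" for E
    using that
  proof (induction E arbitrary: Y)
    case (Cons e E)
    then show ?case
      by (cases E) auto
  qed simp
  then show ?thesis
    unfolding extns_def confl_def by (auto simp: case_prod_beta')
qed

lemma extns_C:
  assumes "E \<in> extns t X Y"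
  shows "X \<in> C" "Y \<in> C" "t \<noteq> 0"
  using assms chain_ends[of X Y E] by (auto simp: extns_iff)

lemma extns_append:
  assumes "E \<in> extns s Y Z" "F \<in> extns t X Y"
  shows "E @ F \<in> extns (s + t) X Z"
  using assms by (auto simp: extns_iff chain_append)

text \<open>The components at the splicing objects are quantified one at a time instead of being
  packed into the families of \<open>extn_map\<close>. Arbitrary end components are allowed so that
  push-outs and pull-backs give maps as well.\<close>

fun lmap :: "'b \<Rightarrow> 'b \<Rightarrow> 'b extn \<Rightarrow> 'b extn \<Rightarrow> bool" where
  "lmap g h [] [] \<longleftrightarrow> g = h"
| "lmap g h (e # E) (f # F) \<longleftrightarrow> (\<exists>k. cmap g k e f \<and> lmap k h E F)"
| "lmap g h [] (f # F) \<longleftrightarrow> False"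
| "lmap g h (e # E) [] \<longleftrightarrow> False"

lemma lmap_length: "lmap g h E F \<Longrightarrow> length E = length F"
  by (induction g h E F rule: lmap.induct) auto

lemma lmap_append:
  assumes "length E = length F"
  shows "lmap g h (E @ E') (F @ F') \<longleftrightarrow> (\<exists>k. lmap g k E F \<and> lmap k h E' F')"
  using assms by (induction E F arbitrary: g rule: list_induct2) auto

lemma lmap_trans:
  assumes "lmap g h E F" "lmap g' h' F G"
  shows "lmap (g' \<cdot> g) (h' \<cdot> h) E G"
  using assms
proof (induction g h E F arbitrary: g' G rule: lmap.induct)
  case (2 g h e E f F)
  then obtain k K where G: "G = k # K"
    by (cases G) auto
  with 2 show ?case
    by (auto intro: cmap_trans)
next
  case (1 g h)
  then show ?case
    by (cases G) auto
qed auto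

lemma lmap_refl:
  assumes "chain X Y E"
  shows "lmap (idm A Y) (idm A X) E E"
  using assms by (induction E arbitrary: Y) (auto intro: cmap_refl)

lemma lmap_ends:
  assumes "lmap g h E F" "E \<noteq> []"
  shows "g \<in> Mor A" "src A g = lft (hd E)" "tgt A g = lft (hd F)"
    "h \<in> Mor A" "src A h = rgt (last E)" "tgt A h = rgt (last F)"
proof -
  show "g \<in> Mor A" "src A g = lft (hd E)" "tgt A g = lft (hd F)"
    using assms by (cases E; cases F; auto dest: cmap_ends)+
  have "h \<in> Mor A \<and> src A h = rgt (last E) \<and> tgt A h = rgt (last F)"
    using assms
  proof (induction g h E F rule: lmap.induct)
    case (2 g h e E f F)
    then obtain k where k: "cmap g k e f" "lmap k h E F"
      by auto
    show ?case
    proof (cases "E = []")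
      case True
      then have "F = []"
        using lmap_length[OF k(2)] by auto
      then show ?thesis
        using k True by (auto dest: cmap_ends)
    next
      case False
      then show ?thesis
        using 2(1)[of k] k lmap_length[OF k(2)] by auto
    qed
  qed auto
  then show "h \<in> Mor A" "src A h = rgt (last E)" "tgt A h = rgt (last F)"
    by auto
qed

lemma lmap_iff:
  assumes "length E = length F" "\<forall>e \<in> set E \<union> set F. confl e"
  shows "lmap g h E F \<longleftrightarrow> (\<exists>k v. k 0 = g \<and> k (length E) = h \<and>
    (\<forall>s < length E. conflation_map (k s) (v s) (k (Suc s)) (E ! s) (F ! s)))"
  using assms
proof (induction E F arbitrary: g rule: list_induct2)
  case Nil
  show ?case
    by auto
next
  case (Cons e E f F)
  show ?case (is "_ \<longleftrightarrow> (\<exists>k v. ?P k v)")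
  proof
    assume "lmap g h (e # E) (f # F)"
    then obtain k' where k': "cmap g k' e f" "lmap k' h E F"
      by auto
    from k'(1) obtain v' where "conflation_map g v' k' e f"
      unfolding cmap_def by blast
    moreover obtain k v where "k 0 = k'" "k (length E) = h"
        "\<forall>s < length E. conflation_map (k s) (v s) (k (Suc s)) (E ! s) (F ! s)"
      using Cons.IH[of k'] Cons.prems k'(2) by auto
    \<comment> \<open>\<open>case_nat\<close> puts the components of the head in front of the
      families of the tail and shifts the indices by one.\<close>
    ultimately have "?P (case_nat g k) (case_nat v' v)"
      by (auto simp: less_Suc_eq_0_disj)
    then show "\<exists>k v. ?P k v"
      by blast
  next
    assume "\<exists>k v. ?P k v"
    then obtain k v where kv: "?P k v"
      by blast
    then have "cmap g (k 1) e f"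
      using Cons.prems spec[OF conjunct2[OF conjunct2[OF kv]], of 0] unfolding cmap_def by auto
    moreover have "lmap (k 1) h E F"
    proof (subst Cons.IH)
      show "\<exists>k' v'. k' 0 = k 1 \<and> k' (length E) = h \<and>
          (\<forall>s<length E. conflation_map (k' s) (v' s) (k' (Suc s)) (E ! s) (F ! s))"
        by (rule exI[of _ "\<lambda>s. k (Suc s)"], rule exI[of _ "\<lambda>s. v (Suc s)"]) (use kv in auto)
    qed (use Cons.prems in auto)
    ultimately show "lmap g h (e # E) (f # F)"
      by auto
  qed
qed

lemma extn_map_iff:
  "extn_map t X Y E F \<longleftrightarrow> E \<in> extns t X Y \<and> F \<in> extns t X Y \<and> lmap (idm A Y) (idm A X) E F"
proof -
  have all: "\<forall>e \<in> set E. confl e" if "E \<in> extns t X Y" for E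
    using that by (auto simp: extns_def confl_def)
  then have "(\<exists>k v. k 0 = idm A Y \<and> k t = idm A X \<and>
      (\<forall>s < t. conflation_map (k s) (v s) (k (Suc s)) (E ! s) (F ! s))) \<longleftrightarrow>
      lmap (idm A Y) (idm A X) E F" if "E \<in> extns t X Y" "F \<in> extns t X Y"
    using lmap_iff[of E F "idm A Y" "idm A X"] that all by (simp add: extns_iff ball_Un)
  then show ?thesis
    unfolding extn_map_def by blast
qed

lemma equiv_extn_rel: "equiv (extns t X Y) (extn_rel t X Y)"
proof (rule equivI)
  show "refl_on (extns t X Y) (extn_rel t X Y)"
    by (auto simp: refl_on_def extn_rel_def)
  show "sym (extn_rel t X Y)"
    by (auto simp: sym_def extn_rel_def intro: equivclp_sym)
  show "trans (extn_rel t X Y)"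
    by (auto simp: trans_def extn_rel_def intro: equivclp_trans)
qed (auto simp: extn_rel_def)

text \<open>The indices are read off the list, so classes of different degrees and ends can be
  multiplied without carrying indices along.\<close>

definition cls :: "'b extn \<Rightarrow> 'b extn set" where
  "cls E = extn_class (length E) (rgt (last E)) (lft (hd E)) E"

lemma extn_class_cls:
  assumes "E \<in> extns t X Y"
  shows "extn_class t X Y E = cls E"
  using assms chain_ends[of X Y E] by (auto simp: cls_def extns_iff)

lemma cls_Ext [intro]: "E \<in> extns t X Y \<Longrightarrow> cls E \<in> Ext t X Y"
  using extn_class_cls[of E t X Y] quotientI[of E "extns t X Y" "extn_rel t X Y"]
  by (simp add: extn_class_def Ext_def)

lemma Ext_cls:
  assumes "\<gamma> \<in> Ext t X Y"
  obtains E where "E \<in> extns t X Y" "\<gamma> = cls E"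
  using assms extn_class_cls unfolding Ext_def extn_class_def by (auto elim!: quotientE)

lemma mem_cls:
  assumes "E \<in> extns t X Y"
  shows "E \<in> cls E" "F \<in> cls E \<Longrightarrow> F \<in> extns t X Y" "F \<in> cls E \<Longrightarrow> cls F = cls E"
proof -
  have c: "cls E = extn_rel t X Y `` {E}"
    using extn_class_cls[OF assms] by (simp add: extn_class_def)
  show "E \<in> cls E"
    unfolding c using equiv_class_self[OF equiv_extn_rel assms] .
  show F: "F \<in> extns t X Y" if "F \<in> cls E"
    using that unfolding c extn_rel_def by auto
  show "cls F = cls E" if "F \<in> cls E"
    using that equiv_class_eq[OF equiv_extn_rel, of E F t X Y] extn_class_cls[OF F[OF that]]
    unfolding c by (simp add: extn_class_def)
qed

lemma cls_eqI:
  assumes "lmap (idm A Y) (idm A X) E F" "E \<in> extns t X Y" "F \<in> extns t X Y"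
  shows "cls E = cls F"
proof -
  have "(E, F) \<in> extn_rel t X Y"
    using assms by (auto simp: extn_rel_def extn_map_iff intro: r_into_equivclp)
  then have "extn_rel t X Y `` {E} = extn_rel t X Y `` {F}"
    by (rule equiv_class_eq[OF equiv_extn_rel])
  then show ?thesis
    using extn_class_cls[OF assms(2)] extn_class_cls[OF assms(3)] by (simp add: extn_class_def)
qed

text \<open>Yoneda equivalence is generated by single maps, so what these preserve is constant on
  classes. It is applied to classes of constructed sequences, to \<open>splits\<close>, and to the
  predicates of the zigzag argument.\<close>

lemma cls_invariant:
  assumes inv: "\<And>E F. E \<in> extns t X Y \<Longrightarrow> F \<in> extns t X Y \<Longrightarrow> lmap (idm A Y) (idm A X) E F \<Longrightarrow> f E = f F"
    and "E \<in> extns t X Y" "F \<in> extns t X Y" "cls E = cls F"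
  shows "f E = f F"
proof -
  have "F \<in> cls E"
    using assms mem_cls by blast
  then have "equivclp (extn_map t X Y) E F"
    using extn_class_cls[OF assms(2)] by (auto simp: extn_class_def extn_rel_def)
  then show ?thesis
    by (induction rule: equivclp_induct) (auto simp: extn_map_iff dest: inv)
qed

text \<open>All members of a class share its length and its ends, so the class determines its
  indices. The addition of untyped arrows relies on this.\<close>

lemma Ext_disjoint:
  assumes "\<gamma> \<in> Ext t X Y" "\<gamma> \<in> Ext t' X' Y'"
  shows "t = t'" "X = X'" "Y = Y'"
proof -
  obtain E where E: "E \<in> extns t X Y" "\<gamma> = cls E"
    using assms(1) by (rule Ext_cls)
  obtain F where F: "F \<in> extns t' X' Y'" "\<gamma> = cls F"
    using assms(2) by (rule Ext_cls)
  have "E \<in> extns t' X' Y'"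
    using E F mem_cls by metis
  then show "t = t'" "X = X'" "Y = Y'"
    using E(1) chain_ends[of X Y E] chain_ends[of X' Y' E] by (auto simp: extns_iff)
qed

lemma Ext_C:
  assumes "\<gamma> \<in> Ext t X Y"
  shows "X \<in> C" "Y \<in> C" "t \<noteq> 0"
  using assms by (auto elim!: Ext_cls dest: extns_C)

lemma pushout_extn_iff:
  "pushout_extn g E F \<longleftrightarrow> (\<exists>e f Es. E = e # Es \<and> F = f # Es \<and> pushes g e f)"
  unfolding pushout_extn_def pushes_def by fastforce

lemma pullback_extn_iff:
  "pullback_extn h E F \<longleftrightarrow> (\<exists>e f Es. E = Es @ [e] \<and> F = Es @ [f] \<and> pulls h e f)"
  unfolding pullback_extn_def pulls_def by fastforce

lemma ex_pushout_extn:
  assumes "E \<in> extns t X Y" "g \<in> Mor A" "src A g = Y" "tgt A g \<in> C"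
  obtains F where "pushout_extn g E F"
proof -
  obtain e Es where E: "E = e # Es" "confl e" "lft e = Y"
    using assms(1) by (cases E) (auto simp: extns_iff)
  then obtain f where "pushes g e f"
    using ex_pushes[of e g] assms by auto
  then show ?thesis
    using that[of "f # Es"] E by (simp add: pushout_extn_iff)
qed

lemma pushout_extn_lmap:
  assumes "pushout_extn g E F" "E \<in> extns t X Y" "tgt A g \<in> C"
  shows "lmap g (idm A X) E F" "F \<in> extns t X (tgt A g)"
proof -
  obtain e f Es where E: "E = e # Es" "F = f # Es" "pushes g e f"
    using assms(1) by (auto simp: pushout_extn_iff)
  have ch: "confl e" "chain X (rgt e) Es"
    using assms(2) E by (auto simp: extns_iff)
  have cm: "cmap g (idm A (rgt e)) e f"
    using pushes_cmap[OF E(3) ch(1) assms(3)] .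
  then show "lmap g (idm A X) E F"
    using E lmap_refl[OF ch(2)] by auto
  have "rgt e \<in> Obj A"
    using confl_ends[OF ch(1)] by auto
  then have "rgt f = rgt e"
    using cmap_ends(8)[OF cm] by simp
  then show "F \<in> extns t X (tgt A g)"
    using assms(2) E cmap_ends[OF cm] by (auto simp: extns_iff)
qed

lemma pushout_extn_factor:
  assumes "lmap g h E F" "pushout_extn g E E'"
  shows "lmap (idm A (tgt A g)) h E' F"
proof -
  obtain e f Es where E: "E = e # Es" "E' = f # Es" "pushes g e f"
    using assms(2) by (auto simp: pushout_extn_iff)
  with assms(1) show ?thesis
    by (cases F) (auto intro: pushes_factor)
qed

lemma ex_pullback_extn:
  assumes "E \<in> extns t X Y" "h \<in> Mor A" "tgt A h = X" "src A h \<in> C"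
  obtains F where "pullback_extn h E F"
proof -
  obtain e Es where E: "E = Es @ [e]" "confl e" "rgt e = X"
    using assms(1) by (cases E rule: rev_cases) (auto simp: extns_iff chain_append)
  then obtain f where "pulls h e f"
    using ex_pulls[of e h] assms by auto
  then show ?thesis
    using that[of "Es @ [f]"] E by (simp add: pullback_extn_iff)
qed

lemma pullback_extn_lmap:
  assumes "pullback_extn h E F" "E \<in> extns t X Y" "src A h \<in> C"
  shows "lmap (idm A Y) h F E" "F \<in> extns t (src A h) Y"
proof -
  obtain e f Es where E: "E = Es @ [e]" "F = Es @ [f]" "pulls h e f"
    using assms(1) by (auto simp: pullback_extn_iff)
  have ch: "confl e" "chain (lft e) Y Es"
    using assms(2) E by (auto simp: extns_iff chain_append)
  have cm: "cmap (idm A (lft e)) h f e"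
    using pulls_cmap[OF E(3) ch(1) assms(3)] .
  then show "lmap (idm A Y) h F E"
    unfolding E using lmap_refl[OF ch(2)] by (subst lmap_append) auto
  have "lft e \<in> Obj A"
    using confl_ends[OF ch(1)] by auto
  then have "lft f = lft e"
    using cmap_ends(4)[OF cm] by simp
  then show "F \<in> extns t (src A h) Y"
    using assms(2) E cmap_ends[OF cm] ch by (auto simp: extns_iff chain_append)
qed

lemma pullback_extn_factor:
  assumes "lmap g h E F" "pullback_extn h F F'"
  shows "lmap g (idm A (src A h)) E F'"
proof -
  obtain f k Fs where F: "F = Fs @ [f]" "F' = Fs @ [k]" "pulls h f k"
    using assms(2) by (auto simp: pullback_extn_iff)
  obtain e Es where E: "E = Es @ [e]" "length Es = length Fs"
    using lmap_length[OF assms(1)] F by (cases E rule: rev_cases) auto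
  obtain l where l: "lmap g l Es Fs" "cmap l h e f"
    using assms(1) unfolding E F lmap_append[OF E(2)] by auto
  then have "cmap l (idm A (src A h)) e k"
    using pulls_factor[OF l(2) F(3)] by simp
  with l(1) show ?thesis
    unfolding E F lmap_append[OF E(2)] by auto
qed

text \<open>Versions of push-out, pull-back and splicing whose indices are read off the extension.\<close>

definition lpush :: "'b \<Rightarrow> 'b extn set \<Rightarrow> 'b extn set" where
  "lpush g \<gamma> = (\<Union>E \<in> \<gamma>. \<Union>F \<in> {F. pushout_extn g E F}. cls F)"

definition lpull :: "'b extn set \<Rightarrow> 'b \<Rightarrow> 'b extn set" where
  "lpull \<gamma> h = (\<Union>E \<in> \<gamma>. \<Union>F \<in> {F. pullback_extn h E F}. cls F)"

definition lsplice :: "'b extn set \<Rightarrow> 'b extn set \<Rightarrow> 'b extn set" where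
  "lsplice \<gamma> \<eta> = (\<Union>E \<in> \<gamma>. \<Union>F \<in> \<eta>. cls (E @ F))"

text \<open>Any map with left component \<open>g\<close> and the identity on the right computes the
  push-out: by \<open>pushout_extn_factor\<close> its target differs from a literal push-out by a
  map with identity ends.\<close>

lemma lpush_cls:
  assumes "lmap g (idm A X) E F" "E \<in> extns t X Y" "F \<in> extns t X Y'"
  shows "lpush g (cls E) = cls F"
proof -
  have g: "g \<in> Mor A" "src A g = Y" "tgt A g = Y'"
    using lmap_ends[OF assms(1)] chain_ends[of X Y E] chain_ends[of X Y' F] assms(2,3)
    by (auto simp: extns_iff)
  have C: "Y' \<in> C" "Y \<in> Obj A" "X \<in> Obj A"
    using extns_C assms by auto
  \<comment> \<open>One push-out is chosen for every sequence to obtain a function to which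
    \<open>cls_invariant\<close> applies.\<close>
  define f where "f E = (SOME F. pushout_extn g E F)" for E
  have f: "pushout_extn g K (f K)" if "K \<in> extns t X Y" for K
    unfolding f_def by (rule someI_ex) (rule ex_pushout_extn[OF that g(1)], use g C in auto)
  have eq: "cls (f K) = cls L" if "K \<in> extns t X Y" "lmap g (idm A X) K L" "L \<in> extns t X Y'" for K L
    using pushout_extn_factor[OF that(2) f[OF that(1)]]
      pushout_extn_lmap[OF f[OF that(1)] that(1)] that g C
    by (intro cls_eqI) auto
  have inv: "cls (f K) = cls (f L)" if "K \<in> extns t X Y" "L \<in> extns t X Y" "lmap (idm A Y) (idm A X) K L" for K L
  proof (rule eq[OF that(1)])
    note L = pushout_extn_lmap[OF f[OF that(2)] that(2)]
    show "f L \<in> extns t X Y'"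
      using L g C by simp
    have "lmap g (idm A X) L (f L)"
      using L g C by simp
    from lmap_trans[OF that(3) this] show "lmap g (idm A X) K (f L)"
      using g C by simp
  qed
  have "cls F' = cls F" if "K \<in> cls E" "pushout_extn g K F'" for K F'
  proof -
    have K: "K \<in> extns t X Y" "cls K = cls E"
      using mem_cls(2,3)[OF assms(2) that(1)] .
    then have "cls F' = cls (f K)"
      using eq[OF K(1)] pushout_extn_lmap[OF that(2) K(1)] g C by simp
    also have "\<dots> = cls (f E)"
      by (rule cls_invariant[of t X Y "\<lambda>K. cls (f K)", OF inv K(1) assms(2) K(2)])
    also have "\<dots> = cls F"
      using eq[OF assms(2,1,3)] .
    finally show ?thesis .
  qed
  moreover have "E \<in> cls E" "pushout_extn g E (f E)"
    using mem_cls(1)[OF assms(2)] f[OF assms(2)] .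
  ultimately show ?thesis
    unfolding lpush_def by blast
qed

lemma lpull_cls:
  assumes "lmap (idm A Y) h F E" "E \<in> extns t X Y" "F \<in> extns t X' Y"
  shows "lpull (cls E) h = cls F"
proof -
  have h: "h \<in> Mor A" "src A h = X'" "tgt A h = X"
    using lmap_ends[OF assms(1)] chain_ends[of X Y E] chain_ends[of X' Y F] assms(2,3)
    by (auto simp: extns_iff)
  have C: "X' \<in> C" "Y \<in> Obj A" "X \<in> Obj A"
    using extns_C assms by auto
  define f where "f E = (SOME F. pullback_extn h E F)" for E
  have f: "pullback_extn h K (f K)" if "K \<in> extns t X Y" for K
    unfolding f_def by (rule someI_ex) (rule ex_pullback_extn[OF that h(1)], use h C in auto)
  have eq: "cls L = cls (f K)" if "K \<in> extns t X Y" "lmap (idm A Y) h L K" "L \<in> extns t X' Y" for K L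
    using pullback_extn_factor[OF that(2) f[OF that(1)]]
      pullback_extn_lmap[OF f[OF that(1)] that(1)] that h C
    by (intro cls_eqI) auto
  have inv: "cls (f K) = cls (f L)" if "K \<in> extns t X Y" "L \<in> extns t X Y" "lmap (idm A Y) (idm A X) K L" for K L
  proof (rule eq[OF that(2)])
    note K = pullback_extn_lmap[OF f[OF that(1)] that(1)]
    show "f K \<in> extns t X' Y"
      using K h C by simp
    have "lmap (idm A Y) h (f K) K"
      using K h C by simp
    from lmap_trans[OF this that(3)] show "lmap (idm A Y) h (f K) L"
      using h C by simp
  qed
  have "cls F' = cls F" if "K \<in> cls E" "pullback_extn h K F'" for K F'
  proof -
    have K: "K \<in> extns t X Y" "cls K = cls E"
      using mem_cls(2,3)[OF assms(2) that(1)] .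
    then have "cls F' = cls (f K)"
      using eq[OF K(1)] pullback_extn_lmap[OF that(2) K(1)] h C by simp
    also have "\<dots> = cls (f E)"
      by (rule cls_invariant[of t X Y "\<lambda>K. cls (f K)", OF inv K(1) assms(2) K(2)])
    also have "\<dots> = cls F"
      using eq[OF assms(2,1,3)] by simp
    finally show ?thesis .
  qed
  moreover have "E \<in> cls E" "pullback_extn h E (f E)"
    using mem_cls(1)[OF assms(2)] f[OF assms(2)] .
  ultimately show ?thesis
    unfolding lpull_def by blast
qed

lemma ex_lpush:
  assumes "E \<in> extns t X Y" "g \<in> Mor A" "src A g = Y" "tgt A g = Y'" "Y' \<in> C"
  obtains F where "F \<in> extns t X Y'" "lmap g (idm A X) E F" "lpush g (cls E) = cls F"
proof -
  obtain F where F: "pushout_extn g E F"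
    by (rule ex_pushout_extn[OF assms(1-3)]) (use assms in auto)
  then show ?thesis
    using that[of F] pushout_extn_lmap[OF F assms(1)] lpush_cls[of g X E F, OF _ assms(1)] assms by simp
qed

lemma ex_lpull:
  assumes "E \<in> extns t X Y" "h \<in> Mor A" "tgt A h = X" "src A h = X'" "X' \<in> C"
  obtains F where "F \<in> extns t X' Y" "lmap (idm A Y) h F E" "lpull (cls E) h = cls F"
proof -
  obtain F where F: "pullback_extn h E F"
    by (rule ex_pullback_extn[OF assms(1-3)]) (use assms in auto)
  then show ?thesis
    using that[of F] pullback_extn_lmap[OF F assms(1)] lpull_cls[of Y h F E, OF _ assms(1)] assms by simp
qed

text \<open>The map factors through the push-out of \<open>E\<close> along \<open>g\<close> and the
  pull-back of \<open>F\<close> along \<open>h\<close>; what remains between them is a map with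
  identity ends. Naturality of the biproduct maps rests on this.\<close>

lemma lmap_cls:
  assumes "lmap g h E F" "E \<in> extns t X Y" "F \<in> extns t X' Y'"
  shows "lpush g (cls E) = lpull (cls F) h"
proof -
  have gh: "g \<in> Mor A" "src A g = Y" "tgt A g = Y'" "h \<in> Mor A" "src A h = X" "tgt A h = X'"
    using lmap_ends[OF assms(1)] chain_ends[of X Y E] chain_ends[of X' Y' F] assms(2,3)
    by (auto simp: extns_iff)
  have C: "X \<in> C" "Y' \<in> C"
    using extns_C assms by auto
  obtain E' where E': "pushout_extn g E E'"
    by (rule ex_pushout_extn[OF assms(2) gh(1,2)]) (use gh C in auto)
  obtain F' where F': "pullback_extn h F F'"
    by (rule ex_pullback_extn[OF assms(3) gh(4,6)]) (use gh C in auto)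
  have "lmap (idm A Y') (idm A X) E' F'"
    using pullback_extn_factor[OF pushout_extn_factor[OF assms(1) E'] F'] gh by simp
  then have "cls E' = cls F'"
    using pushout_extn_lmap[OF E' assms(2)] pullback_extn_lmap[OF F' assms(3)] gh C
    by - (rule cls_eqI[of Y' X], auto)
  moreover have "lpush g (cls E) = cls E'"
    by (rule lpush_cls) (use pushout_extn_lmap[OF E' assms(2)] gh C assms(2) in auto)
  moreover have "lpull (cls F) h = cls F'"
    by (rule lpull_cls) (use pullback_extn_lmap[OF F' assms(3)] gh C assms(3) in auto)
  ultimately show ?thesis
    by simp
qed

lemma push_eq_lpush:
  assumes "\<gamma> \<in> Ext t X Y" "g \<in> Mor A" "src A g = Y" "tgt A g \<in> C"
  shows "push t X g \<gamma> = lpush g \<gamma>"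
proof -
  obtain E where E: "E \<in> extns t X Y" "\<gamma> = cls E"
    using assms(1) by (rule Ext_cls)
  have "extn_class t X (tgt A g) F = cls F" if "K \<in> \<gamma>" "pushout_extn g K F" for K F
    using pushout_extn_lmap(2)[OF that(2) mem_cls(2)[OF E(1)]] that E(2) assms(4)
    by - (rule extn_class_cls, simp)
  then show ?thesis
    unfolding push_def lpush_def by - (rule SUP_cong[OF refl], rule SUP_cong[OF refl], simp)
qed

lemma pull_eq_lpull:
  assumes "\<gamma> \<in> Ext t X Y" "h \<in> Mor A" "tgt A h = X" "src A h \<in> C"
  shows "pull t Y \<gamma> h = lpull \<gamma> h"
proof -
  obtain E where E: "E \<in> extns t X Y" "\<gamma> = cls E"
    using assms(1) by (rule Ext_cls)
  have "extn_class t (src A h) Y F = cls F" if "K \<in> \<gamma>" "pullback_extn h K F" for K F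
    using pullback_extn_lmap(2)[OF that(2) mem_cls(2)[OF E(1)]] that E(2) assms(4)
    by - (rule extn_class_cls, simp)
  then show ?thesis
    unfolding pull_def lpull_def by - (rule SUP_cong[OF refl], rule SUP_cong[OF refl], simp)
qed

lemma lsplice_cls:
  assumes "E \<in> extns s Y Z" "F \<in> extns t X Y"
  shows "lsplice (cls E) (cls F) = cls (E @ F)"
proof -
  have "cls (K @ L) = cls (E @ F)" if "K \<in> cls E" "L \<in> cls F" for K L
  proof -
    have K: "K \<in> extns s Y Z" "cls K = cls E" and L: "L \<in> extns t X Y" "cls L = cls F"
      using mem_cls(2,3)[OF assms(1) that(1)] mem_cls(2,3)[OF assms(2) that(2)] by auto
    have "cls (K @ L) = cls (E @ L)"
    proof (rule cls_invariant[of s Y Z "\<lambda>K. cls (K @ L)", OF _ K(1) assms(1) K(2)])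
      fix E' F' assume h: "E' \<in> extns s Y Z" "F' \<in> extns s Y Z" "lmap (idm A Z) (idm A Y) E' F'"
      then have "lmap (idm A Z) (idm A X) (E' @ L) (F' @ L)"
        using lmap_refl[of X Y L] L(1) by (subst lmap_append) (auto simp: extns_iff)
      then show "cls (E' @ L) = cls (F' @ L)"
        using extns_append h L(1) cls_eqI by blast
    qed
    also have "\<dots> = cls (E @ F)"
    proof (rule cls_invariant[of t X Y "\<lambda>L. cls (E @ L)", OF _ L(1) assms(2) L(2)])
      fix E' F' assume h: "E' \<in> extns t X Y" "F' \<in> extns t X Y" "lmap (idm A Y) (idm A X) E' F'"
      then have "lmap (idm A Z) (idm A X) (E @ E') (E @ F')"
        using lmap_refl[of Y Z E] assms(1) by (subst lmap_append) (auto simp: extns_iff)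
      then show "cls (E @ E') = cls (E @ F')"
        using extns_append h assms(1) cls_eqI by blast
    qed
    finally show ?thesis .
  qed
  then show ?thesis
    unfolding lsplice_def using mem_cls(1)[OF assms(1)] mem_cls(1)[OF assms(2)] by blast
qed

lemma dsum_extn_simps [simp]:
  "dsum_extn [] [] = []"
  "dsum_extn (e # E) (f # F) = (dsum (fst e) (fst f), dsum (snd e) (snd f)) # dsum_extn E F"
  by (auto simp: dsum_extn_def case_prod_beta')

lemma chain_dsum:
  assumes "chain X Y E" "chain X' Y' F" "length E = length F"
  shows "chain (bsum X X') (bsum Y Y') (dsum_extn E F)"
  using assms(3,1,2)
proof (induction E F arbitrary: Y Y' rule: list_induct2)
  case (Cons e E f F)
  then show ?case
    using confl_dsum[of e f] confl_ends[of e] confl_ends[of f] by auto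
qed auto

lemma dsum_extns:
  assumes "E \<in> extns t X Y" "F \<in> extns t X' Y'"
  shows "dsum_extn E F \<in> extns t (bsum X X') (bsum Y Y')"
  using assms chain_dsum by (auto simp: extns_iff dsum_extn_def)

lemma lmap_dsum:
  assumes "lmap g h E F" "lmap g' h' E' F'" "length E = length E'"
  shows "lmap (dsum g g') (dsum h h') (dsum_extn E E') (dsum_extn F F')"
  using assms(3,1,2)
proof (induction E E' arbitrary: g g' F F' rule: list_induct2)
  case (Cons e E e' E')
  then show ?case
    by (cases F; cases F') (auto intro: cmap_dsum)
next
  case Nil
  then show ?case
    by (cases F; cases F') auto
qed

lemma zero_extn_extns:
  assumes "X \<in> C" "Y \<in> C" "t \<noteq> 0"
  shows "zero_extn t X Y \<in> extns t X Y"
proof -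
  define K where "K s = (if s = 0 then Y else if s = t then X else zobj)" for s
  define z where "z s = (inj1 (K s) (K (Suc s)), prj2 (K s) (K (Suc s)))" for s
  have K: "K s \<in> C" for s
    using assms by (auto simp: K_def)
  have "confl (z s)" for s
    using biproduct_C(1)[OF bip_biproduct[of "K s" "K (Suc s)"]] K by (auto simp: confl_def z_def)
  moreover have "lft (z s) = K s" "rgt (z s) = K (Suc s)" for s
    using K by (auto simp: z_def)
  ultimately have "chain (K (a + m)) (K a) (map z [a..<a + m])" for a m
    by (induction m) (auto simp: chain_append)
  from this[of 0 t] have "chain X Y (map z [0..<t])"
    using assms by (simp add: K_def)
  moreover have "zero_extn t X Y = map z [0..<t]"
    by (simp add: zero_extn_def K_def[abs_def] z_def[abs_def])
  ultimately show ?thesis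
    using assms by (simp add: extns_iff)
qed

text \<open>The middle component is \<open>h\<close> after the deflation, placed in the second
  summand, so it vanishes on the left end.\<close>

lemma cmap_zero:
  assumes "confl e" "K \<in> C" "h \<in> Mor A" "src A h = rgt e" "tgt A h \<in> C"
  shows "cmap (zrm A (lft e) K) h e (inj1 K (tgt A h), prj2 K (tgt A h))"
proof -
  obtain i p where e [simp]: "e = (i, p)"
    by (cases e)
  have c: "conflation i p"
    using assms by (simp add: confl_def)
  note [simp] = conflation_simps[OF c]
  have [simp]: "src A h = tgt A p" "K \<in> Obj A" "tgt A h \<in> Obj A"
    using assms by auto
  have c': "conflation (inj1 K (tgt A h)) (prj2 K (tgt A h))"
    using biproduct_C(1)[OF bip_biproduct[of K "tgt A h"]] assms by auto
  show ?thesis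
    unfolding e fst_conv
    by (rule cmapI[OF c c', of _ "inj2 K (tgt A h) \<cdot> (h \<cdot> p)"]) (use assms(3) in simp_all)
qed

text \<open>Every component at a splicing object is zero except the identity at the right end. This
  identifies the zero class with a push-out along a zero morphism.\<close>

lemma lmap_zero:
  assumes "E \<in> extns t X Y'" "Y \<in> C"
  shows "lmap (zrm A Y' Y) (idm A X) E (zero_extn t X Y)"
proof -
  define K where "K s = (if s = 0 then Y else if s = t then X else zobj)" for s
  define z where "z s = (inj1 (K s) (K (Suc s)), prj2 (K s) (K (Suc s)))" for s
  have C: "X \<in> C" "t \<noteq> 0"
    using extns_C[OF assms(1)] by auto
  have K: "K s \<in> C" for s
    using assms C by (auto simp: K_def)
  \<comment> \<open>For the induction, \<open>F\<close> is a tail of the sequence and is mapped to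
    the part of the zero sequence from position \<open>a\<close> on.\<close>
  have *: "lmap (zrm A W (K a)) (idm A X) F (map z [a..<t])"
    if "chain X W F" "F \<noteq> []" "length F = t - a" for F W a
    using that
  proof (induction F arbitrary: W a)
    case (Cons e F)
    have ar: "[a..<t] = a # [Suc a..<t]"
      using Cons.prems by (simp add: upt_conv_Cons)
    have ce: "confl e" "lft e = W"
      using Cons.prems by auto
    show ?case
    proof (cases "F = []")
      case True
      then have "Suc a = t" "rgt e = X"
        using Cons.prems by auto
      then show ?thesis
        using cmap_zero[OF ce(1) K[of a], of "idm A X"] ce C True K[of a] unfolding ar
        by (auto simp: z_def K_def)
    next
      case False
      have r: "rgt e \<in> C"
        using confl_ends[OF ce(1)] by auto
      have "lmap (zrm A (rgt e) (K (Suc a))) (idm A X) F (map z [Suc a..<t])"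
        using Cons False by auto
      moreover have "cmap (zrm A W (K a)) (zrm A (rgt e) (K (Suc a))) e (z a)"
        using cmap_zero[OF ce(1) K[of a], of "zrm A (rgt e) (K (Suc a))"] ce K[of "Suc a"] r
        by (auto simp: z_def)
      ultimately show ?thesis
        unfolding ar by auto
    qed
  qed simp
  have "zero_extn t X Y = map z [0..<t]"
    by (simp add: zero_extn_def K_def[abs_def] z_def[abs_def])
  then show ?thesis
    using *[of Y' E 0] assms(1) by (auto simp: extns_iff K_def)
qed

end

section \<open>The graded category of extensions\<close>

text \<open>Degree 0 stands for Hom and degree k for Ext^k. The degree and the ends index the sets
  \<open>G\<close>, while the product itself is untyped, so duality is an interpretation with the
  product reversed.\<close>

locale graded_category =
  fixes Ob :: "'o set" and G :: "nat \<Rightarrow> 'o \<Rightarrow> 'o \<Rightarrow> 'g set"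
    and mul :: "'g \<Rightarrow> 'g \<Rightarrow> 'g" (infixl "\<star>" 70)
    and add :: "'g \<Rightarrow> 'g \<Rightarrow> 'g" (infixl "\<oplus>" 65)
    and zer :: "nat \<Rightarrow> 'o \<Rightarrow> 'o \<Rightarrow> 'g" and unt :: "'o \<Rightarrow> 'g"
  assumes G_Ob: "a \<in> G k X Y \<Longrightarrow> X \<in> Ob \<and> Y \<in> Ob"
    and mul_in: "a \<in> G k Y Z \<Longrightarrow> b \<in> G l X Y \<Longrightarrow> a \<star> b \<in> G (k + l) X Z"
    and mul_assoc: "a \<in> G k Y Z \<Longrightarrow> b \<in> G l X Y \<Longrightarrow> c \<in> G m W X \<Longrightarrow> (a \<star> b) \<star> c = a \<star> (b \<star> c)"
    and unt_in: "X \<in> Ob \<Longrightarrow> unt X \<in> G 0 X X"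
    and unt_left: "a \<in> G k X Y \<Longrightarrow> unt Y \<star> a = a"
    and unt_right: "a \<in> G k X Y \<Longrightarrow> a \<star> unt X = a"
    and add_in: "a \<in> G k X Y \<Longrightarrow> b \<in> G k X Y \<Longrightarrow> a \<oplus> b \<in> G k X Y"
    and add_assoc: "a \<in> G k X Y \<Longrightarrow> b \<in> G k X Y \<Longrightarrow> c \<in> G k X Y \<Longrightarrow> (a \<oplus> b) \<oplus> c = a \<oplus> (b \<oplus> c)"
    and add_comm: "a \<in> G k X Y \<Longrightarrow> b \<in> G k X Y \<Longrightarrow> a \<oplus> b = b \<oplus> a"
    and zer_in: "X \<in> Ob \<Longrightarrow> Y \<in> Ob \<Longrightarrow> zer k X Y \<in> G k X Y"
    and add_zer: "a \<in> G k X Y \<Longrightarrow> a \<oplus> zer k X Y = a"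
    and ex_neg: "a \<in> G k X Y \<Longrightarrow> \<exists>b \<in> G k X Y. a \<oplus> b = zer k X Y"
    and distrib_left: "a \<in> G k Y Z \<Longrightarrow> b \<in> G l X Y \<Longrightarrow> c \<in> G l X Y \<Longrightarrow> a \<star> (b \<oplus> c) = a \<star> b \<oplus> a \<star> c"
    and distrib_right: "b \<in> G l Y Z \<Longrightarrow> c \<in> G l Y Z \<Longrightarrow> a \<in> G k X Y \<Longrightarrow> (b \<oplus> c) \<star> a = b \<star> a \<oplus> c \<star> a"
begin

lemma graded_category_op:
  "graded_category Ob (\<lambda>k X Y. G k Y X) (\<lambda>a b. b \<star> a) add (\<lambda>k X Y. zer k Y X) unt"
  by unfold_locales
    (auto intro: mul_assoc[symmetric] unt_in unt_left unt_right add_in add_assoc add_comm zer_in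
      add_zer ex_neg distrib_left distrib_right simp: add.commute dest: G_Ob,
     metis mul_in add.commute)

lemma add_cancel:
  assumes "a \<in> G k X Y" "b \<in> G k X Y" "c \<in> G k X Y" "a \<oplus> c = b \<oplus> c"
  shows "a = b"
proof -
  obtain d where d: "d \<in> G k X Y" "c \<oplus> d = zer k X Y"
    using ex_neg assms(3) by blast
  have "(a \<oplus> c) \<oplus> d = (b \<oplus> c) \<oplus> d"
    using assms by simp
  then show ?thesis
    using add_assoc[OF assms(1,3) d(1)] add_assoc[OF assms(2,3) d(1)] d(2) add_zer assms by metis
qed

lemma add_idem_zer: "a \<in> G k X Y \<Longrightarrow> a \<oplus> a = a \<Longrightarrow> a = zer k X Y"
  by (metis add_cancel add_comm add_zer zer_in G_Ob)

lemma mul_zer: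
  assumes "a \<in> G k Y Z" "X \<in> Ob"
  shows "a \<star> zer l X Y = zer (k + l) X Z"
proof -
  have z: "zer l X Y \<in> G l X Y"
    using assms G_Ob zer_in by blast
  then show ?thesis
    using add_idem_zer[OF mul_in[OF assms(1) z]] distrib_left[OF assms(1) z z] add_zer[OF z] by simp
qed

lemma zer_mul:
  assumes "a \<in> G k X Y" "Z \<in> Ob"
  shows "zer l Y Z \<star> a = zer (l + k) X Z"
proof -
  have z: "zer l Y Z \<in> G l Y Z"
    using assms G_Ob zer_in by blast
  then show ?thesis
    using add_idem_zer[OF mul_in[OF z assms(1)]] distrib_right[OF z z assms(1)] add_zer[OF z] by simp
qed

lemma ex_diff:
  assumes "a \<in> G k X Y" "b \<in> G k X Y"
  obtains c where "c \<in> G k X Y" "a = b \<oplus> c"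
proof -
  obtain d where d: "d \<in> G k X Y" "b \<oplus> d = zer k X Y"
    using ex_neg assms(2) by blast
  have "zer k X Y \<oplus> a = a"
    using add_comm[OF _ assms(1), of "zer k X Y"] add_zer[OF assms(1)] zer_in G_Ob[OF assms(1)] by simp
  then have "b \<oplus> (d \<oplus> a) = a"
    using add_assoc[OF assms(2) d(1) assms(1)] d(2) by simp
  then show ?thesis
    using that[OF add_in[OF d(1) assms(1)]] by simp
qed

lemma add_eq_self_iff:
  assumes "a \<in> G k X Y" "b \<in> G k X Y"
  shows "a \<oplus> b = a \<longleftrightarrow> b = zer k X Y"
  using assms by (metis add_cancel add_comm add_zer zer_in G_Ob)

text \<open>Subtraction turns a trivial kernel, assumed for one degree and one pair of objects, into
  cancellation.\<close>

lemma mul_cancel_left: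
  assumes "a \<in> G k Y Z" and inj: "\<And>x. x \<in> G l X Y \<Longrightarrow> a \<star> x = zer (k + l) X Z \<Longrightarrow> x = zer l X Y"
    and "b \<in> G l X Y" "c \<in> G l X Y" "a \<star> b = a \<star> c"
  shows "b = c"
proof -
  obtain d where d: "d \<in> G l X Y" "b = c \<oplus> d"
    using ex_diff assms by blast
  have "a \<star> c = a \<star> c \<oplus> a \<star> d"
    using distrib_left[OF assms(1,4) d(1)] d assms by simp
  then have "a \<star> d = zer (k + l) X Z"
    using add_eq_self_iff[OF mul_in[OF assms(1,4)] mul_in[OF assms(1) d(1)]] by simp
  then show ?thesis
    using inj[OF d(1)] d(2) add_zer[OF assms(4)] by simp
qed

lemma mul_cancel_right:
  assumes "a \<in> G k X Y" and inj: "\<And>x. x \<in> G l Y Z \<Longrightarrow> x \<star> a = zer (l + k) X Z \<Longrightarrow> x = zer l Y Z"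
    and "b \<in> G l Y Z" "c \<in> G l Y Z" "b \<star> a = c \<star> a"
  shows "b = c"
proof -
  obtain d where d: "d \<in> G l Y Z" "b = c \<oplus> d"
    using ex_diff assms by blast
  have "c \<star> a = c \<star> a \<oplus> d \<star> a"
    using distrib_right[OF assms(4) d(1) assms(1)] d assms by simp
  then have "d \<star> a = zer (l + k) X Z"
    using add_eq_self_iff[OF mul_in[OF assms(4,1)] mul_in[OF d(1) assms(1)]] by simp
  then show ?thesis
    using inj[OF d(1)] d(2) add_zer[OF assms(4)] by simp
qed

end

section \<open>Diagonal and codiagonal morphisms\<close>

context abelian_category
begin

lemma diag_simps:
  assumes "X \<in> Obj A"
  shows "diag X \<in> Mor A" "src A (diag X) = X" "tgt A (diag X) = bsum X X"
    "codiag X \<in> Mor A" "src A (codiag X) = bsum X X" "tgt A (codiag X) = X"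
    "prj1 X X \<cdot> diag X = idm A X" "prj2 X X \<cdot> diag X = idm A X"
    "codiag X \<cdot> inj1 X X = idm A X" "codiag X \<cdot> inj2 X X = idm A X"
  using assms by (simp_all add: diag_def codiag_def cmp_addm)

lemma diag_dsum:
  assumes "f \<in> Mor A"
  shows "dsum f f \<cdot> diag (src A f) = diag (tgt A f) \<cdot> f"
    "codiag (tgt A f) \<cdot> dsum f f = f \<cdot> codiag (src A f)"
  using assms by (simp_all add: diag_def codiag_def cmp_addm dsum_inj dsum_inj_cmp)

text \<open>The degree-zero case of the formula for the Baer sum.\<close>

lemma addm_dsum:
  assumes "f \<in> Mor A" "g \<in> Mor A" "src A g = src A f" "tgt A g = tgt A f"
  shows "codiag (tgt A f) \<cdot> (dsum f g \<cdot> diag (src A f)) = f \<boxplus> g"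
proof -
  have *: "dsum f g \<cdot> diag (src A f) = (inj1 (tgt A f) (tgt A f) \<cdot> f) \<boxplus> (inj2 (tgt A f) (tgt A f) \<cdot> g)"
    using assms by (simp add: diag_def cmp_addm dsum_inj)
  have "codiag (tgt A f) \<cdot> (inj1 (tgt A f) (tgt A f) \<cdot> f) = f" "codiag (tgt A f) \<cdot> (inj2 (tgt A f) (tgt A f) \<cdot> g) = g"
    using assms cmp_reassoc[OF diag_simps(9)[of "tgt A f"], of f]
      cmp_reassoc[OF diag_simps(10)[of "tgt A f"], of g] diag_simps[of "tgt A f"] by simp_all
  then show ?thesis
    unfolding * using assms diag_simps[of "tgt A f"] by (simp add: cmp_addm)
qed

end

section \<open>The graded category formed by morphisms and Yoneda classes\<close>

context extension_closed_subcategory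
begin

definition ldsum :: "'b extn set \<Rightarrow> 'b extn set \<Rightarrow> 'b extn set" where
  "ldsum \<gamma> \<eta> = (\<Union>E \<in> \<gamma>. \<Union>F \<in> \<eta>. cls (dsum_extn E F))"

lemma ldsum_cls:
  assumes "E \<in> extns t X Y" "F \<in> extns t X' Y'"
  shows "ldsum (cls E) (cls F) = cls (dsum_extn E F)"
proof -
  have C: "X \<in> Obj A" "Y \<in> Obj A" "X' \<in> Obj A" "Y' \<in> Obj A"
    using extns_C[OF assms(1)] extns_C[OF assms(2)] by auto
  have "cls (dsum_extn K L) = cls (dsum_extn E F)" if "K \<in> cls E" "L \<in> cls F" for K L
  proof -
    have K: "K \<in> extns t X Y" "cls K = cls E" and L: "L \<in> extns t X' Y'" "cls L = cls F"
      using mem_cls(2,3)[OF assms(1) that(1)] mem_cls(2,3)[OF assms(2) that(2)] by auto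
    have len: "length K' = t" if "K' \<in> extns t X Y" for K' X Y
      using that by (auto simp: extns_iff)
    have refl: "lmap (idm A Y) (idm A X) K' K'" if "K' \<in> extns t X Y" for K' X Y
      using that by (auto simp: extns_iff intro: lmap_refl)
    have "cls (dsum_extn K L) = cls (dsum_extn E L)"
    proof (rule cls_invariant[of t X Y "\<lambda>K. cls (dsum_extn K L)", OF _ K(1) assms(1) K(2)])
      fix E' F' assume h: "E' \<in> extns t X Y" "F' \<in> extns t X Y" "lmap (idm A Y) (idm A X) E' F'"
      have "lmap (dsum (idm A Y) (idm A Y')) (dsum (idm A X) (idm A X')) (dsum_extn E' L) (dsum_extn F' L)"
        using lmap_dsum[OF h(3) refl[OF L(1)]] len[OF h(1)] len[OF L(1)] by simp
      then show "cls (dsum_extn E' L) = cls (dsum_extn F' L)"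
        using dsum_extns[OF h(1) L(1)] dsum_extns[OF h(2) L(1)] C
        by - (rule cls_eqI[of "bsum Y Y'" "bsum X X'"], auto simp: dsum_idm)
    qed
    also have "\<dots> = cls (dsum_extn E F)"
    proof (rule cls_invariant[of t X' Y' "\<lambda>L. cls (dsum_extn E L)", OF _ L(1) assms(2) L(2)])
      fix E' F' assume h: "E' \<in> extns t X' Y'" "F' \<in> extns t X' Y'" "lmap (idm A Y') (idm A X') E' F'"
      have "lmap (dsum (idm A Y) (idm A Y')) (dsum (idm A X) (idm A X')) (dsum_extn E E') (dsum_extn E F')"
        using lmap_dsum[OF refl[OF assms(1)] h(3)] len[OF h(1)] len[OF assms(1)] by simp
      then show "cls (dsum_extn E E') = cls (dsum_extn E F')"
        using dsum_extns[OF assms(1) h(1)] dsum_extns[OF assms(1) h(2)] C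
        by - (rule cls_eqI[of "bsum Y Y'" "bsum X X'"], auto simp: dsum_idm)
    qed
    finally show ?thesis .
  qed
  then have "ldsum (cls E) (cls F) = (\<Union>K \<in> cls E. \<Union>L \<in> cls F. cls (dsum_extn E F))"
    unfolding ldsum_def by - (rule SUP_cong[OF refl], rule SUP_cong[OF refl], simp)
  then show ?thesis
    using mem_cls(1)[OF assms(1)] mem_cls(1)[OF assms(2)] by auto
qed

lemma dsum_class_ldsum:
  assumes "\<gamma> \<in> Ext t X Y" "\<eta> \<in> Ext t X Y"
  shows "dsum_class t X Y \<gamma> \<eta> = ldsum \<gamma> \<eta>"
proof -
  obtain E where E: "E \<in> extns t X Y" "\<gamma> = cls E"
    using assms(1) by (rule Ext_cls)
  obtain F where F: "F \<in> extns t X Y" "\<eta> = cls F"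
    using assms(2) by (rule Ext_cls)
  have ends: "src A (prj1 X X) = bsum X X" "src A (prj1 Y Y) = bsum Y Y"
    using extns_C[OF E(1)] by auto
  have "extn_class t (bsum X X) (bsum Y Y) (dsum_extn K L) = cls (dsum_extn K L)"
    if "K \<in> \<gamma>" "L \<in> \<eta>" for K L
    using that mem_cls(2)[OF E(1)] mem_cls(2)[OF F(1)] dsum_extns unfolding E(2) F(2)
    by (intro extn_class_cls) blast
  then show ?thesis
    unfolding dsum_class_def ends ldsum_def
    by - (rule SUP_cong[OF refl], rule SUP_cong[OF refl], simp)
qed

text \<open>Morphisms are the arrows \<open>Inl f\<close> of degree 0, elements of \<open>Ext t X Y\<close> the arrows
  \<open>Inr \<gamma>\<close> of degree \<open>t \<ge> 1\<close>.\<close>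

definition gr :: "nat \<Rightarrow> 'a \<Rightarrow> 'a \<Rightarrow> ('b + 'b extn set) set" where
  "gr t X Y = (if X \<in> C \<and> Y \<in> C then if t = 0 then Inl ` Hom A X Y else Inr ` Ext t X Y else {})"

fun gmul :: "'b + 'b extn set \<Rightarrow> 'b + 'b extn set \<Rightarrow> 'b + 'b extn set" (infixl "\<star>" 70) where
  "Inl g \<star> Inl f = Inl (g \<cdot> f)"
| "Inl g \<star> Inr \<gamma> = Inr (lpush g \<gamma>)"
| "Inr \<gamma> \<star> Inl h = Inr (lpull \<gamma> h)"
| "Inr \<gamma> \<star> Inr \<eta> = Inr (lsplice \<gamma> \<eta>)"

fun gdsum :: "'b + 'b extn set \<Rightarrow> 'b + 'b extn set \<Rightarrow> 'b + 'b extn set" where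
  "gdsum (Inl f) (Inl g) = Inl (dsum f g)"
| "gdsum (Inr \<gamma>) (Inr \<eta>) = Inr (ldsum \<gamma> \<eta>)"
| "gdsum _ _ = undefined"

text \<open>The description recovers degree and ends from the arrows, unambiguously by
  \<open>gr_disjoint\<close>. The formula is the Baer sum, used uniformly in all degrees including
  0.\<close>

definition gadd :: "'b + 'b extn set \<Rightarrow> 'b + 'b extn set \<Rightarrow> 'b + 'b extn set" where
  "gadd a b = (THE c. \<exists>t X Y. a \<in> gr t X Y \<and> b \<in> gr t X Y \<and>
     c = Inl (codiag Y) \<star> (gdsum a b \<star> Inl (diag X)))"

definition gzero :: "nat \<Rightarrow> 'a \<Rightarrow> 'a \<Rightarrow> 'b + 'b extn set" where
  "gzero t X Y = (if t = 0 then Inl (zrm A X Y) else Inr (cls (zero_extn t X Y)))"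

definition gid :: "'a \<Rightarrow> 'b + 'b extn set" where
  "gid X = Inl (idm A X)"

lemma gr_C: "a \<in> gr t X Y \<Longrightarrow> X \<in> C \<and> Y \<in> C"
  by (auto simp: gr_def split: if_splits)

lemma gr_cases [consumes 1, case_names mor ext]:
  assumes "a \<in> gr t X Y"
  obtains f where "t = 0" "a = Inl f" "f \<in> Mor A" "src A f = X" "tgt A f = Y" "X \<in> C" "Y \<in> C"
    | E where "t \<noteq> 0" "a = Inr (cls E)" "E \<in> extns t X Y" "X \<in> C" "Y \<in> C"
  using assms by (auto simp: gr_def split: if_splits elim!: Ext_cls)

lemma gr_disjoint:
  assumes "a \<in> gr t X Y" "a \<in> gr t' X' Y'"
  shows "t = t' \<and> X = X' \<and> Y = Y'"
  using assms by (auto simp: gr_def split: if_splits dest: Ext_disjoint)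

lemma gr_Inl: "f \<in> Mor A \<Longrightarrow> src A f = X \<Longrightarrow> tgt A f = Y \<Longrightarrow> X \<in> C \<Longrightarrow> Y \<in> C \<Longrightarrow> Inl f \<in> gr 0 X Y"
  by (auto simp: gr_def)

lemma gr_Inr: "E \<in> extns t X Y \<Longrightarrow> Inr (cls E) \<in> gr t X Y"
  using extns_C[of E t X Y] by (auto simp: gr_def)

lemma lmap_gmul:
  "lmap g (idm A X) E F \<Longrightarrow> E \<in> extns t X Y \<Longrightarrow> F \<in> extns t X Y' \<Longrightarrow> Inl g \<star> Inr (cls E) = Inr (cls F)"
  "lmap (idm A Y) h F E \<Longrightarrow> E \<in> extns t X Y \<Longrightarrow> F \<in> extns t X' Y \<Longrightarrow> Inr (cls E) \<star> Inl h = Inr (cls F)"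
  using lpush_cls lpull_cls by auto

lemma gr_push_cases:
  assumes "g \<in> Mor A" "src A g = Y" "tgt A g = Y'" "Y' \<in> C" "E \<in> extns t X Y"
  obtains F where "F \<in> extns t X Y'" "lmap g (idm A X) E F" "Inl g \<star> Inr (cls E) = Inr (cls F)"
  using ex_lpush[OF assms(5) assms(1-4)] by (metis gmul.simps(2))

lemma gr_pull_cases:
  assumes "h \<in> Mor A" "src A h = X'" "tgt A h = X" "X' \<in> C" "E \<in> extns t X Y"
  obtains F where "F \<in> extns t X' Y" "lmap (idm A Y) h F E" "Inr (cls E) \<star> Inl h = Inr (cls F)"
  using ex_lpull[OF assms(5) assms(1,3,2,4)] by (metis gmul.simps(3))

lemma splice_gmul:
  "E \<in> extns s Y Z \<Longrightarrow> F \<in> extns t X Y \<Longrightarrow> Inr (cls E) \<star> Inr (cls F) = Inr (cls (E @ F))"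
  using lsplice_cls by auto

lemma gmul_in:
  assumes "a \<in> gr k Y Z" "b \<in> gr l X Y"
  shows "a \<star> b \<in> gr (k + l) X Z"
  using assms(1)
proof (cases rule: gr_cases)
  case f: (mor f)
  from assms(2) show ?thesis
  proof (cases rule: gr_cases)
    case (mor g)
    then show ?thesis
      using f by (auto intro: gr_Inl)
  next
    case (ext E)
    obtain F where "F \<in> extns l X Z" "a \<star> b = Inr (cls F)"
      using gr_push_cases[OF f(3-5,7) ext(3)] f(2) ext(2) by metis
    then show ?thesis
      using f(1) by (auto intro: gr_Inr)
  qed
next
  case E: (ext E)
  from assms(2) show ?thesis
  proof (cases rule: gr_cases)
    case (mor g)
    obtain F where "F \<in> extns k X Z" "a \<star> b = Inr (cls F)"
      using gr_pull_cases[OF mor(3-6) E(3)] E(2) mor(2) by metis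
    then show ?thesis
      using mor(1) by (auto intro: gr_Inr)
  next
    case (ext F)
    then show ?thesis
      using E splice_gmul[OF E(3) ext(3)] extns_append[OF E(3) ext(3)] by (auto intro: gr_Inr)
  qed
qed

lemma extns_refl: "E \<in> extns t X Y \<Longrightarrow> lmap (idm A Y) (idm A X) E E"
  by (auto simp: extns_iff intro: lmap_refl)

lemma extns_length: "E \<in> extns t X Y \<Longrightarrow> length E = t"
  by (auto simp: extns_iff)

lemma lmap_splice:
  assumes "lmap g k E F" "lmap k h E' F'"
  shows "lmap g h (E @ E') (F @ F')"
  using assms lmap_append[OF lmap_length[OF assms(1)]] by auto

text \<open>Eight cases, according to which factors are morphisms. When both kinds occur, a single
  map of sequences accounts for both sides.\<close>

lemma gmul_assoc:
  assumes "a \<in> gr k Y Z" "b \<in> gr l X Y" "c \<in> gr m W X"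
  shows "(a \<star> b) \<star> c = a \<star> (b \<star> c)"
  using assms(1)
proof (cases rule: gr_cases)
  case a: (mor f)
  from assms(2) show ?thesis
  proof (cases rule: gr_cases)
    case b: (mor g)
    from assms(3) show ?thesis
    proof (cases rule: gr_cases)
      case (mor h)
      then show ?thesis
        using a b by auto
    next
      case c: (ext E)
      obtain F where F: "F \<in> extns m W Y" "lmap g (idm A W) E F" "b \<star> c = Inr (cls F)"
        using gr_push_cases[OF b(3-5,7) c(3)] b(2) c(2) by metis
      obtain H where H: "H \<in> extns m W Z" "lmap f (idm A W) F H" "a \<star> (b \<star> c) = Inr (cls H)"
        using gr_push_cases[OF a(3-5,7) F(1)] a(2) F(3) by metis
      have "lmap (f \<cdot> g) (idm A W) E H"
        using lmap_trans[OF F(2) H(2)] c by simp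
      then show ?thesis
        using lmap_gmul(1)[OF _ c(3) H(1)] a(2) b(2) c(2) H(3) by simp
    qed
  next
    case b: (ext E)
    obtain F where F: "F \<in> extns l X Z" "lmap f (idm A X) E F" "a \<star> b = Inr (cls F)"
      using gr_push_cases[OF a(3-5,7) b(3)] a(2) b(2) by metis
    from assms(3) show ?thesis
    proof (cases rule: gr_cases)
      case c: (mor h)
      obtain H where H: "H \<in> extns l W Y" "lmap (idm A Y) h H E" "b \<star> c = Inr (cls H)"
        using gr_pull_cases[OF c(3-6) b(3)] b(2) c(2) by metis
      have "lmap f h H F"
        using lmap_trans[OF H(2) F(2)] a c by simp
      then show ?thesis
        using lmap_cls[OF _ H(1) F(1)] F(3) H(3) a(2) c(2) by simp
    next
      case c: (ext H)
      have "lmap f (idm A W) (E @ H) (F @ H)"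
        using lmap_splice[OF F(2) extns_refl[OF c(3)]] .
      then show ?thesis
        using lmap_gmul(1)[OF _ extns_append[OF b(3) c(3)] extns_append[OF F(1) c(3)]] F(3) a(2) b(2) c(2)
          splice_gmul[OF b(3) c(3)] splice_gmul[OF F(1) c(3)] by simp
    qed
  qed
next
  case a: (ext E)
  from assms(2) show ?thesis
  proof (cases rule: gr_cases)
    case b: (mor g)
    obtain F where F: "F \<in> extns k X Z" "lmap (idm A Z) g F E" "a \<star> b = Inr (cls F)"
      using gr_pull_cases[OF b(3-6) a(3)] a(2) b(2) by metis
    from assms(3) show ?thesis
    proof (cases rule: gr_cases)
      case c: (mor h)
      obtain H where H: "H \<in> extns k W Z" "lmap (idm A Z) h H F" "(a \<star> b) \<star> c = Inr (cls H)"
        using gr_pull_cases[OF c(3-6) F(1)] F(3) c(2) by metis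
      have "lmap (idm A Z) (g \<cdot> h) H E"
        using lmap_trans[OF H(2) F(2)] a by simp
      then show ?thesis
        using lmap_gmul(2)[OF _ a(3) H(1)] a(2) b(2) c(2) H(3) by simp
    next
      case c: (ext H)
      obtain K where K: "K \<in> extns m W Y" "lmap g (idm A W) H K" "b \<star> c = Inr (cls K)"
        using gr_push_cases[OF b(3-5,7) c(3)] b(2) c(2) by metis
      \<comment> \<open>The tensor relation: the pull-back map on the left factor and the push-out
        map on the right factor share the component \<open>g\<close> at the splicing object and can
        be glued there.\<close>
      have "lmap (idm A Z) (idm A W) (F @ H) (E @ K)"
        using lmap_splice[OF F(2) K(2)] .
      then have "cls (F @ H) = cls (E @ K)"
        using cls_eqI extns_append[OF F(1) c(3)] extns_append[OF a(3) K(1)] by blast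
      then show ?thesis
        using F(3) K(3) a(2) c(2) splice_gmul[OF F(1) c(3)] splice_gmul[OF a(3) K(1)] by simp
    qed
  next
    case b: (ext F)
    from assms(3) show ?thesis
    proof (cases rule: gr_cases)
      case c: (mor h)
      obtain H where H: "H \<in> extns l W Y" "lmap (idm A Y) h H F" "b \<star> c = Inr (cls H)"
        using gr_pull_cases[OF c(3-6) b(3)] b(2) c(2) by metis
      have "lmap (idm A Z) h (E @ H) (E @ F)"
        using lmap_splice[OF extns_refl[OF a(3)] H(2)] .
      then show ?thesis
        using lmap_gmul(2)[OF _ extns_append[OF a(3) b(3)] extns_append[OF a(3) H(1)]] H(3) a(2) b(2) c(2)
          splice_gmul[OF a(3) b(3)] splice_gmul[OF a(3) H(1)] by simp
    next
      case c: (ext H)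
      then show ?thesis
        using a b splice_gmul[OF a(3) b(3)] splice_gmul[OF b(3) c(3)]
          splice_gmul[OF extns_append[OF a(3) b(3)] c(3)] splice_gmul[OF a(3) extns_append[OF b(3) c(3)]]
        by simp
    qed
  qed
qed

lemma gid_in: "X \<in> C \<Longrightarrow> gid X \<in> gr 0 X X"
  by (auto simp: gid_def intro: gr_Inl)

lemma gid_mul:
  assumes "a \<in> gr t X Y"
  shows "gid Y \<star> a = a" "a \<star> gid X = a"
proof -
  from assms have "gid Y \<star> a = a \<and> a \<star> gid X = a"
  proof (cases rule: gr_cases)
    case (ext E)
    then show ?thesis
      using lmap_gmul(1)[OF extns_refl[OF ext(3)] ext(3,3)] lmap_gmul(2)[OF extns_refl[OF ext(3)] ext(3,3)]
      by (simp add: gid_def)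
  qed (auto simp: gid_def)
  then show "gid Y \<star> a = a" "a \<star> gid X = a"
    by auto
qed

lemma gdsum_in:
  assumes "a \<in> gr t X Y" "b \<in> gr t X' Y'"
  shows "gdsum a b \<in> gr t (bsum X X') (bsum Y Y')"
  using assms(1)
proof (cases rule: gr_cases)
  case (mor f)
  with assms(2) show ?thesis
    by (cases rule: gr_cases) (auto intro!: gr_Inl)
next
  case E: (ext E)
  with assms(2) obtain F where F: "b = Inr (cls F)" "F \<in> extns t X' Y'"
    by (cases rule: gr_cases) auto
  show ?thesis
    using E F dsum_extns[OF E(3) F(2)] by (auto simp: ldsum_cls[OF E(3) F(2)] intro: gr_Inr)
qed

lemma gdsum_mul:
  assumes "a \<in> gr k Y Z" "b \<in> gr l X Y" "a' \<in> gr k Y' Z'" "b' \<in> gr l X' Y'"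
  shows "gdsum a a' \<star> gdsum b b' = gdsum (a \<star> b) (a' \<star> b')"
proof -
  consider (mor) f f' where "k = 0" "a = Inl f" "a' = Inl f'" "f \<in> Mor A" "src A f = Y" "tgt A f = Z"
      "f' \<in> Mor A" "src A f' = Y'" "tgt A f' = Z'" "Z \<in> C" "Z' \<in> C" "Y \<in> C" "Y' \<in> C"
    | (ext) E E' where "k \<noteq> 0" "a = Inr (cls E)" "a' = Inr (cls E')" "E \<in> extns k Y Z" "E' \<in> extns k Y' Z'"
    using assms(1,3) by (elim gr_cases) auto
  note ca = this
  consider (mor) g g' where "l = 0" "b = Inl g" "b' = Inl g'" "g \<in> Mor A" "src A g = X" "tgt A g = Y"
      "g' \<in> Mor A" "src A g' = X'" "tgt A g' = Y'" "X \<in> C" "X' \<in> C"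
    | (ext) E E' where "l \<noteq> 0" "b = Inr (cls E)" "b' = Inr (cls E')" "E \<in> extns l X Y" "E' \<in> extns l X' Y'"
    using assms(2,4) by (elim gr_cases) auto
  note cb = this
  have C: "X \<in> Obj A" "X' \<in> Obj A" "Y \<in> Obj A" "Y' \<in> Obj A" "Z \<in> Obj A" "Z' \<in> Obj A"
    using gr_C assms by auto
  show ?thesis
    using ca
  proof cases
    case f: mor
    show ?thesis
      using cb
    proof cases
      case g: mor
      then show ?thesis
        using f by (simp add: dsum_cmp)
    next
      case (ext E E')
      obtain F where F: "F \<in> extns l X Z" "lmap f (idm A X) E F" "a \<star> b = Inr (cls F)"
        using gr_push_cases[OF f(4-6,10) ext(4)] f(2) ext(2) by metis
      obtain F' where F': "F' \<in> extns l X' Z'" "lmap f' (idm A X') E' F'" "a' \<star> b' = Inr (cls F')"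
        using gr_push_cases[OF f(7-9,11) ext(5)] f(3) ext(3) by metis
      have "lmap (dsum f f') (idm A (bsum X X')) (dsum_extn E E') (dsum_extn F F')"
        using lmap_dsum[OF F(2) F'(2)] extns_length[OF ext(4)] extns_length[OF ext(5)] C by (simp add: dsum_idm)
      from lmap_gmul(1)[OF this dsum_extns[OF ext(4,5)] dsum_extns[OF F(1) F'(1)]]
      show ?thesis
        using f(2,3) ext(2,3) F(3) F'(3) ldsum_cls[OF ext(4,5)] ldsum_cls[OF F(1) F'(1)] by simp
    qed
  next
    case e: (ext E E')
    show ?thesis
      using cb
    proof cases
      case g: (mor g g')
      obtain F where F: "F \<in> extns k X Z" "lmap (idm A Z) g F E" "a \<star> b = Inr (cls F)"
        using gr_pull_cases[OF g(4-6,10) e(4)] g(2) e(2) by metis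
      obtain F' where F': "F' \<in> extns k X' Z'" "lmap (idm A Z') g' F' E'" "a' \<star> b' = Inr (cls F')"
        using gr_pull_cases[OF g(7-9,11) e(5)] g(3) e(3) by metis
      have "lmap (idm A (bsum Z Z')) (dsum g g') (dsum_extn F F') (dsum_extn E E')"
        using lmap_dsum[OF F(2) F'(2)] extns_length[OF F(1)] extns_length[OF F'(1)] C by (simp add: dsum_idm)
      from lmap_gmul(2)[OF this dsum_extns[OF e(4,5)] dsum_extns[OF F(1) F'(1)]]
      show ?thesis
        using g(2,3) e(2,3) F(3) F'(3) ldsum_cls[OF e(4,5)] ldsum_cls[OF F(1) F'(1)] by simp
    next
      case f: (ext F F')
      have "dsum_extn (E @ F) (E' @ F') = dsum_extn E E' @ dsum_extn F F'"
        using extns_length[OF e(4)] extns_length[OF e(5)] by (simp add: dsum_extn_def)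
      then show ?thesis
        using e(2,3) f(2,3) ldsum_cls[OF e(4,5)] ldsum_cls[OF f(4,5)] splice_gmul[OF e(4) f(4)]
          splice_gmul[OF e(5) f(5)] splice_gmul[OF dsum_extns[OF e(4,5)] dsum_extns[OF f(4,5)]]
          ldsum_cls[OF extns_append[OF e(4) f(4)] extns_append[OF e(5) f(5)]] by simp
    qed
  qed
qed

text \<open>The structure maps of the biproduct are natural with respect to extensions, because they
  are natural with respect to the morphisms of a conflation.\<close>

lemma cmap_natural:
  assumes "confl e"
  shows "cmap (diag (lft e)) (diag (rgt e)) e (dsum (fst e) (fst e), dsum (snd e) (snd e))"
    "cmap (codiag (lft e)) (codiag (rgt e)) (dsum (fst e) (fst e), dsum (snd e) (snd e)) e"
proof -
  obtain i p where e [simp]: "e = (i, p)"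
    by (cases e)
  have c: "conflation i p"
    using assms by (simp add: confl_def)
  note [simp] = conflation_simps[OF c] diag_simps
  have c': "conflation (dsum i i) (dsum p p)"
    using confl_dsum[OF assms assms] by (simp add: confl_def)
  show "cmap (diag (lft e)) (diag (rgt e)) e (dsum (fst e) (fst e), dsum (snd e) (snd e))"
    unfolding e fst_conv snd_conv
    by (rule cmapI[OF c c', of _ "diag (tgt A i)"])
      (use diag_dsum(1)[of i] diag_dsum(1)[of p] in simp_all)
  show "cmap (codiag (lft e)) (codiag (rgt e)) (dsum (fst e) (fst e), dsum (snd e) (snd e)) e"
    unfolding e fst_conv snd_conv
    by (rule cmapI[OF c' c, of _ "codiag (tgt A i)"])
      (use diag_dsum(2)[of i] diag_dsum(2)[of p] in simp_all)
qed

lemma cmap_prj: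
  assumes "confl e" "confl f"
  shows "cmap (prj1 (lft e) (lft f)) (prj1 (rgt e) (rgt f)) (dsum (fst e) (fst f), dsum (snd e) (snd f)) e"
    "cmap (prj2 (lft e) (lft f)) (prj2 (rgt e) (rgt f)) (dsum (fst e) (fst f), dsum (snd e) (snd f)) f"
proof -
  obtain i p j q where e [simp]: "e = (i, p)" "f = (j, q)"
    by (cases e; cases f)
  have c: "conflation i p" "conflation j q"
    using assms by (simp_all add: confl_def)
  note [simp] = conflation_simps[OF c(1)] conflation_simps[OF c(2)]
  have c': "conflation (dsum i j) (dsum p q)"
    using confl_dsum[OF assms] by (simp add: confl_def)
  show "cmap (prj1 (lft e) (lft f)) (prj1 (rgt e) (rgt f)) (dsum (fst e) (fst f), dsum (snd e) (snd f)) e"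
    unfolding e fst_conv snd_conv
    by (rule cmapI[OF c' c(1), of _ "prj1 (tgt A i) (tgt A j)"]) (simp_all add: dsum_inj)
  show "cmap (prj2 (lft e) (lft f)) (prj2 (rgt e) (rgt f)) (dsum (fst e) (fst f), dsum (snd e) (snd f)) f"
    unfolding e fst_conv snd_conv
    by (rule cmapI[OF c' c(2), of _ "prj2 (tgt A i) (tgt A j)"]) (simp_all add: dsum_inj)
qed

lemma lmap_natural:
  assumes "chain X Y E" "E \<noteq> []"
  shows "lmap (diag Y) (diag X) E (dsum_extn E E)" "lmap (codiag Y) (codiag X) (dsum_extn E E) E"
proof -
  have "lmap (diag Y) (diag X) E (dsum_extn E E) \<and> lmap (codiag Y) (codiag X) (dsum_extn E E) E"
    using assms(1)
  proof (induction E arbitrary: Y)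
    case (Cons e E)
    then show ?case
      using cmap_natural[of e] by auto
  qed simp
  then show "lmap (diag Y) (diag X) E (dsum_extn E E)" "lmap (codiag Y) (codiag X) (dsum_extn E E) E"
    by auto
qed

lemma lmap_prj:
  assumes "chain X Y E" "chain X' Y' F" "length E = length F"
  shows "lmap (prj1 Y Y') (prj1 X X') (dsum_extn E F) E \<and> lmap (prj2 Y Y') (prj2 X X') (dsum_extn E F) F"
  using assms(3,1,2)
proof (induction E F arbitrary: Y Y' rule: list_induct2)
  case (Cons e E f F)
  then show ?case
    using cmap_prj[of e f] by auto
qed auto

lemma diag_gr:
  assumes "X \<in> C"
  shows "Inl (diag X) \<in> gr 0 X (bsum X X)" "Inl (codiag X) \<in> gr 0 (bsum X X) X"
  using assms diag_simps[of X] by (auto intro!: gr_Inl)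

lemma prj_gr:
  assumes "X \<in> C" "Y \<in> C"
  shows "Inl (prj1 X Y) \<in> gr 0 (bsum X Y) X" "Inl (prj2 X Y) \<in> gr 0 (bsum X Y) Y"
  using assms by (auto intro!: gr_Inl)

lemma gdsum_natural:
  assumes "a \<in> gr t X Y"
  shows "gdsum a a \<star> Inl (diag X) = Inl (diag Y) \<star> a" "Inl (codiag Y) \<star> gdsum a a = a \<star> Inl (codiag X)"
proof -
  from assms have "gdsum a a \<star> Inl (diag X) = Inl (diag Y) \<star> a \<and>
    Inl (codiag Y) \<star> gdsum a a = a \<star> Inl (codiag X)"
  proof (cases rule: gr_cases)
    case (mor f)
    then show ?thesis
      using diag_dsum[of f] by auto
  next
    case (ext E)
    have ch: "chain X Y E" "E \<noteq> []"
      using ext(3) by (auto simp: extns_iff)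
    show ?thesis
      using lmap_cls[OF lmap_natural(1)[OF ch] ext(3) dsum_extns[OF ext(3,3)]]
        lmap_cls[OF lmap_natural(2)[OF ch] dsum_extns[OF ext(3,3)] ext(3)]
        ldsum_cls[OF ext(3,3)] ext(2) by simp
  qed
  then show "gdsum a a \<star> Inl (diag X) = Inl (diag Y) \<star> a" "Inl (codiag Y) \<star> gdsum a a = a \<star> Inl (codiag X)"
    by auto
qed

lemma gdsum_prj:
  assumes "a \<in> gr t X Y" "b \<in> gr t X' Y'"
  shows "Inl (prj1 Y Y') \<star> gdsum a b = a \<star> Inl (prj1 X X')"
    "Inl (prj2 Y Y') \<star> gdsum a b = b \<star> Inl (prj2 X X')"
proof -
  from assms(1) have "Inl (prj1 Y Y') \<star> gdsum a b = a \<star> Inl (prj1 X X') \<and>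
    Inl (prj2 Y Y') \<star> gdsum a b = b \<star> Inl (prj2 X X')"
  proof (cases rule: gr_cases)
    case f: (mor f)
    with assms(2) obtain g where g: "b = Inl g" "g \<in> Mor A" "src A g = X'" "tgt A g = Y'"
      by (cases rule: gr_cases) auto
    then show ?thesis
      using f by (simp add: dsum_inj)
  next
    case E: (ext E)
    with assms(2) obtain F where F: "b = Inr (cls F)" "F \<in> extns t X' Y'"
      by (cases rule: gr_cases) auto
    have l: "lmap (prj1 Y Y') (prj1 X X') (dsum_extn E F) E" "lmap (prj2 Y Y') (prj2 X X') (dsum_extn E F) F"
      using lmap_prj[of X Y E X' Y' F] E F by (auto simp: extns_iff)
    show ?thesis
      using lmap_cls[OF l(1) dsum_extns[OF E(3) F(2)] E(3)] lmap_cls[OF l(2) dsum_extns[OF E(3) F(2)] F(2)]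
        ldsum_cls[OF E(3) F(2)] E(2) F(1) by simp
  qed
  then show "Inl (prj1 Y Y') \<star> gdsum a b = a \<star> Inl (prj1 X X')"
    "Inl (prj2 Y Y') \<star> gdsum a b = b \<star> Inl (prj2 X X')"
    by auto
qed

lemma gadd_eq:
  assumes "a \<in> gr t X Y" "b \<in> gr t X Y"
  shows "gadd a b = Inl (codiag Y) \<star> (gdsum a b \<star> Inl (diag X))"
  unfolding gadd_def
proof (rule the_equality)
  show "\<exists>t X' Y'. a \<in> gr t X' Y' \<and> b \<in> gr t X' Y' \<and>
      Inl (codiag Y) \<star> (gdsum a b \<star> Inl (diag X)) = Inl (codiag Y') \<star> (gdsum a b \<star> Inl (diag X'))"
    using assms by blast
  fix c assume "\<exists>t X Y. a \<in> gr t X Y \<and> b \<in> gr t X Y \<and> c = Inl (codiag Y) \<star> (gdsum a b \<star> Inl (diag X))"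
  then show "c = Inl (codiag Y) \<star> (gdsum a b \<star> Inl (diag X))"
    using gr_disjoint[OF assms(1)] by blast
qed

lemma gadd_in:
  assumes "a \<in> gr t X Y" "b \<in> gr t X Y"
  shows "gadd a b \<in> gr t X Y"
proof -
  have C: "X \<in> C" "Y \<in> C"
    using gr_C[OF assms(1)] by auto
  have "Inl (codiag Y) \<star> (gdsum a b \<star> Inl (diag X)) \<in> gr (0 + (t + 0)) X Y"
    by (rule gmul_in[OF diag_gr(2)[OF C(2)] gmul_in[OF gdsum_in[OF assms] diag_gr(1)[OF C(1)]]])
  then show ?thesis
    using gadd_eq[OF assms] by simp
qed

text \<open>The factor \<open>a\<close> passes the codiagonal by naturality and enters the direct
  sum by functoriality; no property of sequences is left to check.\<close>

lemma gadd_mul_left: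
  assumes "a \<in> gr k Y Z" "b \<in> gr l X Y" "c \<in> gr l X Y"
  shows "a \<star> gadd b c = gadd (a \<star> b) (a \<star> c)"
proof -
  have C: "X \<in> C" "Y \<in> C" "Z \<in> C"
    using gr_C assms by auto
  note d = diag_gr[OF C(1)] diag_gr[OF C(2)] diag_gr[OF C(3)]
  have bc: "gdsum b c \<star> Inl (diag X) \<in> gr l X (bsum Y Y)"
    using gmul_in[OF gdsum_in[OF assms(2,3)] d(1)] by simp
  have "a \<star> gadd b c = (a \<star> Inl (codiag Y)) \<star> (gdsum b c \<star> Inl (diag X))"
    unfolding gadd_eq[OF assms(2,3)] using gmul_assoc[OF assms(1) d(4) bc] by simp
  also have "\<dots> = (Inl (codiag Z) \<star> gdsum a a) \<star> (gdsum b c \<star> Inl (diag X))"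
    using gdsum_natural(2)[OF assms(1)] by simp
  also have "\<dots> = Inl (codiag Z) \<star> ((gdsum a a \<star> gdsum b c) \<star> Inl (diag X))"
    using gmul_assoc[OF d(6) gdsum_in[OF assms(1,1)] bc]
      gmul_assoc[OF gdsum_in[OF assms(1,1)] gdsum_in[OF assms(2,3)] d(1)] by simp
  also have "\<dots> = gadd (a \<star> b) (a \<star> c)"
    using gadd_eq[OF gmul_in[OF assms(1,2)] gmul_in[OF assms(1,3)]] gdsum_mul[OF assms(1,2,1,3)] by simp
  finally show ?thesis .
qed

lemma gadd_mul_right:
  assumes "b \<in> gr l Y Z" "c \<in> gr l Y Z" "a \<in> gr k X Y"
  shows "gadd b c \<star> a = gadd (b \<star> a) (c \<star> a)"
proof -
  have C: "X \<in> C" "Y \<in> C" "Z \<in> C"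
    using gr_C assms by auto
  note d = diag_gr[OF C(1)] diag_gr[OF C(2)] diag_gr[OF C(3)]
  note bc = gdsum_in[OF assms(1,2)] and aa = gdsum_in[OF assms(3,3)]
  have "gadd b c \<star> a = Inl (codiag Z) \<star> (gdsum b c \<star> (Inl (diag Y) \<star> a))"
    unfolding gadd_eq[OF assms(1,2)]
    using gmul_assoc[OF d(6) gmul_in[OF bc d(3)] assms(3)] gmul_assoc[OF bc d(3) assms(3)] by simp
  also have "\<dots> = Inl (codiag Z) \<star> (gdsum b c \<star> (gdsum a a \<star> Inl (diag X)))"
    using gdsum_natural(1)[OF assms(3)] by simp
  also have "\<dots> = Inl (codiag Z) \<star> ((gdsum b c \<star> gdsum a a) \<star> Inl (diag X))"
    using gmul_assoc[OF bc aa d(1)] by simp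
  also have "\<dots> = gadd (b \<star> a) (c \<star> a)"
    using gadd_eq[OF gmul_in[OF assms(1,3)] gmul_in[OF assms(2,3)]] gdsum_mul[OF assms(1,3,2,3)] by simp
  finally show ?thesis .
qed

lemma gadd_Inl:
  assumes "f \<in> Mor A" "g \<in> Mor A" "src A f = X" "src A g = X" "tgt A f = Y" "tgt A g = Y" "X \<in> C" "Y \<in> C"
  shows "gadd (Inl f) (Inl g) = Inl (f \<boxplus> g)"
  using gadd_eq[of "Inl f" 0 X Y "Inl g"] gr_Inl assms addm_dsum[of f g] by simp

text \<open>Any two elements of \<open>Ext t X Y\<close> are push-outs of a common one, which reduces the laws of the
  Baer sum to those of the addition of morphisms.\<close>

lemma gr_common:
  assumes "a \<in> gr t X Y" "b \<in> gr t X Y'"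
  obtains w where "w \<in> gr t X (bsum Y Y')" "Inl (prj1 Y Y') \<star> w = a" "Inl (prj2 Y Y') \<star> w = b"
proof
  have C: "X \<in> C" "Y \<in> C" "Y' \<in> C"
    using gr_C assms by auto
  note d = diag_gr(1)[OF C(1)] and ab = gdsum_in[OF assms]
  show "gdsum a b \<star> Inl (diag X) \<in> gr t X (bsum Y Y')"
    using gmul_in[OF ab d] by simp
  show "Inl (prj1 Y Y') \<star> (gdsum a b \<star> Inl (diag X)) = a"
    "Inl (prj2 Y Y') \<star> (gdsum a b \<star> Inl (diag X)) = b"
    using gmul_assoc[OF prj_gr(1)[OF C(2,3)] ab d] gmul_assoc[OF prj_gr(2)[OF C(2,3)] ab d]
      gdsum_prj[OF assms] gmul_assoc[OF assms(1) prj_gr(1)[OF C(1,1)] d]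
      gmul_assoc[OF assms(2) prj_gr(2)[OF C(1,1)] d] gid_mul(2)[OF assms(1)] gid_mul(2)[OF assms(2)]
      diag_simps(7,8)[of X] C by (simp_all add: gid_def)
qed

lemma gadd_push:
  assumes "f \<in> Mor A" "g \<in> Mor A" "src A f = Y" "src A g = Y" "tgt A f = Z" "tgt A g = Z" "Z \<in> C"
    "w \<in> gr t X Y"
  shows "gadd (Inl f \<star> w) (Inl g \<star> w) = Inl (f \<boxplus> g) \<star> w"
  using gadd_mul_right[of "Inl f" 0 Y Z "Inl g" w t X] gadd_Inl[OF assms(1-6)] gr_Inl assms gr_C[OF assms(8)]
  by simp

lemma gadd_comm:
  assumes "a \<in> gr t X Y" "b \<in> gr t X Y"
  shows "gadd a b = gadd b a"
proof -
  have C: "Y \<in> C"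
    using gr_C assms by auto
  obtain w where w: "w \<in> gr t X (bsum Y Y)" "Inl (prj1 Y Y) \<star> w = a" "Inl (prj2 Y Y) \<star> w = b"
    using gr_common[OF assms] by blast
  have "gadd a b = Inl (prj1 Y Y \<boxplus> prj2 Y Y) \<star> w" "gadd b a = Inl (prj2 Y Y \<boxplus> prj1 Y Y) \<star> w"
    using gadd_push[OF _ _ _ _ _ _ C w(1), of "prj1 Y Y" "prj2 Y Y"]
      gadd_push[OF _ _ _ _ _ _ C w(1), of "prj2 Y Y" "prj1 Y Y"] w C by simp_all
  then show ?thesis
    using addm_comm[of "prj1 Y Y" "prj2 Y Y"] C by simp
qed

text \<open>All three elements are push-outs of one \<open>v\<close> ending in a threefold
  biproduct, along morphisms whose addition is associative.\<close>

lemma gadd_assoc: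
  assumes "a \<in> gr t X Y" "b \<in> gr t X Y" "c \<in> gr t X Y"
  shows "gadd (gadd a b) c = gadd a (gadd b c)"
proof -
  have C: "Y \<in> C"
    using gr_C assms by auto
  obtain w where w: "w \<in> gr t X (bsum Y Y)" "Inl (prj1 Y Y) \<star> w = b" "Inl (prj2 Y Y) \<star> w = c"
    using gr_common[OF assms(2,3)] by blast
  let ?Z = "bsum Y (bsum Y Y)" and ?f = "prj1 Y (bsum Y Y)"
  obtain v where v: "v \<in> gr t X ?Z" "Inl ?f \<star> v = a" "Inl (prj2 Y (bsum Y Y)) \<star> v = w"
    using gr_common[OF assms(1) w(1)] by blast
  let ?g = "prj1 Y Y \<cdot> prj2 Y (bsum Y Y)" and ?h = "prj2 Y Y \<cdot> prj2 Y (bsum Y Y)"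
  have g: "Inl ?g \<star> v = b" "Inl ?h \<star> v = c"
    using gmul_assoc[OF prj_gr(1)[OF C C] prj_gr(2)[OF C bsum_C[OF C C]] v(1)]
      gmul_assoc[OF prj_gr(2)[OF C C] prj_gr(2)[OF C bsum_C[OF C C]] v(1)] v w by simp_all
  have m: "?f \<in> Mor A" "src A ?f = ?Z" "tgt A ?f = Y" "?g \<in> Mor A" "src A ?g = ?Z" "tgt A ?g = Y"
     "?h \<in> Mor A" "src A ?h = ?Z" "tgt A ?h = Y"
    using C by simp_all
  have "gadd a b = Inl (?f \<boxplus> ?g) \<star> v" "gadd b c = Inl (?g \<boxplus> ?h) \<star> v"
    using gadd_push[OF m(1,4,2,5,3,6) C v(1)] gadd_push[OF m(4,7,5,8,6,9) C v(1)] g v(2) by simp_all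
  then have "gadd (gadd a b) c = Inl ((?f \<boxplus> ?g) \<boxplus> ?h) \<star> v" "gadd a (gadd b c) = Inl (?f \<boxplus> (?g \<boxplus> ?h)) \<star> v"
    using gadd_push[OF _ _ _ _ _ _ C v(1), of "?f \<boxplus> ?g" ?h] gadd_push[OF _ _ _ _ _ _ C v(1), of ?f "?g \<boxplus> ?h"]
      g v(2) m by simp_all
  then show ?thesis
    using addm_assoc[of ?f ?g ?h] m by simp
qed

lemma gzero_in:
  assumes "X \<in> C" "Y \<in> C"
  shows "gzero t X Y \<in> gr t X Y"
  using assms zero_extn_extns[of X Y t] by (auto simp: gzero_def intro!: gr_Inl gr_Inr)

lemma gzero_eq:
  assumes "a \<in> gr t X Y'" "Y \<in> C"
  shows "Inl (zrm A Y' Y) \<star> a = gzero t X Y"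
  using assms(1)
proof (cases rule: gr_cases)
  case (mor f)
  then show ?thesis
    using assms(2) by (simp add: gzero_def)
next
  case (ext E)
  show ?thesis
    using lmap_gmul(1)[OF lmap_zero[OF ext(3) assms(2)] ext(3) zero_extn_extns[OF ext(4) assms(2) ext(1)]] ext
    by (simp add: gzero_def)
qed

text \<open>Zero and the negative of \<open>a\<close> are the push-outs of \<open>a\<close> along
  \<open>0\<close> and \<open>-1\<close>.\<close>

lemma gadd_zero_neg:
  assumes "a \<in> gr t X Y"
  shows "gadd a (gzero t X Y) = a" "\<exists>b \<in> gr t X Y. gadd a b = gzero t X Y"
proof -
  have C: "X \<in> C" "Y \<in> C"
    using gr_C assms by auto
  have i: "Inl (idm A Y) \<star> a = a"
    using gid_mul(1)[OF assms] by (simp add: gid_def)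
  show "gadd a (gzero t X Y) = a"
    using gadd_push[OF _ _ _ _ _ _ C(2) assms, of "idm A Y" "zrm A Y Y"] gzero_eq[OF assms C(2)] i C by simp
  have "Inl (negm (idm A Y)) \<star> a \<in> gr (0 + t) X Y"
    by (rule gmul_in[OF gr_Inl assms]) (use C in auto)
  moreover have "gadd a (Inl (negm (idm A Y)) \<star> a) = gzero t X Y"
    using gadd_push[OF _ _ _ _ _ _ C(2) assms, of "idm A Y" "negm (idm A Y)"] gzero_eq[OF assms C(2)] i C by simp
  ultimately show "\<exists>b \<in> gr t X Y. gadd a b = gzero t X Y"
    by auto
qed

lemma graded_category_gr: "graded_category C gr gmul gadd gzero gid"
  by unfold_locales
    (auto intro: gmul_in gmul_assoc gid_in gid_mul gadd_in gadd_assoc gadd_comm gzero_in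
      gadd_zero_neg gadd_mul_left gadd_mul_right dest: gr_C)

lemma gadd_Inr:
  assumes "\<gamma> \<in> Ext t X Y" "\<eta> \<in> Ext t X Y"
  shows "gadd (Inr \<gamma>) (Inr \<eta>) = Inr (baer_sum t X Y \<gamma> \<eta>)"
proof -
  have C: "X \<in> C" "Y \<in> C" "t \<noteq> 0"
    using Ext_C[OF assms(1)] by auto
  have g: "Inr \<gamma> \<in> gr t X Y" "Inr \<eta> \<in> gr t X Y"
    using assms C by (auto simp: gr_def)
  note d = diag_gr(1)[OF C(1)] diag_gr(2)[OF C(2)]
  have ds: "ldsum \<gamma> \<eta> \<in> Ext t (bsum X X) (bsum Y Y)"
    using gdsum_in[OF g] C by (auto simp: gr_def)
  have "lpush (codiag Y) (ldsum \<gamma> \<eta>) \<in> Ext t (bsum X X) Y"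
    using gmul_in[OF d(2) gdsum_in[OF g]] C by (auto simp: gr_def)
  then have "baer_sum t X Y \<gamma> \<eta> = lpull (lpush (codiag Y) (ldsum \<gamma> \<eta>)) (diag X)"
    using dsum_class_ldsum[OF assms] push_eq_lpush[OF ds, of "codiag Y"]
      pull_eq_lpull[of "lpush (codiag Y) (ldsum \<gamma> \<eta>)" t "bsum X X" Y "diag X"] C
      diag_simps[of X] diag_simps[of Y] by (simp add: baer_sum_def)
  then show ?thesis
    using gadd_eq[OF g] gmul_assoc[OF d(2) gdsum_in[OF g] d(1)] by simp
qed

end

section \<open>Long exact sequences\<close>

text \<open>In \<open>conf B U K i p \<kappa>\<close> the arrow \<open>\<kappa>\<close> is the class of the conflation
  \<open>B \<rightarrow>\<^sup>i U \<rightarrow>\<^sup>p K\<close>. The assumption \<open>zigzag\<close> expresses that the Yoneda product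
  is a tensor product over the category: a vanishing product \<open>\<kappa> \<star> \<xi>\<close> is connected to one with a split
  conflation by moving morphisms across the product sign. All assumptions with the exception of
  \<open>decomp\<close> concern products \<open>\<kappa> \<star> \<xi>\<close> only; the dual statements are obtained by interpreting
  the locale in the opposite graded category.\<close>

locale graded_exact = graded_category +
  fixes conf :: "'a \<Rightarrow> 'a \<Rightarrow> 'a \<Rightarrow> 'b \<Rightarrow> 'b \<Rightarrow> 'b \<Rightarrow> bool"
  assumes conf_in: "conf B U K i p \<kappa> \<Longrightarrow> i \<in> G 0 B U \<and> p \<in> G 0 U K \<and> \<kappa> \<in> G 1 K B"
    and conf_zero: "conf B U K i p \<kappa> \<Longrightarrow> i \<star> \<kappa> = zer 1 K U \<and> \<kappa> \<star> p = zer 1 U B"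
    and exact0: "conf B U K i p \<kappa> \<Longrightarrow> h \<in> G 0 X K \<Longrightarrow> \<kappa> \<star> h = zer 1 X B \<Longrightarrow> \<exists>h' \<in> G 0 X U. h = p \<star> h'"
    and exact1: "conf B U K i p \<kappa> \<Longrightarrow> \<eta> \<in> G 1 X B \<Longrightarrow> i \<star> \<eta> = zer 1 X U \<Longrightarrow> \<exists>h \<in> G 0 X K. \<eta> = \<kappa> \<star> h"
    and exact2: "conf B U K i p \<kappa> \<Longrightarrow> \<xi> \<in> G 1 X U \<Longrightarrow> p \<star> \<xi> = zer 1 X K \<Longrightarrow> \<exists>\<eta> \<in> G 1 X B. \<xi> = i \<star> \<eta>"
    and conf_ex: "\<xi> \<in> G 1 K B \<Longrightarrow> \<exists>U i p. conf B U K i p \<xi>"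
    and decomp: "\<xi> \<in> G (Suc k) X B \<Longrightarrow> 1 \<le> k \<Longrightarrow> \<exists>K. \<exists>\<kappa> \<in> G 1 K B. \<exists>\<eta> \<in> G k X K. \<xi> = \<kappa> \<star> \<eta>"
    and mayer_vietoris: "conf B U K i p \<kappa> \<Longrightarrow> conf B U' K' i' p' \<kappa>' \<Longrightarrow> v \<in> G 0 U U' \<Longrightarrow> g \<in> G 0 K K' \<Longrightarrow>
      v \<star> i = i' \<Longrightarrow> p' \<star> v = g \<star> p \<Longrightarrow>
      \<exists>W m c \<mu> n1 n2 q1 q2. conf U W K' m c \<mu> \<and> n1 \<in> G 0 U' W \<and> n2 \<in> G 0 K W \<and>
        q1 \<in> G 0 W U' \<and> q2 \<in> G 0 W K \<and> q2 \<star> n1 = zer 0 U' K \<and> q2 \<star> n2 = unt K \<and>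
        q2 \<star> m = p \<and> c \<star> n1 = p' \<and> c \<star> n2 \<oplus> g = zer 0 K K'"
    and zigzag: "conf B U K i p \<kappa> \<Longrightarrow> \<xi> \<in> G k X K \<Longrightarrow> 1 \<le> k \<Longrightarrow> \<kappa> \<star> \<xi> = zer (Suc k) X B \<Longrightarrow>
      (\<And>U K i p \<kappa> \<xi> U' K' i' p' \<kappa>' v g. conf B U K i p \<kappa> \<Longrightarrow> conf B U' K' i' p' \<kappa>' \<Longrightarrow> \<xi> \<in> G k X K \<Longrightarrow>
        v \<in> G 0 U U' \<Longrightarrow> g \<in> G 0 K K' \<Longrightarrow> v \<star> i = i' \<Longrightarrow> p' \<star> v = g \<star> p \<Longrightarrow>
        \<Phi> U K p \<xi> \<longleftrightarrow> \<Phi> U' K' p' (g \<star> \<xi>)) \<Longrightarrow>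
      (\<And>U K i p \<kappa> \<xi> s. conf B U K i p \<kappa> \<Longrightarrow> s \<in> G 0 K U \<Longrightarrow> p \<star> s = unt K \<Longrightarrow> \<xi> \<in> G k X K \<Longrightarrow> \<Phi> U K p \<xi>) \<Longrightarrow>
      \<Phi> U K p \<xi>"
begin

text \<open>Exactness at \<open>U\<close> in degree \<open>k\<close> is passed on to exactness at
  \<open>K\<close>. The property followed along the zigzag is that \<open>\<xi>\<close> lifts
  through \<open>p\<close>; in a split conflation the section provides the lift.\<close>

lemma connecting_exact_step:
  assumes mid: "\<And>B U K i p \<kappa> X \<xi>. conf B U K i p \<kappa> \<Longrightarrow> \<xi> \<in> G k X U \<Longrightarrow> p \<star> \<xi> = zer k X K \<Longrightarrow>
      \<exists>\<eta> \<in> G k X B. \<xi> = i \<star> \<eta>"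
    and k: "1 \<le> k"
    and c: "conf B U K i p \<kappa>" and \<xi>: "\<xi> \<in> G k X K" and z: "\<kappa> \<star> \<xi> = zer (Suc k) X B"
  shows "\<exists>\<omega> \<in> G k X U. \<xi> = p \<star> \<omega>"
proof (rule zigzag[OF c \<xi> k z, where \<Phi> = "\<lambda>U K p \<xi>. \<exists>\<omega> \<in> G k X U. \<xi> = p \<star> \<omega>"])
  fix U K i p \<kappa> \<xi> s assume h: "conf B U K i p \<kappa>" "s \<in> G 0 K U" "p \<star> s = unt K" "\<xi> \<in> G k X K"
  have "\<xi> = p \<star> (s \<star> \<xi>)"
    using mul_assoc[of p 0 U K s 0 K \<xi> k X] conf_in[OF h(1)] h unt_left by simp
  then show "\<exists>\<omega> \<in> G k X U. \<xi> = p \<star> \<omega>"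
    using mul_in[OF h(2,4)] by auto
next
  fix U K i p \<kappa> \<xi> U' K' i' p' \<kappa>' v g
  assume c: "conf B U K i p \<kappa>" "conf B U' K' i' p' \<kappa>'" and m: "\<xi> \<in> G k X K" "v \<in> G 0 U U'" "g \<in> G 0 K K'"
    and e: "v \<star> i = i'" "p' \<star> v = g \<star> p"
  have p: "p \<in> G 0 U K" "p' \<in> G 0 U' K'"
    using conf_in c by auto
  show "(\<exists>\<omega> \<in> G k X U. \<xi> = p \<star> \<omega>) \<longleftrightarrow> (\<exists>\<omega> \<in> G k X U'. g \<star> \<xi> = p' \<star> \<omega>)"
  proof
    assume "\<exists>\<omega> \<in> G k X U. \<xi> = p \<star> \<omega>"
    then obtain \<omega> where \<omega>: "\<omega> \<in> G k X U" "\<xi> = p \<star> \<omega>"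
      by blast
    have "g \<star> \<xi> = p' \<star> (v \<star> \<omega>)"
      unfolding \<omega>(2) using mul_assoc[OF m(3) p(1) \<omega>(1)] mul_assoc[OF p(2) m(2) \<omega>(1)] e(2) by simp
    then show "\<exists>\<omega> \<in> G k X U'. g \<star> \<xi> = p' \<star> \<omega>"
      using mul_in[OF m(2) \<omega>(1)] by auto
  next
    assume "\<exists>\<omega> \<in> G k X U'. g \<star> \<xi> = p' \<star> \<omega>"
    then obtain \<psi> where \<psi>: "\<psi> \<in> G k X U'" "g \<star> \<xi> = p' \<star> \<psi>"
      by blast
    \<comment> \<open>For the direction against the map, a lift \<open>\<psi>\<close> of
      \<open>g \<star> \<xi>\<close> is combined with \<open>\<xi>\<close> into an element over the
      Mayer-Vietoris term between \<open>U\<close> and \<open>K'\<close>. Its image in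
      \<open>K'\<close> is \<open>p' \<star> \<psi> - g \<star> \<xi> = 0\<close>, so it comes from
      some \<open>\<rho>\<close> over \<open>U\<close>, and its second component shows that
      \<open>\<rho>\<close> lifts \<open>\<xi>\<close>.\<close>
    obtain W d l \<mu> n1 n2 q1 q2 where cW: "conf U W K' d l \<mu>" and n: "n1 \<in> G 0 U' W" "n2 \<in> G 0 K W"
        "q2 \<in> G 0 W K" and b: "q2 \<star> n1 = zer 0 U' K" "q2 \<star> n2 = unt K"
        and w: "q2 \<star> d = p" "l \<star> n1 = p'" "l \<star> n2 \<oplus> g = zer 0 K K'"
      using mayer_vietoris[OF c m(2,3) e] by blast
    have d: "d \<in> G 0 U W" "l \<in> G 0 W K'"
      using conf_in[OF cW] by auto
    define \<omega> where "\<omega> = n1 \<star> \<psi> \<oplus> n2 \<star> \<xi>"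
    have t: "n1 \<star> \<psi> \<in> G k X W" "n2 \<star> \<xi> \<in> G k X W" "l \<star> n2 \<in> G 0 K K'"
      using mul_in[OF n(1) \<psi>(1)] mul_in[OF n(2) m(1)] mul_in[OF d(2) n(2)] by auto
    then have \<omega>: "\<omega> \<in> G k X W"
      unfolding \<omega>_def by (intro add_in)
    have "l \<star> \<omega> = p' \<star> \<psi> \<oplus> (l \<star> n2) \<star> \<xi>"
      unfolding \<omega>_def using distrib_left[OF d(2) t(1,2)] mul_assoc[OF d(2) n(1) \<psi>(1)]
        mul_assoc[OF d(2) n(2) m(1)] w(2) by simp
    also have "\<dots> = (l \<star> n2 \<oplus> g) \<star> \<xi>"
      using \<psi>(2) distrib_right[OF t(3) m(3,1)] add_comm[of "g \<star> \<xi>" k X K' "(l \<star> n2) \<star> \<xi>"]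
        mul_in[OF m(3,1)] mul_in[OF t(3) m(1)] by simp
    also have "\<dots> = zer k X K'"
      using w(3) zer_mul[OF m(1), of K' 0] G_Ob[OF m(3)] by simp
    finally obtain \<rho> where \<rho>: "\<rho> \<in> G k X U" "\<omega> = d \<star> \<rho>"
      using mid[OF cW \<omega>] by blast
    have "q2 \<star> \<omega> = zer 0 U' K \<star> \<psi> \<oplus> \<xi>"
      unfolding \<omega>_def using distrib_left[OF n(3) t(1,2)] mul_assoc[OF n(3,1) \<psi>(1)] mul_assoc[OF n(3,2) m(1)]
        b unt_left[OF m(1)] by simp
    also have "\<dots> = \<xi>"
      using zer_mul[OF \<psi>(1), of K 0] G_Ob[OF m(1)] add_comm[OF zer_in m(1)] add_zer[OF m(1)] by simp
    finally have "\<xi> = p \<star> \<rho>"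
      using \<rho> mul_assoc[OF n(3) d(1) \<rho>(1)] w(1) by simp
    then show "\<exists>\<omega> \<in> G k X U. \<xi> = p \<star> \<omega>"
      using \<rho>(1) by blast
  qed
qed

text \<open>Induction on the degree, alternating with \<open>connecting_exact_step\<close>. For
  \<open>\<xi> = \<kappa>1 \<star> \<xi>1\<close> the vanishing of
  \<open>(p \<star> \<kappa>1) \<star> \<xi>1\<close> lifts \<open>\<xi>1\<close> through the
  deflation \<open>q\<close> of a conflation with class \<open>p \<star> \<kappa>1\<close>. What
  remains is the element \<open>\<kappa>1 \<star> q\<close> of degree one, to which
  \<open>exact2\<close> applies.\<close>

theorem middle_exact:
  assumes "conf B U K i p \<kappa>" "\<xi> \<in> G k X U" "p \<star> \<xi> = zer k X K" "1 \<le> k"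
  shows "\<exists>\<eta> \<in> G k X B. \<xi> = i \<star> \<eta>"
  using assms(4,1-3)
proof (induction k arbitrary: B U K i p \<kappa> \<xi> X rule: dec_induct)
  case base
  then show ?case
    using exact2 by blast
next
  case (step k)
  obtain K1 \<kappa>1 \<xi>1 where \<kappa>1: "\<kappa>1 \<in> G 1 K1 U" and \<xi>1: "\<xi>1 \<in> G k X K1" and \<xi>: "\<xi> = \<kappa>1 \<star> \<xi>1"
    using decomp[OF step.prems(2) step.hyps(1)] by blast
  have i: "i \<in> G 0 B U" "p \<in> G 0 U K"
    using conf_in[OF step.prems(1)] by auto
  have p\<kappa>: "p \<star> \<kappa>1 \<in> G 1 K1 K"
    using mul_in[OF i(2) \<kappa>1] by simp
  obtain V j q where c: "conf K V K1 j q (p \<star> \<kappa>1)"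
    using conf_ex[OF p\<kappa>] by blast
  have q: "q \<in> G 0 V K1"
    using conf_in[OF c] by auto
  have "(p \<star> \<kappa>1) \<star> \<xi>1 = zer (Suc k) X K"
    using step.prems(3) mul_assoc[OF i(2) \<kappa>1 \<xi>1] \<xi> by simp
  then obtain \<omega> where \<omega>: "\<omega> \<in> G k X V" "\<xi>1 = q \<star> \<omega>"
    using connecting_exact_step[of k, OF _ step.hyps(1) c \<xi>1] step.IH by blast
  have \<kappa>q: "\<kappa>1 \<star> q \<in> G 1 V U"
    using mul_in[OF \<kappa>1 q] by simp
  have "p \<star> (\<kappa>1 \<star> q) = zer 1 V K"
    using conf_zero[OF c] mul_assoc[OF i(2) \<kappa>1 q] by simp
  then obtain \<eta> where \<eta>: "\<eta> \<in> G 1 V B" "\<kappa>1 \<star> q = i \<star> \<eta>"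
    using exact2[OF step.prems(1) \<kappa>q] by blast
  have "\<xi> = i \<star> (\<eta> \<star> \<omega>)"
    using \<xi> \<omega>(2) mul_assoc[OF \<kappa>1 q \<omega>(1)] mul_assoc[OF i(1) \<eta>(1) \<omega>(1)] \<eta>(2) by simp
  then show ?case
    using mul_in[OF \<eta>(1) \<omega>(1)] by auto
qed

theorem connecting_exact:
  assumes "conf B U K i p \<kappa>" "\<xi> \<in> G k X K" "\<kappa> \<star> \<xi> = zer (Suc k) X B"
  shows "\<exists>\<omega> \<in> G k X U. \<xi> = p \<star> \<omega>"
proof (cases "k = 0")
  case True
  then show ?thesis
    using exact0[OF assms(1)] assms by simp
next
  case False
  then have k: "1 \<le> k"
    by simp
  show ?thesis
    by (rule connecting_exact_step[OF middle_exact k assms]) (use k in auto)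
qed

text \<open>The same reduction to degree one, with a conflation of class
  \<open>i \<star> \<kappa>1\<close> and with \<open>exact1\<close> applied to
  \<open>\<kappa>1 \<star> q\<close>.\<close>

theorem exact_connecting:
  assumes "conf B U K i p \<kappa>" "\<eta> \<in> G (Suc k) X B" "i \<star> \<eta> = zer (Suc k) X U"
  shows "\<exists>\<xi> \<in> G k X K. \<eta> = \<kappa> \<star> \<xi>"
proof (cases "k = 0")
  case True
  then show ?thesis
    using exact1[OF assms(1)] assms by simp
next
  case False
  then obtain K1 \<kappa>1 \<eta>1 where \<kappa>1: "\<kappa>1 \<in> G 1 K1 B" and \<eta>1: "\<eta>1 \<in> G k X K1" and \<eta>: "\<eta> = \<kappa>1 \<star> \<eta>1"
    using decomp[OF assms(2)] by auto
  have i: "i \<in> G 0 B U" "\<kappa> \<in> G 1 K B"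
    using conf_in[OF assms(1)] by auto
  have i\<kappa>: "i \<star> \<kappa>1 \<in> G 1 K1 U"
    using mul_in[OF i(1) \<kappa>1] by simp
  obtain V j q where c: "conf U V K1 j q (i \<star> \<kappa>1)"
    using conf_ex[OF i\<kappa>] by blast
  have q: "q \<in> G 0 V K1"
    using conf_in[OF c] by auto
  have "(i \<star> \<kappa>1) \<star> \<eta>1 = zer (Suc k) X U"
    using assms(3) mul_assoc[OF i(1) \<kappa>1 \<eta>1] \<eta> by simp
  then obtain \<omega> where \<omega>: "\<omega> \<in> G k X V" "\<eta>1 = q \<star> \<omega>"
    using connecting_exact[OF c \<eta>1] by blast
  have \<kappa>q: "\<kappa>1 \<star> q \<in> G 1 V B"
    using mul_in[OF \<kappa>1 q] by simp
  have "i \<star> (\<kappa>1 \<star> q) = zer 1 V U"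
    using conf_zero[OF c] mul_assoc[OF i(1) \<kappa>1 q] by simp
  then obtain h where h: "h \<in> G 0 V K" "\<kappa>1 \<star> q = \<kappa> \<star> h"
    using exact1[OF assms(1) \<kappa>q] by blast
  have "\<eta> = \<kappa> \<star> (h \<star> \<omega>)"
    using \<eta> \<omega>(2) mul_assoc[OF \<kappa>1 q \<omega>(1)] mul_assoc[OF i(2) h(1) \<omega>(1)] h(2) by simp
  then show ?thesis
    using mul_in[OF h(1) \<omega>(1)] by auto
qed

end

section \<open>Conflations satisfy the exactness axioms in both variables\<close>

context extension_closed_subcategory
begin

lemma splits_push_colift:
  assumes "cmap h (idm A X) (i, p) f" "splits f" "X \<in> Obj A"
  obtains k where "k \<in> Mor A" "tgt A k = tgt A h" "src A k = tgt A i" "k \<cdot> i = h"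
proof -
  have f: "confl f" "confl (i, p)"
    using cmap_ends[OF assms(1)] by auto
  show ?thesis
  proof (rule extension_closed_subcategory.splits_pull_lift[OF extension_closed_op, of X h "prod.swap f" p i])
    fix k assume "k \<in> Mor (op_cat A)" "src (op_cat A) k = src (op_cat A) h"
      "tgt (op_cat A) k = tgt (op_cat A) p" "cmp (op_cat A) i k = h"
    then show ?thesis
      using that[of k] confl_ends[OF f(2)] by simp
  qed (use assms f in auto)
qed

lemma splits_pull_map:
  assumes "cmap (idm A Y) q f e" "splits f" "conflation j q" "Y \<in> Obj A"
  obtains h where "cmap h (idm A (rgt e)) (j, q) e"
proof -
  have f: "confl f" "confl e"
    using cmap_ends[OF assms(1)] by auto
  show ?thesis
    by (rule extension_closed_subcategory.splits_push_map[OF extension_closed_op, of q Y "prod.swap e" "prod.swap f" j])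
      (use assms f that in auto)
qed

lemma splits_pull_colift:
  assumes "conflation i p" "cmap (idm A Y) i f e" "splits f" "Y \<in> Obj A"
  obtains k where "cmap (idm A Y) p e k"
proof -
  have f: "confl f" "confl e"
    using cmap_ends[OF assms(2)] by auto
  show ?thesis
  proof (rule extension_closed_subcategory.splits_push_lift[OF extension_closed_op, of p i Y "prod.swap e" "prod.swap f"])
    fix k assume "extension_closed_subcategory.cmap (op_cat A) C p (idm (op_cat A) Y) k (prod.swap e)"
    then show ?thesis
      using that[of "prod.swap k"] by simp
  qed (use assms f in auto)
qed

text \<open>A morphism of conflations that is the identity on the left end has a bicartesian
  right-hand square. Written with the biproduct, this square is a conflation with components
  \<open>(v, p)\<close> and \<open>(p', -g)\<close>.\<close>

lemma ex_pullback_biproduct: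
  assumes c: "conflation i p" "conflation i' p'"
    and m: "v \<in> Mor A" "src A v = tgt A i" "tgt A v = tgt A i'" "g \<in> Mor A" "src A g = tgt A p" "tgt A g = tgt A p'"
    and e: "v \<cdot> i = i'" "p' \<cdot> v = g \<cdot> p"
  obtains W a b a' b' m c where "is_biproduct (tgt A i') (tgt A p) W a b a' b'" "conflation m c"
    "src A m = tgt A i" "tgt A m = W" "tgt A c = tgt A p'" "a' \<cdot> m = v" "b' \<cdot> m = p"
    "c \<cdot> a = p'" "c \<cdot> b = negm g"
proof -
  note [simp] = conflation_simps(2-4)[OF c(1)] conflation_simps(2-4)[OF c(2)] m
  obtain S a b a' b' l d q where bp: "is_biproduct (tgt A i') (tgt A p) S a b a' b'"
    and l: "l = p' \<cdot> a' \<boxplus> negm g \<cdot> b'" "short_exact d l"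
    and pb: "is_pullback p' g (a' \<cdot> d) (b' \<cdot> d)"
    and q: "short_exact q (b' \<cdot> d)" "(a' \<cdot> d) \<cdot> q = i'" "src A q = src A i'"
    using ex_pullback[OF conflation_simps(1)[OF c(2)] m(4,6)] by (simp, metis)
  note [simp] = is_biproduct_simps[OF bp]
  have ld [simp]: "l \<in> Mor A" "d \<in> Mor A" "src A l = S" "tgt A l = tgt A p'" "tgt A d = S"
    using short_exact_simps[OF l(2)] by (simp_all add: l(1))
  have la: "l \<cdot> a = p'" "l \<cdot> b = negm g"
    by (simp_all add: l(1) cmp_addm)
  have q' [simp]: "q \<in> Mor A" "tgt A q = src A d"
    using short_exact_simps[OF q(1)] by simp_all
  obtain t where t [simp]: "t \<in> Mor A" "tgt A t = src A d" "src A t = tgt A i"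
    and te: "(a' \<cdot> d) \<cdot> t = v" "(b' \<cdot> d) \<cdot> t = p"
    using pullback_lift[OF pb, of v p] e by auto
  have "t \<cdot> i = q"
  proof (rule pullback_unique[OF pb])
    have "src A i = src A i'"
      using e(1) by auto
    then show "(a' \<cdot> d) \<cdot> (t \<cdot> i) = (a' \<cdot> d) \<cdot> q" "(b' \<cdot> d) \<cdot> (t \<cdot> i) = (b' \<cdot> d) \<cdot> q"
      "src A (t \<cdot> i) = src A q"
      using cmp_reassoc[OF te(1), of i] cmp_reassoc[OF te(2), of i] q(2,3) e(1) short_exact_simps(4)[OF q(1)]
        conflation_simps(5)[OF c(1)] by simp_all
  qed simp_all
  \<comment> \<open>The middle term of the first conflation and the pull-back of \<open>p'\<close>
    along \<open>g\<close> are extensions with the same ends, so the comparison \<open>t\<close> is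
    invertible. Replacing the kernel \<open>d\<close> by \<open>d t\<close> makes
    \<open>tgt A i\<close> itself the source of the new conflation.\<close>
  then obtain s where s: "s \<in> Mor A" "src A s = src A d" "tgt A s = tgt A i" "t \<cdot> s = idm A (src A d)"
    "s \<cdot> t = idm A (tgt A i)"
    using short_five[OF conflation_simps(1)[OF c(1)] q(1), of t] te(2) by auto
  have "monic (s \<cdot> t)"
    unfolding s(5) by (rule monicI) simp_all
  then have "monic t"
    by (rule monic_factor) (use s in simp_all)
  then have mon: "monic (d \<cdot> t)"
    using short_exact_simps(5)[OF l(2)] by (rule monic_cmp) simp
  have ker: "is_kernel (d \<cdot> t) l"
  proof (rule is_kernelI[OF _ mon])
    show "l \<cdot> (d \<cdot> t) = zrm A (src A (d \<cdot> t)) (tgt A l)"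
      using cmp_reassoc[OF short_exact_simps(4)[OF l(2)], of t] by simp
    fix x assume x: "x \<in> Mor A" "tgt A x = src A l" "l \<cdot> x = zrm A (src A x) (tgt A l)"
    obtain y where y: "y \<in> Mor A" "src A y = src A x" "tgt A y = src A d" "d \<cdot> y = x"
      using short_exact_lift[OF l(2), of x] x by auto
    have "t \<cdot> (s \<cdot> y) = y"
      using cmp_reassoc[OF s(4), of y] s(1-3) y by simp
    then have "(d \<cdot> t) \<cdot> (s \<cdot> y) = x"
      using y s by simp
    then show "\<exists>h\<in>Mor A. src A h = src A x \<and> tgt A h = src A (d \<cdot> t) \<and> (d \<cdot> t) \<cdot> h = x"
      using y s by (intro bexI[of _ "s \<cdot> y"]) simp_all
  qed simp_all
  have "conflation (d \<cdot> t) l"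
    by (rule conflationI[OF epic_kernel_short_exact[OF short_exact_simps(6)[OF l(2)] ker]])
      (use conflation_simps(6-)[OF c(1)] conflation_simps(6-)[OF c(2)] in simp_all)
  then show ?thesis
    using that[OF bp, of "d \<cdot> t" l] la te by simp
qed

lemma ex_pushout_biproduct:
  assumes c: "conflation p i" "conflation p' i'"
    and m: "v \<in> Mor A" "tgt A v = tgt A p" "src A v = tgt A p'" "g \<in> Mor A" "tgt A g = src A p" "src A g = src A p'"
    and e: "i \<cdot> v = i'" "v \<cdot> p' = p \<cdot> g"
  obtains W a b a' b' m c where "is_biproduct (tgt A p') (src A p) W a b a' b'" "conflation c m"
    "tgt A m = tgt A p" "src A m = W" "src A c = src A p'" "m \<cdot> a = v" "m \<cdot> b = p"
    "a' \<cdot> c = p'" "b' \<cdot> c = negm g"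
proof -
  note [simp] = conflation_simps(2-4)[OF c(1)] conflation_simps(2-4)[OF c(2)] m
  show ?thesis
  proof (rule extension_closed_subcategory.ex_pullback_biproduct[OF extension_closed_op, of i p i' p' v g])
    fix W a b a' b' m c
    assume h: "preadditive_category.is_biproduct (op_cat A) (tgt (op_cat A) i') (tgt (op_cat A) p) W a b a' b'"
      "extension_closed_subcategory.conflation (op_cat A) C m c"
      "src (op_cat A) m = tgt (op_cat A) i" "tgt (op_cat A) m = W" "tgt (op_cat A) c = tgt (op_cat A) p'"
      "cmp (op_cat A) a' m = v" "cmp (op_cat A) b' m = p" "cmp (op_cat A) c a = p'"
      "cmp (op_cat A) c b = preadditive_category.negm (op_cat A) g"
    show ?thesis
      using that[of W a' b' a b c m] h by simp
  qed (use c e in simp_all)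
qed

text \<open>Splitting is respected by maps with identity ends and so depends on the class alone.
  Conversely, a retraction together with the deflation gives the map to the chosen split
  conflation.\<close>

lemma splits_zero:
  assumes "confl e"
  shows "Inr (cls [e]) = gzero 1 (rgt e) (lft e) \<longleftrightarrow> splits e"
proof -
  obtain i p where e [simp]: "e = (i, p)"
    by (cases e)
  have c: "conflation i p"
    using assms by (simp add: confl_def)
  note [simp] = conflation_simps[OF c]
  let ?z = "(inj1 (src A i) (tgt A p), prj2 (src A i) (tgt A p))"
  have z: "zero_extn 1 (tgt A p) (src A i) = [?z]"
    by (simp add: zero_extn_def)
  have cz: "conflation (fst ?z) (snd ?z)"
    using biproduct_C(1)[OF bip_biproduct[of "src A i" "tgt A p"]] by simp
  have ext: "[e] \<in> extns 1 (tgt A p) (src A i)" "[?z] \<in> extns 1 (tgt A p) (src A i)"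
    using c cz by (auto simp: extns_iff confl_def)
  have "splits ?z"
    unfolding splits_def by (intro bexI[of _ "prj1 (src A i) (tgt A p)"]) simp_all
  moreover have "splits e = splits ?z" if "cls [e] = cls [?z]"
  proof -
    have "splits (hd [e]) = splits (hd [?z])"
    proof (rule cls_invariant[OF _ ext that, of "\<lambda>E. splits (hd E)"])
      fix E F assume h: "E \<in> extns 1 (tgt A p) (src A i)" "F \<in> extns 1 (tgt A p) (src A i)"
        "lmap (idm A (src A i)) (idm A (tgt A p)) E F"
      then obtain e' f' where "E = [e']" "F = [f']"
        by (auto simp: extns_iff length_Suc_conv)
      then show "splits (hd E) = splits (hd F)"
        using h(3) splits_cmap[of "src A i" "tgt A p" e' f'] by auto
    qed
    then show ?thesis
      by simp
  qed
  moreover have "cls [e] = cls [?z]" if "splits e"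
  proof (rule cls_eqI[OF _ ext])
    obtain r where r [simp]: "r \<in> Mor A" "src A r = tgt A i" and ri: "r \<cdot> i = idm A (src A i)"
      using \<open>splits e\<close> by (auto simp: splits_def)
    have [simp]: "tgt A r = src A i"
      using ri cmp_simps(3)[of i r] by simp
    have "cmap (idm A (src A i)) (idm A (tgt A p)) (i, p) (fst ?z, snd ?z)"
      by (rule cmapI[OF c cz, of _ "inj1 (src A i) (tgt A p) \<cdot> r \<boxplus> inj2 (src A i) (tgt A p) \<cdot> p"])
        (simp_all add: cmp_addm ri)
    then show "lmap (idm A (src A i)) (idm A (tgt A p)) [e] [?z]"
      by simp
  qed
  ultimately show ?thesis
    using z by (auto simp: gzero_def)
qed

definition gconf :: "'a \<Rightarrow> 'a \<Rightarrow> 'a \<Rightarrow> 'b + 'b extn set \<Rightarrow> 'b + 'b extn set \<Rightarrow> 'b + 'b extn set \<Rightarrow> bool" where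
  "gconf B U K a b c \<longleftrightarrow> (\<exists>i p. conflation i p \<and> src A i = B \<and> tgt A i = U \<and> tgt A p = K \<and>
     a = Inl i \<and> b = Inl p \<and> c = Inr (cls [(i, p)]))"

lemma gconfE:
  assumes "gconf B U K a b c"
  obtains i p where "conflation i p" "src A i = B" "tgt A i = U" "tgt A p = K" "src A p = U"
    "i \<in> Mor A" "p \<in> Mor A" "B \<in> C" "U \<in> C" "K \<in> C"
    "a = Inl i" "b = Inl p" "c = Inr (cls [(i, p)])" "[(i, p)] \<in> extns 1 K B"
  using assms conflation_simps unfolding gconf_def by (elim exE conjE) (auto simp: extns_iff confl_def)

lemma gconf_in:
  assumes "gconf B U K i p \<kappa>"
  shows "i \<in> gr 0 B U \<and> p \<in> gr 0 U K \<and> \<kappa> \<in> gr 1 K B"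
  using assms by (elim gconfE) (auto intro!: gr_Inl gr_Inr)

lemma extns_single:
  assumes "F \<in> extns 1 X Y"
  obtains f where "F = [f]" "confl f" "lft f = Y" "rgt f = X"
  using assms by (auto simp: extns_iff length_Suc_conv)

lemma gr_single:
  assumes "a \<in> gr 1 X Y"
  obtains e where "confl e" "lft e = Y" "rgt e = X" "a = Inr (cls [e])" "[e] \<in> extns 1 X Y"
  using assms
proof (cases rule: gr_cases)
  case (ext E)
  then show ?thesis
    using that extns_single[OF ext(3)] by metis
qed simp

lemma single_extns: "confl e \<Longrightarrow> [e] \<in> extns 1 (rgt e) (lft e)"
  by (auto simp: extns_iff)

lemma gr0:
  assumes "a \<in> gr 0 X Y"
  obtains f where "a = Inl f" "f \<in> Mor A" "src A f = X" "tgt A f = Y" "X \<in> C" "Y \<in> C"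
  using assms by (cases rule: gr_cases) (auto dest: extns_C)

lemma single_push:
  assumes "confl e" "g \<in> Mor A" "src A g = lft e" "tgt A g \<in> C"
  obtains f where "confl f" "lft f = tgt A g" "rgt f = rgt e" "cmap g (idm A (rgt e)) e f"
    "Inl g \<star> Inr (cls [e]) = Inr (cls [f])"
proof -
  obtain F where F: "F \<in> extns 1 (rgt e) (tgt A g)" "lmap g (idm A (rgt e)) [e] F"
    "Inl g \<star> Inr (cls [e]) = Inr (cls F)"
    using gr_push_cases[OF assms(2,3) refl assms(4) single_extns[OF assms(1)]] by blast
  obtain f where "F = [f]" "confl f" "lft f = tgt A g" "rgt f = rgt e"
    using extns_single[OF F(1)] by blast
  then show ?thesis
    using that F(2,3) by auto
qed

lemma single_pull:
  assumes "confl e" "h \<in> Mor A" "tgt A h = rgt e" "src A h \<in> C"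
  obtains f where "confl f" "lft f = lft e" "rgt f = src A h" "cmap (idm A (lft e)) h f e"
    "Inr (cls [e]) \<star> Inl h = Inr (cls [f])"
proof -
  obtain F where F: "F \<in> extns 1 (src A h) (lft e)" "lmap (idm A (lft e)) h F [e]"
    "Inr (cls [e]) \<star> Inl h = Inr (cls F)"
    using gr_pull_cases[OF assms(2) refl assms(3,4) single_extns[OF assms(1)]] by blast
  obtain f where "F = [f]" "confl f" "lft f = lft e" "rgt f = src A h"
    using extns_single[OF F(1)] by blast
  then show ?thesis
    using that F(2,3) by auto
qed

lemma cmap_gmul:
  assumes "cmap g h e f"
  shows "Inl g \<star> Inr (cls [e]) = Inr (cls [f]) \<star> Inl h"
  using lmap_cls[of g h "[e]" "[f]", OF _ single_extns single_extns] cmap_ends[OF assms] assms by simp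

lemma cmap_gmul_push:
  assumes "cmap g (idm A X) e f" "X \<in> Obj A"
  shows "Inl g \<star> Inr (cls [e]) = Inr (cls [f])"
  using lmap_gmul(1)[of g X "[e]" "[f]" 1 "lft e" "lft f"] single_extns[of e] single_extns[of f]
    cmap_ends[OF assms(1)] assms by simp

lemma cmap_gmul_pull:
  assumes "cmap (idm A Y) h e f" "Y \<in> Obj A"
  shows "Inr (cls [f]) \<star> Inl h = Inr (cls [e])"
  using lmap_gmul(2)[of Y h "[e]" "[f]" 1 "rgt f" "rgt e"] single_extns[of e] single_extns[of f]
    cmap_ends[OF assms(1)] assms by simp

lemma zero_object_conflation:
  assumes "X \<in> C"
  shows "conflation (zrm A zobj X) (idm A X)" "conflation (idm A X) (zrm A X zobj)"
proof -
  have X: "X \<in> Obj A"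
    using assms by simp
  show "conflation (zrm A zobj X) (idm A X)"
    by (rule conflationI[OF zero_object_short_exact(2)[OF zobj_zero zobj_zero X]]) (use assms in auto)
  have "short_exact (idm A X) (zrm A X zobj)"
    using extension_closed_subcategory.zero_object_short_exact(2)[OF extension_closed_op, of zobj zobj X]
      zobj_zero X by simp
  then show "conflation (idm A X) (zrm A X zobj)"
    by (rule conflationI) (use assms in auto)
qed

text \<open>The conflation maps to \<open>U -> U -> 0\<close> with left component \<open>i\<close>
  and receives a map from \<open>0 -> U -> U\<close> with right component \<open>p\<close>; both
  products therefore pass through a zero morphism.\<close>

lemma gconf_zero:
  assumes "gconf B U K i p \<kappa>"
  shows "i \<star> \<kappa> = gzero 1 K U" "\<kappa> \<star> p = gzero 1 U B"
proof -
  interpret graded_category C gr gmul gadd gzero gid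
    by (rule graded_category_gr)
  from assms obtain j q where c: "conflation j q" "src A j = B" "tgt A j = U" "tgt A q = K" "src A q = U"
    and m: "j \<in> Mor A" "q \<in> Mor A" and C: "B \<in> C" "U \<in> C" "K \<in> C"
    and e: "i = Inl j" "p = Inl q" "\<kappa> = Inr (cls [(j, q)])"
    by (rule gconfE)
  note z = zero_object_conflation[OF C(2)]
  have "cmap j (zrm A K zobj) (j, q) (idm A U, zrm A U zobj)"
    by (rule cmapI[OF c(1) z(2), of _ "idm A U"]) (use c m C in simp_all)
  then have "i \<star> \<kappa> = Inr (cls [(idm A U, zrm A U zobj)]) \<star> gzero 0 K zobj"
    using cmap_gmul e by (simp add: gzero_def)
  also have "\<dots> = gzero 1 K U"
    using mul_zer[of _ 1 zobj U K 0] gr_Inr[OF single_extns[of "(idm A U, zrm A U zobj)"]] z(2) C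
    by (simp add: confl_def)
  finally show "i \<star> \<kappa> = gzero 1 K U" .
  have "cmap (zrm A zobj B) q (zrm A zobj U, idm A U) (j, q)"
    by (rule cmapI[OF z(1) c(1), of _ "idm A U"]) (use c m C in simp_all)
  then have "\<kappa> \<star> p = gzero 0 zobj B \<star> Inr (cls [(zrm A zobj U, idm A U)])"
    using cmap_gmul e by (simp add: gzero_def)
  also have "\<dots> = gzero 1 U B"
    using zer_mul[of _ 1 U zobj B 0] gr_Inr[OF single_extns[of "(zrm A zobj U, idm A U)"]] z(1) C
    by (simp add: confl_def)
  finally show "\<kappa> \<star> p = gzero 1 U B" .
qed

text \<open>Exactness at Hom and at Ext^1, three parts in each variable. A vanishing product becomes
  a split conflation by \<open>splits_zero\<close>, and the matching lemma on split conflations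
  produces the factorization.\<close>

lemma gconf_exact:
  assumes "gconf B U K i p \<kappa>"
  shows "h \<in> gr 0 X K \<Longrightarrow> \<kappa> \<star> h = gzero 1 X B \<Longrightarrow> \<exists>h' \<in> gr 0 X U. h = p \<star> h'"
    and "\<eta> \<in> gr 1 X B \<Longrightarrow> i \<star> \<eta> = gzero 1 X U \<Longrightarrow> \<exists>h \<in> gr 0 X K. \<eta> = \<kappa> \<star> h"
    and "\<xi> \<in> gr 1 X U \<Longrightarrow> p \<star> \<xi> = gzero 1 X K \<Longrightarrow> \<exists>\<eta> \<in> gr 1 X B. \<xi> = i \<star> \<eta>"
    and "h \<in> gr 0 B Y \<Longrightarrow> h \<star> \<kappa> = gzero 1 K Y \<Longrightarrow> \<exists>h' \<in> gr 0 U Y. h = h' \<star> i"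
    and "\<eta> \<in> gr 1 K Y \<Longrightarrow> \<eta> \<star> p = gzero 1 U Y \<Longrightarrow> \<exists>h \<in> gr 0 B Y. \<eta> = h \<star> \<kappa>"
    and "\<xi> \<in> gr 1 U Y \<Longrightarrow> \<xi> \<star> i = gzero 1 B Y \<Longrightarrow> \<exists>\<eta> \<in> gr 1 K Y. \<xi> = \<eta> \<star> p"
proof -
  from assms obtain j q where c: "conflation j q" "src A j = B" "tgt A j = U" "tgt A q = K" "src A q = U"
    and m: "j \<in> Mor A" "q \<in> Mor A" and C: "B \<in> C" "U \<in> C" "K \<in> C"
    and e: "i = Inl j" "p = Inl q" "\<kappa> = Inr (cls [(j, q)])"
    by (rule gconfE)
  have cjq: "confl (j, q)"
    using c by (simp add: confl_def)
  show "\<exists>h' \<in> gr 0 X U. h = p \<star> h'" if h: "h \<in> gr 0 X K" "\<kappa> \<star> h = gzero 1 X B"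
  proof -
    obtain f where f: "h = Inl f" "f \<in> Mor A" "src A f = X" "tgt A f = K" "X \<in> C"
      using gr0[OF h(1)] by metis
    obtain k where k: "confl k" "lft k = B" "rgt k = X" "cmap (idm A B) f k (j, q)"
        "Inr (cls [(j, q)]) \<star> Inl f = Inr (cls [k])"
      by (rule single_pull[OF cjq f(2)]) (use f c in auto)
    have "splits k"
      using splits_zero[OF k(1)] k h(2) e f by simp
    then obtain l where "l \<in> Mor A" "src A l = src A f" "tgt A l = tgt A j" "q \<cdot> l = f"
      using splits_pull_lift[OF k(4)] C by auto
    then show ?thesis
      using f e c C by (intro bexI[of _ "Inl l"]) (auto intro: gr_Inl)
  qed
  show "\<exists>h \<in> gr 0 X K. \<eta> = \<kappa> \<star> h" if h: "\<eta> \<in> gr 1 X B" "i \<star> \<eta> = gzero 1 X U"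
  proof -
    obtain f where f: "confl f" "lft f = B" "rgt f = X" "\<eta> = Inr (cls [f])" "X \<in> C"
      using gr_single[OF h(1)] gr_C[OF h(1)] by metis
    obtain k where k: "confl k" "lft k = U" "rgt k = X" "cmap j (idm A X) f k"
        "Inl j \<star> Inr (cls [f]) = Inr (cls [k])"
      by (rule single_push[OF f(1) m(1)]) (use f c C in auto)
    have "splits k"
      using splits_zero[OF k(1)] k h(2) e f by simp
    then obtain l where l: "cmap (idm A B) l f (j, q)"
      using splits_push_map[OF k(4) _ c(1)] f C by auto
    show ?thesis
      using cmap_gmul_pull[OF l] cmap_ends(6-8)[OF l] f e c C
      by (intro bexI[of _ "Inl l"]) (auto intro: gr_Inl)
  qed
  show "\<exists>\<eta> \<in> gr 1 X B. \<xi> = i \<star> \<eta>" if h: "\<xi> \<in> gr 1 X U" "p \<star> \<xi> = gzero 1 X K"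
  proof -
    obtain f where f: "confl f" "lft f = U" "rgt f = X" "\<xi> = Inr (cls [f])" "X \<in> C"
      using gr_single[OF h(1)] gr_C[OF h(1)] by metis
    obtain k where k: "confl k" "lft k = K" "rgt k = X" "cmap q (idm A X) f k"
        "Inl q \<star> Inr (cls [f]) = Inr (cls [k])"
      by (rule single_push[OF f(1) m(2)]) (use f c C in auto)
    have "splits k"
      using splits_zero[OF k(1)] k h(2) e f by simp
    then obtain l where l: "cmap j (idm A X) l f"
      using splits_push_lift[OF c(1) k(4)] f by auto
    have "[l] \<in> extns 1 X B"
      using single_extns[OF cmap_ends(1)[OF l]] cmap_ends(4,7)[OF l] c f by simp
    then show ?thesis
      using cmap_gmul_push[OF l] f e by (intro bexI[of _ "Inr (cls [l])"]) (auto intro: gr_Inr)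
  qed
  show "\<exists>h' \<in> gr 0 U Y. h = h' \<star> i" if h: "h \<in> gr 0 B Y" "h \<star> \<kappa> = gzero 1 K Y"
  proof -
    obtain f where f: "h = Inl f" "f \<in> Mor A" "src A f = B" "tgt A f = Y" "Y \<in> C"
      using gr0[OF h(1)] by metis
    obtain k where k: "confl k" "lft k = Y" "rgt k = K" "cmap f (idm A K) (j, q) k"
        "Inl f \<star> Inr (cls [(j, q)]) = Inr (cls [k])"
      by (rule single_push[OF cjq f(2)]) (use f c in auto)
    have "splits k"
      using splits_zero[OF k(1)] k h(2) e f by simp
    then obtain l where "l \<in> Mor A" "tgt A l = tgt A f" "src A l = tgt A j" "l \<cdot> j = f"
      using splits_push_colift[OF k(4)] C by auto
    then show ?thesis
      using f e c C by (intro bexI[of _ "Inl l"]) (auto intro: gr_Inl)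
  qed
  show "\<exists>h \<in> gr 0 B Y. \<eta> = h \<star> \<kappa>" if h: "\<eta> \<in> gr 1 K Y" "\<eta> \<star> p = gzero 1 U Y"
  proof -
    obtain f where f: "confl f" "lft f = Y" "rgt f = K" "\<eta> = Inr (cls [f])" "Y \<in> C"
      using gr_single[OF h(1)] gr_C[OF h(1)] by metis
    obtain k where k: "confl k" "lft k = Y" "rgt k = U" "cmap (idm A Y) q k f"
        "Inr (cls [f]) \<star> Inl q = Inr (cls [k])"
      by (rule single_pull[OF f(1) m(2)]) (use f c C in auto)
    have "splits k"
      using splits_zero[OF k(1)] k h(2) e f by simp
    then obtain l where l: "cmap l (idm A K) (j, q) f"
      using splits_pull_map[OF k(4) _ c(1)] f C by auto
    show ?thesis
      using cmap_gmul_push[OF l] cmap_ends(3-5)[OF l] f e c C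
      by (intro bexI[of _ "Inl l"]) (auto intro: gr_Inl)
  qed
  show "\<exists>\<eta> \<in> gr 1 K Y. \<xi> = \<eta> \<star> p" if h: "\<xi> \<in> gr 1 U Y" "\<xi> \<star> i = gzero 1 B Y"
  proof -
    obtain f where f: "confl f" "lft f = Y" "rgt f = U" "\<xi> = Inr (cls [f])" "Y \<in> C"
      using gr_single[OF h(1)] gr_C[OF h(1)] by metis
    obtain k where k: "confl k" "lft k = Y" "rgt k = B" "cmap (idm A Y) j k f"
        "Inr (cls [f]) \<star> Inl j = Inr (cls [k])"
      by (rule single_pull[OF f(1) m(1)]) (use f c C in auto)
    have "splits k"
      using splits_zero[OF k(1)] k h(2) e f by simp
    then obtain l where l: "cmap (idm A Y) q f l"
      using splits_pull_colift[OF c(1) k(4)] f by auto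
    have "[l] \<in> extns 1 K Y"
      using single_extns[OF cmap_ends(2)[OF l]] cmap_ends(5,8)[OF l] c f by simp
    then show ?thesis
      using cmap_gmul_pull[OF l] f e by (intro bexI[of _ "Inr (cls [l])"]) (auto intro: gr_Inr)
  qed
qed

lemma gconf_single:
  assumes "confl e"
  shows "gconf (lft e) (tgt A (fst e)) (rgt e) (Inl (fst e)) (Inl (snd e)) (Inr (cls [e]))"
  unfolding gconf_def by (rule exI[of _ "fst e"], rule exI[of _ "snd e"]) (use assms in \<open>simp add: confl_def\<close>)

lemma gconf_ex:
  assumes "\<xi> \<in> gr 1 K B"
  shows "\<exists>U i p. gconf B U K i p \<xi>"
  using gr_single[OF assms] gconf_single by metis

lemma extns_Suc:
  assumes "E \<in> extns (Suc k) X B" "1 \<le> k"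
  obtains e F where "E = e # F" "F \<in> extns k X (rgt e)" "[e] \<in> extns 1 (rgt e) B"
proof -
  obtain e F where e: "E = e # F"
    using assms(1) by (cases E) (auto simp: extns_iff)
  then have "F \<noteq> []"
    using assms by (auto simp: extns_iff)
  then show ?thesis
    using that[OF e] assms(1) e by (auto simp: extns_iff)
qed

lemma extns_Suc_snoc:
  assumes "E \<in> extns (Suc k) X B" "1 \<le> k"
  obtains f F where "E = F @ [f]" "F \<in> extns k (lft f) B" "[f] \<in> extns 1 X (lft f)"
proof -
  obtain f F where f: "E = F @ [f]"
    using assms(1) by (cases E rule: rev_cases) (auto simp: extns_iff)
  then have "F \<noteq> []"
    using assms by (auto simp: extns_iff)
  then show ?thesis
    using that[OF f] assms(1) f by (auto simp: extns_iff chain_append)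
qed

lemma gr_decomp:
  assumes "\<xi> \<in> gr (Suc k) X B" "1 \<le> k"
  shows "\<exists>K. \<exists>\<kappa> \<in> gr 1 K B. \<exists>\<eta> \<in> gr k X K. \<xi> = \<kappa> \<star> \<eta>"
    "\<exists>K. \<exists>\<kappa> \<in> gr 1 X K. \<exists>\<eta> \<in> gr k K B. \<xi> = \<eta> \<star> \<kappa>"
proof -
  obtain E where E: "\<xi> = Inr (cls E)" "E \<in> extns (Suc k) X B"
    using assms(1) by (cases rule: gr_cases) auto
  obtain e F where e: "E = e # F" "F \<in> extns k X (rgt e)" "[e] \<in> extns 1 (rgt e) B"
    using extns_Suc[OF E(2) assms(2)] by blast
  show "\<exists>K. \<exists>\<kappa> \<in> gr 1 K B. \<exists>\<eta> \<in> gr k X K. \<xi> = \<kappa> \<star> \<eta>"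
    using splice_gmul[OF e(3,2)] E(1) e(1) gr_Inr[OF e(2)] gr_Inr[OF e(3)]
    by (intro exI bexI[of _ "Inr (cls [e])"] bexI[of _ "Inr (cls F)"]) simp_all
  obtain f F where f: "E = F @ [f]" "F \<in> extns k (lft f) B" "[f] \<in> extns 1 X (lft f)"
    using extns_Suc_snoc[OF E(2) assms(2)] by blast
  show "\<exists>K. \<exists>\<kappa> \<in> gr 1 X K. \<exists>\<eta> \<in> gr k K B. \<xi> = \<eta> \<star> \<kappa>"
    using splice_gmul[OF f(2,3)] E(1) f(1) gr_Inr[OF f(2)] gr_Inr[OF f(3)]
    by (intro exI bexI[of _ "Inr (cls [f])"] bexI[of _ "Inr (cls F)"]) simp_all
qed

lemma gconf_mayer_vietoris:
  assumes "gconf B U K i p \<kappa>" "gconf B U' K' i' p' \<kappa>'" "v \<in> gr 0 U U'" "g \<in> gr 0 K K'"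
    "v \<star> i = i'" "p' \<star> v = g \<star> p"
  shows "\<exists>W m c \<mu> n1 n2 q1 q2. gconf U W K' m c \<mu> \<and> n1 \<in> gr 0 U' W \<and> n2 \<in> gr 0 K W \<and>
    q1 \<in> gr 0 W U' \<and> q2 \<in> gr 0 W K \<and> q2 \<star> n1 = gzero 0 U' K \<and> q2 \<star> n2 = gid K \<and>
    q2 \<star> m = p \<and> c \<star> n1 = p' \<and> gadd (c \<star> n2) g = gzero 0 K K'"
proof -
  from assms(1) obtain j q where c: "conflation j q" "src A j = B" "tgt A j = U" "tgt A q = K" "src A q = U"
    and m: "j \<in> Mor A" "q \<in> Mor A" and C: "B \<in> C" "U \<in> C" "K \<in> C"
    and e: "i = Inl j" "p = Inl q" "\<kappa> = Inr (cls [(j, q)])"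
    by (rule gconfE)
  from assms(2) obtain j' q' where c': "conflation j' q'" "src A j' = B" "tgt A j' = U'" "tgt A q' = K'" "src A q' = U'"
    and m': "j' \<in> Mor A" "q' \<in> Mor A" and C': "U' \<in> C" "K' \<in> C"
    and e': "i' = Inl j'" "p' = Inl q'" "\<kappa>' = Inr (cls [(j', q')])"
    by (rule gconfE)
  obtain w where w: "v = Inl w" "w \<in> Mor A" "src A w = U" "tgt A w = U'"
    using gr0[OF assms(3)] by metis
  obtain h where h: "g = Inl h" "h \<in> Mor A" "src A h = K" "tgt A h = K'"
    using gr0[OF assms(4)] by metis
  obtain W a b a' b' d l where bp: "is_biproduct U' K W a b a' b'" and dl: "conflation d l"
    "src A d = U" "tgt A d = W" "tgt A l = K'" and r: "a' \<cdot> d = w" "b' \<cdot> d = q" "l \<cdot> a = q'" "l \<cdot> b = negm h"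
    using ex_pullback_biproduct[OF c(1) c'(1) w(2) _ _ h(2)] c c' w h assms(5,6) e e'
    by (simp, metis)
  have C_W: "W \<in> C"
    using conflation_simps(7)[OF dl(1)] dl(3) by simp
  note bs = is_biproduct_simps[OF bp]
  have "gadd (Inl l \<star> Inl b) g = gzero 0 K K'"
    using h r(4) gadd_Inl[of "negm h" h K K'] C C' addm_comm[of "negm h" h] by (simp add: gzero_def)
  moreover have "gconf U W K' (Inl d) (Inl l) (Inr (cls [(d, l)]))"
    using gconf_single[of "(d, l)"] dl by (simp add: confl_def)
  moreover have "Inl a \<in> gr 0 U' W" "Inl b \<in> gr 0 K W" "Inl a' \<in> gr 0 W U'" "Inl b' \<in> gr 0 W K"
    using bs C C' C_W by (simp_all add: gr_def)
  moreover have "Inl b' \<star> Inl a = gzero 0 U' K" "Inl b' \<star> Inl b = gid K" "Inl b' \<star> Inl d = p"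
    "Inl l \<star> Inl a = p'"
    using bs r e e' by (simp_all add: gzero_def gid_def)
  ultimately show ?thesis
    by blast
qed

lemma gconf_mayer_vietoris_op:
  assumes "gconf U K B p i \<kappa>" "gconf U' K' B p' i' \<kappa>'" "v \<in> gr 0 K' K" "g \<in> gr 0 U' U"
    "i \<star> v = i'" "v \<star> p' = p \<star> g"
  shows "\<exists>W m c \<mu> n1 n2 q1 q2. gconf U' W K c m \<mu> \<and> n1 \<in> gr 0 W K' \<and> n2 \<in> gr 0 W U \<and>
    q1 \<in> gr 0 K' W \<and> q2 \<in> gr 0 U W \<and> n1 \<star> q2 = gzero 0 U K' \<and> n2 \<star> q2 = gid U \<and>
    m \<star> q2 = p \<and> n1 \<star> c = p' \<and> gadd (n2 \<star> c) g = gzero 0 U' U"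
proof -
  from assms(1) obtain j q where c: "conflation j q" "src A j = U" "tgt A j = K" "tgt A q = B" "src A q = K"
    and m: "j \<in> Mor A" "q \<in> Mor A" and C: "U \<in> C" "K \<in> C" "B \<in> C"
    and e: "p = Inl j" "i = Inl q" "\<kappa> = Inr (cls [(j, q)])"
    by (rule gconfE)
  from assms(2) obtain j' q' where c': "conflation j' q'" "src A j' = U'" "tgt A j' = K'" "tgt A q' = B" "src A q' = K'"
    and m': "j' \<in> Mor A" "q' \<in> Mor A" and C': "U' \<in> C" "K' \<in> C"
    and e': "p' = Inl j'" "i' = Inl q'" "\<kappa>' = Inr (cls [(j', q')])"
    by (rule gconfE)
  obtain w where w: "v = Inl w" "w \<in> Mor A" "src A w = K'" "tgt A w = K"
    using gr0[OF assms(3)] by metis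
  obtain h where h: "g = Inl h" "h \<in> Mor A" "src A h = U'" "tgt A h = U"
    using gr0[OF assms(4)] by metis
  obtain W a b a' b' l d where bp: "is_biproduct K' U W a b a' b'" and dl: "conflation d l"
    "tgt A l = K" "src A l = W" "src A d = U'" and r: "l \<cdot> a = w" "l \<cdot> b = j" "a' \<cdot> d = j'" "b' \<cdot> d = negm h"
    using ex_pushout_biproduct[OF c(1) c'(1) w(2) _ _ h(2)] c c' w h assms(5,6) e e'
    by (simp, metis)
  have dW: "tgt A d = W"
    using conflation_simps(4)[OF dl(1)] dl(3) by simp
  then have C_W: "W \<in> C"
    using conflation_simps(7)[OF dl(1)] by simp
  note bs = is_biproduct_simps[OF bp]
  have "gadd (Inl b' \<star> Inl d) g = gzero 0 U' U"
    using h r(4) gadd_Inl[of "negm h" h U' U] C C' addm_comm[of "negm h" h] by (simp add: gzero_def)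
  moreover have "gconf U' W K (Inl d) (Inl l) (Inr (cls [(d, l)]))"
    using gconf_single[of "(d, l)"] dl dW by (simp add: confl_def)
  moreover have "Inl a' \<in> gr 0 W K'" "Inl b' \<in> gr 0 W U" "Inl a \<in> gr 0 K' W" "Inl b \<in> gr 0 U W"
    using bs C C' C_W by (simp_all add: gr_def)
  moreover have "Inl a' \<star> Inl b = gzero 0 U K'" "Inl b' \<star> Inl b = gid U" "Inl l \<star> Inl b = p"
    "Inl a' \<star> Inl d = p'"
    using bs r e e' by (simp_all add: gzero_def gid_def)
  ultimately show ?thesis
    by blast
qed

lemma gconf_step:
  assumes "cmap (idm A B) g e f" "B \<in> C"
  obtains v where "gconf B (tgt A (fst e)) (rgt e) (Inl (fst e)) (Inl (snd e)) (Inr (cls [e]))"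
    "gconf B (tgt A (fst f)) (rgt f) (Inl (fst f)) (Inl (snd f)) (Inr (cls [f]))"
    "v \<in> gr 0 (tgt A (fst e)) (tgt A (fst f))" "Inl g \<in> gr 0 (rgt e) (rgt f)"
    "v \<star> Inl (fst e) = Inl (fst f)" "Inl (snd f) \<star> v = Inl g \<star> Inl (snd e)"
proof -
  from assms(1) obtain i p j q v where e: "e = (i, p)" "f = (j, q)" and c: "conflation i p" "conflation j q"
    and "src A (idm A B) = src A i" "tgt A (idm A B) = src A j"
    and m: "v \<in> Mor A" "src A v = tgt A i" "tgt A v = tgt A j"
    "g \<in> Mor A" "src A g = tgt A p" "tgt A g = tgt A q" and s: "v \<cdot> i = j \<cdot> idm A B" "g \<cdot> p = q \<cdot> v"
    by (rule cmapE)
  then have "src A i = B" "src A j = B"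
    using assms(2) by auto
  then show ?thesis
    using that[of "Inl v"] gconf_single[of e] gconf_single[of f] e c m s conflation_simps[OF c(1)]
      conflation_simps[OF c(2)] by (auto simp: confl_def intro!: gr_Inl)
qed

lemma gconf_step_op:
  assumes "cmap g (idm A B) e f" "B \<in> C"
  obtains v where "gconf (lft e) (tgt A (fst e)) B (Inl (fst e)) (Inl (snd e)) (Inr (cls [e]))"
    "gconf (lft f) (tgt A (fst f)) B (Inl (fst f)) (Inl (snd f)) (Inr (cls [f]))"
    "v \<in> gr 0 (tgt A (fst e)) (tgt A (fst f))" "Inl g \<in> gr 0 (lft e) (lft f)"
    "Inl (snd f) \<star> v = Inl (snd e)" "v \<star> Inl (fst e) = Inl (fst f) \<star> Inl g"
proof -
  from assms(1) obtain i p j q v where e: "e = (i, p)" "f = (j, q)" and c: "conflation i p" "conflation j q"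
    and m: "g \<in> Mor A" "src A g = src A i" "tgt A g = src A j"
    "v \<in> Mor A" "src A v = tgt A i" "tgt A v = tgt A j"
    and "src A (idm A B) = tgt A p" "tgt A (idm A B) = tgt A q" and s: "v \<cdot> i = j \<cdot> g" "idm A B \<cdot> p = q \<cdot> v"
    by (rule cmapE)
  then have B: "tgt A p = B" "tgt A q = B"
    using assms(2) by auto
  have "q \<cdot> v = p"
    using s(2) B(1) conflation_simps(3)[OF c(1)] by simp
  then show ?thesis
    using that[of "Inl v"] gconf_single[of e] gconf_single[of f] e c m s(1) B conflation_simps(2-4,6-)[OF c(1)]
      conflation_simps(2-4,6-)[OF c(2)] by (simp add: confl_def gr_def)
qed

text \<open>The predicate is transported to lists, evaluated at the head conflation and the class of
  the tail. A map with identity on \<open>B\<close> gives a morphism of heads with right component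
  \<open>g\<close> and makes one tail the push-out of the other along \<open>g\<close>, so
  \<open>inv\<close> applies; the head of the zero sequence splits.\<close>

lemma gconf_zigzag:
  assumes "gconf B U K i p \<kappa>" "\<xi> \<in> gr k X K" "1 \<le> k" "\<kappa> \<star> \<xi> = gzero (Suc k) X B"
    and inv: "\<And>U K i p \<kappa> \<xi> U' K' i' p' \<kappa>' v g. gconf B U K i p \<kappa> \<Longrightarrow> gconf B U' K' i' p' \<kappa>' \<Longrightarrow>
      \<xi> \<in> gr k X K \<Longrightarrow> v \<in> gr 0 U U' \<Longrightarrow> g \<in> gr 0 K K' \<Longrightarrow> v \<star> i = i' \<Longrightarrow> p' \<star> v = g \<star> p \<Longrightarrow>
      \<Phi> U K p \<xi> \<longleftrightarrow> \<Phi> U' K' p' (g \<star> \<xi>)"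
    and split: "\<And>U K i p \<kappa> \<xi> s. gconf B U K i p \<kappa> \<Longrightarrow> s \<in> gr 0 K U \<Longrightarrow> p \<star> s = gid K \<Longrightarrow>
      \<xi> \<in> gr k X K \<Longrightarrow> \<Phi> U K p \<xi>"
  shows "\<Phi> U K p \<xi>"
proof -
  from assms(1) obtain j q where c: "conflation j q" "src A j = B" "tgt A j = U" "tgt A q = K"
    and C: "B \<in> C" and e: "i = Inl j" "p = Inl q" "\<kappa> = Inr (cls [(j, q)])" and jq: "[(j, q)] \<in> extns 1 K B"
    by (rule gconfE)
  obtain E where E: "\<xi> = Inr (cls E)" "E \<in> extns k X K"
    using assms(2,3) by (cases rule: gr_cases) auto
  have X: "X \<in> C"
    using extns_C[OF E(2)] by simp
  let ?f = "\<lambda>L. \<Phi> (tgt A (fst (hd L))) (rgt (hd L)) (Inl (snd (hd L))) (Inr (cls (tl L)))"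
  have z: "zero_extn (Suc k) X B \<in> extns (Suc k) X B"
    using zero_extn_extns X C by simp
  have jE: "(j, q) # E \<in> extns (Suc k) X B"
    using extns_append[OF jq E(2)] by simp
  have "cls ((j, q) # E) = cls (zero_extn (Suc k) X B)"
    using assms(4) splice_gmul[OF jq E(2)] E(1) e(3) by (simp add: gzero_def)
  then have "?f ((j, q) # E) = ?f (zero_extn (Suc k) X B)"
  proof (rule cls_invariant[OF _ jE z, of ?f, rotated])
    fix E F assume h: "E \<in> extns (Suc k) X B" "F \<in> extns (Suc k) X B" "lmap (idm A B) (idm A X) E F"
    obtain e E' where e: "E = e # E'" "E' \<in> extns k X (rgt e)"
      using extns_Suc[OF h(1) assms(3)] by blast
    obtain f F' where f: "F = f # F'" "F' \<in> extns k X (rgt f)"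
      using extns_Suc[OF h(2) assms(3)] by blast
    obtain g where g: "cmap (idm A B) g e f" "lmap g (idm A X) E' F'"
      using h(3) e f by auto
    obtain v where v: "gconf B (tgt A (fst e)) (rgt e) (Inl (fst e)) (Inl (snd e)) (Inr (cls [e]))"
      "gconf B (tgt A (fst f)) (rgt f) (Inl (fst f)) (Inl (snd f)) (Inr (cls [f]))"
      "v \<in> gr 0 (tgt A (fst e)) (tgt A (fst f))" "Inl g \<in> gr 0 (rgt e) (rgt f)"
      "v \<star> Inl (fst e) = Inl (fst f)" "Inl (snd f) \<star> v = Inl g \<star> Inl (snd e)"
      using gconf_step[OF g(1) C] by blast
    show "?f E = ?f F"
      using inv[OF v(1,2) gr_Inr[OF e(2)] v(3-6)] lmap_gmul(1)[OF g(2) e(2) f(2)] e(1) f(1) by simp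
  qed
  moreover have "?f (zero_extn (Suc k) X B)"
  proof -
    obtain f F where f: "zero_extn (Suc k) X B = f # F" "F \<in> extns k X (rgt f)" "[f] \<in> extns 1 (rgt f) B"
      using extns_Suc[OF z assms(3)] by blast
    then have cf: "confl f" "lft f = B"
      by (auto simp: extns_iff)
    obtain W where W: "f = (inj1 B W, prj2 B W)" "W \<in> C"
    proof -
      have "f = (inj1 B (if k = 0 then X else zobj), prj2 B (if k = 0 then X else zobj))"
        using f(1) unfolding zero_extn_def by (simp add: upt_conv_Cons del: upt_Suc)
      then show ?thesis
        using that X by auto
    qed
    have "\<Phi> (tgt A (fst f)) (rgt f) (Inl (snd f)) (Inr (cls F))"
    proof (rule split)
      show "gconf B (tgt A (fst f)) (rgt f) (Inl (fst f)) (Inl (snd f)) (Inr (cls [f]))"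
        using gconf_single[OF cf(1)] cf(2) by simp
      show "Inl (inj2 B W) \<in> gr 0 (rgt f) (tgt A (fst f))" "Inl (snd f) \<star> Inl (inj2 B W) = gid (rgt f)"
        using W C by (auto simp: gid_def intro!: gr_Inl)
      show "Inr (cls F) \<in> gr k X (rgt f)"
        using gr_Inr[OF f(2)] .
    qed
    then show ?thesis
      using f(1) by simp
  qed
  ultimately show ?thesis
    using c e E by simp
qed

text \<open>Extensions in the opposite category are different lists, reversed and with swapped
  pairs. So the dual is proved directly, with the last conflation in place of the head.\<close>

lemma gconf_zigzag_op:
  assumes "gconf K U B p i \<kappa>" "\<xi> \<in> gr k K X" "1 \<le> k" "\<xi> \<star> \<kappa> = gzero (Suc k) B X"
    and inv: "\<And>U K i p \<kappa> \<xi> U' K' i' p' \<kappa>' v g. gconf K U B p i \<kappa> \<Longrightarrow> gconf K' U' B p' i' \<kappa>' \<Longrightarrow>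
      \<xi> \<in> gr k K X \<Longrightarrow> v \<in> gr 0 U' U \<Longrightarrow> g \<in> gr 0 K' K \<Longrightarrow> i \<star> v = i' \<Longrightarrow> v \<star> p' = p \<star> g \<Longrightarrow>
      \<Phi> U K p \<xi> \<longleftrightarrow> \<Phi> U' K' p' (\<xi> \<star> g)"
    and split: "\<And>U K i p \<kappa> \<xi> s. gconf K U B p i \<kappa> \<Longrightarrow> s \<in> gr 0 U K \<Longrightarrow> s \<star> p = gid K \<Longrightarrow>
      \<xi> \<in> gr k K X \<Longrightarrow> \<Phi> U K p \<xi>"
  shows "\<Phi> U K p \<xi>"
proof -
  from assms(1) obtain j q where c: "conflation j q" "src A j = K" "tgt A j = U" "tgt A q = B"
    and C: "B \<in> C" and e: "p = Inl j" "i = Inl q" "\<kappa> = Inr (cls [(j, q)])" and jq: "[(j, q)] \<in> extns 1 B K"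
    by (rule gconfE)
  obtain E where E: "\<xi> = Inr (cls E)" "E \<in> extns k K X"
    using assms(2,3) by (cases rule: gr_cases) auto
  have X: "X \<in> C"
    using extns_C[OF E(2)] by simp
  let ?f = "\<lambda>L. \<Phi> (tgt A (fst (last L))) (lft (last L)) (Inl (fst (last L))) (Inr (cls (butlast L)))"
  have z: "zero_extn (Suc k) B X \<in> extns (Suc k) B X"
    using zero_extn_extns X C by simp
  have jE: "E @ [(j, q)] \<in> extns (Suc k) B X"
    using extns_append[OF E(2) jq] by simp
  have "cls (E @ [(j, q)]) = cls (zero_extn (Suc k) B X)"
    using assms(4) splice_gmul[OF E(2) jq] E(1) e(3) by (simp add: gzero_def)
  then have "?f (E @ [(j, q)]) = ?f (zero_extn (Suc k) B X)"
  proof (rule cls_invariant[OF _ jE z, of ?f, rotated])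
    fix E F assume h: "E \<in> extns (Suc k) B X" "F \<in> extns (Suc k) B X" "lmap (idm A X) (idm A B) E F"
    obtain e E' where e: "E = E' @ [e]" "E' \<in> extns k (lft e) X"
      using extns_Suc_snoc[OF h(1) assms(3)] by blast
    obtain f F' where f: "F = F' @ [f]" "F' \<in> extns k (lft f) X"
      using extns_Suc_snoc[OF h(2) assms(3)] by blast
    have "length E' = length F'"
      using extns_length[OF e(2)] extns_length[OF f(2)] by simp
    then obtain g where g: "lmap (idm A X) g E' F'" "cmap g (idm A B) e f"
      using h(3) unfolding e(1) f(1) by (auto simp: lmap_append)
    obtain v where v: "gconf (lft e) (tgt A (fst e)) B (Inl (fst e)) (Inl (snd e)) (Inr (cls [e]))"
      "gconf (lft f) (tgt A (fst f)) B (Inl (fst f)) (Inl (snd f)) (Inr (cls [f]))"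
      "v \<in> gr 0 (tgt A (fst e)) (tgt A (fst f))" "Inl g \<in> gr 0 (lft e) (lft f)"
      "Inl (snd f) \<star> v = Inl (snd e)" "v \<star> Inl (fst e) = Inl (fst f) \<star> Inl g"
      using gconf_step_op[OF g(2) C] by blast
    show "?f E = ?f F"
      using inv[OF v(2,1) gr_Inr[OF f(2)] v(3-6)] lmap_gmul(2)[OF g(1) f(2) e(2)] e(1) f(1) by simp
  qed
  moreover have "?f (zero_extn (Suc k) B X)"
  proof -
    obtain f F where f: "zero_extn (Suc k) B X = F @ [f]" "F \<in> extns k (lft f) X" "[f] \<in> extns 1 B (lft f)"
      using extns_Suc_snoc[OF z assms(3)] by blast
    then have cf: "confl f" "rgt f = B"
      by (auto simp: extns_iff)
    obtain W where W: "f = (inj1 W B, prj2 W B)" "W \<in> C"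
    proof -
      have "f = (inj1 (if k = 0 then X else zobj) B, prj2 (if k = 0 then X else zobj) B)"
        using f(1) unfolding zero_extn_def by auto
      then show ?thesis
        using that X by auto
    qed
    have "\<Phi> (tgt A (fst f)) (lft f) (Inl (fst f)) (Inr (cls F))"
    proof (rule split)
      show "gconf (lft f) (tgt A (fst f)) B (Inl (fst f)) (Inl (snd f)) (Inr (cls [f]))"
        using gconf_single[OF cf(1)] cf(2) by simp
      show "Inl (prj1 W B) \<in> gr 0 (tgt A (fst f)) (lft f)" "Inl (prj1 W B) \<star> Inl (fst f) = gid (lft f)"
        using W C by (auto simp: gid_def intro!: gr_Inl)
      show "Inr (cls F) \<in> gr k (lft f) X"
        using gr_Inr[OF f(2)] .
    qed
    then show ?thesis
      using f(1) by simp
  qed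
  ultimately show ?thesis
    using c e E by simp
qed

end

context extension_closed_subcategory
begin

lemma graded_exact_gr: "graded_exact C gr gmul gadd gzero gid gconf"
  apply (intro graded_exact.intro graded_category_gr graded_exact_axioms.intro)
  subgoal by (rule gconf_in)
  subgoal by (rule conjI; rule gconf_zero)
  subgoal by (rule gconf_exact(1))
  subgoal by (rule gconf_exact(2))
  subgoal by (rule gconf_exact(3))
  subgoal by (rule gconf_ex)
  subgoal by (rule gr_decomp(1))
  subgoal by (rule gconf_mayer_vietoris)
  subgoal premises prems for B U K i p \<kappa> \<xi> k X \<Phi>
    by (rule gconf_zigzag[of B U K i p \<kappa> \<xi> k X \<Phi>, OF prems])
  done

lemma graded_exact_op:
  "graded_exact C (\<lambda>k X Y. gr k Y X) (\<lambda>a b. b \<star> a) gadd (\<lambda>k X Y. gzero k Y X) gid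
     (\<lambda>B U K i p. gconf K U B p i)"
  apply (intro graded_exact.intro graded_category.graded_category_op[OF graded_category_gr]
      graded_exact_axioms.intro)
  subgoal using gconf_in by blast
  subgoal by (rule conjI; rule gconf_zero)
  subgoal by (rule gconf_exact(4))
  subgoal by (rule gconf_exact(5))
  subgoal by (rule gconf_exact(6))
  subgoal using gconf_ex by blast
  subgoal by (rule gr_decomp(2))
  subgoal by (rule gconf_mayer_vietoris_op)
  subgoal premises prems for B U K i p \<kappa> \<xi> k X \<Phi>
    by (rule gconf_zigzag_op[of K U B p i \<kappa> \<xi> k X \<Phi>, OF prems])
  done

end

section \<open>Dimension shifting along unit conflations\<close>

text \<open>\<open>U X Y\<close> contains the classes of unit conflations of length 1, \<open>Pr X Y\<close> the elements of degree
  \<open>n\<close> factoring through an \<open>n\<close>-projective object, and \<open>defl\<close> the deflations.\<close>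

locale graded_frobenius = graded_category +
  fixes n :: nat and U :: "'a \<Rightarrow> 'a \<Rightarrow> 'b set" and Pr :: "'a \<Rightarrow> 'a \<Rightarrow> 'b set" and defl :: "'b \<Rightarrow> bool"
  assumes n_pos: "1 \<le> n"
    and U_in: "\<kappa> \<in> U X Y \<Longrightarrow> \<kappa> \<in> G 1 X Y"
    and U_from: "X \<in> Ob \<Longrightarrow> \<exists>Y \<kappa>. \<kappa> \<in> U X Y"
    and U_to: "Y \<in> Ob \<Longrightarrow> \<exists>X \<kappa>. \<kappa> \<in> U X Y"
    and U_inj_left: "\<kappa> \<in> U X Y \<Longrightarrow> \<xi> \<in> G k W X \<Longrightarrow> n < k \<Longrightarrow> \<kappa> \<star> \<xi> = zer (Suc k) W Y \<Longrightarrow> \<xi> = zer k W X"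
    and U_surj_left: "\<kappa> \<in> U X Y \<Longrightarrow> \<eta> \<in> G (Suc k) W Y \<Longrightarrow> n \<le> k \<Longrightarrow> \<exists>\<xi> \<in> G k W X. \<eta> = \<kappa> \<star> \<xi>"
    and U_inj_right: "\<kappa> \<in> U X Y \<Longrightarrow> \<xi> \<in> G k Y Z \<Longrightarrow> n < k \<Longrightarrow> \<xi> \<star> \<kappa> = zer (Suc k) X Z \<Longrightarrow> \<xi> = zer k Y Z"
    and U_surj_right: "\<kappa> \<in> U X Y \<Longrightarrow> \<eta> \<in> G (Suc k) X Z \<Longrightarrow> n \<le> k \<Longrightarrow> \<exists>\<xi> \<in> G k Y Z. \<eta> = \<xi> \<star> \<kappa>"
    and Pr_in: "Pr X Y \<subseteq> G n X Y"
    and U_ker: "\<kappa> \<in> U X Y \<Longrightarrow> \<xi> \<in> G n W X \<Longrightarrow> \<kappa> \<star> \<xi> = zer (Suc n) W Y \<longleftrightarrow> \<xi> \<in> Pr W X"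
    and Pr_annihilated: "p \<in> Pr X Y \<Longrightarrow> \<xi> \<in> G k Y Z \<Longrightarrow> 1 \<le> k \<Longrightarrow> \<xi> \<star> p = zer (k + n) X Z"
    and U_factor: "\<eta> \<in> G 1 X Y \<Longrightarrow> \<exists>D. \<exists>\<kappa> \<in> U D Y. \<exists>f \<in> G 0 X D. \<eta> = \<kappa> \<star> f"
    and G_decomp: "\<xi> \<in> G (Suc k) X Y \<Longrightarrow> 1 \<le> k \<Longrightarrow> \<exists>K. \<exists>\<kappa> \<in> G 1 K Y. \<exists>\<eta> \<in> G k X K. \<xi> = \<kappa> \<star> \<eta>"
    and U_ore: "\<kappa> \<in> U X Y \<Longrightarrow> \<kappa>' \<in> U Z L \<Longrightarrow> a \<in> G 0 L Y \<Longrightarrow>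
      \<exists>L' \<mu> c c'. \<mu> \<in> U L' L \<and> c \<in> G 0 L' X \<and> c' \<in> G 0 L' Z \<and> defl c \<and> defl c' \<and>
        a \<star> \<mu> = \<kappa> \<star> c \<and> \<mu> = \<kappa>' \<star> c'"
    and defl_mul: "defl a \<Longrightarrow> defl b \<Longrightarrow> a \<in> G 0 Y Z \<Longrightarrow> b \<in> G 0 X Y \<Longrightarrow> defl (a \<star> b)"
begin

text \<open>Factors are peeled off at the left end \<open>Y\<close>, matching the head of a list of
  conflations.\<close>

inductive unit :: "nat \<Rightarrow> 'a \<Rightarrow> 'a \<Rightarrow> 'b \<Rightarrow> bool" where
  unit_one: "\<kappa> \<in> U X Y \<Longrightarrow> unit 1 X Y \<kappa>"
| unit_Suc: "\<kappa> \<in> U Z Y \<Longrightarrow> unit k X Z \<delta> \<Longrightarrow> unit (Suc k) X Y (\<kappa> \<star> \<delta>)"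

lemma unit_in: "unit k X Y \<delta> \<Longrightarrow> \<delta> \<in> G k X Y \<and> 1 \<le> k"
proof (induction rule: unit.induct)
  case (unit_Suc \<kappa> Z Y k X \<delta>)
  then show ?case
    using mul_in[OF U_in[OF unit_Suc(1)], of \<delta> k X] by simp
qed (auto dest: U_in)

lemma unit_1: "unit (Suc 0) X Y \<delta> \<longleftrightarrow> \<delta> \<in> U X Y"
proof
  assume "unit (Suc 0) X Y \<delta>"
  then show "\<delta> \<in> U X Y"
    by (cases rule: unit.cases) (auto dest: unit_in)
qed (use unit_one in simp)

lemma unit_SucE:
  assumes "unit (Suc k) X Y \<delta>" "k \<noteq> 0"
  obtains \<kappa> Z \<delta>' where "\<delta> = \<kappa> \<star> \<delta>'" "\<kappa> \<in> U Z Y" "unit k X Z \<delta>'"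
  using assms by (cases rule: unit.cases) auto

lemma unit_inj_left:
  "unit k X Y \<delta> \<Longrightarrow> \<xi> \<in> G l W X \<Longrightarrow> n < l \<Longrightarrow> \<delta> \<star> \<xi> = zer (k + l) W Y \<Longrightarrow> \<xi> = zer l W X"
proof (induction rule: unit.induct)
  case (unit_one \<kappa> X Y)
  then show ?case
    using U_inj_left by simp
next
  case (unit_Suc \<kappa> Z Y k X \<delta>)
  note \<delta> = conjunct1[OF unit_in[OF unit_Suc(2)]]
  have "\<delta> \<star> \<xi> = zer (k + l) W Z"
    using U_inj_left[OF unit_Suc(1) mul_in[OF \<delta> unit_Suc(4)]] unit_Suc(5,6)
      mul_assoc[OF U_in[OF unit_Suc(1)] \<delta> unit_Suc(4)] by simp
  then show ?case
    using unit_Suc by blast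
qed

lemma unit_inj_right:
  "unit k X Y \<delta> \<Longrightarrow> \<xi> \<in> G l Y Z \<Longrightarrow> n < l \<Longrightarrow> \<xi> \<star> \<delta> = zer (l + k) X Z \<Longrightarrow> \<xi> = zer l Y Z"
proof (induction arbitrary: \<xi> l rule: unit.induct)
  case (unit_one \<kappa> X Y)
  then show ?case
    using U_inj_right by simp
next
  case (unit_Suc \<kappa> V Y k X \<delta>)
  note \<delta> = conjunct1[OF unit_in[OF unit_Suc(2)]] and \<kappa> = U_in[OF unit_Suc(1)]
  have "\<xi> \<star> \<kappa> \<in> G (Suc l) V Z"
    using mul_in[OF unit_Suc(4) \<kappa>] by simp
  then have "\<xi> \<star> \<kappa> = zer (Suc l) V Z"
    using unit_Suc.IH[of "\<xi> \<star> \<kappa>" "Suc l"] mul_assoc[OF unit_Suc(4) \<kappa> \<delta>] unit_Suc(5,6) by simp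
  then show ?case
    using U_inj_right[OF unit_Suc(1,4)] unit_Suc(5) by simp
qed

text \<open>Surjectivity begins in degree \<open>n\<close>, one below injectivity: the obstruction
  to division by a unit lies one degree higher than the quotient, and obstructions vanish above
  \<open>n\<close>.\<close>

lemma unit_surj_left:
  "unit k X Y \<delta> \<Longrightarrow> \<eta> \<in> G (k + l) W Y \<Longrightarrow> n \<le> l \<Longrightarrow> \<exists>\<xi> \<in> G l W X. \<eta> = \<delta> \<star> \<xi>"
proof (induction arbitrary: \<eta> rule: unit.induct)
  case (unit_one \<kappa> X Y)
  then show ?case
    using U_surj_left by simp
next
  case (unit_Suc \<kappa> Z Y k X \<delta>)
  note \<delta> = conjunct1[OF unit_in[OF unit_Suc(2)]]
  obtain \<zeta> where \<zeta>: "\<zeta> \<in> G (k + l) W Z" "\<eta> = \<kappa> \<star> \<zeta>"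
    using U_surj_left[OF unit_Suc(1), of \<eta> "k + l" W] unit_Suc(4,5) by auto
  then obtain \<xi> where "\<xi> \<in> G l W X" "\<zeta> = \<delta> \<star> \<xi>"
    using unit_Suc by blast
  then show ?case
    using mul_assoc[OF U_in[OF unit_Suc(1)] \<delta>] \<zeta>(2) by auto
qed

lemma unit_surj_right:
  "unit k X Y \<delta> \<Longrightarrow> \<eta> \<in> G (l + k) X Z \<Longrightarrow> n \<le> l \<Longrightarrow> \<exists>\<xi> \<in> G l Y Z. \<eta> = \<xi> \<star> \<delta>"
proof (induction arbitrary: \<eta> l rule: unit.induct)
  case (unit_one \<kappa> X Y)
  then show ?case
    using U_surj_right by simp
next
  case (unit_Suc \<kappa> V Y k X \<delta>)
  note \<delta> = conjunct1[OF unit_in[OF unit_Suc(2)]]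
  obtain \<zeta> where \<zeta>: "\<zeta> \<in> G (Suc l) V Z" "\<eta> = \<zeta> \<star> \<delta>"
    using unit_Suc.IH[of \<eta> "Suc l"] unit_Suc(4,5) by auto
  then obtain \<xi> where "\<xi> \<in> G l Y Z" "\<zeta> = \<xi> \<star> \<kappa>"
    using U_surj_right[OF unit_Suc(1) \<zeta>(1)] unit_Suc(5) by blast
  then show ?case
    using mul_assoc[OF _ U_in[OF unit_Suc(1)] \<delta>] \<zeta>(2) by auto
qed

lemma unit_cancel_left:
  assumes "unit k X Y \<delta>" "\<xi> \<in> G l W X" "\<xi>' \<in> G l W X" "n < l" "\<delta> \<star> \<xi> = \<delta> \<star> \<xi>'"
  shows "\<xi> = \<xi>'"
  by (rule mul_cancel_left[of \<delta> k X Y l W]) (use assms unit_in unit_inj_left in blast)+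

lemma unit_cancel_right:
  assumes "unit k X Y \<delta>" "\<xi> \<in> G l Y Z" "\<xi>' \<in> G l Y Z" "n < l" "\<xi> \<star> \<delta> = \<xi>' \<star> \<delta>"
  shows "\<xi> = \<xi>'"
  by (rule mul_cancel_right[of \<delta> k X Y l Z]) (use assms unit_in unit_inj_right in blast)+

lemma ex_unit_to: "1 \<le> k \<Longrightarrow> Y \<in> Ob \<Longrightarrow> \<exists>X \<delta>. unit k X Y \<delta>"
proof (induction k arbitrary: Y rule: dec_induct)
  case base
  then show ?case
    using U_to unit_one by blast
next
  case (step k)
  obtain Z \<kappa> where \<kappa>: "\<kappa> \<in> U Z Y"
    using U_to step by blast
  then have "Z \<in> Ob"
    using G_Ob U_in by blast
  then show ?case
    using step.IH unit_Suc[OF \<kappa>] by blast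
qed

lemma ex_unit_from: "1 \<le> k \<Longrightarrow> X \<in> Ob \<Longrightarrow> \<exists>Y \<delta>. unit k X Y \<delta>"
proof (induction k rule: dec_induct)
  case base
  then show ?case
    using U_from unit_one by blast
next
  case (step k)
  then obtain Z \<delta> where \<delta>: "unit k X Z \<delta>"
    by blast
  then have "Z \<in> Ob"
    using G_Ob unit_in by blast
  then obtain Y \<kappa> where "\<kappa> \<in> U Z Y"
    using U_from by blast
  then show ?case
    using unit_Suc \<delta> by blast
qed

text \<open>One conflation at a time: the leading \<open>\<kappa>\<close> factors through a unit,
  the resulting morphism \<open>h\<close> is moved across to the remaining factor, and this is
  factored in turn.\<close>

lemma unit_factor: "1 \<le> k \<Longrightarrow> \<gamma> \<in> G k X Y \<Longrightarrow> \<exists>D \<delta>. \<exists>f \<in> G 0 X D. unit k D Y \<delta> \<and> \<gamma> = \<delta> \<star> f"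
proof (induction k arbitrary: \<gamma> Y rule: dec_induct)
  case base
  then show ?case
    using U_factor unit_one by blast
next
  case (step k)
  obtain K \<kappa> \<eta> where \<kappa>: "\<kappa> \<in> G 1 K Y" and \<eta>: "\<eta> \<in> G k X K" and \<gamma>: "\<gamma> = \<kappa> \<star> \<eta>"
    using G_decomp[OF step.prems step.hyps(1)] by blast
  obtain E \<mu> h where \<mu>: "\<mu> \<in> U E Y" and h: "h \<in> G 0 K E" and \<kappa>': "\<kappa> = \<mu> \<star> h"
    using U_factor[OF \<kappa>] by blast
  have "h \<star> \<eta> \<in> G k X E"
    using mul_in[OF h \<eta>] by simp
  then obtain D \<delta> f where \<delta>: "f \<in> G 0 X D" "unit k D E \<delta>" "h \<star> \<eta> = \<delta> \<star> f"
    using step.IH by blast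
  have "\<gamma> = (\<mu> \<star> \<delta>) \<star> f"
    using \<gamma> \<kappa>' \<delta>(3) mul_assoc[OF U_in[OF \<mu>] h \<eta>] mul_assoc[OF U_in[OF \<mu>] conjunct1[OF unit_in[OF \<delta>(2)]] \<delta>(1)]
    by simp
  then show ?case
    using unit_Suc[OF \<mu> \<delta>(2)] \<delta>(1) by blast
qed

text \<open>Push-outs in degree \<open>n + 1\<close> alone, as for quasi-invertible morphisms;
  \<open>qi_left\<close> and \<open>qi_right\<close> extend this to all higher degrees and to
  pull-backs.\<close>

definition qi :: "'a \<Rightarrow> 'a \<Rightarrow> 'b \<Rightarrow> bool" where
  "qi L D a \<longleftrightarrow> a \<in> G 0 L D \<and> (\<forall>X \<in> Ob. bij_betw (\<lambda>\<xi>. a \<star> \<xi>) (G (Suc n) X L) (G (Suc n) X D))"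

lemma qiI:
  assumes "a \<in> G 0 L D"
    and inj: "\<And>X \<xi>. \<xi> \<in> G (Suc n) X L \<Longrightarrow> a \<star> \<xi> = zer (Suc n) X D \<Longrightarrow> \<xi> = zer (Suc n) X L"
    and surj: "\<And>X \<eta>. \<eta> \<in> G (Suc n) X D \<Longrightarrow> \<exists>\<xi> \<in> G (Suc n) X L. \<eta> = a \<star> \<xi>"
  shows "qi L D a"
  unfolding qi_def bij_betw_def
proof (intro conjI ballI assms(1))
  fix X assume "X \<in> Ob"
  show "inj_on (\<lambda>\<xi>. a \<star> \<xi>) (G (Suc n) X L)"
    using mul_cancel_left[OF assms(1), of "Suc n" X] inj by (auto simp: inj_on_def)
  show "(\<lambda>\<xi>. a \<star> \<xi>) ` G (Suc n) X L = G (Suc n) X D"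
    using mul_in[OF assms(1), of _ "Suc n" X] surj[of _ X] by auto
qed

lemma qi_in: "qi L D a \<Longrightarrow> a \<in> G 0 L D"
  by (simp add: qi_def)

text \<open>The degree is raised by shifting in the free variable \<open>X\<close>: elements over
  \<open>X\<close> are products with a unit on the right, and this does not interfere with
  multiplication by \<open>a\<close> on the left.\<close>

lemma qi_left:
  assumes "qi L D a" "Suc n \<le> k"
  shows "\<xi> \<in> G k X L \<Longrightarrow> a \<star> \<xi> = zer k X D \<Longrightarrow> \<xi> = zer k X L"
    and "\<eta> \<in> G k X D \<Longrightarrow> \<exists>\<xi> \<in> G k X L. \<eta> = a \<star> \<xi>"
proof -
  note a = qi_in[OF assms(1)]
  have "(\<forall>X \<xi>. \<xi> \<in> G k X L \<longrightarrow> a \<star> \<xi> = zer k X D \<longrightarrow> \<xi> = zer k X L) \<and>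
    (\<forall>X \<eta>. \<eta> \<in> G k X D \<longrightarrow> (\<exists>\<xi> \<in> G k X L. \<eta> = a \<star> \<xi>))"
    using assms(2)
  proof (induction k rule: dec_induct)
    case base
    show ?case
    proof (intro conjI allI impI)
      fix X \<xi> assume h: "\<xi> \<in> G (Suc n) X L" "a \<star> \<xi> = zer (Suc n) X D"
      have X: "X \<in> Ob" "L \<in> Ob"
        using G_Ob h by auto
      have "inj_on (\<lambda>\<xi>. a \<star> \<xi>) (G (Suc n) X L)"
        using assms(1) X unfolding qi_def bij_betw_def by blast
      then show "\<xi> = zer (Suc n) X L"
        by (rule inj_onD) (use h mul_zer[OF a X(1), of "Suc n"] zer_in[OF X] in simp_all)
    next
      fix X \<eta> assume h: "\<eta> \<in> G (Suc n) X D"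
      then have "X \<in> Ob"
        using G_Ob by blast
      then have "(\<lambda>\<xi>. a \<star> \<xi>) ` G (Suc n) X L = G (Suc n) X D"
        using assms(1) unfolding qi_def bij_betw_def by blast
      then show "\<exists>\<xi> \<in> G (Suc n) X L. \<eta> = a \<star> \<xi>"
        using h by blast
    qed
  next
    case (step k)
    show ?case
    proof (intro conjI allI impI)
      fix X \<xi> assume h: "\<xi> \<in> G (Suc k) X L" "a \<star> \<xi> = zer (Suc k) X D"
      obtain X' \<kappa> where \<kappa>: "\<kappa> \<in> U X X'"
        using U_from G_Ob[OF h(1)] by blast
      note \<kappa>' = U_in[OF \<kappa>]
      obtain \<xi>' where \<xi>': "\<xi>' \<in> G k X' L" "\<xi> = \<xi>' \<star> \<kappa>"
        using U_surj_right[OF \<kappa> h(1)] step.hyps by auto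
      have "a \<star> \<xi>' \<in> G k X' D"
        using mul_in[OF a \<xi>'(1)] by simp
      then have "a \<star> \<xi>' = zer k X' D"
        using U_inj_right[OF \<kappa>, of "a \<star> \<xi>'" k D] h(2) \<xi>'(2) mul_assoc[OF a \<xi>'(1) \<kappa>'] step.hyps by simp
      then have "\<xi>' = zer k X' L"
        using step.IH \<xi>'(1) by blast
      then show "\<xi> = zer (Suc k) X L"
        using zer_mul[OF \<kappa>', of L k] G_Ob[OF h(1)] \<xi>'(2) by simp
    next
      fix X \<eta> assume h: "\<eta> \<in> G (Suc k) X D"
      obtain X' \<kappa> where \<kappa>: "\<kappa> \<in> U X X'"
        using U_from G_Ob[OF h] by blast
      note \<kappa>' = U_in[OF \<kappa>]
      obtain \<eta>' where \<eta>': "\<eta>' \<in> G k X' D" "\<eta> = \<eta>' \<star> \<kappa>"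
        using U_surj_right[OF \<kappa> h] step.hyps by auto
      obtain \<xi> where \<xi>: "\<xi> \<in> G k X' L" "\<eta>' = a \<star> \<xi>"
        using step.IH \<eta>'(1) by blast
      have "\<eta> = a \<star> (\<xi> \<star> \<kappa>)"
        using \<eta>'(2) \<xi>(2) mul_assoc[OF a \<xi>(1) \<kappa>'] by simp
      then show "\<exists>\<xi> \<in> G (Suc k) X L. \<eta> = a \<star> \<xi>"
        using mul_in[OF \<xi>(1) \<kappa>'] by auto
    qed
  qed
  then show "\<xi> \<in> G k X L \<Longrightarrow> a \<star> \<xi> = zer k X D \<Longrightarrow> \<xi> = zer k X L"
    "\<eta> \<in> G k X D \<Longrightarrow> \<exists>\<xi> \<in> G k X L. \<eta> = a \<star> \<xi>"
    by blast+
qed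

text \<open>Up to dimension shift, the element \<open>v\<close> with \<open>u = a v\<close> for a unit \<open>u\<close> is an inverse of \<open>a\<close>;
  this transfers quasi-invertibility from push-outs to pull-backs.\<close>

lemma qi_right:
  assumes "qi L D a" "Suc n \<le> k"
  shows "\<zeta> \<in> G k D Y \<Longrightarrow> \<zeta> \<star> a = zer k L Y \<Longrightarrow> \<zeta> = zer k D Y"
    and "\<eta> \<in> G k L Y \<Longrightarrow> \<exists>\<zeta> \<in> G k D Y. \<eta> = \<zeta> \<star> a"
proof -
  note a = qi_in[OF assms(1)]
  let ?m = "Suc n"
  have ob: "L \<in> Ob" "D \<in> Ob"
    using G_Ob[OF a] by auto
  obtain D' u where u: "unit ?m D' D u"
    using ex_unit_to[of ?m D] ob by auto
  obtain v where v: "v \<in> G ?m D' L" "u = a \<star> v"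
    using qi_left(2)[OF assms(1) le_refl] unit_in[OF u] by blast
  obtain L' w where w: "unit ?m L' L w"
    using ex_unit_to[of ?m L] ob by auto
  have "L' \<in> Ob"
    using G_Ob unit_in[OF w] by blast
  then obtain L'' x where x: "unit ?m L'' L' x"
    using ex_unit_to[of ?m L'] by auto
  note ui = conjunct1[OF unit_in[OF u]] and wi = conjunct1[OF unit_in[OF w]] and xi = conjunct1[OF unit_in[OF x]]
  note wx = mul_in[OF wi xi]
  have "a \<star> (w \<star> x) \<in> G (?m + ?m) L'' D"
    using mul_in[OF a wx] by simp
  then obtain y where y: "y \<in> G ?m L'' D'" "a \<star> (w \<star> x) = u \<star> y"
    using unit_surj_left[OF u, of _ ?m L''] by auto
  have "a \<star> (w \<star> x) = a \<star> (v \<star> y)"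
    using y(2) v(2) mul_assoc[OF a v(1) y(1)] by simp
  \<comment> \<open>Cancelling \<open>a\<close> shows that \<open>v\<close> has a right inverse up
    to units: \<open>v \<star> y\<close> is the product of the units \<open>w\<close> and
    \<open>x\<close>. Hence multiplication by \<open>v\<close> from the right is injective.\<close>
  then have wxvy: "w \<star> x = v \<star> y"
    using mul_cancel_left[OF a _ wx mul_in[OF v(1) y(1)]] qi_left(1)[OF assms(1), of "?m + ?m" _ L''] by auto
  have v_inj: "\<zeta> = zer k L Y" if \<zeta>: "\<zeta> \<in> G k L Y" "\<zeta> \<star> v = zer (k + ?m) D' Y" for \<zeta>
  proof -
    have Y: "Y \<in> Ob"
      using G_Ob \<zeta> by blast
    have "\<zeta> \<star> (w \<star> x) = zer (k + ?m) D' Y \<star> y"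
      using wxvy mul_assoc[OF \<zeta>(1) v(1) y(1)] \<zeta>(2) by simp
    also have "\<dots> = zer (k + ?m + ?m) L'' Y"
      using zer_mul[OF y(1) Y] by simp
    finally have "(\<zeta> \<star> w) \<star> x = zer (k + ?m + ?m) L'' Y"
      using mul_assoc[OF \<zeta>(1) wi xi] by simp
    then have "\<zeta> \<star> w = zer (k + ?m) L' Y"
      using unit_inj_right[OF x mul_in[OF \<zeta>(1) wi]] assms(2) by simp
    then show ?thesis
      using unit_inj_right[OF w \<zeta>(1)] assms(2) by simp
  qed
  show "\<zeta> = zer k D Y" if \<zeta>: "\<zeta> \<in> G k D Y" "\<zeta> \<star> a = zer k L Y"
  proof -
    have "Y \<in> Ob"
      using G_Ob \<zeta> by blast
    then have "\<zeta> \<star> u = zer (k + ?m) D' Y"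
      using v(2) mul_assoc[OF \<zeta>(1) a v(1)] \<zeta>(2) zer_mul[OF v(1)] by simp
    then show ?thesis
      using unit_inj_right[OF u \<zeta>(1)] assms(2) by simp
  qed
  show "\<exists>\<zeta> \<in> G k D Y. \<eta> = \<zeta> \<star> a" if \<eta>: "\<eta> \<in> G k L Y"
  proof -
    \<comment> \<open>The quotient of \<open>\<eta> \<star> v\<close> by
      \<open>u = a \<star> v\<close> is the candidate; cancelling \<open>v\<close> gives
      \<open>\<eta> = \<zeta> \<star> a\<close>.\<close>
    obtain \<zeta> where \<zeta>: "\<zeta> \<in> G k D Y" "\<eta> \<star> v = \<zeta> \<star> u"
      using unit_surj_right[OF u mul_in[OF \<eta> v(1)]] assms(2) by auto
    have za: "\<zeta> \<star> a \<in> G k L Y"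
      using mul_in[OF \<zeta>(1) a] by simp
    have "\<eta> \<star> v = (\<zeta> \<star> a) \<star> v"
      using \<zeta>(2) v(2) mul_assoc[OF \<zeta>(1) a v(1)] by simp
    then have "\<eta> = \<zeta> \<star> a"
      using mul_cancel_right[OF v(1) _ \<eta> za] v_inj by simp
    then show ?thesis
      using \<zeta>(1) by blast
  qed
qed

text \<open>In \<open>a \<star> (\<mu> \<star> \<xi>) = \<delta> \<star> (c \<star> \<xi>)\<close>
  both units and \<open>a\<close> act bijectively in the degrees concerned, hence so does
  \<open>c\<close>. With \<open>a\<close> an identity this makes both legs of a co-angled pair
  quasi-invertible.\<close>

lemma qi_transport:
  assumes "qi L Y a" "unit k D' L \<mu>" "unit k D Y \<delta>" "c \<in> G 0 D' D" "a \<star> \<mu> = \<delta> \<star> c"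
  shows "qi D' D c"
proof (rule qiI[OF assms(4)])
  note a = qi_in[OF assms(1)] and \<mu> = conjunct1[OF unit_in[OF assms(2)]]
    and \<delta> = conjunct1[OF unit_in[OF assms(3)]]
  have e: "a \<star> (\<mu> \<star> \<xi>) = \<delta> \<star> (c \<star> \<xi>)" if "\<xi> \<in> G l X D'" for \<xi> l X
    using mul_assoc[OF a \<mu> that] mul_assoc[OF \<delta> assms(4) that] assms(5) by simp
  show "\<xi> = zer (Suc n) X D'" if \<xi>: "\<xi> \<in> G (Suc n) X D'" "c \<star> \<xi> = zer (Suc n) X D" for X \<xi>
  proof -
    have "X \<in> Ob"
      using G_Ob \<xi> by blast
    then have "a \<star> (\<mu> \<star> \<xi>) = zer (k + Suc n) X Y"
      using e[OF \<xi>(1)] \<xi>(2) mul_zer[OF \<delta>] by simp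
    then have "\<mu> \<star> \<xi> = zer (k + Suc n) X L"
      using qi_left(1)[OF assms(1) _ mul_in[OF \<mu> \<xi>(1)]] by simp
    then show ?thesis
      using unit_inj_left[OF assms(2) \<xi>(1)] by simp
  qed
  show "\<exists>\<xi> \<in> G (Suc n) X D'. \<eta> = c \<star> \<xi>" if \<eta>: "\<eta> \<in> G (Suc n) X D" for X \<eta>
  proof -
    obtain \<theta> where \<theta>: "\<theta> \<in> G (k + Suc n) X L" "\<delta> \<star> \<eta> = a \<star> \<theta>"
      using qi_left(2)[OF assms(1) _ mul_in[OF \<delta> \<eta>]] by auto
    obtain \<xi> where \<xi>: "\<xi> \<in> G (Suc n) X D'" "\<theta> = \<mu> \<star> \<xi>"
      using unit_surj_left[OF assms(2) \<theta>(1)] by auto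
    have c\<xi>: "c \<star> \<xi> \<in> G (Suc n) X D"
      using mul_in[OF assms(4) \<xi>(1)] by simp
    have "\<eta> = c \<star> \<xi>"
      by (rule unit_cancel_left[OF assms(3) \<eta> c\<xi>]) (use \<theta>(2) \<xi>(2) e[OF \<xi>(1)] in simp_all)
    then show ?thesis
      using \<xi>(1) by blast
  qed
qed

lemma qi_unt:
  assumes "X \<in> Ob"
  shows "qi X X (unt X)"
  using unt_left by (intro qiI unt_in[OF assms]) auto

text \<open>\<open>U_ore\<close> is applied to one conflation at a time, and the morphism
  \<open>c1\<close> it returns is carried past the rest of the unit. The second unit demanded by
  \<open>U_ore\<close> is an arbitrary one here.\<close>

lemma unit_ore:
  "unit k D Y \<delta> \<Longrightarrow> a \<in> G 0 L Y \<Longrightarrow>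
    \<exists>D' \<mu>. \<exists>c \<in> G 0 D' D. unit k D' L \<mu> \<and> defl c \<and> a \<star> \<mu> = \<delta> \<star> c"
proof (induction arbitrary: a L rule: unit.induct)
  case (unit_one \<kappa> X Y)
  obtain Z \<kappa>' where "\<kappa>' \<in> U Z L"
    using U_to G_Ob[OF unit_one(2)] by blast
  then show ?case
    using U_ore[OF unit_one(1) _ unit_one(2)] unit.unit_one by blast
next
  case (unit_Suc \<kappa> Z Y k D \<delta>)
  obtain V \<kappa>' where "\<kappa>' \<in> U V L"
    using U_to G_Ob[OF unit_Suc(4)] by blast
  then obtain L' \<mu>1 c1 where 1: "\<mu>1 \<in> U L' L" "c1 \<in> G 0 L' Z" "a \<star> \<mu>1 = \<kappa> \<star> c1"
    using U_ore[OF unit_Suc(1) _ unit_Suc(4)] by blast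
  obtain D' \<mu> c where 2: "c \<in> G 0 D' D" "unit k D' L' \<mu>" "defl c" "c1 \<star> \<mu> = \<delta> \<star> c"
    using unit_Suc.IH[OF 1(2)] by blast
  note \<mu> = conjunct1[OF unit_in[OF 2(2)]] and \<delta> = conjunct1[OF unit_in[OF unit_Suc(2)]]
  have "a \<star> (\<mu>1 \<star> \<mu>) = (\<kappa> \<star> \<delta>) \<star> c"
    using mul_assoc[OF unit_Suc(4) U_in[OF 1(1)] \<mu>] mul_assoc[OF U_in[OF unit_Suc(1)] 1(2) \<mu>]
      mul_assoc[OF U_in[OF unit_Suc(1)] \<delta> 2(1)] 1(3) 2(4) by simp
  then show ?case
    using unit.unit_Suc[OF 1(1) 2(2)] 2(1,3) by blast
qed

text \<open>The heads are joined over a common unit \<open>\<mu>\<close> by \<open>U_ore\<close>,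
  and the tails are transported along its two legs by \<open>unit_ore\<close>. The transported tails
  both begin with \<open>L\<close>, so the induction hypothesis joins them.\<close>

lemma ex_co_angled:
  "unit k D Y \<delta> \<Longrightarrow> unit k D' Y \<delta>' \<Longrightarrow>
    \<exists>L. \<exists>a \<in> G 0 L D. \<exists>b \<in> G 0 L D'. defl a \<and> defl b \<and> \<delta> \<star> a = \<delta>' \<star> b \<and> unit k L Y (\<delta> \<star> a)"
proof (induction k arbitrary: D D' Y \<delta> \<delta>')
  case 0
  then show ?case
    using unit_in by force
next
  case (Suc k)
  show ?case
  proof (cases "k = 0")
    case True
    then have \<kappa>: "\<delta> \<in> U D Y" "\<delta>' \<in> U D' Y"
      using Suc.prems unit_1 by auto
    have Y: "Y \<in> Ob"
      using G_Ob U_in \<kappa> by blast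
    obtain L \<mu> c c' where m: "\<mu> \<in> U L Y" "c \<in> G 0 L D" "c' \<in> G 0 L D'" "defl c" "defl c'"
        "unt Y \<star> \<mu> = \<delta> \<star> c" "\<mu> = \<delta>' \<star> c'"
      using U_ore[OF \<kappa> unt_in[OF Y]] by blast
    have "unt Y \<star> \<mu> = \<mu>"
      using unt_left[OF U_in[OF m(1)]] .
    then show ?thesis
      using m unit_one[OF m(1)] True by (metis One_nat_def)
  next
    case False
    obtain \<kappa> Z \<delta>1 where 1: "\<delta> = \<kappa> \<star> \<delta>1" "\<kappa> \<in> U Z Y" "unit k D Z \<delta>1"
      using unit_SucE[OF Suc.prems(1) False] by metis
    obtain \<kappa>' Z' \<delta>1' where 2: "\<delta>' = \<kappa>' \<star> \<delta>1'" "\<kappa>' \<in> U Z' Y" "unit k D' Z' \<delta>1'"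
      using unit_SucE[OF Suc.prems(2) False] by metis
    note \<kappa> = U_in[OF 1(2)] U_in[OF 2(2)]
    note \<delta> = conjunct1[OF unit_in[OF 1(3)]] conjunct1[OF unit_in[OF 2(3)]]
    have Y: "Y \<in> Ob"
      using G_Ob \<kappa> by blast
    obtain L \<mu> a b where m: "\<mu> \<in> U L Y" "a \<in> G 0 L Z" "b \<in> G 0 L Z'" "\<mu> = \<kappa> \<star> a" "\<mu> = \<kappa>' \<star> b"
      using U_ore[OF 1(2) 2(2) unt_in[OF Y]] unt_left U_in by metis
    obtain E \<nu> c where 3: "c \<in> G 0 E D" "unit k E L \<nu>" "defl c" "a \<star> \<nu> = \<delta>1 \<star> c"
      using unit_ore[OF 1(3) m(2)] by blast
    obtain E' \<nu>' c' where 4: "c' \<in> G 0 E' D'" "unit k E' L \<nu>'" "defl c'" "b \<star> \<nu>' = \<delta>1' \<star> c'"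
      using unit_ore[OF 2(3) m(3)] by blast
    obtain K x x' where 5: "x \<in> G 0 K E" "x' \<in> G 0 K E'" "defl x" "defl x'" "\<nu> \<star> x = \<nu>' \<star> x'"
        "unit k K L (\<nu> \<star> x)"
      using Suc.IH[OF 3(2) 4(2)] by blast
    note \<nu> = conjunct1[OF unit_in[OF 3(2)]] conjunct1[OF unit_in[OF 4(2)]]
    have cx: "c \<star> x \<in> G 0 K D" "c' \<star> x' \<in> G 0 K D'"
      using mul_in[OF 3(1) 5(1)] mul_in[OF 4(1) 5(2)] by auto
    have "\<delta> \<star> (c \<star> x) = \<kappa> \<star> ((\<delta>1 \<star> c) \<star> x)"
      unfolding 1(1) using mul_assoc[OF \<kappa>(1) \<delta>(1) cx(1)] mul_assoc[OF \<delta>(1) 3(1) 5(1)] by simp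
    also have "\<dots> = (\<kappa> \<star> a) \<star> (\<nu> \<star> x)"
      unfolding 3(4)[symmetric] using mul_assoc[OF m(2) \<nu>(1) 5(1)] mul_assoc[OF \<kappa>(1) m(2) mul_in[OF \<nu>(1) 5(1)]]
      by simp
    finally have e: "\<delta> \<star> (c \<star> x) = \<mu> \<star> (\<nu> \<star> x)"
      using m(4) by simp
    have "\<delta>' \<star> (c' \<star> x') = \<kappa>' \<star> ((\<delta>1' \<star> c') \<star> x')"
      unfolding 2(1) using mul_assoc[OF \<kappa>(2) \<delta>(2) cx(2)] mul_assoc[OF \<delta>(2) 4(1) 5(2)] by simp
    also have "\<dots> = (\<kappa>' \<star> b) \<star> (\<nu>' \<star> x')"
      unfolding 4(4)[symmetric] using mul_assoc[OF m(3) \<nu>(2) 5(2)] mul_assoc[OF \<kappa>(2) m(3) mul_in[OF \<nu>(2) 5(2)]]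
      by simp
    finally have "\<delta>' \<star> (c' \<star> x') = \<mu> \<star> (\<nu> \<star> x)"
      using m(5) 5(5) by simp
    then show ?thesis
      using e unit_Suc[OF m(1) 5(6)] cx defl_mul[OF 3(3) 5(3) 3(1) 5(1)] defl_mul[OF 4(3) 5(4) 4(1) 5(2)]
      by (intro exI[of _ K] bexI[of _ "c \<star> x"] bexI[of _ "c' \<star> x'"]) auto
  qed
qed

text \<open>Congruence modulo \<open>Pr\<close>, in a form that avoids inverses.\<close>

definition peq :: "'a \<Rightarrow> 'a \<Rightarrow> 'b \<Rightarrow> 'b \<Rightarrow> bool" where
  "peq X Y a b \<longleftrightarrow> a \<in> G n X Y \<and> b \<in> G n X Y \<and> (\<exists>p \<in> Pr X Y. a = b \<oplus> p)"

text \<open>In degree \<open>n\<close> the kernel of multiplication by a unit is \<open>Pr\<close>;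
  thus congruence becomes an equality one degree higher.\<close>

lemma peq_iff:
  assumes "\<kappa> \<in> U Y Z" "a \<in> G n X Y" "b \<in> G n X Y"
  shows "peq X Y a b \<longleftrightarrow> \<kappa> \<star> a = \<kappa> \<star> b"
proof -
  obtain c where c: "c \<in> G n X Y" "a = b \<oplus> c"
    using ex_diff[OF assms(2,3)] .
  note \<kappa> = U_in[OF assms(1)]
  have "\<kappa> \<star> a = \<kappa> \<star> b \<longleftrightarrow> \<kappa> \<star> c = zer (Suc n) X Z"
    using distrib_left[OF \<kappa> assms(3) c(1)] c(2)
      add_eq_self_iff[OF mul_in[OF \<kappa> assms(3)] mul_in[OF \<kappa> c(1)]] by simp
  also have "\<dots> \<longleftrightarrow> c \<in> Pr X Y"
    using U_ker[OF assms(1) c(1)] .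
  also have "\<dots> \<longleftrightarrow> peq X Y a b"
  proof
    show "peq X Y a b" if "c \<in> Pr X Y"
      using that c assms by (auto simp: peq_def)
    show "c \<in> Pr X Y" if ab: "peq X Y a b"
    proof -
      obtain p where p: "p \<in> Pr X Y" "a = b \<oplus> p"
        using ab by (auto simp: peq_def)
      have "p \<in> G n X Y"
        using p(1) Pr_in by blast
      then have "c = p"
        using add_cancel[OF c(1) _ assms(3)] add_comm[OF assms(3)] c p(2) by metis
      then show ?thesis
        using p by simp
    qed
  qed
  finally show ?thesis
    by simp
qed

text \<open>Multiplication by a unit \<open>\<kappa>\<close> moves \<open>\<theta>\<close> to degree
  \<open>n + 1\<close>, where division by \<open>b\<close> is possible; surjectivity of
  \<open>\<kappa>\<close> brings the quotient back to degree \<open>n\<close>.\<close>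

lemma right_quotient:
  assumes "qi L D b" "\<theta> \<in> G n L Y"
  shows "\<exists>\<epsilon> \<in> G n D Y. peq L Y \<theta> (\<epsilon> \<star> b)"
proof -
  have "Y \<in> Ob"
    using G_Ob assms(2) by blast
  then obtain Z \<kappa> where \<kappa>: "\<kappa> \<in> U Y Z"
    using U_from by blast
  note \<kappa>' = U_in[OF \<kappa>] and b = qi_in[OF assms(1)]
  have "\<kappa> \<star> \<theta> \<in> G (Suc n) L Z"
    using mul_in[OF \<kappa>' assms(2)] by simp
  then obtain \<psi> where \<psi>: "\<psi> \<in> G (Suc n) D Z" "\<kappa> \<star> \<theta> = \<psi> \<star> b"
    using qi_right(2)[OF assms(1) le_refl] by blast
  obtain \<epsilon> where \<epsilon>: "\<epsilon> \<in> G n D Y" "\<psi> = \<kappa> \<star> \<epsilon>"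
    using U_surj_left[OF \<kappa> \<psi>(1)] by blast
  have "\<epsilon> \<star> b \<in> G n L Y"
    using mul_in[OF \<epsilon>(1) b] by simp
  then have "peq L Y \<theta> (\<epsilon> \<star> b)"
    using peq_iff[OF \<kappa> assms(2)] \<psi>(2) \<epsilon>(2) mul_assoc[OF \<kappa>' \<epsilon>(1) b] by simp
  then show ?thesis
    using \<epsilon>(1) by blast
qed

lemma peq_mul_left:
  assumes "peq X Y a b" "\<xi> \<in> G k Y Z" "1 \<le> k"
  shows "\<xi> \<star> a = \<xi> \<star> b"
proof -
  obtain p where p: "p \<in> Pr X Y" "a = b \<oplus> p" and ab: "a \<in> G n X Y" "b \<in> G n X Y"
    using assms(1) by (auto simp: peq_def)
  have "p \<in> G n X Y"
    using p(1) Pr_in by blast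
  then show ?thesis
    using distrib_left[OF assms(2) ab(2)] p(2) Pr_annihilated[OF p(1) assms(2,3)]
      add_zer[OF mul_in[OF assms(2) ab(2)]] by simp
qed

text \<open>All factors of the unit except the one next to \<open>a\<close> and \<open>b\<close> are
  multiplied onto elements of degree above \<open>n\<close> and can be cancelled; the remaining one
  is handled by \<open>peq_iff\<close>.\<close>

lemma peq_unit_cancel:
  assumes "unit k Y Z \<delta>" "a \<in> G n X Y" "b \<in> G n X Y" "\<delta> \<star> a = \<delta> \<star> b"
  shows "peq X Y a b"
  using assms(1)
proof (cases rule: unit.cases)
  case unit_one
  then show ?thesis
    using peq_iff assms(2-4) by blast
next
  case (unit_Suc \<kappa> W l \<delta>')
  have "\<exists>\<mu> V. \<mu> \<in> U Y V \<and> \<mu> \<star> a = \<mu> \<star> b"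
    using assms
  proof (induction rule: unit.induct)
    case (unit_Suc \<kappa> W Z l X' \<delta>)
    note \<delta> = conjunct1[OF unit_in[OF unit_Suc(2)]] and \<kappa> = U_in[OF unit_Suc(1)]
    have "\<kappa> \<star> (\<delta> \<star> a) = \<kappa> \<star> (\<delta> \<star> b)"
      using unit_Suc mul_assoc[OF \<kappa> \<delta>] by simp
    then have "\<delta> \<star> a = \<delta> \<star> b"
      using unit_cancel_left[OF unit_one[OF unit_Suc(1)] mul_in[OF \<delta> unit_Suc(4)] mul_in[OF \<delta> unit_Suc(5)]]
        unit_in[OF unit_Suc(2)] by simp
    then show ?case
      using unit_Suc by blast
  qed blast
  then show ?thesis
    using peq_iff assms(2,3) by blast
qed

end

section \<open>The action of degree n on degree n + 1 given by a unit of length n\<close>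

locale graded_frobenius_unit = graded_frobenius +
  fixes M B :: 'a and d :: 'b
  assumes d_unit: "unit n M B d"
begin

lemma d_in: "d \<in> G n M B" and MB: "M \<in> Ob" "B \<in> Ob"
  using unit_in[OF d_unit] G_Ob by blast+

text \<open>Well defined because right multiplication by \<open>d\<close> is a bijection from degree
  \<open>n + 1\<close> to degree \<open>2 n + 1\<close>.\<close>

definition act :: "'a \<Rightarrow> 'b \<Rightarrow> 'b \<Rightarrow> 'b" where
  "act Y \<gamma> \<xi> = (THE \<zeta>. \<zeta> \<in> G (Suc n) B Y \<and> \<zeta> \<star> d = \<xi> \<star> \<gamma>)"

lemma act:
  assumes "\<gamma> \<in> G n M B" "\<xi> \<in> G (Suc n) B Y"
  shows "act Y \<gamma> \<xi> \<in> G (Suc n) B Y" "act Y \<gamma> \<xi> \<star> d = \<xi> \<star> \<gamma>"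
proof -
  obtain \<zeta> where \<zeta>: "\<zeta> \<in> G (Suc n) B Y" "\<zeta> \<star> d = \<xi> \<star> \<gamma>"
    using unit_surj_right[OF d_unit mul_in[OF assms(2,1)]] by auto
  have "\<exists>!\<zeta>. \<zeta> \<in> G (Suc n) B Y \<and> \<zeta> \<star> d = \<xi> \<star> \<gamma>"
    using \<zeta> unit_cancel_right[OF d_unit, of _ "Suc n" Y] by (intro ex1I[of _ \<zeta>]) auto
  from theI'[OF this, folded act_def] show "act Y \<gamma> \<xi> \<in> G (Suc n) B Y" "act Y \<gamma> \<xi> \<star> d = \<xi> \<star> \<gamma>"
    by auto
qed

lemma act_unique:
  assumes "\<gamma> \<in> G n M B" "\<xi> \<in> G (Suc n) B Y" "\<zeta> \<in> G (Suc n) B Y" "\<zeta> \<star> d = \<xi> \<star> \<gamma>"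
  shows "act Y \<gamma> \<xi> = \<zeta>"
  using unit_cancel_right[OF d_unit act(1)[OF assms(1,2)] assms(3)] act(2)[OF assms(1,2)] assms(4) by simp

lemma act_d: "\<xi> \<in> G (Suc n) B Y \<Longrightarrow> act Y d \<xi> = \<xi>"
  using act_unique d_in by simp

lemma act_add:
  assumes "\<gamma> \<in> G n M B" "\<gamma>' \<in> G n M B" "\<xi> \<in> G (Suc n) B Y"
  shows "act Y (\<gamma> \<oplus> \<gamma>') \<xi> = act Y \<gamma> \<xi> \<oplus> act Y \<gamma>' \<xi>"
proof (rule act_unique[OF add_in[OF assms(1,2)] assms(3)])
  note a = act[OF assms(1,3)] act[OF assms(2,3)]
  show "act Y \<gamma> \<xi> \<oplus> act Y \<gamma>' \<xi> \<in> G (Suc n) B Y"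
    using add_in a by blast
  show "(act Y \<gamma> \<xi> \<oplus> act Y \<gamma>' \<xi>) \<star> d = \<xi> \<star> (\<gamma> \<oplus> \<gamma>')"
    using distrib_right[OF a(1,3) d_in] distrib_left[OF assms(3,1,2)] a by simp
qed

lemma act_add_right:
  assumes "\<gamma> \<in> G n M B" "\<xi> \<in> G (Suc n) B Y" "\<xi>' \<in> G (Suc n) B Y"
  shows "act Y \<gamma> (\<xi> \<oplus> \<xi>') = act Y \<gamma> \<xi> \<oplus> act Y \<gamma> \<xi>'"
proof (rule act_unique[OF assms(1) add_in[OF assms(2,3)]])
  note a = act[OF assms(1,2)] act[OF assms(1,3)]
  show "act Y \<gamma> \<xi> \<oplus> act Y \<gamma> \<xi>' \<in> G (Suc n) B Y"
    using add_in a by blast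
  show "(act Y \<gamma> \<xi> \<oplus> act Y \<gamma> \<xi>') \<star> d = (\<xi> \<oplus> \<xi>') \<star> \<gamma>"
    using distrib_right[OF a(1,3) d_in] distrib_right[OF assms(2,3,1)] a by simp
qed

text \<open>For this object the unit \<open>u\<close> is itself one of the elements acted upon, and
  equal action on \<open>u\<close> alone forces congruence by
  \<open>peq_unit_cancel\<close>.\<close>

definition faithful :: 'a where
  "faithful = (SOME Y. \<exists>u. unit (Suc n) B Y u)"

lemma act_eq_iff:
  assumes "\<gamma> \<in> G n M B" "\<gamma>' \<in> G n M B"
  shows "peq M B \<gamma> \<gamma>' \<longleftrightarrow> (\<forall>\<xi> \<in> G (Suc n) B faithful. act faithful \<gamma> \<xi> = act faithful \<gamma>' \<xi>)"
proof
  assume p: "peq M B \<gamma> \<gamma>'"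
  show "\<forall>\<xi> \<in> G (Suc n) B faithful. act faithful \<gamma> \<xi> = act faithful \<gamma>' \<xi>"
  proof
    fix \<xi> assume \<xi>: "\<xi> \<in> G (Suc n) B faithful"
    show "act faithful \<gamma> \<xi> = act faithful \<gamma>' \<xi>"
      using act_unique[OF assms(1) \<xi> act(1)[OF assms(2) \<xi>]] act(2)[OF assms(2) \<xi>] peq_mul_left[OF p \<xi>] by simp
  qed
next
  assume h: "\<forall>\<xi> \<in> G (Suc n) B faithful. act faithful \<gamma> \<xi> = act faithful \<gamma>' \<xi>"
  obtain u where u: "unit (Suc n) B faithful u"
    using someI_ex[of "\<lambda>Y. \<exists>u. unit (Suc n) B Y u"] ex_unit_from[of "Suc n" B] MB
    unfolding faithful_def by auto
  note ui = conjunct1[OF unit_in[OF u]]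
  have "u \<star> \<gamma> = u \<star> \<gamma>'"
    using h ui act(2)[OF assms(1) ui] act(2)[OF assms(2) ui] by metis
  then show "peq M B \<gamma> \<gamma>'"
    using peq_unit_cancel[OF u assms] by simp
qed

text \<open>One value of the product before passing to classes, for one admissible choice of
  factorization, co-angled pair and quotient. Independence of these choices will follow from
  \<open>comp_act\<close>.\<close>

definition comp_rel :: "'b \<Rightarrow> 'b \<Rightarrow> 'b \<Rightarrow> bool" where
  "comp_rel \<beta> \<gamma> z \<longleftrightarrow> (\<exists>\<delta> D f L a b \<epsilon>. unit n D B \<delta> \<and> f \<in> G 0 M D \<and> \<gamma> = \<delta> \<star> f \<and>
     a \<in> G 0 L M \<and> b \<in> G 0 L D \<and> defl a \<and> defl b \<and> qi L M a \<and> qi L D b \<and>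
     d \<star> a = \<delta> \<star> b \<and> unit n L B (d \<star> a) \<and> \<epsilon> \<in> G n D B \<and> peq L B (\<beta> \<star> a) (\<epsilon> \<star> b) \<and> z = \<epsilon> \<star> f)"

lemma ex_comp:
  assumes "\<beta> \<in> G n M B" "\<gamma> \<in> G n M B"
  shows "\<exists>z. comp_rel \<beta> \<gamma> z"
proof -
  obtain D \<delta> f where f: "f \<in> G 0 M D" "unit n D B \<delta>" "\<gamma> = \<delta> \<star> f"
    using unit_factor[OF n_pos assms(2)] by blast
  obtain L a b where ab: "a \<in> G 0 L M" "b \<in> G 0 L D" "defl a" "defl b" "d \<star> a = \<delta> \<star> b" "unit n L B (d \<star> a)"
    using ex_co_angled[OF d_unit f(2)] by blast
  have e: "unt B \<star> (d \<star> a) = d \<star> a"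
    using unt_left[OF conjunct1[OF unit_in[OF ab(6)]]] .
  have qi: "qi L M a" "qi L D b"
    using qi_transport[OF qi_unt[OF MB(2)] ab(6) d_unit ab(1)] qi_transport[OF qi_unt[OF MB(2)] ab(6) f(2) ab(2)]
      e ab(5) by simp_all
  have "\<beta> \<star> a \<in> G n L B"
    using mul_in[OF assms(1) ab(1)] by simp
  then obtain \<epsilon> where "\<epsilon> \<in> G n D B" "peq L B (\<beta> \<star> a) (\<epsilon> \<star> b)"
    using right_quotient[OF qi(2)] by blast
  then show ?thesis
    unfolding comp_rel_def using f ab qi by blast
qed

text \<open>With \<open>\<zeta> = act Y \<beta> \<xi>\<close>, both
  \<open>\<xi> \<star> \<epsilon>\<close> and \<open>\<zeta> \<star> \<delta>\<close> become
  \<open>\<xi> \<star> (\<beta> \<star> a)\<close> after multiplication by \<open>b\<close>.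
  Cancelling \<open>b\<close> in degree \<open>2 n + 1\<close> and multiplying by \<open>f\<close>
  gives \<open>\<xi> \<star> z = \<zeta> \<star> \<gamma>\<close>. The maps compose in reversed
  order because this is a right action.\<close>

lemma comp_act:
  assumes "comp_rel \<beta> \<gamma> z" "\<beta> \<in> G n M B"
  shows "z \<in> G n M B" "\<gamma> \<in> G n M B"
    "\<xi> \<in> G (Suc n) B Y \<Longrightarrow> act Y z \<xi> = act Y \<gamma> (act Y \<beta> \<xi>)"
proof -
  obtain \<delta> D f L a b \<epsilon> where \<delta>: "unit n D B \<delta>" "f \<in> G 0 M D" "\<gamma> = \<delta> \<star> f"
    and ab: "a \<in> G 0 L M" "b \<in> G 0 L D" "qi L D b" "d \<star> a = \<delta> \<star> b"
    and \<epsilon>: "\<epsilon> \<in> G n D B" "peq L B (\<beta> \<star> a) (\<epsilon> \<star> b)" "z = \<epsilon> \<star> f"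
    using assms(1) unfolding comp_rel_def by blast
  note \<delta>i = conjunct1[OF unit_in[OF \<delta>(1)]]
  show z: "z \<in> G n M B" and \<gamma>: "\<gamma> \<in> G n M B"
    using mul_in[OF \<epsilon>(1) \<delta>(2)] mul_in[OF \<delta>i \<delta>(2)] \<epsilon>(3) \<delta>(3) by simp_all
  assume \<xi>: "\<xi> \<in> G (Suc n) B Y"
  define \<zeta> where "\<zeta> = act Y \<beta> \<xi>"
  have \<zeta>: "\<zeta> \<in> G (Suc n) B Y" "\<zeta> \<star> d = \<xi> \<star> \<beta>"
    using act[OF assms(2) \<xi>] by (simp_all add: \<zeta>_def)
  have "(\<xi> \<star> \<epsilon>) \<star> b = \<xi> \<star> (\<beta> \<star> a)"
    using mul_assoc[OF \<xi> \<epsilon>(1) ab(2)] peq_mul_left[OF \<epsilon>(2) \<xi>] by simp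
  also have "\<dots> = \<zeta> \<star> (d \<star> a)"
    using mul_assoc[OF \<xi> assms(2) ab(1)] mul_assoc[OF \<zeta>(1) d_in ab(1)] \<zeta>(2) by simp
  also have "\<dots> = (\<zeta> \<star> \<delta>) \<star> b"
    unfolding ab(4) using mul_assoc[OF \<zeta>(1) \<delta>i ab(2)] by simp
  finally have "\<xi> \<star> \<epsilon> = \<zeta> \<star> \<delta>"
    using mul_cancel_right[OF ab(2) _ mul_in[OF \<xi> \<epsilon>(1)] mul_in[OF \<zeta>(1) \<delta>i]]
      qi_right(1)[OF ab(3), of "Suc n + n"] by simp
  then have "\<xi> \<star> z = \<zeta> \<star> \<gamma>"
    unfolding \<epsilon>(3) \<delta>(3) using mul_assoc[OF \<xi> \<epsilon>(1) \<delta>(2)] mul_assoc[OF \<zeta>(1) \<delta>i \<delta>(2)] by simp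
  then show "act Y z \<xi> = act Y \<gamma> (act Y \<beta> \<xi>)"
    using act_unique[OF z \<xi> act(1)[OF \<gamma> \<zeta>(1)]] act(2)[OF \<gamma> \<zeta>(1)] by (simp add: \<zeta>_def)
qed

text \<open>A product whose right factor is \<open>d f\<close> is computed with \<open>\<delta> = d\<close> and \<open>a = b = 1\<close>.\<close>

lemma comp_d:
  assumes "\<beta> \<in> G n M B" "f \<in> G 0 M M" "defl (unt M)"
  shows "comp_rel \<beta> (d \<star> f) (\<beta> \<star> f)"
proof -
  have "peq M B (\<beta> \<star> unt M) (\<beta> \<star> unt M)"
    using peq_iff U_from[OF MB(2)] unt_right[OF assms(1)] assms(1) by metis
  then show ?thesis
    unfolding comp_rel_def using d_unit assms qi_unt[OF MB(1)] unt_in[OF MB(1)] unt_right[OF d_in] by metis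
qed

text \<open>The first part divides \<open>d\<close> by \<open>f\<close> modulo \<open>Pr\<close>;
  the second cancels \<open>f\<close> and then \<open>d\<close>, both from the right in degrees
  above \<open>n\<close>.\<close>

lemma qi_inverse:
  assumes "qi M M f"
  shows "\<exists>\<epsilon> \<in> G n M B. peq M B d (\<epsilon> \<star> f)"
    and "\<xi> \<in> G (Suc n) B Y \<Longrightarrow> \<xi>' \<in> G (Suc n) B Y \<Longrightarrow> act Y (d \<star> f) \<xi> = act Y (d \<star> f) \<xi>' \<Longrightarrow> \<xi> = \<xi>'"
proof -
  note f = qi_in[OF assms]
  show "\<exists>\<epsilon> \<in> G n M B. peq M B d (\<epsilon> \<star> f)"
    using right_quotient[OF assms d_in] .
  assume \<xi>: "\<xi> \<in> G (Suc n) B Y" "\<xi>' \<in> G (Suc n) B Y" and e: "act Y (d \<star> f) \<xi> = act Y (d \<star> f) \<xi>'"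
  have df: "d \<star> f \<in> G n M B"
    using mul_in[OF d_in f] by simp
  have "(\<xi> \<star> d) \<star> f = (\<xi>' \<star> d) \<star> f"
    using act(2)[OF df \<xi>(1)] act(2)[OF df \<xi>(2)] e mul_assoc[OF \<xi>(1) d_in f] mul_assoc[OF \<xi>(2) d_in f] by simp
  then have "\<xi> \<star> d = \<xi>' \<star> d"
    using mul_cancel_right[OF f _ mul_in[OF \<xi>(1) d_in] mul_in[OF \<xi>(2) d_in]]
      qi_right(1)[OF assms, of "Suc n + n"] by simp
  then show "\<xi> = \<xi>'"
    using unit_cancel_right[OF d_unit \<xi>] by simp
qed

end

section \<open>Ext groups of an exact category\<close>

context extension_closed_subcategory
begin

lemma Inr_gr: "t \<noteq> 0 \<Longrightarrow> Inr \<gamma> \<in> gr t X Y \<longleftrightarrow> \<gamma> \<in> Ext t X Y"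
  using Ext_C[of \<gamma> t X Y] by (auto simp: gr_def)

lemma Inl_gr: "Inl f \<in> gr 0 X Y \<longleftrightarrow> f \<in> Hom A X Y \<and> X \<in> C \<and> Y \<in> C"
  by (auto simp: gr_def)

lemma gr_Ext:
  assumes "a \<in> gr t X Y" "t \<noteq> 0"
  obtains \<gamma> where "a = Inr \<gamma>" "\<gamma> \<in> Ext t X Y"
  using assms by (auto simp: gr_def split: if_splits)

lemma Ext_group_simps:
  "carrier (Ext_group t X Y) = Ext t X Y"
  "\<gamma> \<in> Ext t X Y \<Longrightarrow> \<eta> \<in> Ext t X Y \<Longrightarrow> Inr (\<gamma> \<otimes>\<^bsub>Ext_group t X Y\<^esub> \<eta>) = gadd (Inr \<gamma>) (Inr \<eta>)"
  "X \<in> C \<Longrightarrow> Y \<in> C \<Longrightarrow> t \<noteq> 0 \<Longrightarrow> Inr \<one>\<^bsub>Ext_group t X Y\<^esub> = gzero t X Y"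
  using gadd_Inr extn_class_cls[OF zero_extn_extns] by (auto simp: Ext_group_def gzero_def)

text \<open>The laws of \<open>gadd\<close> are carried over along the injection
  \<open>Inr\<close>.\<close>

lemma Ext_comm_group:
  assumes "X \<in> C" "Y \<in> C" "t \<noteq> 0"
  shows "comm_group (Ext_group t X Y)"
proof -
  interpret g: graded_category C gr gmul gadd gzero gid
    by (rule graded_category_gr)
  note s = Ext_group_simps[where t = t and X = X and Y = Y]
  note i = Inr_gr[OF assms(3), of _ X Y]
  let ?E = "Ext_group t X Y"
  have cl: "\<gamma> \<otimes>\<^bsub>?E\<^esub> \<eta> \<in> Ext t X Y" if "\<gamma> \<in> Ext t X Y" "\<eta> \<in> Ext t X Y" for \<gamma> \<eta>
    using g.add_in[of "Inr \<gamma>" t X Y "Inr \<eta>"] s(2) i that by metis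
  have one: "\<one>\<^bsub>?E\<^esub> \<in> Ext t X Y"
    using gzero_in[OF assms(1,2), of t] s(3)[OF assms] i by metis
  show ?thesis
  proof (rule comm_groupI)
    show "\<gamma> \<otimes>\<^bsub>?E\<^esub> \<eta> \<in> carrier ?E" if "\<gamma> \<in> carrier ?E" "\<eta> \<in> carrier ?E" for \<gamma> \<eta>
      using cl that s(1) by simp
    show "\<one>\<^bsub>?E\<^esub> \<in> carrier ?E"
      using one s(1) by simp
    show "\<gamma> \<otimes>\<^bsub>?E\<^esub> \<eta> \<otimes>\<^bsub>?E\<^esub> \<zeta> = \<gamma> \<otimes>\<^bsub>?E\<^esub> (\<eta> \<otimes>\<^bsub>?E\<^esub> \<zeta>)"
      if "\<gamma> \<in> carrier ?E" "\<eta> \<in> carrier ?E" "\<zeta> \<in> carrier ?E" for \<gamma> \<eta> \<zeta>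
    proof -
      have h: "\<gamma> \<in> Ext t X Y" "\<eta> \<in> Ext t X Y" "\<zeta> \<in> Ext t X Y"
        using that s(1) by auto
      have "Inr (\<gamma> \<otimes>\<^bsub>?E\<^esub> \<eta> \<otimes>\<^bsub>?E\<^esub> \<zeta>) = gadd (gadd (Inr \<gamma>) (Inr \<eta>)) (Inr \<zeta>)"
        using s(2)[OF cl[OF h(1,2)] h(3)] s(2)[OF h(1,2)] by simp
      also have "\<dots> = Inr (\<gamma> \<otimes>\<^bsub>?E\<^esub> (\<eta> \<otimes>\<^bsub>?E\<^esub> \<zeta>))"
        using s(2)[OF h(1) cl[OF h(2,3)]] s(2)[OF h(2,3)] g.add_assoc[of "Inr \<gamma>" t X Y "Inr \<eta>" "Inr \<zeta>"] h i
        by simp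
      finally show ?thesis
        by simp
    qed
    show "\<gamma> \<otimes>\<^bsub>?E\<^esub> \<eta> = \<eta> \<otimes>\<^bsub>?E\<^esub> \<gamma>" if "\<gamma> \<in> carrier ?E" "\<eta> \<in> carrier ?E" for \<gamma> \<eta>
    proof -
      have h: "\<gamma> \<in> Ext t X Y" "\<eta> \<in> Ext t X Y"
        using that s(1) by auto
      have "gadd (Inr \<gamma>) (Inr \<eta>) = gadd (Inr \<eta>) (Inr \<gamma>)"
        using g.add_comm[of "Inr \<gamma>" t X Y "Inr \<eta>"] h i by blast
      then have "(Inr (\<gamma> \<otimes>\<^bsub>?E\<^esub> \<eta>) :: 'b + 'b extn set) = Inr (\<eta> \<otimes>\<^bsub>?E\<^esub> \<gamma>)"
        unfolding s(2)[OF h] s(2)[OF h(2,1)] .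
      then show ?thesis
        by simp
    qed
    show "\<one>\<^bsub>?E\<^esub> \<otimes>\<^bsub>?E\<^esub> \<gamma> = \<gamma>" if "\<gamma> \<in> carrier ?E" for \<gamma>
    proof -
      have h: "\<gamma> \<in> Ext t X Y"
        using that s(1) by auto
      have "gadd (gzero t X Y) (Inr \<gamma>) = Inr \<gamma>"
        using g.add_comm[of "gzero t X Y" t X Y "Inr \<gamma>"] g.add_zer[of "Inr \<gamma>" t X Y]
          gzero_in[OF assms(1,2)] h i by simp
      then have "(Inr (\<one>\<^bsub>?E\<^esub> \<otimes>\<^bsub>?E\<^esub> \<gamma>) :: 'b + 'b extn set) = Inr \<gamma>"
        unfolding s(2)[OF one h] s(3)[OF assms] .
      then show ?thesis
        by simp
    qed
    show "\<exists>\<eta> \<in> carrier ?E. \<eta> \<otimes>\<^bsub>?E\<^esub> \<gamma> = \<one>\<^bsub>?E\<^esub>" if "\<gamma> \<in> carrier ?E" for \<gamma>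
    proof -
      have h: "\<gamma> \<in> Ext t X Y"
        using that s(1) by auto
      then obtain b where b: "b \<in> gr t X Y" "gadd (Inr \<gamma>) b = gzero t X Y"
        using g.ex_neg[of "Inr \<gamma>" t X Y] i by auto
      obtain \<eta> where \<eta>: "b = Inr \<eta>" "\<eta> \<in> Ext t X Y"
        using gr_Ext[OF b(1) assms(3)] .
      have "gadd (Inr \<eta>) (Inr \<gamma>) = gzero t X Y"
        using g.add_comm[of "Inr \<gamma>" t X Y "Inr \<eta>"] h i \<eta> b by simp
      then have "(Inr (\<eta> \<otimes>\<^bsub>?E\<^esub> \<gamma>) :: 'b + 'b extn set) = Inr \<one>\<^bsub>?E\<^esub>"
        unfolding s(2)[OF \<eta>(2) h] s(3)[OF assms] .
      then show ?thesis
        using \<eta>(2) s(1) by auto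
    qed
  qed
qed

lemma n_projective_iff:
  "n_projective n P \<longleftrightarrow> P \<in> C \<and> (\<forall>i Y. \<forall>a \<in> gr i P Y. n < i \<longrightarrow> a = gzero i P Y)"
proof (cases "P \<in> C")
  case True
  have "Ext i P Y = {\<one>\<^bsub>Ext_group i P Y\<^esub>} \<longleftrightarrow> (\<forall>a \<in> gr i P Y. a = gzero i P Y)" if "n < i" "Y \<in> C" for i Y
  proof -
    have o: "Inr \<one>\<^bsub>Ext_group i P Y\<^esub> = gzero i P Y"
      using Ext_group_simps(3)[OF True that(2), of i] that(1) by simp
    then have "\<one>\<^bsub>Ext_group i P Y\<^esub> \<in> Ext i P Y"
      using gzero_in[OF True that(2), of i] Inr_gr[of i _ P Y] that(1) by (metis less_nat_zero_code)
    then show ?thesis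
      unfolding o[symmetric] using True that by (auto simp: gr_def)
  qed
  then have "n_projective n P \<longleftrightarrow> (\<forall>i > n. \<forall>Y \<in> C. \<forall>a \<in> gr i P Y. a = gzero i P Y)"
    unfolding n_projective_def using True by simp
  moreover have "Y \<in> C" if "a \<in> gr i P Y" for a i Y
    using gr_C[OF that] by simp
  ultimately show ?thesis
    using True by auto
qed (simp add: n_projective_def)

lemma n_injective_iff:
  "n_injective n P \<longleftrightarrow> P \<in> C \<and> (\<forall>i Y. \<forall>a \<in> gr i Y P. n < i \<longrightarrow> a = gzero i Y P)"
proof (cases "P \<in> C")
  case True
  have "Ext i Y P = {\<one>\<^bsub>Ext_group i Y P\<^esub>} \<longleftrightarrow> (\<forall>a \<in> gr i Y P. a = gzero i Y P)" if "n < i" "Y \<in> C" for i Y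
  proof -
    have o: "Inr \<one>\<^bsub>Ext_group i Y P\<^esub> = gzero i Y P"
      using Ext_group_simps(3)[OF that(2) True, of i] that(1) by simp
    then have "\<one>\<^bsub>Ext_group i Y P\<^esub> \<in> Ext i Y P"
      using gzero_in[OF that(2) True, of i] Inr_gr[of i _ Y P] that(1) by (metis less_nat_zero_code)
    then show ?thesis
      unfolding o[symmetric] using True that by (auto simp: gr_def)
  qed
  then have "n_injective n P \<longleftrightarrow> (\<forall>i > n. \<forall>Y \<in> C. \<forall>a \<in> gr i Y P. a = gzero i Y P)"
    unfolding n_injective_def using True by simp
  moreover have "Y \<in> C" if "a \<in> gr i Y P" for a i Y
    using gr_C[OF that] by simp
  ultimately show ?thesis
    using True by auto
qed (simp add: n_injective_def)

lemmas connecting_exact = graded_exact.connecting_exact[OF graded_exact_gr]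
lemmas exact_connecting = graded_exact.exact_connecting[OF graded_exact_gr]
lemmas connecting_exact_op = graded_exact.connecting_exact[OF graded_exact_op]
lemmas exact_connecting_op = graded_exact.exact_connecting[OF graded_exact_op]
lemmas middle_exact_op = graded_exact.middle_exact[OF graded_exact_op]

text \<open>An element over \<open>W\<close> restricts to zero on \<open>P\<close>, so by
  contravariant exactness it comes from \<open>Q\<close>, where it vanishes too.\<close>

lemma n_projective_biproduct:
  assumes "is_biproduct P Q W i j p q" "n_projective n P" "n_projective n Q"
  shows "n_projective n W"
proof -
  interpret g: graded_category C gr gmul gadd gzero gid
    by (rule graded_category_gr)
  have C: "P \<in> C" "Q \<in> C"
    using assms by (auto simp: n_projective_iff)
  note c = biproduct_C[OF assms(1) C]
  note b = is_biproduct_simps[OF assms(1)]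
  have gc: "gconf P W Q (Inl i) (Inl q) (Inr (cls [(i, q)]))"
    using gconf_single[of "(i, q)"] c b by (simp add: confl_def)
  note m = gconf_in[OF gc]
  have "a = gzero t W Y" if a: "a \<in> gr t W Y" "n < t" for a t Y
  proof -
    have "a \<star> Inl i \<in> gr t P Y"
      using g.mul_in[OF a(1)] m by fastforce
    then have "a \<star> Inl i = gzero t P Y"
      using assms(2) a(2) by (auto simp: n_projective_iff)
    then obtain e where e: "e \<in> gr t Q Y" "a = e \<star> Inl q"
      using middle_exact_op[OF gc a(1)] a(2) by auto
    then have "e = gzero t Q Y"
      using assms(3) a(2) by (auto simp: n_projective_iff)
    then show ?thesis
      using g.zer_mul[of "Inl q" 0 W Q Y t] e m gr_C[OF a(1)] by simp
  qed
  then show ?thesis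
    using c(3) by (auto simp: n_projective_iff)
qed

lemma short_exact_iso:
  assumes "short_exact i p" "t \<in> Mor A" "s \<in> Mor A" "tgt A t = tgt A i" "src A s = tgt A i" "tgt A s = src A t"
    "s \<cdot> t = idm A (src A t)" "t \<cdot> s = idm A (tgt A i)"
  shows "short_exact (s \<cdot> i) (p \<cdot> t)"
proof -
  note [simp] = short_exact_simps(1-3)[OF assms(1)] assms(2-6)
  have "epic (t \<cdot> s)"
    unfolding assms(8) by (rule epicI) simp_all
  then have "epic t"
    by (rule epic_factor) simp_all
  then have ep: "epic (p \<cdot> t)"
    by (rule epic_cmp[OF short_exact_simps(6)[OF assms(1)]]) simp
  have ts: "t \<cdot> (s \<cdot> x) = x" if "x \<in> Mor A" "tgt A x = tgt A i" for x
    using cmp_reassoc[OF assms(8), of x] that by simp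
  have "monic (t \<cdot> s)"
    unfolding assms(8) by (rule monicI) simp_all
  then have "monic s"
    by (rule monic_factor) simp_all
  have "is_kernel (s \<cdot> i) (p \<cdot> t)"
  proof (rule is_kernelI)
    show "monic (s \<cdot> i)"
      by (rule monic_cmp[OF short_exact_simps(5)[OF assms(1)] \<open>monic s\<close>]) simp
    show "(p \<cdot> t) \<cdot> (s \<cdot> i) = zrm A (src A (s \<cdot> i)) (tgt A (p \<cdot> t))"
      using ts[of i] short_exact_simps(4)[OF assms(1)] by simp
    fix x assume x: "x \<in> Mor A" "tgt A x = src A (p \<cdot> t)" "(p \<cdot> t) \<cdot> x = zrm A (src A x) (tgt A (p \<cdot> t))"
    then obtain y where y: "y \<in> Mor A" "src A y = src A x" "tgt A y = src A i" "i \<cdot> y = t \<cdot> x"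
      using short_exact_lift[OF assms(1), of "t \<cdot> x"] by auto
    have "(s \<cdot> i) \<cdot> y = x"
      using y x cmp_reassoc[OF assms(7), of x] by simp
    then show "\<exists>h\<in>Mor A. src A h = src A x \<and> tgt A h = src A (s \<cdot> i) \<and> (s \<cdot> i) \<cdot> h = x"
      using y by (intro bexI[of _ y]) simp_all
  qed simp_all
  then show ?thesis
    by (rule epic_kernel_short_exact[OF ep])
qed

text \<open>The inflation is \<open>m = (q, j a)\<close> into the biproduct of the two middle terms.
  Its cokernel is the push-out of \<open>q\<close> along \<open>-(j a)\<close>, so the kernel of
  \<open>e'\<close> is the middle term of \<open>(j, r)\<close>. To see that the kernel of
  \<open>e\<close> lies in \<open>C\<close>, the same cokernel is rebuilt by two push-outs: of
  \<open>q\<close> along \<open>a\<close>, then of \<open>j\<close> along the inflation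
  obtained.\<close>

lemma ex_ore_square:
  assumes c: "conflation j r" "conflation q s" and a: "a \<in> Mor A" "src A a = src A q" "tgt A a = src A j"
  obtains W x y x' y' m d e e' where "is_biproduct (tgt A q) (tgt A j) W x y x' y'" "conflation m d"
    "tgt A m = W" "deflation e" "deflation e'" "cmap a e (m, d) (j, r)" "cmap (idm A (src A q)) e' (m, d) (q, s)"
proof -
  note [simp] = conflation_simps(2-4,6-)[OF c(1)] conflation_simps(2-4,6-)[OF c(2)] a
  \<comment> \<open>\<open>ex_pushout\<close> negates its second component, so this sign cancels and
    \<open>m\<close> has components \<open>q\<close> and \<open>j a\<close>.\<close>
  let ?g = "negm (j \<cdot> a)"
  obtain W x y x' y' m d u k p' where bp: "is_biproduct (tgt A q) (tgt A j) W x y x' y'"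
    and m: "m = x \<cdot> q \<boxplus> y \<cdot> negm ?g" and md: "short_exact m d" and uk: "u = d \<cdot> x" "k = d \<cdot> y"
    and po: "is_pushout q ?g u k" and kp: "short_exact k p'" "p' \<cdot> u = s" "tgt A p' = tgt A s"
    using ex_pushout[OF conflation_simps(1)[OF c(2)], of ?g] by (simp, metis)
  note [simp] = is_biproduct_simps[OF bp]
  have [simp]: "d \<in> Mor A" "src A d = W" "m \<in> Mor A" "tgt A m = W" "src A m = src A q"
    using short_exact_simps[OF md] by (simp_all add: m)
  have uks: "u \<in> Mor A" "src A u = tgt A q" "k \<in> Mor A" "src A k = tgt A j" "tgt A u = tgt A d" "tgt A k = tgt A d"
    by (simp_all add: uk)
  note [simp] = uks short_exact_simps(1-3)[OF kp(1)]
  have xm: "x' \<cdot> m = q" "y' \<cdot> m = j \<cdot> a"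
    by (simp_all add: m cmp_addm)
  have p'k: "p' \<cdot> k = zrm A (tgt A j) (tgt A s)"
    using short_exact_simps(4)[OF kp(1)] kp(3) by simp
  have ck: "conflation k p'"
    by (rule conflationI[OF kp(1)]) (simp_all add: kp(3))
  have Cd: "tgt A d \<in> C"
    using conflation_simps(7)[OF ck] by simp
  have cm: "conflation m d"
    by (rule conflationI[OF md]) (simp_all add: Cd)
  have p'd: "s \<cdot> x' = p' \<cdot> d"
  proof (rule biproduct_eqI(2)[OF bp])
    show "(s \<cdot> x') \<cdot> x = (p' \<cdot> d) \<cdot> x" "(s \<cdot> x') \<cdot> y = (p' \<cdot> d) \<cdot> y"
      using kp(2) p'k by (simp_all add: uk)
  qed (use kp(3) in simp_all)
  have ce': "cmap (idm A (src A q)) p' (m, d) (q, s)"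
    by (rule cmapI[OF cm c(2), of _ x']) (use kp(3) xm p'd in simp_all)
  \<comment> \<open>The middle term of \<open>f\<close> is an extension of \<open>tgt A s\<close> by
    \<open>src A j\<close>, hence in \<open>C\<close>; it becomes the kernel of
    \<open>e\<close>.\<close>
  obtain f where f: "pushes a (q, s) f"
    by (rule ex_pushes[of "(q, s)" a]) (use c in \<open>auto simp: confl_def\<close>)
  obtain z where z: "is_pushout q a z (fst f)"
    using f by (auto simp: pushes_def)
  have cf: "cmap a (idm A (tgt A s)) (q, s) f"
    using pushes_cmap[OF f] c by (simp add: confl_def)
  note zs = pushout_simps[OF z]
  have lf: "lft f = src A j"
    using cmap_ends(5)[OF cf] by simp
  have fC: "tgt A (fst f) \<in> C"
    using confl_ends(6)[OF cmap_ends(2)[OF cf]] .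
  have g: "fst f \<in> Mor A" "src A (fst f) = lft (j, r)" "tgt A (fst f) \<in> C"
    using confl_ends[OF cmap_ends(2)[OF cf]] lf by auto
  obtain h where h: "pushes (fst f) (j, r) h"
    by (rule ex_pushes[of "(j, r)" "fst f"]) (use g c in \<open>auto simp: confl_def\<close>)
  obtain w where w: "is_pushout j (fst f) w (fst h)" "snd h \<cdot> w = r" "tgt A (snd h) = tgt A r"
      "snd h \<cdot> fst h = zrm A (tgt A (fst f)) (tgt A r)"
    using h by (auto simp: pushes_def)
  have ch: "confl h"
    using cmap_ends(2)[OF pushes_cmap[OF h]] c fC by (simp add: confl_def)
  note ws = pushout_simps[OF w(1)]
  note hs = confl_ends[OF ch]
  have [simp]: "z \<in> Mor A" "src A z = tgt A q" "tgt A z = tgt A (fst f)" "fst f \<in> Mor A" "lft f = src A j"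
    "w \<in> Mor A" "src A w = tgt A j" "tgt A w = tgt A (fst h)" "fst h \<in> Mor A" "lft h = tgt A (fst f)"
    "snd h \<in> Mor A" "src A (snd h) = tgt A (fst h)"
    using zs ws hs lf by simp_all
  \<comment> \<open>\<open>t\<close> and the later \<open>l\<close> are inverse comparisons between
    the two constructions of the cokernel. The minus sign on \<open>u\<close> compensates for the
    negated \<open>j a\<close> in the first push-out.\<close>
  obtain t where t [simp]: "t \<in> Mor A" "src A t = tgt A d" "tgt A t = tgt A (fst h)"
    and tu: "t \<cdot> u = negm (fst h \<cdot> z)" and tk: "t \<cdot> k = w"
  proof (rule pushout_colift[OF po, of "negm (fst h \<cdot> z)" w])
    have "w \<cdot> (j \<cdot> a) = fst h \<cdot> (z \<cdot> q)"
      using cmp_reassoc[OF ws(9), of a] zs(9) by simp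
    then show "negm (fst h \<cdot> z) \<cdot> q = w \<cdot> ?g"
      by (simp add: negm_cmp)
  qed (use that in auto)
  obtain v where v [simp]: "v \<in> Mor A" "src A v = tgt A (fst f)" "tgt A v = tgt A d"
    and vz: "v \<cdot> z = negm u" and vf: "v \<cdot> fst f = k \<cdot> j"
  proof (rule pushout_colift[OF z, of "negm u" "k \<cdot> j"])
    have "u \<cdot> q = negm (k \<cdot> (j \<cdot> a))"
      using pushout_simps(9)[OF po] by (simp add: negm_cmp)
    then show "negm u \<cdot> q = (k \<cdot> j) \<cdot> a"
      by (simp add: negm_cmp)
  qed (use that in auto)
  obtain l where l [simp]: "l \<in> Mor A" "src A l = tgt A (fst h)" "tgt A l = tgt A d"
    and lw: "l \<cdot> w = k" and lh: "l \<cdot> fst h = v"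
    by (rule pushout_colift[OF w(1), of k v]) (use vf in auto)
  have "l \<cdot> t = idm A (tgt A d)"
  proof (rule pushout_unique[OF po])
    have "l \<cdot> (fst h \<cdot> z) = v \<cdot> z"
      using cmp_reassoc[OF lh, of z] by simp
    then show "(l \<cdot> t) \<cdot> u = idm A (tgt A d) \<cdot> u"
      using tu vz by (simp add: negm_cmp)
    show "(l \<cdot> t) \<cdot> k = idm A (tgt A d) \<cdot> k"
      using tk lw by simp
  qed simp_all
  moreover have "t \<cdot> l = idm A (tgt A (fst h))"
  proof (rule pushout_unique[OF w(1)])
    show "(t \<cdot> l) \<cdot> w = idm A (tgt A (fst h)) \<cdot> w"
      using lw tk by simp
    have "t \<cdot> v = fst h"
    proof (rule pushout_unique[OF z])
      show "(t \<cdot> v) \<cdot> z = fst h \<cdot> z"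
        using vz tu by (simp add: negm_cmp)
      show "(t \<cdot> v) \<cdot> fst f = fst h \<cdot> fst f"
        using vf cmp_reassoc[OF tk, of j] ws(9) by simp
    qed simp_all
    then show "(t \<cdot> l) \<cdot> fst h = idm A (tgt A (fst h)) \<cdot> fst h"
      using lh by simp
  qed simp_all
  ultimately have se: "short_exact (l \<cdot> fst h) (snd h \<cdot> t)"
    by (intro short_exact_iso[OF hs(7)]) simp_all
  have ce: "conflation (l \<cdot> fst h) (snd h \<cdot> t)"
    by (rule conflationI[OF se]) (use fC w(3) in simp_all)
  have "r \<cdot> y' = (snd h \<cdot> t) \<cdot> d"
  proof (rule biproduct_eqI(2)[OF bp])
    have "snd h \<cdot> (t \<cdot> u) = zrm A (tgt A q) (tgt A r)"
      using tu cmp_reassoc[OF w(4), of z] w(3) by (simp add: negm_cmp)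
        (metis negm_unique addm_zrm(1) zrm_simps src_Obj tgt_Obj conflation_simps(2,3)[OF c(1)] conflation_simps(2)[OF c(2)])
    then show "(r \<cdot> y') \<cdot> x = ((snd h \<cdot> t) \<cdot> d) \<cdot> x"
      by (simp add: uk)
    have "snd h \<cdot> (t \<cdot> k) = r"
      using tk w(2) by simp
    then show "(r \<cdot> y') \<cdot> y = ((snd h \<cdot> t) \<cdot> d) \<cdot> y"
      by (simp add: uk)
  qed (use w(3) in simp_all)
  then have "cmap a (snd h \<cdot> t) (m, d) (j, r)"
    by - (rule cmapI[OF cm c(1), of _ y'], use xm w(3) in simp_all)
  moreover have "deflation (snd h \<cdot> t)" "deflation p'"
    using ce ck by (auto simp: deflation_def)
  ultimately show ?thesis
    using that[OF bp cm] ce' by simp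
qed

end

section \<open>Unit conflations in an n-Frobenius category\<close>

context extension_closed_subcategory
begin

definition gunit :: "nat \<Rightarrow> 'a \<Rightarrow> 'a \<Rightarrow> ('b + 'b extn set) set" where
  "gunit n X Y = {\<kappa>. \<exists>P i p. gconf Y P X i p \<kappa> \<and> n_projective n P}"

definition gproj :: "nat \<Rightarrow> 'a \<Rightarrow> 'a \<Rightarrow> ('b + 'b extn set) set" where
  "gproj n X Y = {\<eta> \<star> h | \<eta> h P. n_projective n P \<and> \<eta> \<in> gr n P Y \<and> h \<in> gr 0 X P}"

definition gdefl :: "'b + 'b extn set \<Rightarrow> bool" where
  "gdefl a \<longleftrightarrow> (\<exists>p. a = Inl p \<and> deflation p)"

lemma deflation_cmp:
  assumes "deflation p" "deflation q" "src A q = tgt A p"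
  shows "deflation (q \<cdot> p)"
proof -
  obtain i j where c: "conflation i p" "conflation j q"
    using assms by (auto simp: deflation_def)
  show ?thesis
  proof (rule extension_closed_subcategory.inflation_trans[OF extension_closed_op, of q j p i])
    fix r assume "extension_closed_subcategory.conflation (op_cat A) C (cmp (op_cat A) p q) r"
    then show ?thesis
      by (auto simp: deflation_def)
  qed (use c assms(3) conflation_simps(4)[OF c(1)] in simp_all)
qed

text \<open>The middle term embeds into an n-injective, which is also n-projective. The composite
  inflation begins a unit conflation, and the induced morphism of cokernels is
  \<open>f\<close>.\<close>

lemma gunit_factor:
  assumes "n_Frobenius n" "\<eta> \<in> gr 1 X Y"
  shows "\<exists>D. \<exists>\<kappa> \<in> gunit n D Y. \<exists>f \<in> gr 0 X D. \<eta> = \<kappa> \<star> f"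
proof -
  obtain e where e: "confl e" "lft e = Y" "rgt e = X" "\<eta> = Inr (cls [e])"
    using gr_single[OF assms(2)] by metis
  obtain i p where ip: "e = (i, p)" "conflation i p"
    using e(1) by (cases e) (simp add: confl_def)
  obtain j where j: "inflation j" "src A j = tgt A i" "n_injective n (tgt A j)"
    using assms(1) conflation_simps(7)[OF ip(2)] by (auto simp: n_Frobenius_def)
  obtain q where q: "conflation j q"
    using j(1) by (auto simp: inflation_def)
  obtain r h where r: "conflation (j \<cdot> i) r" and h: "cmap (idm A (src A i)) h (i, p) (j \<cdot> i, r)"
    using inflation_trans[OF ip(2) q j(2)] .
  have s: "src A i = Y" "tgt A (j \<cdot> i) = tgt A j" "src A (j \<cdot> i) = Y" "tgt A p = X"
    using conflation_simps(2)[OF ip(2)] conflation_simps(2)[OF q] j(2) e(2,3) ip(1) by auto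
  have "gconf Y (tgt A j) (tgt A r) (Inl (j \<cdot> i)) (Inl r) (Inr (cls [(j \<cdot> i, r)]))"
    using gconf_single[of "(j \<cdot> i, r)"] r s by (simp add: confl_def)
  moreover have "n_projective n (tgt A j)"
    using j(3) assms(1) by (auto simp: n_Frobenius_def)
  ultimately have "Inr (cls [(j \<cdot> i, r)]) \<in> gunit n (tgt A r) Y"
    by (auto simp: gunit_def)
  moreover have "Inl h \<in> gr 0 X (tgt A r)"
    using cmap_ends[OF h] s conflation_simps(8)[OF r] gr_C[OF assms(2)] by (auto intro: gr_Inl)
  moreover have "Inr (cls [(j \<cdot> i, r)]) \<star> Inl h = \<eta>"
    using cmap_gmul_pull[OF h] conflation_simps(6)[OF ip(2)] e(4) ip(1) by simp
  ultimately show ?thesis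
    by blast
qed

lemma gunit_ore:
  assumes "\<kappa> \<in> gunit n X Y" "\<kappa>' \<in> gunit n Z L" "a \<in> gr 0 L Y"
  shows "\<exists>L' \<mu> c c'. \<mu> \<in> gunit n L' L \<and> c \<in> gr 0 L' X \<and> c' \<in> gr 0 L' Z \<and> gdefl c \<and> gdefl c' \<and>
    a \<star> \<mu> = \<kappa> \<star> c \<and> \<mu> = \<kappa>' \<star> c'"
proof -
  obtain P j' r' where "gconf Y P X j' r' \<kappa>" and P: "n_projective n P"
    using assms(1) by (auto simp: gunit_def)
  then obtain j r where c1: "conflation j r" and s1: "src A j = Y" "tgt A j = P" "tgt A r = X"
    and C1: "Y \<in> C" "P \<in> C" "X \<in> C" and \<kappa>: "\<kappa> = Inr (cls [(j, r)])"
    by (elim gconfE) auto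
  obtain Q q' s' where "gconf L Q Z q' s' \<kappa>'" and Q: "n_projective n Q"
    using assms(2) by (auto simp: gunit_def)
  then obtain q s where c2: "conflation q s" and s2: "src A q = L" "tgt A q = Q" "tgt A s = Z"
    and C2: "L \<in> C" "Q \<in> C" "Z \<in> C" and \<kappa>': "\<kappa>' = Inr (cls [(q, s)])"
    by (elim gconfE) auto
  obtain a0 where a: "a = Inl a0" "a0 \<in> Mor A" "src A a0 = L" "tgt A a0 = Y"
    using gr0[OF assms(3)] by metis
  obtain W x y x' y' m d e e' where bp: "is_biproduct (tgt A q) (tgt A j) W x y x' y'" and md: "conflation m d"
    "tgt A m = W" and df: "deflation e" "deflation e'"
    and cm: "cmap a0 e (m, d) (j, r)" "cmap (idm A (src A q)) e' (m, d) (q, s)"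
    using ex_ore_square[OF c1 c2 a(2)] a s1 s2 by metis
  have W: "n_projective n W"
    using n_projective_biproduct[OF bp] P Q s1 s2 by simp
  have sm: "src A m = L"
    using cmap_ends(4)[OF cm(1)] a by simp
  have "gconf L W (tgt A d) (Inl m) (Inl d) (Inr (cls [(m, d)]))"
    using gconf_single[of "(m, d)"] md sm by (simp add: confl_def)
  then have "Inr (cls [(m, d)]) \<in> gunit n (tgt A d) L"
    using W by (auto simp: gunit_def)
  moreover have "Inl e \<in> gr 0 (tgt A d) X" "Inl e' \<in> gr 0 (tgt A d) Z"
    using cmap_ends(6-8)[OF cm(1)] cmap_ends(6-8)[OF cm(2)] s1 s2 C1 C2 conflation_simps(8)[OF md(1)]
    by (auto intro: gr_Inl)
  moreover have "gdefl (Inl e)" "gdefl (Inl e')"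
    using df by (auto simp: gdefl_def)
  moreover have "a \<star> Inr (cls [(m, d)]) = \<kappa> \<star> Inl e" "\<kappa>' \<star> Inl e' = Inr (cls [(m, d)])"
    using cmap_gmul[OF cm(1)] cmap_gmul_pull[OF cm(2)] a(1) \<kappa> \<kappa>' s2 C2 by simp_all
  ultimately show ?thesis
    by metis
qed

text \<open>The middle term of a unit is n-projective and n-injective, so Ext above degree
  \<open>n\<close> vanishes on it in both variables (\<open>van\<close> and \<open>van'\<close>),
  and the long exact sequences turn into shifts on both sides.\<close>

lemma graded_frobenius_gr:
  assumes F: "n_Frobenius n" and n: "1 \<le> n"
  shows "graded_frobenius C gr gmul gadd gzero gid n (gunit n) (gproj n) gdefl"
proof -
  interpret g: graded_category C gr gmul gadd gzero gid
    by (rule graded_category_gr)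
  have van: "a = gzero k P Y" if "n_projective n P" "a \<in> gr k P Y" "n < k" for a k P Y
    using that by (auto simp: n_projective_iff)
  have van': "a = gzero k Y P" if "n_projective n P" "a \<in> gr k Y P" "n < k" for a k P Y
    using that F by (auto simp: n_Frobenius_def n_injective_iff)
  have uin: "\<kappa> \<in> gr 1 X Y" if "\<kappa> \<in> gunit n X Y" for \<kappa> X Y
    using that gconf_in by (auto simp: gunit_def)
  have from': "\<exists>Y \<kappa>. \<kappa> \<in> gunit n X Y" if "X \<in> C" for X
  proof -
    obtain p where p: "deflation p" "n_projective n (src A p)" "tgt A p = X"
      using F \<open>X \<in> C\<close> by (auto simp: n_Frobenius_def)
    then obtain i where c: "conflation i p"
      by (auto simp: deflation_def)
    have "gconf (src A i) (src A p) X (Inl i) (Inl p) (Inr (cls [(i, p)]))"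
      using gconf_single[of "(i, p)"] c conflation_simps(4)[OF c] p(3) by (simp add: confl_def)
    then show ?thesis
      using p(2) unfolding gunit_def by blast
  qed
  have to': "\<exists>X \<kappa>. \<kappa> \<in> gunit n X Y" if "Y \<in> C" for Y
  proof -
    obtain i where i: "inflation i" "src A i = Y" "n_injective n (tgt A i)"
      using F \<open>Y \<in> C\<close> by (auto simp: n_Frobenius_def)
    then obtain p where c: "conflation i p"
      by (auto simp: inflation_def)
    have "gconf Y (tgt A i) (tgt A p) (Inl i) (Inl p) (Inr (cls [(i, p)]))"
      using gconf_single[of "(i, p)"] c i(2) by (simp add: confl_def)
    then show ?thesis
      using i(3) F unfolding gunit_def n_Frobenius_def by blast
  qed
  have inj_left: "\<xi> = gzero k W X"
    if \<kappa>: "\<kappa> \<in> gunit n X Y" and \<xi>: "\<xi> \<in> gr k W X" and k: "n < k" and z: "\<kappa> \<star> \<xi> = gzero (Suc k) W Y" for \<kappa> X Y \<xi> k W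
  proof -
    obtain P i p where c: "gconf Y P X i p \<kappa>" and P: "n_projective n P"
      using \<kappa> by (auto simp: gunit_def)
    obtain w where w: "w \<in> gr k W P" "\<xi> = p \<star> w"
      using connecting_exact[OF c \<xi> z] by blast
    then show ?thesis
      using van'[OF P w(1) k] g.mul_zer[of p 0 P X W k] gconf_in[OF c] gr_C[OF \<xi>] by simp
  qed
  have surj_left: "\<exists>\<xi> \<in> gr k W X. \<eta> = \<kappa> \<star> \<xi>"
    if \<kappa>: "\<kappa> \<in> gunit n X Y" and \<eta>: "\<eta> \<in> gr (Suc k) W Y" and k: "n \<le> k" for \<kappa> X Y \<eta> k W
  proof -
    obtain P i p where c: "gconf Y P X i p \<kappa>" and P: "n_projective n P"
      using \<kappa> by (auto simp: gunit_def)
    have "i \<star> \<eta> \<in> gr (Suc k) W P"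
      using g.mul_in[of i 0 Y P \<eta> "Suc k" W] gconf_in[OF c] \<eta> by simp
    then have "i \<star> \<eta> = gzero (Suc k) W P"
      using van'[OF P] k by simp
    then show ?thesis
      using exact_connecting[OF c \<eta>] by blast
  qed
  have inj_right: "\<xi> = gzero k Y Z"
    if \<kappa>: "\<kappa> \<in> gunit n X Y" and \<xi>: "\<xi> \<in> gr k Y Z" and k: "n < k" and z: "\<xi> \<star> \<kappa> = gzero (Suc k) X Z" for \<kappa> X Y \<xi> k Z
  proof -
    obtain P i p where c: "gconf Y P X i p \<kappa>" and P: "n_projective n P"
      using \<kappa> by (auto simp: gunit_def)
    obtain w where w: "w \<in> gr k P Z" "\<xi> = w \<star> i"
      using connecting_exact_op[OF c \<xi> z] by blast
    then show ?thesis
      using van[OF P w(1) k] g.zer_mul[of i 0 Y P Z k] gconf_in[OF c] gr_C[OF \<xi>] by simp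
  qed
  have surj_right: "\<exists>\<xi> \<in> gr k Y Z. \<eta> = \<xi> \<star> \<kappa>"
    if \<kappa>: "\<kappa> \<in> gunit n X Y" and \<eta>: "\<eta> \<in> gr (Suc k) X Z" and k: "n \<le> k" for \<kappa> X Y \<eta> k Z
  proof -
    obtain P i p where c: "gconf Y P X i p \<kappa>" and P: "n_projective n P"
      using \<kappa> by (auto simp: gunit_def)
    have "\<eta> \<star> p \<in> gr (Suc k) P Z"
      using g.mul_in[of \<eta> "Suc k" X Z p 0 P] gconf_in[OF c] \<eta> by simp
    then have "\<eta> \<star> p = gzero (Suc k) P Z"
      using van[OF P] k by simp
    then show ?thesis
      using exact_connecting_op[OF c \<eta>] by blast
  qed
  have proj_in: "gproj n X Y \<subseteq> gr n X Y" for X Y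
    using g.mul_in unfolding gproj_def by fastforce
  have annih: "\<xi> \<star> p = gzero (k + n) X Z" if p: "p \<in> gproj n X Y" and \<xi>: "\<xi> \<in> gr k Y Z" "1 \<le> k" for p X Y \<xi> k Z
  proof -
    obtain P \<eta> h where h: "n_projective n P" "\<eta> \<in> gr n P Y" "h \<in> gr 0 X P" "p = \<eta> \<star> h"
      using p by (auto simp: gproj_def)
    have "\<xi> \<star> p = (\<xi> \<star> \<eta>) \<star> h"
      using g.mul_assoc[OF \<xi>(1) h(2,3)] h(4) by simp
    also have "\<dots> = gzero (k + n) P Z \<star> h"
      using van[OF h(1) g.mul_in[OF \<xi>(1) h(2)]] \<xi>(2) by simp
    also have "\<dots> = gzero (k + n) X Z"
      using g.zer_mul[OF h(3)] gr_C[OF \<xi>(1)] by simp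
    finally show ?thesis .
  qed
  have ker: "\<kappa> \<star> \<xi> = gzero (Suc n) W Y \<longleftrightarrow> \<xi> \<in> gproj n W X"
    if \<kappa>: "\<kappa> \<in> gunit n X Y" and \<xi>: "\<xi> \<in> gr n W X" for \<kappa> X Y \<xi> W
  proof
    assume z: "\<kappa> \<star> \<xi> = gzero (Suc n) W Y"
    obtain P i p where c: "gconf Y P X i p \<kappa>" and P: "n_projective n P"
      using \<kappa> by (auto simp: gunit_def)
    obtain w where w: "w \<in> gr n W P" "\<xi> = p \<star> w"
      using connecting_exact[OF c \<xi> z] by blast
    \<comment> \<open>The factorization \<open>\<xi> = p \<star> w\<close> has its
      degree-\<open>n\<close> part on the wrong side. So \<open>w\<close> is extended along an
      inflation of \<open>W\<close> into an n-projective \<open>Q\<close>; the obstruction lies in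
      Ext^(n+1) into the n-injective \<open>P\<close>, and \<open>\<xi>\<close> then factors through
      \<open>Q\<close>.\<close>
    obtain W' \<mu> where "\<mu> \<in> gunit n W' W"
      using to' gr_C[OF \<xi>] by blast
    then obtain Q j q where c': "gconf W Q W' j q \<mu>" and Q: "n_projective n Q"
      by (auto simp: gunit_def)
    have "w \<star> \<mu> \<in> gr (Suc n) W' P"
      using g.mul_in[OF w(1), of \<mu> 1 W'] gconf_in[OF c'] by simp
    then have "w \<star> \<mu> = gzero (Suc n) W' P"
      using van'[OF P] by simp
    then obtain v where v: "v \<in> gr n Q P" "w = v \<star> j"
      using connecting_exact_op[OF c' w(1)] by blast
    have m: "p \<in> gr 0 P X" "j \<in> gr 0 W Q"
      using gconf_in[OF c] gconf_in[OF c'] by auto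
    have "\<xi> = (p \<star> v) \<star> j"
      using w(2) v(2) g.mul_assoc[OF m(1) v(1) m(2)] by simp
    moreover have "p \<star> v \<in> gr n Q X"
      using g.mul_in[OF m(1) v(1)] by simp
    ultimately show "\<xi> \<in> gproj n W X"
      using Q m(2) unfolding gproj_def by blast
  next
    assume "\<xi> \<in> gproj n W X"
    then show "\<kappa> \<star> \<xi> = gzero (Suc n) W Y"
      using annih[OF _ uin[OF \<kappa>]] by simp
  qed
  show ?thesis
    apply (intro graded_frobenius.intro graded_category_gr graded_frobenius_axioms.intro)
    subgoal by (rule n)
    subgoal by (rule uin)
    subgoal by (rule from')
    subgoal by (rule to')
    subgoal by (rule inj_left)
    subgoal by (rule surj_left)
    subgoal by (rule inj_right)
    subgoal by (rule surj_right)
    subgoal by (rule proj_in)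
    subgoal by (rule ker)
    subgoal by (rule annih)
    subgoal by (rule gunit_factor[OF F])
    subgoal by (rule gr_decomp(1))
    subgoal by (rule gunit_ore)
    subgoal for a b Y Z X
      using deflation_cmp unfolding gdefl_def by (auto simp: gr_def split: if_splits)
    done
qed

end

section \<open>The endomorphism ring of an object\<close>

context preadditive_category
begin

lemma ring_End_ring:
  assumes "X \<in> Obj A"
  shows "ring (End_ring X)"
proof (rule ringI)
  show "abelian_group (End_ring X)"
  proof (rule abelian_groupI)
    show "\<exists>g \<in> carrier (End_ring X). g \<oplus>\<^bsub>End_ring X\<^esub> f = \<zero>\<^bsub>End_ring X\<^esub>"
      if "f \<in> carrier (End_ring X)" for f
      using that addm_comm[of "negm f" f] by (intro bexI[of _ "negm f"]) (auto simp: End_ring_def)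
  qed (use assms in \<open>auto simp: End_ring_def addm_assoc intro: addm_comm\<close>)
  show "Group.monoid (End_ring X)"
    by (rule monoidI) (use assms in \<open>auto simp: End_ring_def\<close>)
qed (auto simp: End_ring_def cmp_addm)

end

section \<open>The ring of stable extensions\<close>

locale n_frobenius_unit = extension_closed_subcategory +
  fixes n :: nat and M B :: 'a and d :: "'b extn set"
  assumes n_ge: "1 \<le> n" and frob: "n_Frobenius n" and d_unit_exts: "d \<in> unit_exts n M B"
begin

sublocale F: graded_frobenius C gr gmul gadd gzero gid n "gunit n" "gproj n" gdefl
  by (rule graded_frobenius_gr[OF frob n_ge])

lemma unit_extns:
  assumes "E \<in> extns k X Y" "\<forall>(i, p) \<in> set E. n_projective n (tgt A i)"
  shows "F.unit k X Y (Inr (cls E))"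
  using assms
proof (induction E arbitrary: k Y)
  case Nil
  then show ?case
    by (simp add: extns_iff)
next
  case (Cons e E)
  have e: "confl e" "lft e = Y" "n_projective n (tgt A (fst e))"
    using Cons.prems by (auto simp: extns_iff case_prod_beta')
  have u: "Inr (cls [e]) \<in> gunit n (rgt e) Y"
    using gconf_single[OF e(1)] e(2,3) unfolding gunit_def by blast
  show ?case
  proof (cases "E = []")
    case True
    then have "k = 1" "rgt e = X"
      using Cons.prems(1) by (auto simp: extns_iff)
    then show ?thesis
      using True F.unit_one[OF u] by simp
  next
    case False
    have l: "length E = k - 1" "k = Suc (length E)" "E \<in> extns (length E) X (rgt e)"
      using Cons.prems(1) False by (auto simp: extns_iff)
    have "F.unit (length E) X (rgt e) (Inr (cls E))"
      using Cons.IH[OF l(3)] Cons.prems(2) by simp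
    from F.unit_Suc[OF u this] show ?thesis
      using splice_gmul[OF single_extns[OF e(1)] l(3)] l(2) by (metis append_Cons append_Nil)
  qed
qed

lemma unit_extnsE:
  assumes "F.unit k X Y a"
  shows "\<exists>E \<in> extns k X Y. a = Inr (cls E) \<and> (\<forall>(i, p) \<in> set E. n_projective n (tgt A i))"
proof -
  have one: "\<exists>e. confl e \<and> lft e = Y \<and> rgt e = X \<and> \<kappa> = Inr (cls [e]) \<and> n_projective n (tgt A (fst e))"
    if \<kappa>: "\<kappa> \<in> gunit n X Y" for \<kappa> X Y
  proof -
    obtain P i p where "gconf Y P X i p \<kappa>" "n_projective n P"
      using \<kappa> by (auto simp: gunit_def)
    then show ?thesis
      by (elim gconfE) (auto simp: confl_def)
  qed
  from assms show ?thesis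
  proof (induction rule: F.unit.induct)
    case (unit_one \<kappa> X Y)
    then obtain e where e: "confl e" "lft e = Y" "rgt e = X" "\<kappa> = Inr (cls [e])" "n_projective n (tgt A (fst e))"
      using one by blast
    then show ?case
      using single_extns[OF e(1)] by (intro bexI[of _ "[e]"]) (auto simp: case_prod_beta')
  next
    case (unit_Suc \<kappa> Z Y k X \<delta>)
    then obtain e where e: "confl e" "lft e = Y" "rgt e = Z" "\<kappa> = Inr (cls [e])" "n_projective n (tgt A (fst e))"
      using one by blast
    obtain E where E: "E \<in> extns k X Z" "\<delta> = Inr (cls E)" "\<forall>(i, p) \<in> set E. n_projective n (tgt A i)"
      using unit_Suc.IH by blast
    have s: "[e] \<in> extns 1 Z Y"
      using single_extns[OF e(1)] e(2,3) by simp
    show ?case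
      using splice_gmul[OF s E(1)] extns_append[OF s E(1)] E e
      by (intro bexI[of _ "e # E"]) (auto simp: case_prod_beta')
  qed
qed

text \<open>One representative with n-projective terms is enough on the left; cutting it into its
  conflations yields the inductive description, and splicing leads back.\<close>

lemma unit_exts_iff: "\<delta> \<in> unit_exts n X Y \<longleftrightarrow> F.unit n X Y (Inr \<delta>)"
proof
  assume "\<delta> \<in> unit_exts n X Y"
  then obtain E where E: "\<delta> \<in> Ext n X Y" "E \<in> \<delta>" "\<forall>(i, p) \<in> set E. n_projective n (tgt A i)"
    by (auto simp: unit_exts_def)
  obtain K where K: "K \<in> extns n X Y" "\<delta> = cls K"
    using Ext_cls[OF E(1)] .
  have "E \<in> extns n X Y" "\<delta> = cls E"
    using mem_cls(2,3)[OF K(1), of E] E(2) K(2) by simp_all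
  then show "F.unit n X Y (Inr \<delta>)"
    using unit_extns E(3) by simp
next
  assume "F.unit n X Y (Inr \<delta>)"
  then obtain E where E: "E \<in> extns n X Y" "\<delta> = cls E" "\<forall>(i, p) \<in> set E. n_projective n (tgt A i)"
    using unit_extnsE by blast
  then show "\<delta> \<in> unit_exts n X Y"
    using cls_Ext[OF E(1)] mem_cls(1)[OF E(1)] unfolding unit_exts_def by blast
qed

sublocale F: graded_frobenius_unit C gr gmul gadd gzero gid n "gunit n" "gproj n" gdefl M B "Inr d"
  by unfold_locales (use d_unit_exts unit_exts_iff in blast)

lemma pull_eq:
  assumes "\<gamma> \<in> Ext n X Y" "Inl h \<in> gr 0 X' X"
  shows "Inr (pull n Y \<gamma> h) = Inr \<gamma> \<star> Inl h" "pull n Y \<gamma> h \<in> Ext n X' Y"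
proof -
  have h: "h \<in> Mor A" "src A h = X'" "tgt A h = X" "X' \<in> C"
    using assms(2) by (auto simp: Inl_gr)
  show e: "Inr (pull n Y \<gamma> h) = Inr \<gamma> \<star> Inl h"
    using pull_eq_lpull[OF assms(1) h(1,3)] h by simp
  have "Inr \<gamma> \<star> Inl h \<in> gr n X' Y"
    using F.mul_in[of "Inr \<gamma>" n X Y "Inl h" 0 X'] assms Inr_gr[of n \<gamma> X Y] n_ge by simp
  then show "pull n Y \<gamma> h \<in> Ext n X' Y"
    unfolding e[symmetric] using Inr_gr[of n _ X' Y] n_ge by simp
qed

lemma proj_ext_iff:
  assumes "X \<in> C"
  shows "\<gamma> \<in> proj_ext n X Y \<longleftrightarrow> Inr \<gamma> \<in> gproj n X Y"
proof
  assume "\<gamma> \<in> proj_ext n X Y"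
  then obtain \<eta> h P where h: "n_projective n P" "h \<in> Hom A X P" "\<eta> \<in> Ext n P Y" "\<gamma> = pull n Y \<eta> h"
    unfolding proj_ext_def by blast
  have "Inl h \<in> gr 0 X P"
    using h(1,2) assms by (auto simp: Inl_gr n_projective_iff)
  moreover have "Inr \<eta> \<in> gr n P Y"
    using h(3) Inr_gr[of n \<eta> P Y] n_ge by simp
  ultimately show "Inr \<gamma> \<in> gproj n X Y"
    using pull_eq(1)[OF h(3)] h(1,4) unfolding gproj_def by blast
next
  assume "Inr \<gamma> \<in> gproj n X Y"
  then obtain b a P where h: "n_projective n P" "b \<in> gr n P Y" "a \<in> gr 0 X P" "Inr \<gamma> = b \<star> a"
    unfolding gproj_def by blast
  obtain \<eta> where \<eta>: "b = Inr \<eta>" "\<eta> \<in> Ext n P Y"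
    using gr_Ext[OF h(2)] n_ge by (metis not_one_le_zero)
  obtain f where f: "a = Inl f" "f \<in> Hom A X P"
    using gr0[OF h(3)] by (metis Hom_iff)
  have "Inr \<gamma> = (Inr (pull n Y \<eta> f) :: 'b + 'b extn set)"
    using pull_eq(1)[OF \<eta>(2)] h(3,4) f(1) \<eta>(1) by simp
  then show "\<gamma> \<in> proj_ext n X Y"
    using h(1) f(2) \<eta>(2) unfolding proj_ext_def by blast
qed

text \<open>Push-out is additive by distributivity, so membership in \<open>iso\<close> comes down
  to bijectivity.\<close>

lemma quasi_invertible_iff:
  assumes "f \<in> Hom A X Y"
  shows "quasi_invertible n f \<longleftrightarrow> F.qi X Y (Inl f)"
proof (cases "X \<in> C \<and> Y \<in> C")
  case True
  have f: "f \<in> Mor A" "src A f = X" "tgt A f = Y"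
    using assms by auto
  have fg: "Inl f \<in> gr 0 X Y"
    using True f by (simp add: Inl_gr)
  have "push (Suc n) W f \<in> iso (Ext_group (Suc n) W X) (Ext_group (Suc n) W Y) \<longleftrightarrow>
    bij_betw (\<lambda>\<xi>. Inl f \<star> \<xi>) (gr (Suc n) W X) (gr (Suc n) W Y)" if W: "W \<in> C" for W
  proof -
    have i: "Inr (push (Suc n) W f \<gamma>) = Inl f \<star> Inr \<gamma>" if "\<gamma> \<in> Ext (Suc n) W X" for \<gamma>
      using push_eq_lpush[OF that f(1,2)] f(3) True by simp
    have g: "gr (Suc n) W X = Inr ` Ext (Suc n) W X" "gr (Suc n) W Y = Inr ` Ext (Suc n) W Y"
      using True W by (simp_all add: gr_def)
    have "bij_betw (\<lambda>\<xi>. Inl f \<star> \<xi>) (Inr ` Ext (Suc n) W X) (Inr ` Ext (Suc n) W Y) \<longleftrightarrow>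
      bij_betw (push (Suc n) W f) (Ext (Suc n) W X) (Ext (Suc n) W Y)"
    proof -
      have "(\<lambda>\<xi>. Inl f \<star> \<xi>) ` Inr ` Ext (Suc n) W X = Inr ` push (Suc n) W f ` Ext (Suc n) W X"
        unfolding image_image using i by (intro image_cong) simp_all
      moreover have "inj_on (\<lambda>\<xi>. Inl f \<star> \<xi>) (Inr ` Ext (Suc n) W X) \<longleftrightarrow>
          inj_on (push (Suc n) W f) (Ext (Suc n) W X)"
        using i[symmetric] by (auto simp: inj_on_def)
      ultimately show ?thesis
        unfolding bij_betw_def by (simp add: inj_image_eq_iff)
    qed
    moreover have "push (Suc n) W f \<in> hom (Ext_group (Suc n) W X) (Ext_group (Suc n) W Y)"
    proof (rule homI)
      fix \<gamma> assume "\<gamma> \<in> carrier (Ext_group (Suc n) W X)"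
      then have \<gamma>: "\<gamma> \<in> Ext (Suc n) W X"
        by (simp add: Ext_group_simps)
      have "Inl f \<star> Inr \<gamma> \<in> gr (Suc n) W Y"
        using F.mul_in[OF fg, of "Inr \<gamma>" "Suc n" W] \<gamma> Inr_gr[of "Suc n" \<gamma> W X] by simp
      then show "push (Suc n) W f \<gamma> \<in> carrier (Ext_group (Suc n) W Y)"
        unfolding i[OF \<gamma>, symmetric] by (auto simp: g Ext_group_simps)
    next
      fix \<gamma> \<eta> assume "\<gamma> \<in> carrier (Ext_group (Suc n) W X)" "\<eta> \<in> carrier (Ext_group (Suc n) W X)"
      then have \<gamma>: "\<gamma> \<in> Ext (Suc n) W X" "\<eta> \<in> Ext (Suc n) W X"
        by (simp_all add: Ext_group_simps)
      then have gr: "Inr \<gamma> \<in> gr (Suc n) W X" "Inr \<eta> \<in> gr (Suc n) W X"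
        by (simp_all add: g)
      have im: "push (Suc n) W f \<zeta> \<in> Ext (Suc n) W Y" if "\<zeta> \<in> Ext (Suc n) W X" for \<zeta>
      proof -
        have "Inl f \<star> Inr \<zeta> \<in> gr (Suc n) W Y"
          using F.mul_in[OF fg, of "Inr \<zeta>" "Suc n" W] that Inr_gr[of "Suc n" \<zeta> W X] by simp
        then show ?thesis
          unfolding i[OF that, symmetric] by (auto simp: g)
      qed
      have cl: "\<gamma> \<otimes>\<^bsub>Ext_group (Suc n) W X\<^esub> \<eta> \<in> Ext (Suc n) W X"
        using F.add_in[OF gr] unfolding Ext_group_simps(2)[OF \<gamma>, symmetric] by (auto simp: g)
      have "Inl f \<star> gadd (Inr \<gamma>) (Inr \<eta>) = gadd (Inl f \<star> Inr \<gamma>) (Inl f \<star> Inr \<eta>)"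
        using F.distrib_left[OF fg gr] .
      then have "(Inr (push (Suc n) W f (\<gamma> \<otimes>\<^bsub>Ext_group (Suc n) W X\<^esub> \<eta>)) :: 'b + 'b extn set) =
        Inr (push (Suc n) W f \<gamma> \<otimes>\<^bsub>Ext_group (Suc n) W Y\<^esub> push (Suc n) W f \<eta>)"
        unfolding Ext_group_simps(2)[OF im[OF \<gamma>(1)] im[OF \<gamma>(2)]] i[OF \<gamma>(1)] i[OF \<gamma>(2)] i[OF cl]
          Ext_group_simps(2)[OF \<gamma>] .
      then show "push (Suc n) W f (\<gamma> \<otimes>\<^bsub>Ext_group (Suc n) W X\<^esub> \<eta>) =
        push (Suc n) W f \<gamma> \<otimes>\<^bsub>Ext_group (Suc n) W Y\<^esub> push (Suc n) W f \<eta>"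
        by simp
    qed
    ultimately show ?thesis
      unfolding g by (simp add: iso_def Ext_group_simps)
  qed
  then show ?thesis
    using True f fg unfolding quasi_invertible_def F.qi_def by simp
next
  case False
  then show ?thesis
    using assms F.qi_in[of X Y "Inl f"] gr_C[of "Inl f" 0 X Y] by (auto simp: quasi_invertible_def)
qed

abbreviation E :: "'b extn set monoid" where "E \<equiv> Ext_group n M B"
abbreviation H :: "'b extn set set" where "H \<equiv> proj_ext n M B"
abbreviation R :: "'b extn set set ring" where "R \<equiv> Ext_ring n M B d"
abbreviation br :: "'b extn set \<Rightarrow> 'b extn set set" where "br \<equiv> bar n M B"

lemma n_nz: "n \<noteq> 0" and MC: "M \<in> C" "B \<in> C"
  using n_ge F.MB by auto

lemma Inr_mem: "Inr \<gamma> \<in> gr n M B \<longleftrightarrow> \<gamma> \<in> Ext n M B"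
  using Inr_gr[OF n_nz] .

lemma d_Ext: "d \<in> Ext n M B"
  using F.d_in Inr_mem by simp

lemma E_mult:
  assumes "\<gamma> \<in> Ext n X Y" "\<eta> \<in> Ext n X Y"
  shows "Inr (\<gamma> \<otimes>\<^bsub>Ext_group n X Y\<^esub> \<eta>) = gadd (Inr \<gamma>) (Inr \<eta>)" "\<gamma> \<otimes>\<^bsub>Ext_group n X Y\<^esub> \<eta> \<in> Ext n X Y"
proof -
  show e: "Inr (\<gamma> \<otimes>\<^bsub>Ext_group n X Y\<^esub> \<eta>) = gadd (Inr \<gamma>) (Inr \<eta>)"
    by (rule Ext_group_simps(2)[OF assms])
  have "gadd (Inr \<gamma>) (Inr \<eta>) \<in> gr n X Y"
    using gadd_in Inr_gr[OF n_nz] assms by blast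
  then show "\<gamma> \<otimes>\<^bsub>Ext_group n X Y\<^esub> \<eta> \<in> Ext n X Y"
    unfolding e[symmetric] using Inr_gr[OF n_nz] by blast
qed

lemma peq_proj_ext:
  assumes "\<gamma> \<in> Ext n X Y" "\<eta> \<in> Ext n X Y"
  shows "F.peq X Y (Inr \<gamma>) (Inr \<eta>) \<longleftrightarrow> \<gamma> \<otimes>\<^bsub>Ext_group n X Y\<^esub> inv\<^bsub>Ext_group n X Y\<^esub> \<eta> \<in> proj_ext n X Y"
proof -
  have C: "X \<in> C" "Y \<in> C"
    using Ext_C[OF assms(1)] by auto
  interpret G: comm_group "Ext_group n X Y"
    by (rule Ext_comm_group[OF C n_nz])
  let ?c = "\<gamma> \<otimes>\<^bsub>Ext_group n X Y\<^esub> inv\<^bsub>Ext_group n X Y\<^esub> \<eta>"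
  note ca = Ext_group_simps(1)[of n X Y]
  have c: "?c \<in> Ext n X Y"
    using assms ca G.inv_closed G.m_closed by metis
  have "\<gamma> = \<eta> \<otimes>\<^bsub>Ext_group n X Y\<^esub> ?c"
    using assms ca by (metis G.inv_closed G.m_comm G.m_closed G.inv_solve_right)
  then have e: "(Inr \<gamma> :: 'b + 'b extn set) = gadd (Inr \<eta>) (Inr ?c)"
    using E_mult(1)[OF assms(2) c] by simp
  have g: "Inr \<gamma> \<in> gr n X Y" "Inr \<eta> \<in> gr n X Y" "Inr ?c \<in> gr n X Y"
    using assms c Inr_gr[OF n_nz] by auto
  show ?thesis
  proof
    assume "F.peq X Y (Inr \<gamma>) (Inr \<eta>)"
    then obtain p where p: "p \<in> gproj n X Y" "Inr \<gamma> = gadd (Inr \<eta>) p"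
      by (auto simp: F.peq_def)
    have "p \<in> gr n X Y"
      using p(1) F.Pr_in by blast
    then have "p = Inr ?c"
      using F.add_cancel[of p n X Y "Inr ?c" "Inr \<eta>"] g p(2) e F.add_comm[of "Inr \<eta>" n X Y] by metis
    then show "?c \<in> proj_ext n X Y"
      using p(1) proj_ext_iff[OF C(1)] by simp
  next
    assume "?c \<in> proj_ext n X Y"
    then show "F.peq X Y (Inr \<gamma>) (Inr \<eta>)"
      using e g proj_ext_iff[OF C(1)] unfolding F.peq_def by blast
  qed
qed

text \<open>For a unit \<open>\<kappa>\<close> with right end \<open>B\<close>, \<open>H\<close> is
  the kernel of the additive map \<open>\<gamma> \<mapsto> \<kappa> \<star> \<gamma>\<close> into
  Ext^(n+1).\<close>

lemma H_subgroup: "subgroup H E"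
proof -
  interpret G: comm_group E
    by (rule Ext_comm_group[OF MC n_nz])
  note ca = Ext_group_simps(1)[of n M B]
  obtain Z \<kappa> where \<kappa>: "\<kappa> \<in> gunit n B Z"
    using F.U_from[OF MC(2)] by blast
  note \<kappa>' = F.U_in[OF \<kappa>]
  have Z: "Z \<in> C"
    using gr_C[OF \<kappa>'] by simp
  have Hi: "\<gamma> \<in> H \<longleftrightarrow> \<gamma> \<in> Ext n M B \<and> \<kappa> \<star> Inr \<gamma> = gzero (Suc n) M Z" for \<gamma>
    using proj_ext_iff[OF MC(1)] F.Pr_in F.U_ker[OF \<kappa>, of "Inr \<gamma>" M] Inr_mem by blast
  have mul: "\<kappa> \<star> Inr (\<gamma> \<otimes>\<^bsub>E\<^esub> \<eta>) = gadd (\<kappa> \<star> Inr \<gamma>) (\<kappa> \<star> Inr \<eta>)"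
    if "\<gamma> \<in> Ext n M B" "\<eta> \<in> Ext n M B" for \<gamma> \<eta>
    using E_mult(1)[OF that] F.distrib_left[OF \<kappa>', of "Inr \<gamma>" n M "Inr \<eta>"] that Inr_mem by simp
  have z: "gadd (gzero (Suc n) M Z) b = b" if "b \<in> gr (Suc n) M Z" for b
    using F.add_comm[OF gzero_in[OF MC(1) Z] that] F.add_zer[OF that] by simp
  have one: "\<kappa> \<star> Inr \<one>\<^bsub>E\<^esub> = gzero (Suc n) M Z"
    using Ext_group_simps(3)[OF MC n_nz] F.mul_zer[OF \<kappa>' MC(1), of n] by simp
  show ?thesis
  proof (rule G.subgroupI)
    show "H \<subseteq> carrier E"
      using Hi ca by auto
    have "\<one>\<^bsub>E\<^esub> \<in> H"
      using Hi one G.one_closed ca by blast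
    then show "H \<noteq> {}"
      by blast
    show "inv\<^bsub>E\<^esub> \<gamma> \<in> H" if "\<gamma> \<in> H" for \<gamma>
    proof -
      have g: "\<gamma> \<in> Ext n M B" "\<kappa> \<star> Inr \<gamma> = gzero (Suc n) M Z"
        using that Hi by auto
      then have i: "inv\<^bsub>E\<^esub> \<gamma> \<in> Ext n M B" "\<gamma> \<otimes>\<^bsub>E\<^esub> inv\<^bsub>E\<^esub> \<gamma> = \<one>\<^bsub>E\<^esub>"
        using G.inv_closed[of \<gamma>] G.r_inv[of \<gamma>] ca by auto
      have "\<kappa> \<star> Inr (inv\<^bsub>E\<^esub> \<gamma>) \<in> gr (Suc n) M Z"
        using F.mul_in[OF \<kappa>', of "Inr (inv\<^bsub>E\<^esub> \<gamma>)" n M] i(1) Inr_mem by simp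
      then have "\<kappa> \<star> Inr (inv\<^bsub>E\<^esub> \<gamma>) = gzero (Suc n) M Z"
        using mul[OF g(1) i(1)] i(2) one g(2) z by simp
      then show ?thesis
        using Hi i(1) by blast
    qed
    show "\<gamma> \<otimes>\<^bsub>E\<^esub> \<eta> \<in> H" if "\<gamma> \<in> H" "\<eta> \<in> H" for \<gamma> \<eta>
    proof -
      have g: "\<gamma> \<in> Ext n M B" "\<kappa> \<star> Inr \<gamma> = gzero (Suc n) M Z" "\<eta> \<in> Ext n M B" "\<kappa> \<star> Inr \<eta> = gzero (Suc n) M Z"
        using that Hi by auto
      then show ?thesis
        using Hi E_mult(2)[OF g(1,3)] mul[OF g(1,3)] z[OF gzero_in[OF MC(1) Z]] by simp
    qed
  qed
qed

text \<open>Equality of cosets means that the difference lies in \<open>H\<close>, which is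
  congruence and is detected by the action. The laws involving products can then be verified on
  actions.\<close>

lemma br_eq_iff:
  assumes "\<beta> \<in> Ext n M B" "\<gamma> \<in> Ext n M B"
  shows "br \<beta> = br \<gamma> \<longleftrightarrow>
    (\<forall>\<xi> \<in> gr (Suc n) B F.faithful. F.act F.faithful (Inr \<beta>) \<xi> = F.act F.faithful (Inr \<gamma>) \<xi>)"
proof -
  interpret G: comm_group E
    by (rule Ext_comm_group[OF MC n_nz])
  note ca = Ext_group_simps(1)[of n M B]
  note sg = H_subgroup
  have "br \<beta> = br \<gamma> \<longleftrightarrow> \<beta> \<in> H #>\<^bsub>E\<^esub> \<gamma>"
  proof
    show "\<beta> \<in> H #>\<^bsub>E\<^esub> \<gamma>" if "br \<beta> = br \<gamma>"
      using G.rcos_self[OF _ sg, of \<beta>] that assms ca by (simp add: bar_def)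
    show "br \<beta> = br \<gamma>" if "\<beta> \<in> H #>\<^bsub>E\<^esub> \<gamma>"
      using G.repr_independence[OF that _ sg] assms ca by (simp add: bar_def)
  qed
  also have "\<dots> \<longleftrightarrow> \<beta> \<otimes>\<^bsub>E\<^esub> inv\<^bsub>E\<^esub> \<gamma> \<in> H"
  proof
    assume "\<beta> \<in> H #>\<^bsub>E\<^esub> \<gamma>"
    then obtain h where h: "h \<in> H" "\<beta> = h \<otimes>\<^bsub>E\<^esub> \<gamma>"
      by (auto simp: r_coset_def)
    then have "h \<in> carrier E"
      using subgroup.mem_carrier[OF sg] by blast
    then have "\<beta> \<otimes>\<^bsub>E\<^esub> inv\<^bsub>E\<^esub> \<gamma> = h"
      using h(2) assms ca G.inv_solve_right' by (metis G.m_closed)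
    then show "\<beta> \<otimes>\<^bsub>E\<^esub> inv\<^bsub>E\<^esub> \<gamma> \<in> H"
      using h(1) by simp
  next
    assume h: "\<beta> \<otimes>\<^bsub>E\<^esub> inv\<^bsub>E\<^esub> \<gamma> \<in> H"
    have "\<beta> \<in> carrier E" "\<gamma> \<in> carrier E"
      using assms ca by auto
    then have "\<beta> = (\<beta> \<otimes>\<^bsub>E\<^esub> inv\<^bsub>E\<^esub> \<gamma>) \<otimes>\<^bsub>E\<^esub> \<gamma>"
      by (simp add: G.m_assoc)
    then show "\<beta> \<in> H #>\<^bsub>E\<^esub> \<gamma>"
      using h unfolding r_coset_def by blast
  qed
  also have "\<dots> \<longleftrightarrow> F.peq M B (Inr \<beta>) (Inr \<gamma>)"
    using peq_proj_ext[OF assms] by simp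
  finally show ?thesis
    using F.act_eq_iff[of "Inr \<beta>" "Inr \<gamma>"] assms Inr_mem by simp
qed

lemma deflation_gdefl: "gdefl (Inl a) \<longleftrightarrow> deflation a"
  by (auto simp: gdefl_def)

lemma right_unit_factorization_iff:
  "right_unit_factorization n M B D \<gamma> \<delta> f \<longleftrightarrow>
    F.unit n D B (Inr \<delta>) \<and> Inl f \<in> gr 0 M D \<and> Inr \<gamma> = Inr \<delta> \<star> Inl f"
proof
  assume h: "right_unit_factorization n M B D \<gamma> \<delta> f"
  then have \<delta>: "F.unit n D B (Inr \<delta>)"
    by (simp add: right_unit_factorization_def unit_exts_iff)
  then have "Inr \<delta> \<in> gr n D B"
    using F.unit_in by blast
  then have D: "\<delta> \<in> Ext n D B" "D \<in> C"
    using Inr_gr[OF n_nz] gr_C by blast+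
  then have "Inl f \<in> gr 0 M D"
    using h MC by (simp add: right_unit_factorization_def Inl_gr)
  then show "F.unit n D B (Inr \<delta>) \<and> Inl f \<in> gr 0 M D \<and> Inr \<gamma> = Inr \<delta> \<star> Inl f"
    using h \<delta> pull_eq(1)[OF D(1)] by (simp add: right_unit_factorization_def)
next
  assume h: "F.unit n D B (Inr \<delta>) \<and> Inl f \<in> gr 0 M D \<and> Inr \<gamma> = Inr \<delta> \<star> Inl f"
  then have "\<delta> \<in> Ext n D B"
    using F.unit_in Inr_gr[OF n_nz] by blast
  then have "\<gamma> = pull n B \<delta> f" "\<gamma> \<in> Ext n M B"
    using pull_eq[of \<delta> D B f M] h by auto
  then show "right_unit_factorization n M B D \<gamma> \<delta> f"
    using h by (simp add: right_unit_factorization_def unit_exts_iff Inl_gr)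
qed

lemma co_angled_pair_iff:
  "co_angled_pair n B M D L d \<delta> a b \<longleftrightarrow> F.unit n D B (Inr \<delta>) \<and> Inl a \<in> gr 0 L M \<and> Inl b \<in> gr 0 L D \<and>
    gdefl (Inl a) \<and> gdefl (Inl b) \<and> F.qi L M (Inl a) \<and> F.qi L D (Inl b) \<and>
    Inr d \<star> Inl a = Inr \<delta> \<star> Inl b \<and> F.unit n L B (Inr d \<star> Inl a)" (is "?l \<longleftrightarrow> ?r")
proof
  assume h: ?l
  then have ab: "a \<in> Hom A L M" "b \<in> Hom A L D" and \<delta>: "F.unit n D B (Inr \<delta>)"
    by (simp_all add: co_angled_pair_def unit_exts_iff)
  have \<delta>E: "\<delta> \<in> Ext n D B"
    using F.unit_in[OF \<delta>] Inr_gr[OF n_nz] by blast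
  have q: "F.qi L M (Inl a)" "F.qi L D (Inl b)"
    using h quasi_invertible_iff[OF ab(1)] quasi_invertible_iff[OF ab(2)] by (simp_all add: co_angled_pair_def)
  note g = F.qi_in[OF q(1)] F.qi_in[OF q(2)]
  show ?r
    using h \<delta> q g pull_eq(1)[OF d_Ext g(1)] pull_eq(1)[OF \<delta>E g(2)]
    by (auto simp: co_angled_pair_def deflation_gdefl unit_exts_iff)
next
  assume h: ?r
  then have ab: "a \<in> Hom A L M" "b \<in> Hom A L D" and g: "Inl a \<in> gr 0 L M" "Inl b \<in> gr 0 L D"
    by (simp_all add: Inl_gr)
  have \<delta>E: "\<delta> \<in> Ext n D B"
    using F.unit_in h Inr_gr[OF n_nz] by blast
  have e: "(Inr (pull n B d a) :: 'b + 'b extn set) = Inr (pull n B \<delta> b)" "F.unit n L B (Inr (pull n B d a))"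
    using h unfolding pull_eq(1)[OF d_Ext g(1)] pull_eq(1)[OF \<delta>E g(2)] by auto
  show ?l
    using h ab e quasi_invertible_iff[OF ab(1)] quasi_invertible_iff[OF ab(2)] d_unit_exts
    by (auto simp: co_angled_pair_def deflation_gdefl unit_exts_iff)
qed

lemma is_right_quotient_iff:
  assumes "\<theta> \<in> Ext n L B" "F.qi L D (Inl b)"
  shows "is_right_quotient n L D B \<theta> b \<epsilon> \<longleftrightarrow> Inr \<epsilon> \<in> gr n D B \<and> F.peq L B (Inr \<theta>) (Inr \<epsilon> \<star> Inl b)"
proof -
  note g = F.qi_in[OF assms(2)]
  have b: "b \<in> Hom A L D" "quasi_invertible n b"
    using g quasi_invertible_iff[of b L D] assms(2) by (simp_all add: Inl_gr)
  show ?thesis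
    using assms(1) b Inr_gr[OF n_nz, of \<epsilon> D B] pull_eq[of \<epsilon> D B b L] g peq_proj_ext[OF assms(1), of "pull n B \<epsilon> b"]
    unfolding is_right_quotient_def by auto
qed

text \<open>By \<open>comp_act\<close>, any other choice, including that of the representatives,
  gives an element with the same action as \<open>\<zeta>\<close>. So the definite description has
  exactly one value.\<close>

lemma ext_comp_br:
  assumes "\<beta> \<in> Ext n M B" "\<gamma> \<in> Ext n M B" and c: "F.comp_rel (Inr \<beta>) (Inr \<gamma>) (Inr \<zeta>)"
  shows "ext_comp n M B d (br \<beta>) (br \<gamma>) = br \<zeta>"
  unfolding ext_comp_def
proof (rule the_equality)
  have g: "Inr \<beta> \<in> gr n M B" "Inr \<gamma> \<in> gr n M B"
    using assms Inr_mem by auto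
  obtain \<delta>' D f' L a' b' \<epsilon>' where h: "F.unit n D B \<delta>'" "f' \<in> gr 0 M D" "Inr \<gamma> = \<delta>' \<star> f'"
     "a' \<in> gr 0 L M" "b' \<in> gr 0 L D" "gdefl a'" "gdefl b'" "F.qi L M a'" "F.qi L D b'"
     "Inr d \<star> a' = \<delta>' \<star> b'" "F.unit n L B (Inr d \<star> a')" "\<epsilon>' \<in> gr n D B"
     "F.peq L B (Inr \<beta> \<star> a') (\<epsilon>' \<star> b')" "Inr \<zeta> = \<epsilon>' \<star> f'"
    using c unfolding F.comp_rel_def by blast
  obtain \<delta> where \<delta>: "\<delta>' = Inr \<delta>"
    using gr_Ext[OF _ n_nz] F.unit_in[OF h(1)] by metis
  obtain f a b where fab: "f' = Inl f" "a' = Inl a" "b' = Inl b"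
    using gr0[OF h(2)] gr0[OF h(4)] gr0[OF h(5)] by metis
  obtain \<epsilon> where \<epsilon>: "\<epsilon>' = Inr \<epsilon>" "\<epsilon> \<in> Ext n D B"
    using gr_Ext[OF h(12) n_nz] by metis
  have ga: "Inl a \<in> gr 0 L M" "Inl f \<in> gr 0 M D"
    using h fab by auto
  note pb = pull_eq[OF assms(1) ga(1)]
  have "right_unit_factorization n M B D \<gamma> \<delta> f"
    using h \<delta> fab by (simp add: right_unit_factorization_iff)
  moreover have "co_angled_pair n B M D L d \<delta> a b"
    using h \<delta> fab by (simp add: co_angled_pair_iff)
  moreover have "is_right_quotient n L D B (pull n B \<beta> a) b \<epsilon>"
    using is_right_quotient_iff[OF pb(2), of D b \<epsilon>] pb(1) h \<epsilon> fab by simp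
  moreover have "\<zeta> = pull n B \<epsilon> f"
    using pull_eq(1)[OF \<epsilon>(2) ga(2)] h(14) \<epsilon>(1) fab(1) by simp
  ultimately show "\<exists>\<beta>' \<gamma>' \<delta> D f L a b \<epsilon>. \<beta>' \<in> Ext n M B \<and> \<gamma>' \<in> Ext n M B \<and> br \<beta> = br \<beta>' \<and>
      br \<gamma> = br \<gamma>' \<and> right_unit_factorization n M B D \<gamma>' \<delta> f \<and> co_angled_pair n B M D L d \<delta> a b \<and>
      is_right_quotient n L D B (pull n B \<beta>' a) b \<epsilon> \<and> br \<zeta> = br (pull n B \<epsilon> f)"
    using assms(1,2) by blast
next
  fix z assume "\<exists>\<beta>' \<gamma>' \<delta> D f L a b \<epsilon>. \<beta>' \<in> Ext n M B \<and> \<gamma>' \<in> Ext n M B \<and> br \<beta> = br \<beta>' \<and>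
      br \<gamma> = br \<gamma>' \<and> right_unit_factorization n M B D \<gamma>' \<delta> f \<and> co_angled_pair n B M D L d \<delta> a b \<and>
      is_right_quotient n L D B (pull n B \<beta>' a) b \<epsilon> \<and> z = br (pull n B \<epsilon> f)"
  then obtain \<beta>' \<gamma>' \<delta> D f L a b \<epsilon> where h: "\<beta>' \<in> Ext n M B" "\<gamma>' \<in> Ext n M B" "br \<beta> = br \<beta>'" "br \<gamma> = br \<gamma>'"
    "right_unit_factorization n M B D \<gamma>' \<delta> f" "co_angled_pair n B M D L d \<delta> a b"
    "is_right_quotient n L D B (pull n B \<beta>' a) b \<epsilon>" "z = br (pull n B \<epsilon> f)"
    by blast
  note r = h(5)[unfolded right_unit_factorization_iff] and c' = h(6)[unfolded co_angled_pair_iff]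
  have ga: "Inl a \<in> gr 0 L M" "F.qi L D (Inl b)" "Inl f \<in> gr 0 M D"
    using c' r by auto
  note pb = pull_eq[OF h(1) ga(1)]
  have q: "Inr \<epsilon> \<in> gr n D B" "F.peq L B (Inr \<beta>' \<star> Inl a) (Inr \<epsilon> \<star> Inl b)"
    using h(7) is_right_quotient_iff[OF pb(2) ga(2)] pb(1) by auto
  have \<epsilon>: "\<epsilon> \<in> Ext n D B"
    using q(1) Inr_gr[OF n_nz] by blast
  note pe = pull_eq[OF \<epsilon> ga(3)]
  have cr: "F.comp_rel (Inr \<beta>') (Inr \<gamma>') (Inr (pull n B \<epsilon> f))"
    unfolding F.comp_rel_def using r c' q pe(1) by blast
  have g: "Inr \<beta> \<in> gr n M B" "Inr \<gamma> \<in> gr n M B" "Inr \<beta>' \<in> gr n M B" "Inr \<gamma>' \<in> gr n M B"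
    using assms h Inr_mem by auto
  have \<zeta>: "\<zeta> \<in> Ext n M B"
    using F.comp_act(1)[OF c g(1)] Inr_mem by simp
  have "F.act F.faithful (Inr (pull n B \<epsilon> f)) \<xi> = F.act F.faithful (Inr \<zeta>) \<xi>" if \<xi>: "\<xi> \<in> gr (Suc n) B F.faithful" for \<xi>
  proof -
    have "F.act F.faithful (Inr \<beta>') \<xi> = F.act F.faithful (Inr \<beta>) \<xi>"
      using br_eq_iff[OF assms(1) h(1)] h(3) \<xi> by simp
    moreover have "F.act F.faithful (Inr \<gamma>') \<psi> = F.act F.faithful (Inr \<gamma>) \<psi>" if "\<psi> \<in> gr (Suc n) B F.faithful" for \<psi>
      using br_eq_iff[OF assms(2) h(2)] h(4) that by simp
    ultimately show ?thesis
      using F.comp_act(3)[OF cr g(3) \<xi>] F.comp_act(3)[OF c g(1) \<xi>] F.act(1)[OF g(1) \<xi>] by simp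
  qed
  then show "z = br \<zeta>"
    using br_eq_iff[OF pe(2) \<zeta>] h(8) by simp
qed

lemma R_carrier: "x \<in> carrier R \<longleftrightarrow> (\<exists>\<beta> \<in> Ext n M B. x = br \<beta>)"
  by (auto simp: Ext_ring_def Let_def FactGroup_def RCOSETS_def bar_def Ext_group_simps)

lemma R_obtain:
  assumes "x \<in> carrier R"
  obtains \<beta> where "\<beta> \<in> Ext n M B" "x = br \<beta>"
  using assms unfolding R_carrier by (elim bexE)

lemma br_in_carrier: "\<beta> \<in> Ext n M B \<Longrightarrow> br \<beta> \<in> carrier R"
  unfolding R_carrier by (rule bexI, rule refl)

lemma R_simps:
  "x \<otimes>\<^bsub>R\<^esub> y = ext_comp n M B d x y" "\<one>\<^bsub>R\<^esub> = br d" "\<zero>\<^bsub>R\<^esub> = H" "x \<oplus>\<^bsub>R\<^esub> y = x <#>\<^bsub>E\<^esub> y"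
  by (simp_all add: Ext_ring_def Let_def FactGroup_def)

lemma br_add:
  assumes "\<beta> \<in> Ext n M B" "\<gamma> \<in> Ext n M B"
  shows "br \<beta> \<oplus>\<^bsub>R\<^esub> br \<gamma> = br (\<beta> \<otimes>\<^bsub>E\<^esub> \<gamma>)"
proof -
  interpret G: comm_group E
    by (rule Ext_comm_group[OF MC n_nz])
  interpret N: normal H E
    by (rule G.subgroup_imp_normal[OF H_subgroup])
  show ?thesis
    unfolding R_simps bar_def using N.rcos_sum assms Ext_group_simps(1) by metis
qed

lemma act_br_add:
  assumes "\<beta> \<in> Ext n M B" "\<gamma> \<in> Ext n M B" "\<xi> \<in> gr (Suc n) B Y"
  shows "F.act Y (Inr (\<beta> \<otimes>\<^bsub>E\<^esub> \<gamma>)) \<xi> = gadd (F.act Y (Inr \<beta>) \<xi>) (F.act Y (Inr \<gamma>) \<xi>)"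
  unfolding E_mult(1)[OF assms(1,2)] using F.act_add assms Inr_mem by blast

lemma br_mul:
  assumes "\<beta> \<in> Ext n M B" "\<gamma> \<in> Ext n M B"
  obtains \<zeta> where "\<zeta> \<in> Ext n M B" "br \<beta> \<otimes>\<^bsub>R\<^esub> br \<gamma> = br \<zeta>"
    "\<forall>\<xi> \<in> gr (Suc n) B F.faithful.
      F.act F.faithful (Inr \<zeta>) \<xi> = F.act F.faithful (Inr \<gamma>) (F.act F.faithful (Inr \<beta>) \<xi>)"
proof -
  have g: "Inr \<beta> \<in> gr n M B" "Inr \<gamma> \<in> gr n M B"
    using assms Inr_mem by auto
  obtain z where z: "F.comp_rel (Inr \<beta>) (Inr \<gamma>) z"
    using F.ex_comp[OF g] by blast
  obtain \<zeta> where \<zeta>: "z = Inr \<zeta>" "\<zeta> \<in> Ext n M B"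
    using gr_Ext[OF F.comp_act(1)[OF z g(1)] n_nz] .
  show ?thesis
    by (rule that[of \<zeta>]) (use \<zeta> z ext_comp_br[OF assms] F.comp_act(3)[OF z g(1)] in \<open>simp_all add: R_simps\<close>)
qed

lemma comm_group_add_R: "comm_group (add_monoid R)"
proof -
  interpret G: comm_group E
    by (rule Ext_comm_group[OF MC n_nz])
  have "comm_group (E Mod H)"
    by (rule G.abelian_FactGroup[OF H_subgroup])
  moreover have "add_monoid R = E Mod H"
    by (simp add: Ext_ring_def Let_def FactGroup_def)
  ultimately show ?thesis
    by simp
qed

lemma act_in: "\<beta> \<in> Ext n M B \<Longrightarrow> \<xi> \<in> gr (Suc n) B Y \<Longrightarrow> F.act Y (Inr \<beta>) \<xi> \<in> gr (Suc n) B Y"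
  using F.act(1) Inr_mem by blast

lemma br_mul_assoc:
  assumes "\<alpha> \<in> Ext n M B" "\<beta> \<in> Ext n M B" "\<gamma> \<in> Ext n M B"
  shows "br \<alpha> \<otimes>\<^bsub>R\<^esub> br \<beta> \<otimes>\<^bsub>R\<^esub> br \<gamma> = br \<alpha> \<otimes>\<^bsub>R\<^esub> (br \<beta> \<otimes>\<^bsub>R\<^esub> br \<gamma>)"
proof -
  obtain \<zeta> where \<zeta>: "\<zeta> \<in> Ext n M B" "br \<alpha> \<otimes>\<^bsub>R\<^esub> br \<beta> = br \<zeta>" "\<forall>\<xi> \<in> gr (Suc n) B F.faithful.
      F.act F.faithful (Inr \<zeta>) \<xi> = F.act F.faithful (Inr \<beta>) (F.act F.faithful (Inr \<alpha>) \<xi>)"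
    by (rule br_mul[OF assms(1,2)])
  obtain \<eta> where \<eta>: "\<eta> \<in> Ext n M B" "br \<beta> \<otimes>\<^bsub>R\<^esub> br \<gamma> = br \<eta>" "\<forall>\<xi> \<in> gr (Suc n) B F.faithful.
      F.act F.faithful (Inr \<eta>) \<xi> = F.act F.faithful (Inr \<gamma>) (F.act F.faithful (Inr \<beta>) \<xi>)"
    by (rule br_mul[OF assms(2,3)])
  obtain \<mu> where \<mu>: "\<mu> \<in> Ext n M B" "br \<zeta> \<otimes>\<^bsub>R\<^esub> br \<gamma> = br \<mu>" "\<forall>\<xi> \<in> gr (Suc n) B F.faithful.
      F.act F.faithful (Inr \<mu>) \<xi> = F.act F.faithful (Inr \<gamma>) (F.act F.faithful (Inr \<zeta>) \<xi>)"
    by (rule br_mul[OF \<zeta>(1) assms(3)])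
  obtain \<nu> where \<nu>: "\<nu> \<in> Ext n M B" "br \<alpha> \<otimes>\<^bsub>R\<^esub> br \<eta> = br \<nu>" "\<forall>\<xi> \<in> gr (Suc n) B F.faithful.
      F.act F.faithful (Inr \<nu>) \<xi> = F.act F.faithful (Inr \<eta>) (F.act F.faithful (Inr \<alpha>) \<xi>)"
    by (rule br_mul[OF assms(1) \<eta>(1)])
  show ?thesis
    unfolding \<zeta>(2) \<eta>(2) \<mu>(2) \<nu>(2) br_eq_iff[OF \<mu>(1) \<nu>(1)]
    using \<mu>(3) \<nu>(3) \<zeta>(3) \<eta>(3) act_in[OF assms(1)] by simp
qed

lemma br_one:
  assumes "\<alpha> \<in> Ext n M B"
  shows "br d \<otimes>\<^bsub>R\<^esub> br \<alpha> = br \<alpha>" "br \<alpha> \<otimes>\<^bsub>R\<^esub> br d = br \<alpha>"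
proof -
  obtain \<zeta> where \<zeta>: "\<zeta> \<in> Ext n M B" "br d \<otimes>\<^bsub>R\<^esub> br \<alpha> = br \<zeta>" "\<forall>\<xi> \<in> gr (Suc n) B F.faithful.
      F.act F.faithful (Inr \<zeta>) \<xi> = F.act F.faithful (Inr \<alpha>) (F.act F.faithful (Inr d) \<xi>)"
    by (rule br_mul[OF d_Ext assms])
  show "br d \<otimes>\<^bsub>R\<^esub> br \<alpha> = br \<alpha>"
    unfolding \<zeta>(2) br_eq_iff[OF \<zeta>(1) assms] using \<zeta>(3) F.act_d by simp
  obtain \<eta> where \<eta>: "\<eta> \<in> Ext n M B" "br \<alpha> \<otimes>\<^bsub>R\<^esub> br d = br \<eta>" "\<forall>\<xi> \<in> gr (Suc n) B F.faithful.
      F.act F.faithful (Inr \<eta>) \<xi> = F.act F.faithful (Inr d) (F.act F.faithful (Inr \<alpha>) \<xi>)"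
    by (rule br_mul[OF assms d_Ext])
  show "br \<alpha> \<otimes>\<^bsub>R\<^esub> br d = br \<alpha>"
    unfolding \<eta>(2) br_eq_iff[OF \<eta>(1) assms] using \<eta>(3) F.act_d act_in[OF assms] by simp
qed

lemma br_distrib:
  assumes "\<alpha> \<in> Ext n M B" "\<beta> \<in> Ext n M B" "\<gamma> \<in> Ext n M B"
  shows "(br \<alpha> \<oplus>\<^bsub>R\<^esub> br \<beta>) \<otimes>\<^bsub>R\<^esub> br \<gamma> = br \<alpha> \<otimes>\<^bsub>R\<^esub> br \<gamma> \<oplus>\<^bsub>R\<^esub> br \<beta> \<otimes>\<^bsub>R\<^esub> br \<gamma>"
    "br \<gamma> \<otimes>\<^bsub>R\<^esub> (br \<alpha> \<oplus>\<^bsub>R\<^esub> br \<beta>) = br \<gamma> \<otimes>\<^bsub>R\<^esub> br \<alpha> \<oplus>\<^bsub>R\<^esub> br \<gamma> \<otimes>\<^bsub>R\<^esub> br \<beta>"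
proof -
  note ab = E_mult(2)[OF assms(1,2)]
  have add: "br \<alpha> \<oplus>\<^bsub>R\<^esub> br \<beta> = br (\<alpha> \<otimes>\<^bsub>E\<^esub> \<beta>)"
    using br_add[OF assms(1,2)] .
  obtain \<zeta> where \<zeta>: "\<zeta> \<in> Ext n M B" "br \<alpha> \<otimes>\<^bsub>R\<^esub> br \<gamma> = br \<zeta>" "\<forall>\<xi> \<in> gr (Suc n) B F.faithful.
      F.act F.faithful (Inr \<zeta>) \<xi> = F.act F.faithful (Inr \<gamma>) (F.act F.faithful (Inr \<alpha>) \<xi>)"
    by (rule br_mul[OF assms(1,3)])
  obtain \<eta> where \<eta>: "\<eta> \<in> Ext n M B" "br \<beta> \<otimes>\<^bsub>R\<^esub> br \<gamma> = br \<eta>" "\<forall>\<xi> \<in> gr (Suc n) B F.faithful.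
      F.act F.faithful (Inr \<eta>) \<xi> = F.act F.faithful (Inr \<gamma>) (F.act F.faithful (Inr \<beta>) \<xi>)"
    by (rule br_mul[OF assms(2,3)])
  obtain \<mu> where \<mu>: "\<mu> \<in> Ext n M B" "br (\<alpha> \<otimes>\<^bsub>E\<^esub> \<beta>) \<otimes>\<^bsub>R\<^esub> br \<gamma> = br \<mu>" "\<forall>\<xi> \<in> gr (Suc n) B F.faithful.
      F.act F.faithful (Inr \<mu>) \<xi> = F.act F.faithful (Inr \<gamma>) (F.act F.faithful (Inr (\<alpha> \<otimes>\<^bsub>E\<^esub> \<beta>)) \<xi>)"
    by (rule br_mul[OF ab assms(3)])
  note \<nu> = E_mult(2)[OF \<zeta>(1) \<eta>(1)]
  show "(br \<alpha> \<oplus>\<^bsub>R\<^esub> br \<beta>) \<otimes>\<^bsub>R\<^esub> br \<gamma> = br \<alpha> \<otimes>\<^bsub>R\<^esub> br \<gamma> \<oplus>\<^bsub>R\<^esub> br \<beta> \<otimes>\<^bsub>R\<^esub> br \<gamma>"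
    unfolding add \<zeta>(2) \<eta>(2) \<mu>(2) br_add[OF \<zeta>(1) \<eta>(1)] br_eq_iff[OF \<mu>(1) \<nu>]
  proof
    fix \<xi> assume \<xi>: "\<xi> \<in> gr (Suc n) B F.faithful"
    show "F.act F.faithful (Inr \<mu>) \<xi> = F.act F.faithful (Inr (\<zeta> \<otimes>\<^bsub>E\<^esub> \<eta>)) \<xi>"
      unfolding bspec[OF \<mu>(3) \<xi>] act_br_add[OF \<zeta>(1) \<eta>(1) \<xi>] bspec[OF \<zeta>(3) \<xi>] bspec[OF \<eta>(3) \<xi>] act_br_add[OF assms(1,2) \<xi>]
      using F.act_add_right[of "Inr \<gamma>"] Inr_mem assms(3) act_in[OF assms(1) \<xi>] act_in[OF assms(2) \<xi>] by blast
  qed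
  obtain \<zeta>' where \<zeta>': "\<zeta>' \<in> Ext n M B" "br \<gamma> \<otimes>\<^bsub>R\<^esub> br \<alpha> = br \<zeta>'" "\<forall>\<xi> \<in> gr (Suc n) B F.faithful.
      F.act F.faithful (Inr \<zeta>') \<xi> = F.act F.faithful (Inr \<alpha>) (F.act F.faithful (Inr \<gamma>) \<xi>)"
    by (rule br_mul[OF assms(3,1)])
  obtain \<eta>' where \<eta>': "\<eta>' \<in> Ext n M B" "br \<gamma> \<otimes>\<^bsub>R\<^esub> br \<beta> = br \<eta>'" "\<forall>\<xi> \<in> gr (Suc n) B F.faithful.
      F.act F.faithful (Inr \<eta>') \<xi> = F.act F.faithful (Inr \<beta>) (F.act F.faithful (Inr \<gamma>) \<xi>)"
    by (rule br_mul[OF assms(3,2)])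
  obtain \<mu>' where \<mu>': "\<mu>' \<in> Ext n M B" "br \<gamma> \<otimes>\<^bsub>R\<^esub> br (\<alpha> \<otimes>\<^bsub>E\<^esub> \<beta>) = br \<mu>'" "\<forall>\<xi> \<in> gr (Suc n) B F.faithful.
      F.act F.faithful (Inr \<mu>') \<xi> = F.act F.faithful (Inr (\<alpha> \<otimes>\<^bsub>E\<^esub> \<beta>)) (F.act F.faithful (Inr \<gamma>) \<xi>)"
    by (rule br_mul[OF assms(3) ab])
  note \<nu>' = E_mult(2)[OF \<zeta>'(1) \<eta>'(1)]
  show "br \<gamma> \<otimes>\<^bsub>R\<^esub> (br \<alpha> \<oplus>\<^bsub>R\<^esub> br \<beta>) = br \<gamma> \<otimes>\<^bsub>R\<^esub> br \<alpha> \<oplus>\<^bsub>R\<^esub> br \<gamma> \<otimes>\<^bsub>R\<^esub> br \<beta>"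
    unfolding add \<zeta>'(2) \<eta>'(2) \<mu>'(2) br_add[OF \<zeta>'(1) \<eta>'(1)] br_eq_iff[OF \<mu>'(1) \<nu>']
  proof
    fix \<xi> assume \<xi>: "\<xi> \<in> gr (Suc n) B F.faithful"
    show "F.act F.faithful (Inr \<mu>') \<xi> = F.act F.faithful (Inr (\<zeta>' \<otimes>\<^bsub>E\<^esub> \<eta>')) \<xi>"
      unfolding bspec[OF \<mu>'(3) \<xi>] act_br_add[OF \<zeta>'(1) \<eta>'(1) \<xi>] bspec[OF \<zeta>'(3) \<xi>] bspec[OF \<eta>'(3) \<xi>]
        act_br_add[OF assms(1,2) act_in[OF assms(3) \<xi>]] ..
  qed
qed

lemma ring_R: "ring R"
proof (rule ringI)
  show "abelian_group R"
    by (rule comm_group_abelian_groupI[OF comm_group_add_R])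
  show "Group.monoid R"
  proof (rule monoidI)
    show "\<one>\<^bsub>R\<^esub> \<in> carrier R"
      unfolding R_simps(2) by (rule br_in_carrier[OF d_Ext])
  next
    fix x assume "x \<in> carrier R"
    then obtain \<alpha> where \<alpha>: "\<alpha> \<in> Ext n M B" "x = br \<alpha>"
      by (rule R_obtain)
    show "\<one>\<^bsub>R\<^esub> \<otimes>\<^bsub>R\<^esub> x = x" "x \<otimes>\<^bsub>R\<^esub> \<one>\<^bsub>R\<^esub> = x"
      unfolding \<alpha>(2) R_simps(2) by (rule br_one[OF \<alpha>(1)])+
  next
    fix x y assume x: "x \<in> carrier R" and y: "y \<in> carrier R"
    obtain \<alpha> where \<alpha>: "\<alpha> \<in> Ext n M B" "x = br \<alpha>"
      by (rule R_obtain[OF x])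
    obtain \<beta> where \<beta>: "\<beta> \<in> Ext n M B" "y = br \<beta>"
      by (rule R_obtain[OF y])
    obtain \<zeta> where "\<zeta> \<in> Ext n M B" "br \<alpha> \<otimes>\<^bsub>R\<^esub> br \<beta> = br \<zeta>"
      by (rule br_mul[OF \<alpha>(1) \<beta>(1)])
    then show "x \<otimes>\<^bsub>R\<^esub> y \<in> carrier R"
      using br_in_carrier unfolding \<alpha>(2) \<beta>(2) by simp
    fix z assume "z \<in> carrier R"
    then obtain \<gamma> where \<gamma>: "\<gamma> \<in> Ext n M B" "z = br \<gamma>"
      by (rule R_obtain)
    show "x \<otimes>\<^bsub>R\<^esub> y \<otimes>\<^bsub>R\<^esub> z = x \<otimes>\<^bsub>R\<^esub> (y \<otimes>\<^bsub>R\<^esub> z)"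
      unfolding \<alpha>(2) \<beta>(2) \<gamma>(2) by (rule br_mul_assoc[OF \<alpha>(1) \<beta>(1) \<gamma>(1)])
  qed
  fix x y z assume x: "x \<in> carrier R" and y: "y \<in> carrier R" and z: "z \<in> carrier R"
  obtain \<alpha> where \<alpha>: "\<alpha> \<in> Ext n M B" "x = br \<alpha>"
    by (rule R_obtain[OF x])
  obtain \<beta> where \<beta>: "\<beta> \<in> Ext n M B" "y = br \<beta>"
    by (rule R_obtain[OF y])
  obtain \<gamma> where \<gamma>: "\<gamma> \<in> Ext n M B" "z = br \<gamma>"
    by (rule R_obtain[OF z])
  show "(x \<oplus>\<^bsub>R\<^esub> y) \<otimes>\<^bsub>R\<^esub> z = x \<otimes>\<^bsub>R\<^esub> z \<oplus>\<^bsub>R\<^esub> y \<otimes>\<^bsub>R\<^esub> z"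
    "z \<otimes>\<^bsub>R\<^esub> (x \<oplus>\<^bsub>R\<^esub> y) = z \<otimes>\<^bsub>R\<^esub> x \<oplus>\<^bsub>R\<^esub> z \<otimes>\<^bsub>R\<^esub> y"
    unfolding \<alpha>(2) \<beta>(2) \<gamma>(2) by (rule br_distrib[OF \<alpha>(1) \<beta>(1) \<gamma>(1)])+
qed

section \<open>The homomorphism from the endomorphism ring and its values\<close>

lemma Inl_M: "f \<in> Hom A M M \<Longrightarrow> Inl f \<in> gr 0 M M"
  using MC by (simp add: Inl_gr)

lemma pull_d:
  assumes "f \<in> Hom A M M"
  shows "pull n B d f \<in> Ext n M B" "Inr (pull n B d f) = Inr d \<star> Inl f"
  using pull_eq[OF d_Ext Inl_M[OF assms]] by auto

text \<open>Multiplicativity of the homomorphism is the case where \<open>\<beta>\<close> is itself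
  a pull-back of \<open>d\<close>; the left inverse of a quasi-invertible morphism is another
  case.\<close>

lemma br_mul_pull:
  assumes "\<beta> \<in> Ext n M B" "f \<in> Hom A M M"
  shows "br \<beta> \<otimes>\<^bsub>R\<^esub> br (pull n B d f) = br (pull n B \<beta> f)"
proof -
  note f = Inl_M[OF assms(2)]
  \<comment> \<open>Co-angled pairs consist of deflations; the identity is one, with zero
    kernel.\<close>
  have "gdefl (gid M)"
    using zero_object_conflation(1)[OF MC(1)] by (auto simp: gdefl_def gid_def deflation_def)
  then have "F.comp_rel (Inr \<beta>) (Inr d \<star> Inl f) (Inr \<beta> \<star> Inl f)"
    using F.comp_d[OF _ f] assms(1) Inr_mem by blast
  then have "F.comp_rel (Inr \<beta>) (Inr (pull n B d f)) (Inr (pull n B \<beta> f))"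
    using pull_d(2)[OF assms(2)] pull_eq(1)[OF assms(1) f] by simp
  then show ?thesis
    using ext_comp_br[OF assms(1) pull_d(1)[OF assms(2)]] by (simp add: R_simps)
qed

lemma ring_hom_pull: "ring_hom_ring (End_ring M) R (\<lambda>f. br (pull n B d f))"
proof (intro ring_hom_ring.intro ring_hom_ring_axioms.intro ring_R ring_End_ring ring_hom_memI)
  show "M \<in> Obj A"
    using MC by simp
  fix f assume "f \<in> carrier (End_ring M)"
  then have f: "f \<in> Hom A M M"
    by (simp add: End_ring_def)
  show "br (pull n B d f) \<in> carrier R"
    by (rule br_in_carrier[OF pull_d(1)[OF f]])
  fix g assume "g \<in> carrier (End_ring M)"
  then have g: "g \<in> Hom A M M"
    by (simp add: End_ring_def)
  have fg: "f \<cdot> g \<in> Hom A M M" "f \<boxplus> g \<in> Hom A M M"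
    using f g by auto
  have "Inr d \<star> Inl (f \<cdot> g) = (Inr d \<star> Inl f) \<star> Inl g"
    using F.mul_assoc[OF F.d_in Inl_M[OF f] Inl_M[OF g]] by simp
  then have "(Inr (pull n B d (f \<cdot> g)) :: 'b + 'b extn set) = Inr (pull n B (pull n B d f) g)"
    unfolding pull_d(2)[OF fg(1)] pull_eq(1)[OF pull_d(1)[OF f] Inl_M[OF g]] pull_d(2)[OF f] .
  then show "br (pull n B d (f \<otimes>\<^bsub>End_ring M\<^esub> g)) = br (pull n B d f) \<otimes>\<^bsub>R\<^esub> br (pull n B d g)"
    using br_mul_pull[OF pull_d(1)[OF f] g] by (simp add: End_ring_def)
  have "Inr d \<star> Inl (f \<boxplus> g) = gadd (Inr d \<star> Inl f) (Inr d \<star> Inl g)"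
    using F.distrib_left[OF F.d_in Inl_M[OF f] Inl_M[OF g]] gadd_Inl[of f g M M] f g MC by simp
  then have "(Inr (pull n B d (f \<boxplus> g)) :: 'b + 'b extn set) = Inr (pull n B d f \<otimes>\<^bsub>E\<^esub> pull n B d g)"
    unfolding pull_d(2)[OF fg(2)] E_mult(1)[OF pull_d(1)[OF f] pull_d(1)[OF g]] pull_d(2)[OF f] pull_d(2)[OF g] .
  then show "br (pull n B d (f \<oplus>\<^bsub>End_ring M\<^esub> g)) = br (pull n B d f) \<oplus>\<^bsub>R\<^esub> br (pull n B d g)"
    using br_add[OF pull_d(1)[OF f] pull_d(1)[OF g]] by (simp add: End_ring_def)
next
  have i: "idm A M \<in> Hom A M M"
    using MC by simp
  have "(Inr (pull n B d (idm A M)) :: 'b + 'b extn set) = Inr d"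
    using pull_d(2)[OF i] gid_mul(2)[OF F.d_in] by (simp add: gid_def)
  then show "br (pull n B d \<one>\<^bsub>End_ring M\<^esub>) = \<one>\<^bsub>R\<^esub>"
    by (simp add: End_ring_def R_simps)
qed

lemma pull_quasi_invertible:
  assumes "f \<in> Hom A M M" "quasi_invertible n f"
  shows "br (pull n B d f) \<in> Units R"
proof -
  let ?\<phi> = "pull n B d f"
  note \<phi> = pull_d[OF assms(1)] and f = Inl_M[OF assms(1)]
  have q: "F.qi M M (Inl f)"
    using quasi_invertible_iff[OF assms(1)] assms(2) by simp
  obtain e where e: "e \<in> gr n M B" "F.peq M B (Inr d) (e \<star> Inl f)"
    using F.qi_inverse(1)[OF q] by blast
  obtain \<epsilon> where \<epsilon>: "e = Inr \<epsilon>" "\<epsilon> \<in> Ext n M B"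
    using gr_Ext[OF e(1) n_nz] .
  note p\<epsilon> = pull_eq[OF \<epsilon>(2) f]
  have "\<forall>\<xi> \<in> gr (Suc n) B F.faithful. F.act F.faithful (Inr d) \<xi> = F.act F.faithful (Inr (pull n B \<epsilon> f)) \<xi>"
    using e(2) F.act_eq_iff[OF F.d_in, of "Inr (pull n B \<epsilon> f)"] p\<epsilon> \<epsilon>(1) Inr_mem by simp
  then have "br (pull n B \<epsilon> f) = \<one>\<^bsub>R\<^esub>"
    using br_eq_iff[OF d_Ext p\<epsilon>(2)] by (simp add: R_simps)
  then have one: "br \<epsilon> \<otimes>\<^bsub>R\<^esub> br ?\<phi> = \<one>\<^bsub>R\<^esub>"
    using br_mul_pull[OF \<epsilon>(2) assms(1)] by simp
  obtain \<zeta> where \<zeta>: "\<zeta> \<in> Ext n M B" "br \<epsilon> \<otimes>\<^bsub>R\<^esub> br ?\<phi> = br \<zeta>" "\<forall>\<xi> \<in> gr (Suc n) B F.faithful.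
    F.act F.faithful (Inr \<zeta>) \<xi> = F.act F.faithful (Inr ?\<phi>) (F.act F.faithful (Inr \<epsilon>) \<xi>)"
    by (rule br_mul[OF \<epsilon>(2) \<phi>(1)])
  have inv: "F.act F.faithful (Inr ?\<phi>) (F.act F.faithful (Inr \<epsilon>) \<xi>) = \<xi>" if "\<xi> \<in> gr (Suc n) B F.faithful" for \<xi>
  proof -
    have "br \<zeta> = br d"
      using one \<zeta>(2) R_simps(2) by simp
    then have "F.act F.faithful (Inr \<zeta>) \<xi> = F.act F.faithful (Inr d) \<xi>"
      using br_eq_iff[OF \<zeta>(1) d_Ext] that by simp
    then show ?thesis
      using bspec[OF \<zeta>(3) that] F.act_d[OF that] by simp
  qed
  obtain \<eta> where \<eta>: "\<eta> \<in> Ext n M B" "br ?\<phi> \<otimes>\<^bsub>R\<^esub> br \<epsilon> = br \<eta>" "\<forall>\<xi> \<in> gr (Suc n) B F.faithful.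
    F.act F.faithful (Inr \<eta>) \<xi> = F.act F.faithful (Inr \<epsilon>) (F.act F.faithful (Inr ?\<phi>) \<xi>)"
    by (rule br_mul[OF \<phi>(1) \<epsilon>(2)])
  \<comment> \<open>By \<open>inv\<close>, the action of \<open>?\<phi>\<close> undoes that of
    \<open>\<epsilon>\<close>, so it takes the same value on both sides. Its injectivity makes the
    one-sided inverse two-sided.\<close>
  have "F.act F.faithful (Inr \<eta>) \<xi> = \<xi>" if \<xi>: "\<xi> \<in> gr (Suc n) B F.faithful" for \<xi>
  proof -
    have x: "F.act F.faithful (Inr \<eta>) \<xi> \<in> gr (Suc n) B F.faithful"
      using act_in[OF \<eta>(1) \<xi>] .
    have "F.act F.faithful (Inr ?\<phi>) (F.act F.faithful (Inr \<eta>) \<xi>) = F.act F.faithful (Inr ?\<phi>) \<xi>"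
      using bspec[OF \<eta>(3) \<xi>] inv[OF act_in[OF \<phi>(1) \<xi>]] by simp
    then show ?thesis
      using F.qi_inverse(2)[OF q x \<xi>] \<phi>(2) by simp
  qed
  then have "br \<eta> = br d"
    using br_eq_iff[OF \<eta>(1) d_Ext] F.act_d by simp
  then have "br ?\<phi> \<otimes>\<^bsub>R\<^esub> br \<epsilon> = \<one>\<^bsub>R\<^esub>"
    using \<eta>(2) R_simps(2) by simp
  moreover have "br ?\<phi> \<in> carrier R" "br \<epsilon> \<in> carrier R"
    by (rule br_in_carrier[OF \<phi>(1)], rule br_in_carrier[OF \<epsilon>(2)])
  ultimately show ?thesis
    using one unfolding Units_def by blast
qed

text \<open>The phantom condition, applied to the single element \<open>d\<close>, places the
  pull-back of \<open>d\<close> along \<open>f\<close> in \<open>H\<close>.\<close>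

lemma pull_ext_phantom:
  assumes "f \<in> Hom A M M" "ext_phantom n f"
  shows "br (pull n B d f) = \<zero>\<^bsub>R\<^esub>"
proof -
  interpret G: comm_group E
    by (rule Ext_comm_group[OF MC n_nz])
  have "pull n B d f \<in> H"
    using assms d_Ext MC by (auto simp: ext_phantom_def)
  then show ?thesis
    unfolding bar_def R_simps using G.coset_join2[OF _ H_subgroup] pull_d(1)[OF assms(1)] Ext_group_simps(1) by metis
qed

end

theorem proposition7p11:
  fixes A :: "('o, 'm) cat_data" and C :: "'o set" and n :: nat
    and M B :: 'o and \<delta>\<^sub>M :: "'m extn set"
  assumes "extension_closed_subcategory A C"
    and "n \<ge> 1"
    and "extension_closed_subcategory.n_Frobenius A C n"
    and "M \<in> C"
    and "\<delta>\<^sub>M \<in> extension_closed_subcategory.unit_exts A C n M B"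
  shows "\<exists>\<phi>.
    ring_hom_ring (preadditive_category.End_ring A M)
      (extension_closed_subcategory.Ext_ring A C n M B \<delta>\<^sub>M) \<phi> \<and>
    (\<forall>f \<in> Hom A M M. \<phi> f = extension_closed_subcategory.bar A C n M B
        (extension_closed_subcategory.pull A C n B \<delta>\<^sub>M f)) \<and>
    (\<forall>f \<in> Hom A M M. extension_closed_subcategory.quasi_invertible A C n f \<longrightarrow>
        \<phi> f \<in> Units (extension_closed_subcategory.Ext_ring A C n M B \<delta>\<^sub>M)) \<and>
    (\<forall>f \<in> Hom A M M. extension_closed_subcategory.ext_phantom A C n f \<longrightarrow>
        \<phi> f = \<zero>\<^bsub>extension_closed_subcategory.Ext_ring A C n M B \<delta>\<^sub>M\<^esub>)"
proof -
  interpret n_frobenius_unit A C n M B \<delta>\<^sub>M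
    using assms by (intro n_frobenius_unit.intro n_frobenius_unit_axioms.intro)
  show ?thesis
    using ring_hom_pull pull_quasi_invertible pull_ext_phantom
    by (intro exI[of _ "\<lambda>f. bar n M B (pull n B \<delta>\<^sub>M f)"]) blast
qed

end
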